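(* Let $K:\mathbb R\to\overline{\mathbb R}$ be such that $K$ and $K^2$ are Lebesgue integrable. Suppose that: (i) $\{x_t(n)\}$ is the linear process array described in the context, satisfying Assumption INN and either Assumption FR (i.e. FR1 or FR2) or Assumption MI; (ii) $\{h_n\}$ is a positive sequence with $\beta_n^{-1}h_n+\beta_n(nh_n)^{-1}\to0$; and (iii) for each $x\in\mathbb R$ and $t'\in\mathbb N$, $\frac{\beta_n}{nh_n}\sum_{t=1}^{t'}K\left(\frac{x_t(n)-x}{h_n}\right)=o_p(1)$. Then, for each $x\in\mathbb R$, as $n\to\infty$, $$\frac{\beta_n}{h_nn}\sum_{t=1}^nK\left(\frac{x_t(n)-x}{h_n}\right)\overset{d}{\rightarrow}\varrho(0)\int_{\mathbb R}K(u)\,du .$$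
   Context: For $n\in\mathbb N$ and $t=1,\dots,n$, $x_t(n)=\sum_{j=0}^{t-1}\phi_j(n)v_{t-j}$ with $v_t=\sum_{i=0}^\infty c_i\xi_{t-i}$; $\beta_n^2:=\mathrm{Var}(x_n(n))$, $\beta_n>0$. $\overline{\mathbb R}$ is the extended real line. Assumption INN: $\{\xi_t\}_{t\in\mathbb Z}$ is i.i.d. with $\mathbf E\xi_1=0$, $\mathrm{Var}(\xi_1)=\sigma_\xi^2<\infty$; $\xi_1$ has an absolutely continuous distribution and a characteristic function $\psi_\xi$ satisfying $\int_{\mathbb R}|\psi_\xi(\lambda)|^\theta d\lambda<\infty$ for some $\theta\in\mathbb N$. Assumption FR: $\phi_j(n)=\phi_j$ does not depend on $n$; $\ell:\mathbb R_+\to\mathbb R_+$ is locally integrable on $[1,\infty)$, positive-valued and slowly varying at infinity, with $L(n):=\int_1^n[\ell^2(x)/x]dx\to\infty$; and either FR1: $\phi_j=1$ for all $j\ge0$, $c_s\sim\ell(s)s^{-3/2}$, and $\sum_{s=0}^\infty c_s=0$; or FR2: $\phi_j\sim\ell(j)j^{-1/2}$, $\phi_0\ne0$, $\sum_{s=0}^\infty|c_s|<\infty$, $\sum_{s=0}^\infty c_s\ne0$. Assumption MI: $\phi_j(n)=(1-\kappa_n^{-1})^j$; $\sum_{s=0}^\infty|c_s|<\infty$ and $\sum_{s=0}^\infty c_s\neq0$; $\kappa_n>1$, $\kappa_n=n^{\alpha_\kappa}\ell_\kappa(n)$ with $\ell_\kappa$ slowly varying at infinity and $\alpha_\kappa\in[0,1)$,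 $\kappa_n\to\infty$, and $\sup_{n\ge1}\sup_{1\le t\le n}\kappa_n^{-1}\kappa_t<\infty$. Here $a_n\sim b_n$ means $a_n/b_n\to1$. $\varphi_{\sigma^2}$ denotes the $N[0,\sigma^2]$ density. With $X^-\sim N[0,1/2]$, $\varrho(x):=\varphi_{1/2}(x-X^-)$ under FR1 (a random density) and $\varrho(x):=\varphi_1(x)$ under FR2 or MI. *)

theory Defs
  imports "HOL-Probability.Probability" "HOL-Library.Landau_Symbols"
begin

section \<open>Slow variation and integrability of extended-real functions\<close>

text \<open>Slow variation at infinity in the usual (Karamata) sense: only the values near infinity
  matter, and measurability there is part of the notion.\<close>

definition slowly_varying :: "(real \<Rightarrow> real) \<Rightarrow> bool" where
  "slowly_varying l \<longleftrightarrow>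
     (\<exists>a. set_borel_measurable lebesgue {a..} l \<and> (\<forall>x\<ge>a. 0 < l x)) \<and>
     (\<forall>r>0. ((\<lambda>x. l (r * x) / l x) \<longlongrightarrow> 1) at_top)"

definition integrable_ereal :: "'a measure \<Rightarrow> ('a \<Rightarrow> ereal) \<Rightarrow> bool" where
  "integrable_ereal M f \<longleftrightarrow>
     f \<in> borel_measurable M \<and> (\<integral>\<^sup>+ x. e2ennreal \<bar>f x\<bar> \<partial>M) < \<infinity>"

text \<open>Meant for functions that satisfy \<^term>\<open>integrable_ereal M f\<close>. Such functions are finite almost
  everywhere, so it is irrelevant that \<^const>\<open>real_of_ereal\<close> sends the infinite values to 0.\<close>

definition integral_ereal :: "'a measure \<Rightarrow> ('a \<Rightarrow> ereal) \<Rightarrow> real" where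
  "integral_ereal M f = (\<integral>x. real_of_ereal (f x) \<partial>M)"

section \<open>The linear process array\<close>

text \<open>Under each of the assumptions below, the coefficients c are absolutely summable and the
  innovations have a finite mean, so the series converges almost surely.\<close>

definition lin_proc :: "(nat \<Rightarrow> real) \<Rightarrow> (int \<Rightarrow> 'a \<Rightarrow> real) \<Rightarrow> int \<Rightarrow> 'a \<Rightarrow> real" where
  "lin_proc c \<xi> t \<omega> = (\<Sum>i. c i * \<xi> (t - int i) \<omega>)"

text \<open>In the following, \<open>\<phi> n j\<close> stands for \<open>\<phi>\<^sub>j(n)\<close> and \<open>lin_array \<phi> c \<xi> n t\<close> for \<open>x\<^sub>t(n)\<close>.\<close>

definition lin_array ::
  "(nat \<Rightarrow> nat \<Rightarrow> real) \<Rightarrow> (nat \<Rightarrow> real) \<Rightarrow> (int \<Rightarrow> 'a \<Rightarrow> real) \<Rightarrow> nat \<Rightarrow> nat \<Rightarrow> 'a \<Rightarrow> real" where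
  "lin_array \<phi> c \<xi> n t \<omega> = (\<Sum>j<t. \<phi> n j * lin_proc c \<xi> (int t - int j) \<omega>)"

definition var :: "'a measure \<Rightarrow> ('a \<Rightarrow> real) \<Rightarrow> real" where
  "var M X = (\<integral>\<omega>. (X \<omega> - (\<integral>\<omega>. X \<omega> \<partial>M))\<^sup>2 \<partial>M)"

definition assumption_INN :: "'a measure \<Rightarrow> (int \<Rightarrow> 'a \<Rightarrow> real) \<Rightarrow> bool" where
  "assumption_INN M \<xi> \<longleftrightarrow>
     prob_space.indep_vars M (\<lambda>_. borel) \<xi> UNIV \<and>
     (\<forall>t. distr M borel (\<xi> t) = distr M borel (\<xi> 1)) \<and>
     integrable M (\<xi> 1) \<and> (\<integral>\<omega>. \<xi> 1 \<omega> \<partial>M) = 0 \<and>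
     integrable M (\<lambda>\<omega>. (\<xi> 1 \<omega>)\<^sup>2) \<and>
     absolutely_continuous lborel (distr M borel (\<xi> 1)) \<and>
     (\<exists>\<theta>::nat. \<theta> \<ge> 1 \<and> integrable lborel (\<lambda>u. cmod (char (distr M borel (\<xi> 1)) u) ^ \<theta>))"

text \<open>Since a non-integrable function has integral 0 in the library, the last conjunct also says
  that \<open>L(n)\<close> is finite.\<close>

definition FR_scale :: "(real \<Rightarrow> real) \<Rightarrow> bool" where
  "FR_scale l \<longleftrightarrow>
     (\<forall>x>0. 0 < l x) \<and> (\<forall>b\<ge>1. set_integrable lebesgue {1..b} l) \<and> slowly_varying l \<and>
     filterlim (\<lambda>n. LINT x:{1..real n}|lebesgue. (l x)\<^sup>2 / x) at_top sequentially"

definition assumption_FR1 :: "(nat \<Rightarrow> nat \<Rightarrow> real) \<Rightarrow> (nat \<Rightarrow> real) \<Rightarrow> bool" where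
  "assumption_FR1 \<phi> c \<longleftrightarrow>
     (\<exists>l. FR_scale l \<and>
        (\<forall>n\<ge>1. \<forall>j. \<phi> n j = 1) \<and>
        c \<sim>[sequentially] (\<lambda>s. l (real s) * real s powr (- 3 / 2)) \<and>
        c sums 0)"

definition assumption_FR2 :: "(nat \<Rightarrow> nat \<Rightarrow> real) \<Rightarrow> (nat \<Rightarrow> real) \<Rightarrow> bool" where
  "assumption_FR2 \<phi> c \<longleftrightarrow>
     (\<exists>l p. FR_scale l \<and>
        (\<forall>n\<ge>1. \<forall>j. \<phi> n j = p j) \<and>
        p \<sim>[sequentially] (\<lambda>j. l (real j) * real j powr (- 1 / 2)) \<and> p 0 \<noteq> 0 \<and>
        summable (\<lambda>s. \<bar>c s\<bar>) \<and> (\<Sum>s. c s) \<noteq> 0)"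

definition assumption_MI :: "(nat \<Rightarrow> nat \<Rightarrow> real) \<Rightarrow> (nat \<Rightarrow> real) \<Rightarrow> bool" where
  "assumption_MI \<phi> c \<longleftrightarrow>
     (\<exists>(\<kappa> :: nat \<Rightarrow> real) \<alpha> l.
        (\<forall>n\<ge>1. \<forall>j. \<phi> n j = (1 - inverse (\<kappa> n)) ^ j) \<and>
        summable (\<lambda>s. \<bar>c s\<bar>) \<and> (\<Sum>s. c s) \<noteq> 0 \<and>
        (\<forall>n\<ge>1. \<kappa> n > 1 \<and> \<kappa> n = real n powr \<alpha> * l (real n)) \<and>
        slowly_varying l \<and> 0 \<le> \<alpha> \<and> \<alpha> < 1 \<and>
        filterlim \<kappa> at_top sequentially \<and>
        bdd_above {inverse (\<kappa> n) * \<kappa> t | n t. 1 \<le> t \<and> t \<le> n})"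

section \<open>The limit and the modes of convergence\<close>

text \<open>The density of the normal law with mean 0 and variance v (the library's \<^const>\<open>normal_density\<close> is
  parametrised by the standard deviation).\<close>

definition gauss :: "real \<Rightarrow> real \<Rightarrow> real" where
  "gauss v = normal_density 0 (sqrt v)"

text \<open>The argument y is the value taken by \<open>X\<^sup>-\<close>. The first case excludes both other assumptions,
  as the coefficients c sum to 0 there and to a nonzero value otherwise.\<close>

definition varrho :: "(nat \<Rightarrow> nat \<Rightarrow> real) \<Rightarrow> (nat \<Rightarrow> real) \<Rightarrow> real \<Rightarrow> real \<Rightarrow> real" where
  "varrho \<phi> c y x = (if assumption_FR1 \<phi> c then gauss (1 / 2) (x - y) else gauss 1 x)"

definition little_op1 :: "'a measure \<Rightarrow> (nat \<Rightarrow> 'a \<Rightarrow> ereal) \<Rightarrow> bool" where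
  "little_op1 M Z \<longleftrightarrow>
     (\<forall>\<epsilon>>0. (\<lambda>n. measure M {\<omega> \<in> space M. ereal \<epsilon> < \<bar>Z n \<omega>\<bar>}) \<longlonglongrightarrow> 0)"

text \<open>To be used for variables \<open>Z n\<close> that are almost surely finite; \<^const>\<open>real_of_ereal\<close> then
  changes them on a null event only.\<close>

definition conv_in_distr :: "'a measure \<Rightarrow> (nat \<Rightarrow> 'a \<Rightarrow> ereal) \<Rightarrow> real measure \<Rightarrow> bool" where
  "conv_in_distr M Z \<mu> \<longleftrightarrow> weak_conv_m (\<lambda>n. distr M borel (\<lambda>\<omega>. real_of_ereal (Z n \<omega>))) \<mu>"

definition kernel_sum ::
  "(real \<Rightarrow> ereal) \<Rightarrow> (nat \<Rightarrow> real) \<Rightarrow> (nat \<Rightarrow> real) \<Rightarrow> (nat \<Rightarrow> nat \<Rightarrow> 'a \<Rightarrow> real) \<Rightarrow>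
   real \<Rightarrow> nat \<Rightarrow> nat \<Rightarrow> 'a \<Rightarrow> ereal" where
  "kernel_sum K \<beta> h X x m n \<omega> =
     ereal (\<beta> n / (real n * h n)) * (\<Sum>t=1..m. K ((X n t \<omega> - x) / h n))"

end

theory Submission imports Defs begin

text \<open>
  The variable \<open>x\<^sub>t(n)\<close> is a moving average of the innovations whose weights at lags \<open>k < t\<close> do
  not depend on \<open>t\<close>. As a power of the characteristic function of \<open>\<xi>\<^sub>1\<close> is integrable, the sum over
  the last \<open>d\<close> innovations has a smooth density of the size of its inverse standard deviation.
  Hence, up to an error of order \<open>\<epsilon>\<close> in mean square, \<open>K(\<cdot> / h\<^sub>n) / h\<^sub>n\<close> may be replaced by \<open>\<integral>K\<close> times
  the \<open>N[0, \<epsilon>\<^sup>2 \<beta>\<^sub>n\<^sup>2]\<close> density, once the first few terms have been removed by (iii).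
  Split \<open>x\<^sub>t(n)\<close> into a sum \<open>F\<^sub>t\<close> over the innovations after time 0 and a remainder that is close to a
  variable \<open>Y\<^sub>n\<close> independent of \<open>t\<close> and of \<open>F\<^sub>t\<close>. Since the variance of the partial sums of the weights
  is slowly varying, \<open>Var(F\<^sub>t) / \<beta>\<^sub>n\<^sup>2\<close> tends to a constant \<open>1 - \<tau>\<close> uniformly in \<open>t \<ge> \<delta> n\<close>, and \<open>F\<^sub>s\<close>, \<open>F\<^sub>t\<close>
  are asymptotically independent for most pairs \<open>s, t\<close>. The average over \<open>t\<close> of the Gaussian density is
  therefore close to the \<open>N[0, 1 - \<tau> + \<epsilon>\<^sup>2]\<close> density at \<open>Y\<^sub>n / \<beta>\<^sub>n\<close>, and \<open>Y\<^sub>n / \<beta>\<^sub>n\<close> tends to \<open>N[0, \<tau>]\<close>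
  in distribution, where \<open>\<tau> = 1/2\<close> under FR1 and \<open>\<tau> = 0\<close> otherwise.
\<close>

section \<open>Characteristic functions of sums\<close>

text \<open>The weights are arbitrary except that none dominates, so the density estimate cannot
  rest on a fixed number of comparable summands. The product of characteristic functions is instead
  split by a weighted mean inequality, with weights proportional to the squared coefficients: after
  rescaling every factor is the same function, a characteristic function at
  \<open>u / sqrt p\<close> raised to the power \<open>p\<close>. Kernel and Gaussian window have
  equal Lebesgue integrals. Their difference, tested against a density that is flat on the scale of
  the window, is therefore small; this controls pairs of times far apart, and the few close pairs
  vanish through \<open>\<beta> n / (n * h n)\<close>. An exponent below 1 in the growth of the
  variance makes the inverse variances summable over the gaps. The window
  \<open>\<epsilon> * \<beta> n\<close> must be wide against \<open>h n\<close> and narrow against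
  \<open>\<beta> n\<close>, so \<open>n\<close> goes to infinity first and \<open>\<epsilon>\<close>
  to 0 afterwards. The value 1/2 of \<open>\<tau>\<close> under FR1 is a matter of symmetry: the
  partial sums \<open>S k\<close> of \<open>c\<close> tend to 0, the innovations after time 0 carry
  the weights \<open>S k\<close>, those before it nearly \<open>- S k\<close>, hence equal shares of
  the variance.\<close>

lemma abs_one_minus_exp_le:
  fixes y :: real assumes "0 \<le> y" shows "\<bar>1 - y - exp (-y)\<bar> \<le> y\<^sup>2"
proof -
  have 1: "1 - y \<le> exp (-y)" using exp_ge_add_one_self[of "-y"] by simp
  have "exp (-y) = 1 / exp y" by (simp add: exp_minus inverse_eq_divide)
  also have "\<dots> \<le> 1 / (1 + y)" using assms by (intro divide_left_mono) (auto simp: add_pos_pos)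
  also have "\<dots> \<le> 1 - y + y\<^sup>2" using assms
    by (simp add: divide_simps power2_eq_square algebra_simps add_nonneg_eq_0_iff)
  finally show ?thesis using 1 by simp
qed

lemma cmod_iexp_diff_le: "cmod (iexp x - iexp y) \<le> \<bar>x - y\<bar>"
proof -
  have "iexp x - iexp y = iexp y * (iexp (x - y) - 1)" by (simp add: algebra_simps flip: exp_add)
  then have "cmod (iexp x - iexp y) = cmod (iexp (x - y) - 1)" by (simp add: norm_mult)
  also have "\<dots> \<le> \<bar>x - y\<bar>" using iexp_approx1[of "x - y" 0] by simp
  finally show ?thesis .
qed

text \<open>Jensen's inequality for \<open>exp\<close> at the points \<open>ln (y k) / w k\<close>:
  the weighted inequality between geometric and arithmetic mean. Under an integral it does the work
  of Hoelder's inequality with the exponents \<open>1 / w k\<close>, for any number of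
  factors.\<close>

lemma weighted_prod_le_sum:
  fixes w y :: "'i \<Rightarrow> real"
  assumes "finite S" and w: "\<And>k. k \<in> S \<Longrightarrow> 0 < w k" "sum w S = 1"
    and y: "\<And>k. k \<in> S \<Longrightarrow> 0 \<le> y k"
  shows "(\<Prod>k\<in>S. y k) \<le> (\<Sum>k\<in>S. w k * y k powr (1 / w k))"
proof (cases "\<exists>k\<in>S. y k = 0")
  case True
  then have "(\<Prod>k\<in>S. y k) = 0" using \<open>finite S\<close> by simp
  then show ?thesis using w y by (auto intro!: sum_nonneg simp: less_imp_le)
next
  case False
  then have pos: "\<And>k. k \<in> S \<Longrightarrow> 0 < y k" using y by force
  have "S \<noteq> {}" using w by auto
  have "(\<Prod>k\<in>S. y k) = exp (\<Sum>k\<in>S. w k *\<^sub>R (ln (y k) / w k))"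
    using pos w \<open>finite S\<close> by (simp add: exp_sum) (intro prod.cong, auto, metis less_numeral_extra(3))
  also have "\<dots> \<le> (\<Sum>k\<in>S. w k * exp (ln (y k) / w k))"
    by (rule convex_on_sum[OF _ _ exp_convex]) (use assms \<open>S \<noteq> {}\<close> in \<open>auto simp: less_imp_le\<close>)
  also have "\<dots> = (\<Sum>k\<in>S. w k * y k powr (1 / w k))"
    using pos by (intro sum.cong) (auto simp: powr_def less_imp_neq[symmetric])
  finally show ?thesis .
qed

text \<open>The cutoff \<open>m\<close> will take values in [0, 1]: the constant 1 leads to the
  bound of a density, a truncated multiple of \<open>|u|\<close> to its modulus of
  continuity.\<close>

abbreviation gauss_weight :: "real \<Rightarrow> (real \<Rightarrow> real) \<Rightarrow> ennreal" where
  "gauss_weight c m \<equiv> (\<integral>\<^sup>+ u. ennreal (exp (- (c * u\<^sup>2)) * m u) \<partial>lborel)"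

section \<open>The characteristic function of one innovation\<close>

locale smooth_law = real_distribution \<mu> for \<mu> :: "real measure" +
  fixes \<sigma>2 :: real and \<theta> :: nat
  assumes int1: "integrable \<mu> (\<lambda>x. x)" and mean0: "(\<integral>x. x \<partial>\<mu>) = 0"
    and int2: "integrable \<mu> (\<lambda>x. x\<^sup>2)" and var_eq: "(\<integral>x. x\<^sup>2 \<partial>\<mu>) = \<sigma>2" and var_pos: "0 < \<sigma>2"
    and theta_pos: "1 \<le> \<theta>" and int_char: "integrable lborel (\<lambda>u. cmod (char \<mu> u) ^ \<theta>)"
begin

text \<open>The Taylor remainder in \<open>char_approx3\<close> is \<open>v^2 / 6\<close> times the
  mean of \<open>min (6 * x^2) (|v| * |x|^3)\<close>, and this mean tends to 0 with \<open>v\<close>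
  by dominated convergence, on the strength of the second moment.\<close>

lemma char_quadratic_approx:
  assumes "0 < \<eta>"
  shows "\<exists>r>0. \<forall>v. \<bar>v\<bar> \<le> r \<longrightarrow> cmod (char \<mu> v - of_real (1 - \<sigma>2 * v\<^sup>2 / 2)) \<le> \<eta> * v\<^sup>2"
proof -
  define g where "g v = expectation (\<lambda>x. min (6 * x\<^sup>2) (\<bar>v\<bar> * \<bar>x\<bar> ^ 3))" for v
  have gint: "integrable \<mu> (\<lambda>x. min (6 * x\<^sup>2) (\<bar>v\<bar> * \<bar>x\<bar> ^ 3))" for v
    by (rule Bochner_Integration.integrable_bound[where f="\<lambda>x. 6 * x\<^sup>2"]) (use int2 in auto)
  have "(\<lambda>n. g (inverse (real (Suc n)))) \<longlonglongrightarrow> expectation (\<lambda>x. 0)" unfolding g_def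
  proof (rule integral_dominated_convergence)
    show "integrable \<mu> (\<lambda>x. 6 * x\<^sup>2)" using int2 by simp
    show "AE x in \<mu>. (\<lambda>n. min (6 * x\<^sup>2) (\<bar>inverse (real (Suc n))\<bar> * \<bar>x\<bar> ^ 3)) \<longlonglongrightarrow> 0"
    proof (rule AE_I2)
      fix x
      have "(\<lambda>n. min (6 * x\<^sup>2) (\<bar>inverse (real (Suc n))\<bar> * \<bar>x\<bar> ^ 3)) \<longlonglongrightarrow> min (6 * x\<^sup>2) (\<bar>0\<bar> * \<bar>x\<bar> ^ 3)"
        by (intro tendsto_intros LIMSEQ_inverse_real_of_nat)
      then show "(\<lambda>n. min (6 * x\<^sup>2) (\<bar>inverse (real (Suc n))\<bar> * \<bar>x\<bar> ^ 3)) \<longlonglongrightarrow> 0" by simp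
    qed
  qed auto
  then have "(\<lambda>n. g (inverse (real (Suc n)))) \<longlonglongrightarrow> 0" by simp
  then have "\<forall>\<^sub>F n in sequentially. g (inverse (real (Suc n))) < \<eta>"
    using assms by (auto dest: order_tendstoD)
  then obtain n where n: "g (inverse (real (Suc n))) < \<eta>" by (auto simp: eventually_sequentially)
  have "cmod (char \<mu> v - of_real (1 - \<sigma>2 * v\<^sup>2 / 2)) \<le> \<eta> * v\<^sup>2" if "\<bar>v\<bar> \<le> inverse (real (Suc n))" for v
  proof -
    \<comment> \<open>Monotonicity in \<open>|v|\<close> turns the limit along
      \<open>1 / (n + 1)\<close> into a whole neighbourhood of 0.\<close>
    have "g v \<le> g (inverse (real (Suc n)))" unfolding g_def using that
      by (intro integral_mono gint) (intro min.mono mult_right_mono, auto)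
    then have "g v \<le> \<eta>" using n by simp
    moreover have "0 \<le> g v" unfolding g_def by (intro integral_nonneg_AE) auto
    ultimately have "v\<^sup>2 / 6 * g v \<le> v\<^sup>2 * \<eta>" using assms by (intro mult_mono) auto
    moreover have "cmod (char \<mu> v - (1 - v\<^sup>2 * \<sigma>2 / 2)) \<le> v\<^sup>2 / 6 * g v"
      unfolding g_def by (rule char_approx3) (use int1 mean0 int2 var_eq in auto)
    ultimately show ?thesis by (simp add: mult.commute)
  qed
  then show ?thesis by (intro exI[of _ "inverse (real (Suc n))"]) auto
qed

lemma char_gauss_approx:
  assumes "0 < \<eta>"
  shows "\<exists>r>0. \<forall>v. \<bar>v\<bar> \<le> r \<longrightarrow> cmod (char \<mu> v - of_real (exp (- (\<sigma>2 * v\<^sup>2 / 2)))) \<le> \<eta> * v\<^sup>2"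
proof -
  obtain r where r: "r > 0" "\<And>v. \<bar>v\<bar> \<le> r \<Longrightarrow> cmod (char \<mu> v - of_real (1 - \<sigma>2 * v\<^sup>2 / 2)) \<le> \<eta> / 2 * v\<^sup>2"
    using char_quadratic_approx[of "\<eta> / 2"] assms by auto
  \<comment> \<open>Within the radius \<open>sqrt (2 * \<eta>) / \<sigma>2\<close> the error
    \<open>y^2 = \<sigma>2^2 * v^4 / 4\<close> of replacing \<open>1 - y\<close> by
    \<open>exp (-y)\<close> uses at most half of the allowance \<open>\<eta> * v^2\<close>.\<close>
  define r' where "r' = min r (sqrt (2 * \<eta>) / \<sigma>2)"
  have "cmod (char \<mu> v - of_real (exp (- (\<sigma>2 * v\<^sup>2 / 2)))) \<le> \<eta> * v\<^sup>2" if v: "\<bar>v\<bar> \<le> r'" for v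
  proof -
    define y where "y = \<sigma>2 * v\<^sup>2 / 2"
    have "y \<ge> 0" unfolding y_def using var_pos by simp
    have "\<sigma>2 * \<bar>v\<bar> \<le> sqrt (2 * \<eta>)" using v var_pos unfolding r'_def by (simp add: field_simps)
    then have "(\<sigma>2 * \<bar>v\<bar>)\<^sup>2 \<le> (sqrt (2 * \<eta>))\<^sup>2" using var_pos by (intro power_mono) auto
    then have "\<sigma>2\<^sup>2 * v\<^sup>2 \<le> 2 * \<eta>" using assms by (simp add: power_mult_distrib)
    then have "\<sigma>2\<^sup>2 * v\<^sup>2 * v\<^sup>2 \<le> 2 * \<eta> * v\<^sup>2" by (intro mult_right_mono) auto
    then have y2: "y\<^sup>2 \<le> \<eta> / 2 * v\<^sup>2" unfolding y_def by (simp add: power2_eq_square algebra_simps)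
    have "cmod (char \<mu> v - of_real (exp (- y))) \<le> cmod (char \<mu> v - of_real (1 - y)) + cmod (of_real (1 - y) - of_real (exp (- y)))"
      using norm_triangle_ineq[of "char \<mu> v - of_real (1 - y)" "of_real (1 - y) - of_real (exp (- y))"] by simp
    also have "cmod (of_real (1 - y) - of_real (exp (- y))) = \<bar>1 - y - exp (-y)\<bar>"
      unfolding of_real_diff[symmetric] norm_of_real by simp
    also have "\<dots> \<le> y\<^sup>2" using abs_one_minus_exp_le[OF \<open>y \<ge> 0\<close>] .
    also have "cmod (char \<mu> v - of_real (1 - y)) \<le> \<eta> / 2 * v\<^sup>2" using r(2)[of v] v unfolding y_def r'_def by auto
    finally show ?thesis using y2 unfolding y_def by simp
  qed
  then show ?thesis using r var_pos assms by (intro exI[of _ r']) (auto simp: r'_def)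
qed

text \<open>Half of the quadratic decrease \<open>\<sigma>2 * v^2 / 2\<close> pays for the
  approximation error, the other half becomes the exponent.\<close>

lemma char_near_zero:
  "\<exists>r>0. \<forall>v. \<bar>v\<bar> \<le> r \<longrightarrow> cmod (char \<mu> v) \<le> exp (- (\<sigma>2 / 4 * v\<^sup>2))"
proof -
  obtain r where r: "r > 0" "\<And>v. \<bar>v\<bar> \<le> r \<Longrightarrow> cmod (char \<mu> v - of_real (1 - \<sigma>2 * v\<^sup>2 / 2)) \<le> \<sigma>2 / 4 * v\<^sup>2"
    using char_quadratic_approx[of "\<sigma>2 / 4"] var_pos by auto
  \<comment> \<open>The radius \<open>1 / sqrt \<sigma>2\<close> keeps
    \<open>1 - \<sigma>2 * v^2 / 2\<close> nonnegative, so that it equals its modulus.\<close>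
  define r' where "r' = min r (1 / sqrt \<sigma>2)"
  have "cmod (char \<mu> v) \<le> exp (- (\<sigma>2 / 4 * v\<^sup>2))" if v: "\<bar>v\<bar> \<le> r'" for v
  proof -
    have "\<bar>v\<bar> \<le> 1 / sqrt \<sigma>2" using v by (simp add: r'_def)
    then have "\<bar>v\<bar> * sqrt \<sigma>2 \<le> 1" using var_pos by (simp add: field_simps)
    then have "(\<bar>v\<bar> * sqrt \<sigma>2)\<^sup>2 \<le> 1\<^sup>2" using var_pos by (intro power_mono) auto
    then have s: "\<sigma>2 * v\<^sup>2 \<le> 1" using var_pos by (simp add: power_mult_distrib mult.commute)
    have "cmod (char \<mu> v) \<le> cmod (char \<mu> v - of_real (1 - \<sigma>2 * v\<^sup>2 / 2)) + cmod (of_real (1 - \<sigma>2 * v\<^sup>2 / 2))"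
      using norm_triangle_ineq[of "char \<mu> v - of_real (1 - \<sigma>2 * v\<^sup>2 / 2)" "of_real (1 - \<sigma>2 * v\<^sup>2 / 2)"] by simp
    also have "\<dots> \<le> \<sigma>2 / 4 * v\<^sup>2 + (1 - \<sigma>2 * v\<^sup>2 / 2)"
      unfolding norm_of_real using r(2)[of v] v s by (intro add_mono) (auto simp: r'_def)
    also have "\<dots> = 1 + (- (\<sigma>2 / 4 * v\<^sup>2))" by simp
    also have "\<dots> \<le> exp (- (\<sigma>2 / 4 * v\<^sup>2))" by (rule exp_ge_add_one_self)
    finally show ?thesis .
  qed
  then show ?thesis using r var_pos by (intro exI[of _ r']) (auto simp: r'_def)
qed

lemma char_lipschitz: "cmod (char \<mu> u - char \<mu> v) \<le> \<bar>u - v\<bar> * expectation (\<lambda>x. \<bar>x\<bar>)"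
proof -
  have i: "integrable \<mu> (\<lambda>x. iexp (u * x))" for u by (rule integrable_const_bound[of _ 1]) auto
  have "char \<mu> u - char \<mu> v = (CLINT x|\<mu>. iexp (u * x) - iexp (v * x))"
    unfolding char_def by (rule Bochner_Integration.integral_diff[OF i i, symmetric])
  also have "cmod \<dots> \<le> expectation (\<lambda>x. \<bar>u - v\<bar> * \<bar>x\<bar>)"
  proof (rule Bochner_Integration.integral_norm_bound_integral)
    show "integrable \<mu> (\<lambda>x. iexp (u * x) - iexp (v * x))" by (intro Bochner_Integration.integrable_diff i)
    show "integrable \<mu> (\<lambda>x. \<bar>u - v\<bar> * \<bar>x\<bar>)" using int1 by auto
    show "cmod (iexp (u * x) - iexp (v * x)) \<le> \<bar>u - v\<bar> * \<bar>x\<bar>" for x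
      using cmod_iexp_diff_le[of "u * x" "v * x"] by (simp add: abs_mult flip: left_diff_distrib)
  qed
  finally show ?thesis by simp
qed

text \<open>A Lipschitz function with an integrable power vanishes at infinity: a value above 1/2 at
  a distant point would keep the modulus above 1/4 on an interval of fixed length, against the
  smallness of the tail integral.\<close>

lemma char_at_infinity: "\<exists>R>0. \<forall>u. R \<le> \<bar>u\<bar> \<longrightarrow> cmod (char \<mu> u) \<le> 1 / 2"
proof -
  define m where "m = expectation (\<lambda>x. \<bar>x\<bar>)"
  have "m \<ge> 0" unfolding m_def by simp
  \<comment> \<open>Over the distance \<open>w\<close> the Lipschitz bound allows a change of at
    most 1/4.\<close>
  define w where "w = 1 / (4 * (m + 1))"
  have w: "w > 0" "w * m \<le> 1 / 4" using \<open>m \<ge> 0\<close> by (auto simp: w_def field_simps)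
  define G where "G n = (\<integral>u. indicator {u. real n \<le> \<bar>u\<bar>} u * cmod (char \<mu> u) ^ \<theta> \<partial>lborel)" for n
  have Gi: "integrable lborel (\<lambda>u. indicator {u. real n \<le> \<bar>u\<bar>} u * cmod (char \<mu> u) ^ \<theta>)" for n
    by (rule Bochner_Integration.integrable_bound[OF int_char]) (auto simp: indicator_def)
  have "G \<longlonglongrightarrow> integral\<^sup>L lborel (\<lambda>u::real. 0::real)" unfolding G_def
  proof (rule integral_dominated_convergence)
    show "AE x in lborel. (\<lambda>n. indicator {u. real n \<le> \<bar>u\<bar>} x * cmod (char \<mu> x) ^ \<theta>) \<longlonglongrightarrow> 0"
    proof (rule AE_I2, rule tendsto_eventually)
      fix x :: real
      obtain N where "\<bar>x\<bar> < real N" using reals_Archimedean2 by blast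
      then have "indicator {u. real n \<le> \<bar>u\<bar>} x = (0::real)" if "n \<ge> N" for n
        using that by (auto simp: indicator_def)
      then show "\<forall>\<^sub>F n in sequentially. indicator {u. real n \<le> \<bar>u\<bar>} x * cmod (char \<mu> x) ^ \<theta> = 0"
        unfolding eventually_sequentially by (intro exI[of _ N]) auto
    qed
  qed (use int_char in \<open>auto simp: indicator_def\<close>)
  then have "\<forall>\<^sub>F n in sequentially. G n < 2 * w * (1/4) ^ \<theta>"
    using w by (intro order_tendstoD) auto
  then obtain n where n: "G n < 2 * w * (1/4) ^ \<theta>" by (auto simp: eventually_sequentially)
  have "cmod (char \<mu> u) \<le> 1 / 2" if u: "real n + w \<le> \<bar>u\<bar>" for u
  proof (rule ccontr)
    assume "\<not> cmod (char \<mu> u) \<le> 1 / 2"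
    then have big: "cmod (char \<mu> u) > 1 / 2" by simp
    have *: "1 / 4 \<le> cmod (char \<mu> v)" "real n \<le> \<bar>v\<bar>" if "v \<in> {u-w..u+w}" for v
    proof -
      have uv: "\<bar>u - v\<bar> \<le> w" using that by auto
      then show "real n \<le> \<bar>v\<bar>" using u by linarith
      have "cmod (char \<mu> u - char \<mu> v) \<le> w * m"
        using char_lipschitz[of u v] mult_right_mono[OF uv \<open>m \<ge> 0\<close>] unfolding m_def by linarith
      then show "1 / 4 \<le> cmod (char \<mu> v)"
        using w big norm_triangle_ineq2[of "char \<mu> u" "char \<mu> v"] by linarith
    qed
    have "2 * w * (1/4) ^ \<theta> = (\<integral>v. indicator {u-w..u+w} v * (1/4) ^ \<theta> \<partial>lborel)" using w by simp
    also have "\<dots> \<le> G n" unfolding G_def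
    proof (rule integral_mono[OF _ Gi])
      show "integrable lborel (\<lambda>v. indicator {u-w..u+w} v * (1/4::real) ^ \<theta>)"
        by (intro integrable_mult_left integrable_real_indicator) (use w in auto)
      show "indicator {u-w..u+w} v * (1/4) ^ \<theta> \<le> indicator {u. real n \<le> \<bar>u\<bar>} v * cmod (char \<mu> v) ^ \<theta>" for v
        using *[of v] by (auto simp: indicator_def intro!: power_mono)
    qed
    finally show False using n by simp
  qed
  then show ?thesis using w by (intro exI[of _ "real n + w"]) auto
qed

text \<open>A factor \<open>w\<close> of modulus 1 makes the modulus at \<open>u\<close> the mean of
  a cosine \<open>c\<close>. The square of this mean is at most the mean of the square, and the
  double-angle formula expresses the latter by the characteristic function at
  \<open>2 * u\<close>.\<close>

lemma char_doubling: "(cmod (char \<mu> u))\<^sup>2 \<le> (1 + cmod (char \<mu> (2 * u))) / 2"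
proof (cases "char \<mu> u = 0")
  case False
  define \<rho> where "\<rho> = cmod (char \<mu> u)"
  have "\<rho> > 0" using False by (simp add: \<rho>_def)
  define w where "w = cnj (char \<mu> u) / of_real \<rho>"
  have w: "cmod w = 1" using \<open>\<rho> > 0\<close> by (simp add: w_def norm_divide \<rho>_def)
  have i: "integrable \<mu> (\<lambda>x. iexp (u * x))" for u by (rule integrable_const_bound[of _ 1]) auto
  define c where "c x = Re (w * iexp (u * x))" for x
  have ci: "integrable \<mu> c" unfolding c_def[abs_def] by (intro integrable_Re integrable_mult_right i)
  have "expectation c = Re (w * char \<mu> u)"
    unfolding c_def[abs_def] char_def by (subst integral_Re[OF integrable_mult_right[OF i]]) simp
  also have "w * char \<mu> u = of_real \<rho>" using \<open>\<rho> > 0\<close> complex_norm_square[of "char \<mu> u"] unfolding w_def \<rho>_def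
    by (simp add: field_simps power2_eq_square)
  finally have Ec: "expectation c = \<rho>" by simp
  have c2: "(c x)\<^sup>2 = (1 + Re (w\<^sup>2 * iexp (2 * u * x))) / 2" for x
  proof -
    define y where "y = w * iexp (u * x)"
    have "cmod y = 1" using w by (simp add: y_def norm_mult)
    then have "(Re y)\<^sup>2 + (Im y)\<^sup>2 = 1" by (simp add: cmod_def)
    moreover have "Re (y\<^sup>2) = (Re y)\<^sup>2 - (Im y)\<^sup>2" by (simp add: power2_eq_square)
    moreover have "y\<^sup>2 = w\<^sup>2 * iexp (2 * u * x)" by (simp add: y_def power_mult_distrib mult_ac flip: exp_double)
    ultimately show ?thesis unfolding c_def y_def[symmetric] by (simp add: field_simps)
  qed
  have i2: "integrable \<mu> (\<lambda>x. Re (w\<^sup>2 * iexp (2 * u * x)))" by (intro integrable_Re integrable_mult_right i)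
  have c2i: "integrable \<mu> (\<lambda>x. (c x)\<^sup>2)" unfolding c2 using i2 by simp
  have "0 \<le> variance c" by simp
  also have "\<dots> = expectation (\<lambda>x. (c x)\<^sup>2) - \<rho>\<^sup>2" using variance_eq[OF ci c2i] Ec by simp
  also have "expectation (\<lambda>x. (c x)\<^sup>2) = (1 + expectation (\<lambda>x. Re (w\<^sup>2 * iexp (2 * u * x)))) / 2"
    unfolding c2 using i2 prob_space by simp
  also have "expectation (\<lambda>x. Re (w\<^sup>2 * iexp (2 * u * x))) = Re (w\<^sup>2 * char \<mu> (2 * u))"
    unfolding char_def by (subst integral_Re[OF integrable_mult_right[OF i]]) simp
  also have "\<dots> \<le> cmod (char \<mu> (2 * u))"
    using complex_Re_le_cmod[of "w\<^sup>2 * char \<mu> (2 * u)"] w by (simp add: norm_mult norm_power)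
  finally show ?thesis by (simp add: \<rho>_def)
qed simp

text \<open>\<open>char_doubling\<close> carries a bound below 1 from \<open>2 * u\<close> to
  \<open>u\<close>, so finitely many halvings bring the bound at infinity down to any
  \<open>r\<close>. The clause \<open>1 / 2 \<le> q\<close> keeps \<open>q\<close> positive for
  later logarithms and powers.\<close>

lemma char_away_from_zero:
  assumes "0 < r"
  shows "\<exists>q<1. 1 / 2 \<le> q \<and> (\<forall>u. r \<le> \<bar>u\<bar> \<longrightarrow> cmod (char \<mu> u) \<le> q)"
proof -
  obtain R where R: "R > 0" "\<And>u. R \<le> \<bar>u\<bar> \<Longrightarrow> cmod (char \<mu> u) \<le> 1 / 2" using char_at_infinity by auto
  have *: "\<exists>q<1. 1 / 2 \<le> q \<and> (\<forall>u. R / 2 ^ k \<le> \<bar>u\<bar> \<longrightarrow> cmod (char \<mu> u) \<le> q)" for k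
  proof (induction k)
    case 0 then show ?case using R by (intro exI[of _ "1/2"]) auto
  next
    case (Suc k)
    then obtain q where q: "q < 1" "1/2 \<le> q" "\<And>u. R / 2 ^ k \<le> \<bar>u\<bar> \<Longrightarrow> cmod (char \<mu> u) \<le> q" by auto
    show ?case
    proof (intro exI[of _ "sqrt ((1 + q) / 2)"] conjI allI impI)
      show "sqrt ((1 + q) / 2) < 1" using q by simp
      show "1 / 2 \<le> sqrt ((1 + q) / 2)" using q by (intro real_le_rsqrt) (simp add: power2_eq_square)
      fix u :: real assume "R / 2 ^ Suc k \<le> \<bar>u\<bar>"
      then have "R / 2 ^ k \<le> \<bar>2 * u\<bar>" by (simp add: field_simps abs_mult)
      from q(3)[OF this] char_doubling[of u] have "(cmod (char \<mu> u))\<^sup>2 \<le> (1 + q) / 2" by simp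
      then show "cmod (char \<mu> u) \<le> sqrt ((1 + q) / 2)" by (rule real_le_rsqrt)
    qed
  qed
  obtain k where "R / r < 2 ^ k" using real_arch_pow[of 2 "R / r"] by auto
  then have "R / 2 ^ k < r" using assms by (simp add: field_simps)
  then show ?thesis using *[of k] by (meson less_le_trans less_imp_le order_trans)
qed

section \<open>Integrals of powers and products of characteristic functions\<close>

lemma nn_integral_gauss_moment_finite:
  fixes c :: real
  assumes "0 < c"
  shows "(\<integral>\<^sup>+ u. ennreal (exp (- (c * u\<^sup>2)) * \<bar>u\<bar> ^ k) \<partial>lborel) < \<infinity>"
proof -
  define s where "s = 1 / sqrt (2 * c)"
  have "s > 0" using assms by (simp add: s_def)
  have "integrable lborel (\<lambda>x. normal_density 0 s x * \<bar>x - 0\<bar> ^ k)" by (rule integrable_normal_moment_abs) fact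
  then have "integrable lborel (\<lambda>x. sqrt (2 * pi * s\<^sup>2) * (normal_density 0 s x * \<bar>x\<bar> ^ k))" by simp
  also have "(\<lambda>x. sqrt (2 * pi * s\<^sup>2) * (normal_density 0 s x * \<bar>x\<bar> ^ k)) = (\<lambda>u. exp (- (c * u\<^sup>2)) * \<bar>u\<bar> ^ k)"
    using \<open>s > 0\<close> assms by (auto simp: normal_density_def s_def power_divide field_simps)
  finally show ?thesis by (subst nn_integral_eq_integral) auto
qed

text \<open>Conjugate symmetry; it reduces negative coefficients to their moduli.\<close>

lemma cmod_char_abs: "cmod (char \<mu> \<bar>u\<bar>) = cmod (char \<mu> u)"
proof -
  have "char \<mu> (- u) = cnj (char \<mu> u)" for u
    unfolding char_def by (simp add: exp_cnj flip: Bochner_Integration.integral_cnj)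
  then show ?thesis by (cases "0 \<le> u") auto
qed

text \<open>For integer \<open>p\<close> the integrand is the modulus of the characteristic function
  of a normalised sum of \<open>p\<close> copies; real exponents are needed later. Near the origin
  it lies below a Gaussian. Elsewhere \<open>p - \<theta>\<close> of the \<open>p\<close> factors
  are at most \<open>q\<close>, the other \<open>\<theta>\<close> are integrable, and the
  exponential smallness beats the factor \<open>sqrt p\<close> from the substitution.\<close>

lemma scaled_power_integral:
  obtains c C P0 :: real where "0 < c" "0 < C" "1 \<le> P0"
    "\<And>p m. P0 \<le> p \<Longrightarrow> m \<in> borel_measurable borel \<Longrightarrow> (\<And>u. 0 \<le> m u \<and> m u \<le> 1) \<Longrightarrow>
      (\<integral>\<^sup>+ u. ennreal (cmod (char \<mu> (u / sqrt p)) powr p * m u) \<partial>lborel)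
        \<le> gauss_weight c m + ennreal (C / sqrt p)"
proof -
  obtain r where r: "r > 0" "\<And>v. \<bar>v\<bar> \<le> r \<Longrightarrow> cmod (char \<mu> v) \<le> exp (- (\<sigma>2 / 4 * v\<^sup>2))" using char_near_zero by auto
  obtain q where q: "q < 1" "1 / 2 \<le> q" "\<And>u. r \<le> \<bar>u\<bar> \<Longrightarrow> cmod (char \<mu> u) \<le> q" using char_away_from_zero[OF r(1)] by auto
  define I where "I = (\<integral>u. cmod (char \<mu> u) ^ \<theta> \<partial>lborel)"
  have "I \<ge> 0" by (simp add: I_def)
  define L where "L = ln (1 / q)"
  have "L > 0" using q by (simp add: L_def)
  \<comment> \<open>The summand 1 makes \<open>C\<close> positive without any discussion of
    \<open>I\<close>.\<close>
  define C where "C = I / (q ^ \<theta> * L) + 1"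
  have C: "C > 0" using \<open>I \<ge> 0\<close> \<open>L > 0\<close> q by (auto simp: C_def intro!: add_nonneg_pos divide_nonneg_nonneg)
  show ?thesis
  proof (rule that[of "\<sigma>2 / 4" C "max 1 (real \<theta>)"])
    fix p and m :: "real \<Rightarrow> real"
    assume p: "max 1 (real \<theta>) \<le> p" and [measurable]: "m \<in> borel_measurable borel" and m: "\<And>u. 0 \<le> m u \<and> m u \<le> 1"
    have p0: "p > 0" "sqrt p > 0" "real \<theta> \<le> p" using p by auto
    have pt: "cmod (char \<mu> (u / sqrt p)) powr p * m u
      \<le> exp (- (\<sigma>2 / 4 * u\<^sup>2)) * m u + q powr (p - \<theta>) * cmod (char \<mu> (u / sqrt p)) ^ \<theta>" for u
    proof (cases "\<bar>u / sqrt p\<bar> \<le> r")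
      case True
      have "cmod (char \<mu> (u / sqrt p)) powr p \<le> exp (- (\<sigma>2 / 4 * (u / sqrt p)\<^sup>2)) powr p"
        using r(2)[OF True] p0 by (intro powr_mono2) auto
      also have "\<dots> = exp (- (\<sigma>2 / 4 * u\<^sup>2))" using p0 by (simp add: exp_powr_real power_divide)
      finally have "cmod (char \<mu> (u / sqrt p)) powr p * m u \<le> exp (- (\<sigma>2 / 4 * u\<^sup>2)) * m u"
        using m[of u] by (intro mult_right_mono) auto
      moreover have "0 \<le> q powr (p - \<theta>) * cmod (char \<mu> (u / sqrt p)) ^ \<theta>" by simp
      ultimately show ?thesis by linarith
    next
      case False
      define y where "y = cmod (char \<mu> (u / sqrt p))"
      have y: "0 \<le> y" "y \<le> q" using q(3)[of "u / sqrt p"] False by (auto simp: y_def)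
      have "y powr p = y powr (p - \<theta>) * y ^ \<theta>"
      proof (cases "y = 0")
        case False then show ?thesis using y by (simp add: powr_diff powr_realpow)
      qed (use theta_pos in auto)
      also have "\<dots> \<le> q powr (p - \<theta>) * y ^ \<theta>" using y p0 by (intro mult_right_mono powr_mono2) auto
      finally have "y powr p * m u \<le> q powr (p - \<theta>) * y ^ \<theta>" using m[of u] mult_left_le[of "m u" "y powr p"] by auto
      then show ?thesis unfolding y_def using m[of u] by (simp add: add_increasing)
    qed
    have "(\<integral>\<^sup>+ u. ennreal (cmod (char \<mu> (u / sqrt p)) powr p * m u) \<partial>lborel)
      \<le> (\<integral>\<^sup>+ u. ennreal (exp (- (\<sigma>2 / 4 * u\<^sup>2)) * m u) + ennreal (q powr (p - \<theta>) * cmod (char \<mu> (u / sqrt p)) ^ \<theta>) \<partial>lborel)"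
      using pt m q by (intro nn_integral_mono) (auto simp flip: ennreal_plus intro!: ennreal_leI)
    also have "\<dots> = (\<integral>\<^sup>+ u. ennreal (exp (- (\<sigma>2 / 4 * u\<^sup>2)) * m u) \<partial>lborel)
       + (\<integral>\<^sup>+ u. ennreal (q powr (p - \<theta>) * cmod (char \<mu> (u / sqrt p)) ^ \<theta>) \<partial>lborel)" by (rule nn_integral_add) auto
    also have "(\<integral>\<^sup>+ u. ennreal (q powr (p - \<theta>) * cmod (char \<mu> (u / sqrt p)) ^ \<theta>) \<partial>lborel)
       = ennreal (q powr (p - \<theta>)) * (\<integral>\<^sup>+ u. ennreal (cmod (char \<mu> (u / sqrt p)) ^ \<theta>) \<partial>lborel)"
      using q by (simp add: nn_integral_cmult ennreal_mult)
    also have "(\<integral>\<^sup>+ u. ennreal (cmod (char \<mu> (u / sqrt p)) ^ \<theta>) \<partial>lborel)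
       = ennreal (sqrt p) * (\<integral>\<^sup>+ u. ennreal (cmod (char \<mu> u) ^ \<theta>) \<partial>lborel)"
      using p0 by (subst nn_integral_real_affine[of _ "sqrt p" 0]) auto
    also have "(\<integral>\<^sup>+ u. ennreal (cmod (char \<mu> u) ^ \<theta>) \<partial>lborel) = ennreal I"
      unfolding I_def by (intro nn_integral_eq_integral int_char) auto
    also have "ennreal (q powr (p - \<theta>)) * (ennreal (sqrt p) * ennreal I) = ennreal (q powr (p - \<theta>) * (sqrt p * I))"
      using \<open>I \<ge> 0\<close> p0 by (simp add: ennreal_mult)
    also have "\<dots> \<le> ennreal (C / sqrt p)"
    proof (rule ennreal_leI)
      have "q powr p = exp (- (p * L))" using q by (simp add: powr_def L_def ln_div)
      also have "\<dots> = 1 / exp (p * L)" by (simp add: exp_minus inverse_eq_divide)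
      \<comment> \<open>The exponential decay is weakened to \<open>1 / (p * L)\<close>; against the
        factor \<open>sqrt p\<close> this leaves the desired \<open>1 / sqrt p\<close>.\<close>
      also have "\<dots> \<le> 1 / (p * L)"
        using p0 \<open>L > 0\<close> exp_ge_add_one_self[of "p * L"] by (intro divide_left_mono) (linarith, auto)
      finally have "q powr p \<le> 1 / (p * L)" .
      then have "q powr p / q ^ \<theta> * (sqrt p * I) \<le> 1 / (p * L) / q ^ \<theta> * (sqrt p * I)"
        using q \<open>I \<ge> 0\<close> p0 by (intro mult_right_mono divide_right_mono) auto
      also have "\<dots> = I / (q ^ \<theta> * L) / sqrt p" using p0 \<open>L > 0\<close> q by (simp add: field_simps flip: power2_eq_square)
      also have "\<dots> \<le> C / sqrt p" using p0 by (intro divide_right_mono) (auto simp: C_def)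
      finally show "q powr (p - \<theta>) * (sqrt p * I) \<le> C / sqrt p" using q by (simp add: powr_diff powr_realpow)
    qed
    finally show "(\<integral>\<^sup>+ u. ennreal (cmod (char \<mu> (u / sqrt p)) powr p * m u) \<partial>lborel)
        \<le> (\<integral>\<^sup>+ u. ennreal (exp (- (\<sigma>2 / 4 * u\<^sup>2)) * m u) \<partial>lborel) + ennreal (C / sqrt p)" by (simp add: add_left_mono)
  qed (use var_pos C in auto)
qed

text \<open>\<open>weighted_prod_le_sum\<close> with the weights \<open>(a k)^2 / V\<close> raises
  the \<open>k\<close>-th factor to the power \<open>p = V / (a k)^2\<close>. With
  \<open>u = sqrt V * l\<close> it becomes the integrand of \<open>scaled_power_integral\<close>, so
  all terms have one common bound and the weights add up to 1. The condition on \<open>P\<close>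
  says that no coefficient carries more than the fraction \<open>1 / P\<close> of the variance, that
  is \<open>p \<ge> P\<close>.\<close>

lemma prod_char_integral:
  obtains c C P0 :: real where "0 < c" "0 < C" "1 \<le> P0"
    "\<And>(S :: nat set) a V P m. finite S \<Longrightarrow> V = (\<Sum>k\<in>S. (a k)\<^sup>2) \<Longrightarrow> 0 < V \<Longrightarrow> P0 \<le> P \<Longrightarrow> (\<And>k. k \<in> S \<Longrightarrow> P * (a k)\<^sup>2 \<le> V) \<Longrightarrow>
      m \<in> borel_measurable borel \<Longrightarrow> (\<And>u. 0 \<le> m u \<and> m u \<le> 1) \<Longrightarrow>
      (\<integral>\<^sup>+ l. ennreal ((\<Prod>k\<in>S. cmod (char \<mu> (a k * l))) * m (sqrt V * l)) \<partial>lborel)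
        \<le> ennreal (1 / sqrt V) * (gauss_weight c m + ennreal (C / sqrt P))"
proof -
  obtain c C P0 :: real where cC: "0 < c" "0 < C" "1 \<le> P0"
    and J: "\<And>p m. P0 \<le> p \<Longrightarrow> m \<in> borel_measurable borel \<Longrightarrow> (\<And>u. 0 \<le> m u \<and> m u \<le> 1) \<Longrightarrow>
      (\<integral>\<^sup>+ u. ennreal (cmod (char \<mu> (u / sqrt p)) powr p * m u) \<partial>lborel)
        \<le> gauss_weight c m + ennreal (C / sqrt p)" using scaled_power_integral by blast
  show ?thesis
  proof (rule that[OF cC])
    fix S :: "nat set" and a :: "nat \<Rightarrow> real" and V P :: real and m :: "real \<Rightarrow> real"
    assume S: "finite S" and V: "V = (\<Sum>k\<in>S. (a k)\<^sup>2)" "0 < V" and P: "P0 \<le> P"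
      and aP: "\<And>k. k \<in> S \<Longrightarrow> P * (a k)\<^sup>2 \<le> V" and [measurable]: "m \<in> borel_measurable borel"
      and m: "\<And>u. 0 \<le> m u \<and> m u \<le> 1"
    \<comment> \<open>Zero coefficients contribute the factor 1 and are dropped, because the mean
      inequality needs positive weights.\<close>
    define T where "T = {k\<in>S. a k \<noteq> 0}"
    define w where "w k = (a k)\<^sup>2 / V" for k
    define B where "B = gauss_weight c m + ennreal (C / sqrt P)"
    have T: "finite T" using S by (simp add: T_def)
    have "(\<Sum>k\<in>T. (a k)\<^sup>2) = V" unfolding V by (rule sum.mono_neutral_left) (use S in \<open>auto simp: T_def\<close>)
    then have w: "\<And>k. k \<in> T \<Longrightarrow> 0 < w k" "sum w T = 1"
      using V(2) by (auto simp: w_def T_def simp flip: sum_divide_distrib)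
    have prodT: "(\<Prod>k\<in>S. cmod (char \<mu> (a k * l))) = (\<Prod>k\<in>T. cmod (char \<mu> (a k * l)))" for l
      by (rule prod.mono_neutral_right) (use S in \<open>auto simp: T_def char_zero\<close>)
    have one: "(\<integral>\<^sup>+ l. ennreal (cmod (char \<mu> (a k * l)) powr (1 / w k) * m (sqrt V * l)) \<partial>lborel) \<le> ennreal (1 / sqrt V) * B"
      if k: "k \<in> T" for k
    proof -
      define p where "p = 1 / w k"
      have ak: "a k \<noteq> 0" "(a k)\<^sup>2 > 0" using k by (auto simp: T_def)
      have p: "p = V / (a k)\<^sup>2" by (simp add: p_def w_def)
      have "P \<le> p" using aP[of k] k ak unfolding p T_def by (simp add: field_simps)
      then have p0: "P0 \<le> p" "p > 0" "P > 0" using P cC by auto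
      have sp: "sqrt p = sqrt V / \<bar>a k\<bar>" unfolding p by (simp add: real_sqrt_divide)
      have "(\<integral>\<^sup>+ l. ennreal (cmod (char \<mu> (a k * l)) powr p * m (sqrt V * l)) \<partial>lborel)
         = ennreal (1 / sqrt V) * (\<integral>\<^sup>+ u. ennreal (cmod (char \<mu> (a k * (u / sqrt V))) powr p * m u) \<partial>lborel)"
        using V(2) by (subst nn_integral_real_affine[of _ "1 / sqrt V" 0]) auto
      also have "(\<integral>\<^sup>+ u. ennreal (cmod (char \<mu> (a k * (u / sqrt V))) powr p * m u) \<partial>lborel)
         = (\<integral>\<^sup>+ u. ennreal (cmod (char \<mu> (u / sqrt p)) powr p * m u) \<partial>lborel)"
      proof (intro nn_integral_cong)
        fix u
        have "cmod (char \<mu> (a k * (u / sqrt V))) = cmod (char \<mu> (u / sqrt p))"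
          using ak V(2) cmod_char_abs[of "a k * (u / sqrt V)"] cmod_char_abs[of "u / sqrt p"]
          by (simp add: sp abs_mult abs_divide mult.commute)
        then show "ennreal (cmod (char \<mu> (a k * (u / sqrt V))) powr p * m u) = ennreal (cmod (char \<mu> (u / sqrt p)) powr p * m u)" by simp
      qed
      also have "\<dots> \<le> gauss_weight c m + ennreal (C / sqrt p)" by (rule J) (use p0 m in auto)
      also have "\<dots> \<le> B" unfolding B_def using \<open>P \<le> p\<close> p0 cC by (intro add_left_mono ennreal_leI divide_left_mono) auto
      finally show ?thesis unfolding p_def by (simp add: mult_left_mono)
    qed
    have "(\<integral>\<^sup>+ l. ennreal ((\<Prod>k\<in>S. cmod (char \<mu> (a k * l))) * m (sqrt V * l)) \<partial>lborel)
      \<le> (\<integral>\<^sup>+ l. (\<Sum>k\<in>T. ennreal (w k) * ennreal (cmod (char \<mu> (a k * l)) powr (1 / w k) * m (sqrt V * l))) \<partial>lborel)"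
    proof (rule nn_integral_mono)
      fix l
      have "(\<Prod>k\<in>S. cmod (char \<mu> (a k * l))) * m (sqrt V * l)
        \<le> (\<Sum>k\<in>T. w k * cmod (char \<mu> (a k * l)) powr (1 / w k)) * m (sqrt V * l)"
        unfolding prodT using m by (intro mult_right_mono weighted_prod_le_sum T w) auto
      also have "\<dots> = (\<Sum>k\<in>T. w k * (cmod (char \<mu> (a k * l)) powr (1 / w k) * m (sqrt V * l)))"
        by (simp add: sum_distrib_right mult.assoc)
      finally show "ennreal ((\<Prod>k\<in>S. cmod (char \<mu> (a k * l))) * m (sqrt V * l))
        \<le> (\<Sum>k\<in>T. ennreal (w k) * ennreal (cmod (char \<mu> (a k * l)) powr (1 / w k) * m (sqrt V * l)))"
        using w m by (subst (2) ennreal_mult[symmetric] | simp add: less_imp_le sum_ennreal ennreal_leI flip: ennreal_mult)+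
    qed
    also have "\<dots> = (\<Sum>k\<in>T. ennreal (w k) * (\<integral>\<^sup>+ l. ennreal (cmod (char \<mu> (a k * l)) powr (1 / w k) * m (sqrt V * l)) \<partial>lborel))"
      by (subst nn_integral_sum) (auto intro!: sum.cong nn_integral_cmult)
    also have "\<dots> \<le> (\<Sum>k\<in>T. ennreal (w k) * (ennreal (1 / sqrt V) * B))" by (intro sum_mono mult_left_mono one) auto
    also have "\<dots> = ennreal (sum w T) * (ennreal (1 / sqrt V) * B)"
      using w by (simp add: less_imp_le sum_ennreal flip: sum_distrib_right)
    finally show "(\<integral>\<^sup>+ l. ennreal ((\<Prod>k\<in>S. cmod (char \<mu> (a k * l))) * m (sqrt V * l)) \<partial>lborel)
        \<le> ennreal (1 / sqrt V) * (gauss_weight c m + ennreal (C / sqrt P))" using w by (simp add: B_def)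
  qed
qed

end

section \<open>Fourier inversion for an integrable characteristic function\<close>

context real_distribution
begin

text \<open>The inverse Fourier integral. The real part makes it real-valued before it is known that
  the imaginary part vanishes.\<close>

definition inversion_density :: "real \<Rightarrow> real" where
  "inversion_density z = Re (CLBINT t. iexp (- (t * z)) * char M t) / (2 * pi)"

context
  assumes int_char: "integrable lborel (\<lambda>t. cmod (char M t))"
begin

lemma complex_integrable_char: "complex_integrable lborel (\<lambda>t. iexp (- (t * z)) * char M t)"
  by (rule Bochner_Integration.integrable_bound[OF int_char]) (auto simp: norm_mult)

lemma inversion_density_diff_le:
  "\<bar>inversion_density z - inversion_density z'\<bar>
     \<le> (\<integral>t. cmod (char M t) * min 2 (\<bar>t\<bar> * \<bar>z - z'\<bar>) \<partial>lborel) / (2 * pi)"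
proof -
  let ?f = "\<lambda>z t. iexp (- (t * z)) * char M t"
  have "inversion_density z - inversion_density z' = Re ((CLBINT t. ?f z t) - (CLBINT t. ?f z' t)) / (2 * pi)"
    by (simp add: inversion_density_def diff_divide_distrib)
  also have "(CLBINT t. ?f z t) - (CLBINT t. ?f z' t) = (CLBINT t. ?f z t - ?f z' t)"
    by (rule Bochner_Integration.integral_diff[symmetric]; rule complex_integrable_char)
  finally have "\<bar>inversion_density z - inversion_density z'\<bar> \<le> cmod (CLBINT t. ?f z t - ?f z' t) / (2 * pi)"
    using abs_Re_le_cmod[of "CLBINT t. ?f z t - ?f z' t"] by (simp add: divide_right_mono)
  also have "cmod (CLBINT t. ?f z t - ?f z' t) \<le> (\<integral>t. cmod (char M t) * min 2 (\<bar>t\<bar> * \<bar>z - z'\<bar>) \<partial>lborel)"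
  proof (rule Bochner_Integration.integral_norm_bound_integral)
    show "complex_integrable lborel (\<lambda>t. ?f z t - ?f z' t)"
      by (intro Bochner_Integration.integrable_diff complex_integrable_char)
    show "integrable lborel (\<lambda>t. cmod (char M t) * min 2 (\<bar>t\<bar> * \<bar>z - z'\<bar>))"
      by (rule Bochner_Integration.integrable_bound[OF integrable_mult_right[OF int_char, of 2]])
        (auto intro!: AE_I2 mult_left_mono simp: mult.commute[of 2] abs_mult)
    show "cmod (?f z t - ?f z' t) \<le> cmod (char M t) * min 2 (\<bar>t\<bar> * \<bar>z - z'\<bar>)" for t
    proof -
      have "cmod (iexp (- (t * z)) - iexp (- (t * z'))) \<le> 1 + 1" by (rule order_trans[OF norm_triangle_ineq4]) simp
      moreover have "cmod (iexp (- (t * z)) - iexp (- (t * z'))) \<le> \<bar>t\<bar> * \<bar>z - z'\<bar>"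
      proof -
        let ?x = "- (t * z)" and ?y = "- (t * z')"
        have "iexp ?x - iexp ?y = iexp ?y * (iexp (?x - ?y) - 1)" by (simp add: algebra_simps flip: exp_add)
        then have "cmod (iexp ?x - iexp ?y) = cmod (iexp (?x - ?y) - 1)" by (simp add: norm_mult)
        also have "\<dots> \<le> \<bar>?x - ?y\<bar>" using iexp_approx1[of "?x - ?y" 0] by simp
        also have "\<dots> = \<bar>t\<bar> * \<bar>z - z'\<bar>" by (simp add: abs_minus_commute flip: abs_mult right_diff_distrib) (simp add: abs_mult abs_minus_commute)
        finally show ?thesis .
      qed
      ultimately have "cmod (iexp (- (t * z)) - iexp (- (t * z'))) \<le> min 2 (\<bar>t\<bar> * \<bar>z - z'\<bar>)" by simp
      then show ?thesis
        unfolding left_diff_distrib[symmetric] norm_mult by (subst mult.commute) (rule mult_left_mono, auto)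
    qed
  qed
  finally show ?thesis by (simp add: divide_right_mono)
qed

lemma inversion_density_abs_le: "\<bar>inversion_density z\<bar> \<le> (\<integral>t. cmod (char M t) \<partial>lborel) / (2 * pi)"
proof -
  have "\<bar>Re (CLBINT t. iexp (- (t * z)) * char M t)\<bar> \<le> cmod (CLBINT t. iexp (- (t * z)) * char M t)"
    by (rule abs_Re_le_cmod)
  also have "\<dots> \<le> (\<integral>t. cmod (iexp (- (t * z)) * char M t) \<partial>lborel)" by (rule integral_norm_bound)
  finally show ?thesis by (simp add: inversion_density_def divide_right_mono norm_mult)
qed

lemma continuous_inversion_density: "isCont inversion_density z" unfolding continuous_at_sequentially
proof safe
  fix X assume X: "X \<longlonglongrightarrow> z"
  have "(\<lambda>n. CLBINT t. iexp (- (t * X n)) * char M t) \<longlonglongrightarrow> (CLBINT t. iexp (- (t * z)) * char M t)"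
    by (rule integral_dominated_convergence[where w="\<lambda>t. cmod (char M t)"])
      (auto intro!: tendsto_intros X int_char AE_I2 simp: norm_mult)
  then show "(inversion_density \<circ> X) \<longlonglongrightarrow> inversion_density z"
    unfolding comp_def inversion_density_def by (intro tendsto_intros) auto
qed

lemma borel_measurable_inversion_density [measurable]: "inversion_density \<in> borel_measurable borel"
  by (intro borel_measurable_continuous_onI continuous_at_imp_continuous_on)
    (auto intro: continuous_inversion_density)

lemma set_integrable_inversion_density: "set_integrable lborel {a<..b} inversion_density"
proof (cases "a \<le> b")
  case True
  have "set_integrable lborel {a..b} inversion_density"
    by (rule borel_integrable_atLeastAtMost') (auto intro: continuous_at_imp_continuous_on continuous_inversion_density)
  then show ?thesis by (rule set_integrable_subset) auto
qed (simp add: set_integrable_def)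

lemma inversion_kernel:
  assumes "a \<le> b" "t \<noteq> 0"
  shows "(CLBINT z:{a<..b}. iexp (- (t * z))) = (iexp (-(t * a)) - iexp (-(t * b))) / (\<i> * t)"
proof -
  have "(CLBINT z:{a<..b}. iexp (- (t * z))) = (CLBINT z=a..b. iexp (- (t * z)))"
    using assms by (simp add: interval_integral_Ioc)
  also have "\<dots> = iexp (- (t * b)) * (\<i> / t) - iexp (- (t * a)) * (\<i> / t)"
    by (subst interval_integral_FTC_finite[where F="\<lambda>z. iexp (- (t * z)) * (\<i> / t)"])
      (use assms in \<open>auto intro!: continuous_intros derivative_eq_intros
         simp: has_vector_derivative_complex_iff Re_exp Im_exp field_simps\<close>)
  also have "\<dots> = (iexp (-(t * a)) - iexp (-(t * b))) / (\<i> * t)" using assms by (simp add: field_simps)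
  finally show ?thesis .
qed

text \<open>Levy's inversion formula gives the mass as a limit of truncated integrals. Integrability
  of the characteristic function removes the truncation by dominated convergence, and Fubini moves
  the integral over the interval outside.\<close>

lemma measure_Ioc_no_atoms:
  assumes "a \<le> b" "measure M {a} = 0" "measure M {b} = 0"
  shows "measure M {a<..b} = (LBINT z:{a<..b}. inversion_density z)"
proof -
  define F where "F t = (iexp (-(t * a)) - iexp (-(t * b))) / (\<i> * t)" for t :: real
  define G where "G t = (CLBINT z:{a<..b}. iexp (- (t * z)))" for t :: real
  \<comment> \<open>At \<open>t = 0\<close> the quotient \<open>F\<close> has the default value 0
    while \<open>G\<close> is the length of the interval; a single point does not affect the
    integrals.\<close>
  have GF: "G t = F t" if "t \<noteq> 0" for t unfolding G_def F_def by (rule inversion_kernel) (use that assms in auto)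
  have Gle: "cmod (G t) \<le> b - a" for t
  proof -
    have "cmod (G t) \<le> (\<integral>z. indicator {a<..b} z \<partial>lborel)" unfolding G_def set_lebesgue_integral_def
      by (rule order_trans[OF integral_norm_bound]) (auto simp: norm_mult)
    then show ?thesis using assms by simp
  qed
  have [measurable]: "F \<in> borel_measurable borel" unfolding F_def by measurable
  have [measurable]: "G \<in> borel_measurable borel" unfolding G_def set_lebesgue_integral_def by measurable
  have L: "(\<lambda>T. 1 / (2 * pi) * (CLBINT t=-real T..T. F t * char M t)) \<longlonglongrightarrow> measure M {a<..b}"
    using Levy_Inversion[OF assms] unfolding F_def by simp
  have ae: "AE t in lborel. F t * char M t = G t * char M t"
    using AE_lborel_singleton[of 0] by eventually_elim (simp add: GF)
  have "(CLBINT t=-real T..T. F t * char M t) = (CLBINT t. indicator {-real T<..<T} t * (G t * char M t))" for T :: nat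
  proof -
    have "(CLBINT t=-real T..T. F t * char M t) = (CLBINT t. indicator {-real T<..<T} t *\<^sub>R (F t * char M t))"
      using interval_lebesgue_integral_le_eq[of "ereal (- real T)" "ereal (real T)" lborel "\<lambda>t. F t * char M t"]
      by (simp add: set_lebesgue_integral_def)
    also have "\<dots> = (CLBINT t. indicator {-real T<..<T} t * (G t * char M t))"
      by (rule integral_cong_AE) (use ae in \<open>auto simp: indicator_def\<close>)
    finally show ?thesis .
  qed
  note eqT = this
  have ic: "integrable lborel (\<lambda>t. (b - a) * cmod (char M t))" using int_char by simp
  have lim: "(\<lambda>T. CLBINT t. indicator {-real T<..<T} t * (G t * char M t)) \<longlonglongrightarrow> (CLBINT t. G t * char M t)"
  proof (rule integral_dominated_convergence[OF _ _ ic])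
    show "AE t in lborel. (\<lambda>T. indicator {- real T<..<real T} t * (G t * char M t)) \<longlonglongrightarrow> G t * char M t"
    proof (rule AE_I2, rule tendsto_eventually)
      fix t :: real
      obtain N :: nat where N: "\<bar>t\<bar> < real N" using reals_Archimedean2 by blast
      then have "indicator {- real T<..<real T} t = (1::complex)" if "T \<ge> N" for T :: nat
        using that by (auto simp: indicator_def)
      then show "\<forall>\<^sub>F T in sequentially. indicator {- real T<..<real T} t * (G t * char M t) = G t * char M t"
        unfolding eventually_sequentially by (intro exI[of _ N]) auto
    qed
    show "AE x in lborel. cmod (indicator {- real n<..<real n} x * (G x * char M x)) \<le> (b - a) * cmod (char M x)" for n
      using Gle assms by (intro AE_I2) (auto simp: norm_mult indicator_def intro!: mult_right_mono)
  qed auto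
  have "(\<lambda>T. 1 / (2 * pi) * (CLBINT t=-real T..T. F t * char M t)) \<longlonglongrightarrow> 1 / (2 * pi) * (CLBINT t. G t * char M t)"
    unfolding eqT by (intro tendsto_mult tendsto_const lim)
  from LIMSEQ_unique[OF this L]
  have 1: "complex_of_real (measure M {a<..b}) = 1 / (2 * pi) * (CLBINT t. G t * char M t)" by simp
  let ?h = "\<lambda>t z. indicator {a<..b} z *\<^sub>R (iexp (- (t * z)) * char M t)"
  have hi: "integrable (lborel \<Otimes>\<^sub>M lborel) (\<lambda>(t, z). ?h t z)"
  proof (rule lborel_pair.Fubini_integrable)
    show "AE x in lborel. integrable lborel (\<lambda>y. case (x, y) of (t, z) \<Rightarrow> ?h t z)"
    proof (rule AE_I2)
      fix t show "integrable lborel (\<lambda>y. case (t, y) of (t, z) \<Rightarrow> ?h t z)"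
        by (rule Bochner_Integration.integrable_bound[where f="\<lambda>z. indicator {a<..b} z * cmod (char M t)"])
          (use assms in \<open>auto simp: norm_mult intro!: integrable_mult_left integrable_real_indicator\<close>)
    qed
    have "(\<lambda>x. LBINT y. norm (case (x, y) of (t, z) \<Rightarrow> ?h t z)) = (\<lambda>t. (b - a) * cmod (char M t))"
      using assms by (simp add: norm_mult fun_eq_iff)
    then show "integrable lborel (\<lambda>x. LBINT y. norm (case (x, y) of (t, z) \<Rightarrow> ?h t z))"
      using ic by simp
  qed auto
  have "(CLBINT t. G t * char M t) = (CLBINT t. (CLBINT z. ?h t z))" unfolding G_def set_lebesgue_integral_def
    by (rule Bochner_Integration.integral_cong[OF refl]) (simp flip: integral_mult_left_zero)
  also have "\<dots> = (CLBINT z. (CLBINT t. ?h t z))" by (rule lborel_pair.Fubini_integral[symmetric, OF hi])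
  also have "\<dots> = (CLBINT z. indicator {a<..b} z *\<^sub>R (CLBINT t. iexp (- (t * z)) * char M t))" by simp
  finally have 2: "(CLBINT t. G t * char M t) = (CLBINT z. indicator {a<..b} z *\<^sub>R (CLBINT t. iexp (- (t * z)) * char M t))" .
  have i3: "complex_integrable lborel (\<lambda>z. indicator {a<..b} z *\<^sub>R (CLBINT t. iexp (- (t * z)) * char M t))"
    using lborel_pair.integrable_snd[OF hi] by simp
  have "measure M {a<..b} = Re (1 / (2 * pi) * (CLBINT t. G t * char M t))" using 1 by (metis Re_complex_of_real)
  also have "\<dots> = 1 / (2 * pi) * Re (CLBINT t. G t * char M t)" by simp
  also have "\<dots> = 1 / (2 * pi) * (LBINT z. Re (indicator {a<..b} z *\<^sub>R (CLBINT t. iexp (- (t * z)) * char M t)))"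
    unfolding 2 integral_Re[OF i3] ..
  also have "\<dots> = (LBINT z:{a<..b}. inversion_density z)" unfolding set_lebesgue_integral_def inversion_density_def
    by (subst integral_mult_right_zero[symmetric]) (auto intro!: Bochner_Integration.integral_cong)
  finally show ?thesis .
qed

text \<open>The set of atoms is countable and an open interval is not.\<close>

lemma no_atom_between:
  assumes "x < (y::real)" shows "\<exists>a. x < a \<and> a < y \<and> measure M {a} = 0"
  using open_minus_countable[OF countable_support, of "{x<..<y}"] assms by auto

text \<open>Enclose \<open>x\<close> in a short interval with endpoints that carry no mass: the mass
  of the interval is at most its length times the bound of the density, which leaves no room for an
  atom.\<close>

lemma no_atoms: "measure M {x} = 0"
proof (rule ccontr)
  define B where "B = (\<integral>t. cmod (char M t) \<partial>lborel) / (2 * pi)"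
  assume "measure M {x} \<noteq> 0"
  then have pos: "measure M {x} > 0" by (simp add: zero_less_measure_iff)
  have "B \<ge> 0" by (simp add: B_def)
  \<comment> \<open>An interval of length below \<open>2 * d\<close> has mass at most
    \<open>2 * d * B\<close>, less than half of the supposed atom.\<close>
  define d where "d = measure M {x} / (4 * (B + 1))"
  have "d > 0" using pos \<open>B \<ge> 0\<close> by (simp add: d_def)
  obtain a where a: "x - d < a" "a < x" "measure M {a} = 0" using no_atom_between[of "x - d" x] \<open>d > 0\<close> by auto
  obtain b where b: "x < b" "b < x + d" "measure M {b} = 0" using no_atom_between[of x "x + d"] \<open>d > 0\<close> by auto
  have "measure M {x} \<le> measure M {a<..b}" using a b by (intro finite_measure_mono) auto
  also have "\<dots> = (LBINT z:{a<..b}. inversion_density z)" using measure_Ioc_no_atoms a b by simp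
  also have "\<dots> \<le> (LBINT z:{a<..b}. B)" using inversion_density_abs_le a b
    by (intro set_integral_mono set_integrable_inversion_density)
      (auto simp: B_def abs_le_iff set_integrable_def intro!: integrable_real_mult_indicator integrable_mult_left)
  also have "\<dots> = (b - a) * B" using a b by (simp add: set_lebesgue_integral_def)
  also have "\<dots> \<le> (2 * d) * B" using a b \<open>B \<ge> 0\<close> by (intro mult_right_mono) auto
  also have "\<dots> < measure M {x}" using pos \<open>B \<ge> 0\<close> by (simp add: d_def field_simps) (simp add: add_pos_nonneg)
  finally show False by simp
qed

lemma measure_Ioc: "a \<le> b \<Longrightarrow> measure M {a<..b} = (LBINT z:{a<..b}. inversion_density z)"
  using measure_Ioc_no_atoms no_atoms by simp

text \<open>By continuity a negative value would persist on an interval and give it negative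
  mass.\<close>

lemma inversion_density_nonneg: "0 \<le> inversion_density z"
proof (rule ccontr)
  assume "\<not> 0 \<le> inversion_density z"
  then have neg: "inversion_density z < 0" by simp
  have "\<forall>\<^sub>F y in at z. inversion_density y < inversion_density z / 2"
    using continuous_inversion_density[of z] neg by (intro order_tendstoD) (auto simp: isCont_def)
  then obtain d where d: "d > 0" "\<And>y. y \<noteq> z \<Longrightarrow> dist y z < d \<Longrightarrow> inversion_density y < inversion_density z / 2"
    by (auto simp: eventually_at)
  have "0 \<le> measure M {z<..z+d/2}" by simp
  also have "\<dots> = (LBINT z:{z<..z+d/2}. inversion_density z)" using measure_Ioc[of z "z+d/2"] d by simp
  also have "\<dots> \<le> (LBINT y:{z<..z+d/2}. inversion_density z / 2)"
  proof (intro set_integral_mono set_integrable_inversion_density)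
    show "inversion_density y \<le> inversion_density z / 2" if "y \<in> {z<..z+d/2}" for y
      using d(2)[of y] that d(1) by (auto simp: dist_real_def)
  qed (use d in \<open>auto simp: set_integrable_def intro!: integrable_mult_left integrable_divide integrable_real_indicator\<close>)
  also have "\<dots> = (d / 2) * (inversion_density z / 2)" using d by (simp add: set_lebesgue_integral_def)
  also have "\<dots> < 0" using d neg by (simp add: mult_pos_neg)
  finally show False by simp
qed

theorem density_inversion_density: "M = density lborel inversion_density"
proof (rule measure_eqI_generator_eq[where E="range (\<lambda>(a, b). {a<..b::real})" and \<Omega>=UNIV and A="\<lambda>i. {- real i<..real i}"])
  show "Int_stable (range (\<lambda>(a, b). {a<..b::real}))" by (auto simp: Int_stable_def Int_greaterThanAtMost)
  show "sets M = sigma_sets UNIV (range (\<lambda>(a, b). {a<..b}))"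
    by (subst events_eq_borel, subst borel_sigma_sets_Ioc) (auto intro!: sets_measure_of)
  show "sets (density lborel inversion_density) = sigma_sets UNIV (range (\<lambda>(a, b). {a<..b}))"
    by (subst sets_density, subst sets_lborel, subst borel_sigma_sets_Ioc) (auto intro!: sets_measure_of)
  show "(\<Union>i. {- real i<..real i}) = UNIV"
  proof -
    have "\<exists>i. x \<in> {- real i<..real i}" for x
    proof -
      obtain N :: nat where "\<bar>x\<bar> < real N" using reals_Archimedean2 by blast
      then show ?thesis by (intro exI[of _ N]) auto
    qed
    then show ?thesis by auto
  qed
  fix X assume "X \<in> range (\<lambda>(a, b). {a<..b::real})"
  then obtain a b where X: "X = {a<..b}" by auto
  show "emeasure M X = emeasure (density lborel inversion_density) X"
  proof (cases "a \<le> b")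
    case True
    have "emeasure (density lborel inversion_density) X = (\<integral>\<^sup>+ z. ennreal (indicator {a<..b} z * inversion_density z) \<partial>lborel)"
      unfolding X by (subst emeasure_density) (auto intro!: nn_integral_cong simp: indicator_def)
    also have "\<dots> = ennreal (LBINT z. indicator {a<..b} z * inversion_density z)"
      using set_integrable_inversion_density[of a b] inversion_density_nonneg
      by (intro nn_integral_eq_integral) (auto simp: set_integrable_def)
    also have "\<dots> = ennreal (measure M X)" unfolding X measure_Ioc[OF True] by (simp add: set_lebesgue_integral_def)
    finally show ?thesis by (simp add: emeasure_eq_measure)
  qed (simp add: X)
qed (auto simp: emeasure_eq_measure)

end
end

section \<open>Linear processes\<close>

locale innovations = prob_space M + law: smooth_law "distr M borel (\<xi> 1)" \<sigma>2 \<theta>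
  for M :: "'a measure" and \<xi> :: "int \<Rightarrow> 'a \<Rightarrow> real" and \<sigma>2 \<theta> +
  assumes indep: "indep_vars (\<lambda>_. borel) \<xi> UNIV"
    and ident: "distr M borel (\<xi> t) = distr M borel (\<xi> 1)"
begin

abbreviation "\<psi> \<equiv> char (distr M borel (\<xi> 1))"

lemma random_variable_xi [measurable]: "\<xi> i \<in> borel_measurable M" using indep unfolding indep_vars_def by blast

lemma nn_integral_xi: "f \<in> borel_measurable borel \<Longrightarrow> (\<integral>\<^sup>+ \<omega>. f (\<xi> i \<omega>) \<partial>M) = (\<integral>\<^sup>+ x. f x \<partial>distr M borel (\<xi> 1))"
  by (subst ident[of i, symmetric]) (simp add: nn_integral_distr)

lemma integrable_xi_iff:
  fixes f :: "real \<Rightarrow> real"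
  shows "f \<in> borel_measurable borel \<Longrightarrow> integrable M (\<lambda>\<omega>. f (\<xi> i \<omega>)) \<longleftrightarrow> integrable (distr M borel (\<xi> 1)) f"
  by (subst ident[of i, symmetric]) (simp add: integrable_distr_eq)

lemma expectation_xi:
  fixes f :: "real \<Rightarrow> real"
  shows "f \<in> borel_measurable borel \<Longrightarrow> expectation (\<lambda>\<omega>. f (\<xi> i \<omega>)) = (\<integral>x. f x \<partial>distr M borel (\<xi> 1))"
  by (subst ident[of i, symmetric]) (simp add: integral_distr)

lemma xi_moments:
  shows "integrable M (\<xi> i)" "expectation (\<xi> i) = 0"
    and "integrable M (\<lambda>\<omega>. (\<xi> i \<omega>)\<^sup>2)" "expectation (\<lambda>\<omega>. (\<xi> i \<omega>)\<^sup>2) = \<sigma>2"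
proof -
  have m: "(\<lambda>x::real. x) \<in> borel_measurable borel" "(\<lambda>x::real. x\<^sup>2) \<in> borel_measurable borel" by auto
  show "integrable M (\<xi> i)" using law.int1 unfolding integrable_xi_iff[OF m(1), of i, symmetric] .
  show "expectation (\<xi> i) = 0" using law.mean0 unfolding expectation_xi[OF m(1), of i, symmetric] .
  show "integrable M (\<lambda>\<omega>. (\<xi> i \<omega>)\<^sup>2)" using law.int2 unfolding integrable_xi_iff[OF m(2), of i, symmetric] .
  show "expectation (\<lambda>\<omega>. (\<xi> i \<omega>)\<^sup>2) = \<sigma>2" using law.var_eq unfolding expectation_xi[OF m(2), of i, symmetric] .
qed

lemma indep_var_xi: "i \<noteq> j \<Longrightarrow> indep_var borel (\<xi> i) borel (\<xi> j)"
  using indep_vars_sum[of "{j}" i \<xi>] indep_vars_subset[OF indep, of "{i, j}"] by simp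

lemma integrable_xi_mult: "integrable M (\<lambda>\<omega>. \<xi> i \<omega> * \<xi> j \<omega>)"
proof (cases "i = j")
  case True
  then show ?thesis using xi_moments(3)[of i] by (simp add: power2_eq_square)
next
  case False
  then show ?thesis by (intro indep_var_integrable indep_var_xi xi_moments)
qed

lemma expectation_xi_mult: "expectation (\<lambda>\<omega>. \<xi> i \<omega> * \<xi> j \<omega>) = (if i = j then \<sigma>2 else 0)"
proof (cases "i = j")
  case True
  then show ?thesis using xi_moments(4)[of i] by (simp add: power2_eq_square)
next
  case False
  then have "expectation (\<lambda>\<omega>. \<xi> i \<omega> * \<xi> j \<omega>) = expectation (\<xi> i) * expectation (\<xi> j)"
    by (intro indep_var_lebesgue_integral indep_var_xi xi_moments)
  then show ?thesis using False by (simp add: xi_moments(2))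
qed

lemma finite_sum_second_moment:
  fixes u :: "int \<Rightarrow> real"
  assumes "finite I"
  shows "integrable M (\<lambda>\<omega>. (\<Sum>i\<in>I. u i * \<xi> i \<omega>)\<^sup>2)"
    and "expectation (\<lambda>\<omega>. (\<Sum>i\<in>I. u i * \<xi> i \<omega>)\<^sup>2) = \<sigma>2 * (\<Sum>i\<in>I. (u i)\<^sup>2)"
proof -
  have eq: "(\<lambda>\<omega>. (\<Sum>i\<in>I. u i * \<xi> i \<omega>)\<^sup>2) = (\<lambda>\<omega>. \<Sum>i\<in>I. \<Sum>j\<in>I. (u i * u j) * (\<xi> i \<omega> * \<xi> j \<omega>))"
    by (auto simp: power2_eq_square sum_product mult_ac)
  show "integrable M (\<lambda>\<omega>. (\<Sum>i\<in>I. u i * \<xi> i \<omega>)\<^sup>2)"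
    unfolding eq by (intro Bochner_Integration.integrable_sum integrable_mult_right integrable_xi_mult)
  have int: "integrable M (\<lambda>\<omega>. (u i * u j) * (\<xi> i \<omega> * \<xi> j \<omega>))" for i j
    by (intro integrable_mult_right integrable_xi_mult)
  have "expectation (\<lambda>\<omega>. (\<Sum>i\<in>I. u i * \<xi> i \<omega>)\<^sup>2) = (\<Sum>i\<in>I. \<Sum>j\<in>I. expectation (\<lambda>\<omega>. (u i * u j) * (\<xi> i \<omega> * \<xi> j \<omega>)))"
    unfolding eq by (subst Bochner_Integration.integral_sum, intro Bochner_Integration.integrable_sum int, subst Bochner_Integration.integral_sum, intro int, rule refl)
  also have "\<dots> = (\<Sum>i\<in>I. \<Sum>j\<in>I. (u i * u j) * (if i = j then \<sigma>2 else 0))" by (simp add: expectation_xi_mult)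
  also have "\<dots> = \<sigma>2 * (\<Sum>i\<in>I. (u i)\<^sup>2)"
    using assms by (simp add: if_distrib sum.delta sum_distrib_left power2_eq_square mult_ac cong: if_cong)
  finally show "expectation (\<lambda>\<omega>. (\<Sum>i\<in>I. u i * \<xi> i \<omega>)\<^sup>2) = \<sigma>2 * (\<Sum>i\<in>I. (u i)\<^sup>2)" .
qed

lemma char_finite_sum:
  fixes u :: "int \<Rightarrow> real"
  shows "char (distr M borel (\<lambda>\<omega>. \<Sum>i\<in>I. u i * \<xi> i \<omega>)) l = (\<Prod>i\<in>I. \<psi> (u i * l))"
proof -
  have iv: "indep_vars (\<lambda>_. borel) (\<lambda>i \<omega>. u i * \<xi> i \<omega>) I"
    by (rule indep_vars_compose2[OF indep_vars_subset[OF indep]]) auto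
  have "char (distr M borel (\<lambda>\<omega>. u i * \<xi> i \<omega>)) l = \<psi> (u i * l)" for i
    unfolding ident[of i, symmetric] by (simp add: char_def integral_distr mult_ac)
  then show ?thesis by (subst char_distr_sum[OF iv]) simp
qed

text \<open>All factors of the two products have modulus at most 1, so the products differ by at
  most the sum of the differences of the factors. The radius depends neither on the number of
  summands nor on the weights, which makes this a uniform central limit theorem.\<close>

lemma finite_sum_gauss_approx:
  assumes "0 < \<eta>"
  shows "\<exists>r>0. \<forall>(I::int set) u. finite I \<longrightarrow> (\<forall>i\<in>I. \<bar>u i\<bar> \<le> r) \<longrightarrow>
    cmod ((CLINT \<omega>|M. iexp (\<Sum>i\<in>I. u i * \<xi> i \<omega>)) - of_real (exp (- (\<sigma>2 * (\<Sum>i\<in>I. (u i)\<^sup>2) / 2)))) \<le> \<eta> * (\<Sum>i\<in>I. (u i)\<^sup>2)"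
proof -
  obtain r where r: "r > 0" "\<And>v. \<bar>v\<bar> \<le> r \<Longrightarrow> cmod (\<psi> v - of_real (exp (- (\<sigma>2 * v\<^sup>2 / 2)))) \<le> \<eta> * v\<^sup>2"
    using law.char_gauss_approx[OF assms] by auto
  show ?thesis
  proof (intro exI[of _ r] conjI allI impI)
    fix I :: "int set" and u assume I: "finite I" and u: "\<forall>i\<in>I. \<bar>u i\<bar> \<le> r"
    have "(CLINT \<omega>|M. iexp (\<Sum>i\<in>I. u i * \<xi> i \<omega>)) = (\<Prod>i\<in>I. \<psi> (u i))"
      using char_finite_sum[of u I 1] by (simp add: char_def integral_distr)
    moreover have "complex_of_real (exp (- (\<sigma>2 * (\<Sum>i\<in>I. (u i)\<^sup>2) / 2))) = (\<Prod>i\<in>I. of_real (exp (- (\<sigma>2 * (u i)\<^sup>2 / 2))))"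
      using I by (simp add: sum_distrib_left sum_divide_distrib exp_sum flip: sum_negf of_real_prod)
    ultimately have "cmod ((CLINT \<omega>|M. iexp (\<Sum>i\<in>I. u i * \<xi> i \<omega>)) - of_real (exp (- (\<sigma>2 * (\<Sum>i\<in>I. (u i)\<^sup>2) / 2))))
      = cmod ((\<Prod>i\<in>I. \<psi> (u i)) - (\<Prod>i\<in>I. of_real (exp (- (\<sigma>2 * (u i)\<^sup>2 / 2)))))" by (simp only:)
    also have "\<dots> \<le> (\<Sum>i\<in>I. cmod (\<psi> (u i) - of_real (exp (- (\<sigma>2 * (u i)\<^sup>2 / 2)))))"
      by (rule norm_prod_diff) (use law.var_pos in \<open>auto intro: law.cmod_char_le_1\<close>)
    also have "\<dots> \<le> (\<Sum>i\<in>I. \<eta> * (u i)\<^sup>2)" using u r by (intro sum_mono) auto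
    finally show "cmod ((CLINT \<omega>|M. iexp (\<Sum>i\<in>I. u i * \<xi> i \<omega>)) - of_real (exp (- (\<sigma>2 * (\<Sum>i\<in>I. (u i)\<^sup>2) / 2)))) \<le> \<eta> * (\<Sum>i\<in>I. (u i)\<^sup>2)"
      by (simp add: sum_distrib_left)
  qed fact
qed

lemma sum_lag:
  fixes b :: "nat \<Rightarrow> real"
  shows "(\<Sum>k<d. b k * \<xi> (t - int k) \<omega>) = (\<Sum>i\<in>(\<lambda>k. t - int k) ` {..<d}. b (nat (t - i)) * \<xi> i \<omega>)"
  by (subst sum.reindex) (auto simp: inj_on_def)

lemma sum_lag_sq:
  fixes b :: "nat \<Rightarrow> real"
  shows "(\<Sum>i\<in>(\<lambda>k. t - int k) ` {..<d}. (b (nat (t - i)))\<^sup>2) = (\<Sum>k<d. (b k)\<^sup>2)"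
  by (subst sum.reindex) (auto simp: inj_on_def)

lemma char_lag_sum: "char (distr M borel (\<lambda>\<omega>. \<Sum>k<d. b k * \<xi> (t - int k) \<omega>)) l = (\<Prod>k<d. \<psi> (b k * l))"
  unfolding sum_lag char_finite_sum by (subst prod.reindex) (auto simp: inj_on_def)

section \<open>Series of innovations and their past and future parts\<close>

lemma borel_measurable_lin_proc [measurable]: "lin_proc b \<xi> t \<in> borel_measurable M"
  unfolding lin_proc_def by measurable

text \<open>By Tonelli the series of absolute values has a finite mean.\<close>

lemma AE_summable_lin_proc:
  assumes "summable (\<lambda>k. \<bar>b k\<bar>)"
  shows "AE \<omega> in M. summable (\<lambda>k. \<bar>b k * \<xi> (t - int k) \<omega>\<bar>)"
proof -
  define m where "m = expectation (\<lambda>\<omega>. \<bar>\<xi> 1 \<omega>\<bar>)"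
  have "m \<ge> 0" by (simp add: m_def)
  have m: "(\<integral>\<^sup>+ \<omega>. ennreal \<bar>\<xi> i \<omega>\<bar> \<partial>M) = ennreal m" for i
  proof -
    have "(\<integral>\<^sup>+ \<omega>. ennreal \<bar>\<xi> i \<omega>\<bar> \<partial>M) = (\<integral>\<^sup>+ \<omega>. ennreal \<bar>\<xi> 1 \<omega>\<bar> \<partial>M)"
      using nn_integral_xi[of "\<lambda>x. ennreal \<bar>x\<bar>"] by simp
    also have "\<dots> = ennreal m" unfolding m_def by (rule nn_integral_eq_integral) (auto intro: xi_moments(1))
    finally show ?thesis .
  qed
  have "(\<integral>\<^sup>+ \<omega>. (\<Sum>k. ennreal \<bar>b k * \<xi> (t - int k) \<omega>\<bar>) \<partial>M) = (\<Sum>k. ennreal \<bar>b k\<bar> * ennreal m)"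
    by (subst nn_integral_suminf) (auto simp: abs_mult ennreal_mult nn_integral_cmult m)
  also have "\<dots> = ennreal (\<Sum>k. \<bar>b k\<bar> * m)"
    using assms \<open>m \<ge> 0\<close> by (subst suminf_ennreal2[symmetric]) (auto simp: ennreal_mult intro: summable_mult2)
  finally have "(\<integral>\<^sup>+ \<omega>. (\<Sum>k. ennreal \<bar>b k * \<xi> (t - int k) \<omega>\<bar>) \<partial>M) \<noteq> \<infinity>" by simp
  then have "AE \<omega> in M. (\<Sum>k. ennreal \<bar>b k * \<xi> (t - int k) \<omega>\<bar>) \<noteq> \<infinity>"
    by (intro nn_integral_PInf_AE) auto
  then show ?thesis
    by eventually_elim (auto intro!: summable_suminf_not_top)
qed

lemma AE_lin_proc_sums:
  assumes "summable (\<lambda>k. \<bar>b k\<bar>)"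
  shows "AE \<omega> in M. (\<lambda>k. b k * \<xi> (t - int k) \<omega>) sums lin_proc b \<xi> t \<omega>" using AE_summable_lin_proc[OF assms, of t]
  by eventually_elim (auto simp: lin_proc_def intro!: summable_sums intro: summable_rabs_cancel)

text \<open>Cauchy-Schwarz with the weights \<open>|b k|\<close> bounds the squares of all partial
  sums by one integrable variable \<open>Y\<close>. Dominated convergence then transfers the first
  two moments from the finite sums to the series.\<close>

lemma lin_proc_second_moment:
  assumes b: "summable (\<lambda>k. \<bar>b k\<bar>)"
  shows "integrable M (\<lambda>\<omega>. (lin_proc b \<xi> t \<omega>)\<^sup>2)"
    and "summable (\<lambda>k. (b k)\<^sup>2)"
    and "expectation (\<lambda>\<omega>. (lin_proc b \<xi> t \<omega>)\<^sup>2) = \<sigma>2 * (\<Sum>k. (b k)\<^sup>2)"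
    and "integrable M (lin_proc b \<xi> t)" and "expectation (lin_proc b \<xi> t) = 0"
proof -
  define S where "S N \<omega> = (\<Sum>k<N. b k * \<xi> (t - int k) \<omega>)" for N \<omega>
  have [measurable]: "S N \<in> borel_measurable M" for N unfolding S_def by measurable
  define B where "B = (\<Sum>k. \<bar>b k\<bar>)"
  define Y where "Y \<omega> = B * (\<Sum>k. \<bar>b k\<bar> * (\<xi> (t - int k) \<omega>)\<^sup>2)" for \<omega>
  have B: "B \<ge> 0" unfolding B_def using b by (rule suminf_nonneg) auto
  have [measurable]: "Y \<in> borel_measurable M" unfolding Y_def by measurable
  have nn: "(\<integral>\<^sup>+ \<omega>. (\<Sum>k. ennreal (\<bar>b k\<bar> * (\<xi> (t - int k) \<omega>)\<^sup>2)) \<partial>M) = ennreal (\<Sum>k. \<bar>b k\<bar> * \<sigma>2)"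
  proof -
    have "(\<integral>\<^sup>+ \<omega>. ennreal ((\<xi> i \<omega>)\<^sup>2) \<partial>M) = ennreal \<sigma>2" for i
      unfolding xi_moments(4)[of i, symmetric] by (rule nn_integral_eq_integral) (auto intro: xi_moments(3))
    then have "(\<integral>\<^sup>+ \<omega>. ennreal (\<bar>b k\<bar> * (\<xi> (t - int k) \<omega>)\<^sup>2) \<partial>M) = ennreal (\<bar>b k\<bar> * \<sigma>2)" for k
      using law.var_pos by (simp add: ennreal_mult nn_integral_cmult)
    then show ?thesis
      using law.var_pos by (subst nn_integral_suminf) (auto intro!: suminf_ennreal2 summable_mult2 b)
  qed
  have "AE \<omega> in M. (\<Sum>k. ennreal (\<bar>b k\<bar> * (\<xi> (t - int k) \<omega>)\<^sup>2)) \<noteq> \<infinity>" using nn by (intro nn_integral_PInf_AE) auto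
  then have ae2: "AE \<omega> in M. summable (\<lambda>k. \<bar>b k\<bar> * (\<xi> (t - int k) \<omega>)\<^sup>2)"
    by eventually_elim (auto intro!: summable_suminf_not_top)
  have Yi: "integrable M Y"
  proof (rule integrableI_bounded)
    have "(\<integral>\<^sup>+ \<omega>. ennreal (norm (Y \<omega>)) \<partial>M) = (\<integral>\<^sup>+ \<omega>. ennreal B * (\<Sum>k. ennreal (\<bar>b k\<bar> * (\<xi> (t - int k) \<omega>)\<^sup>2)) \<partial>M)"
    proof (rule nn_integral_cong_AE, use ae2 in eventually_elim)
      case (elim \<omega>)
      have nn: "0 \<le> (\<Sum>k. \<bar>b k\<bar> * (\<xi> (t - int k) \<omega>)\<^sup>2)" using elim by (rule suminf_nonneg) simp
      have "(\<Sum>k. ennreal (\<bar>b k\<bar> * (\<xi> (t - int k) \<omega>)\<^sup>2)) = ennreal (\<Sum>k. \<bar>b k\<bar> * (\<xi> (t - int k) \<omega>)\<^sup>2)"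
        by (rule suminf_ennreal2[OF _ elim]) simp
      moreover have "norm (Y \<omega>) = B * (\<Sum>k. \<bar>b k\<bar> * (\<xi> (t - int k) \<omega>)\<^sup>2)" unfolding Y_def using B nn by simp
      ultimately show ?case using ennreal_mult[OF B nn] by (simp only:)
    qed
    also have "\<dots> = ennreal B * ennreal (\<Sum>k. \<bar>b k\<bar> * \<sigma>2)" by (subst nn_integral_cmult) (auto simp: nn)
    finally show "(\<integral>\<^sup>+ \<omega>. ennreal (norm (Y \<omega>)) \<partial>M) < \<infinity>" by (simp add: ennreal_mult_less_top)
  qed measurable
  have bound: "AE \<omega> in M. \<forall>N. (S N \<omega>)\<^sup>2 \<le> Y \<omega>" using ae2
  proof eventually_elim
    case (elim \<omega>)
    show ?case
    proof
      fix N
      \<comment> \<open>The weight \<open>b k\<close> is shared between the two factors as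
        \<open>sgn (b k) * sqrt |b k|\<close> and \<open>sqrt |b k|\<close>.\<close>
      have "(S N \<omega>)\<^sup>2 = (\<Sum>k<N. (sgn (b k) * sqrt \<bar>b k\<bar>) * (sqrt \<bar>b k\<bar> * \<xi> (t - int k) \<omega>))\<^sup>2"
        unfolding S_def by (intro arg_cong[where f="\<lambda>x. x\<^sup>2"] sum.cong refl) (simp add: sgn_mult_abs mult.assoc[symmetric], simp add: mult.assoc sgn_mult_abs)
      also have "\<dots> \<le> (\<Sum>k<N. (sgn (b k) * sqrt \<bar>b k\<bar>)\<^sup>2) * (\<Sum>k<N. (sqrt \<bar>b k\<bar> * \<xi> (t - int k) \<omega>)\<^sup>2)"
        by (rule Cauchy_Schwarz_ineq_sum)
      also have "\<dots> \<le> B * (\<Sum>k. \<bar>b k\<bar> * (\<xi> (t - int k) \<omega>)\<^sup>2)"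
      proof (rule mult_mono)
        have "(\<Sum>k<N. (sgn (b k) * sqrt \<bar>b k\<bar>)\<^sup>2) \<le> (\<Sum>k<N. \<bar>b k\<bar>)"
          by (intro sum_mono) (auto simp: power_mult_distrib sgn_if)
        also have "\<dots> \<le> B" unfolding B_def using b by (intro sum_le_suminf) auto
        finally show "(\<Sum>k<N. (sgn (b k) * sqrt \<bar>b k\<bar>)\<^sup>2) \<le> B" .
        show "(\<Sum>k<N. (sqrt \<bar>b k\<bar> * \<xi> (t - int k) \<omega>)\<^sup>2) \<le> (\<Sum>k. \<bar>b k\<bar> * (\<xi> (t - int k) \<omega>)\<^sup>2)"
          using elim by (simp add: power_mult_distrib sum_le_suminf)
      qed (use B in \<open>simp_all add: sum_nonneg\<close>)
      finally show "(S N \<omega>)\<^sup>2 \<le> Y \<omega>" by (simp add: Y_def)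
    qed
  qed
  have conv: "AE \<omega> in M. (\<lambda>N. S N \<omega>) \<longlonglongrightarrow> lin_proc b \<xi> t \<omega>"
    using AE_lin_proc_sums[OF b, of t] by eventually_elim (simp add: S_def sums_def)
  then have conv2: "AE \<omega> in M. (\<lambda>N. (S N \<omega>)\<^sup>2) \<longlonglongrightarrow> (lin_proc b \<xi> t \<omega>)\<^sup>2"
    by eventually_elim (intro tendsto_intros)
  have bd: "AE \<omega> in M. norm ((S N \<omega>)\<^sup>2) \<le> Y \<omega>" for N using bound by eventually_elim simp
  show int2: "integrable M (\<lambda>\<omega>. (lin_proc b \<xi> t \<omega>)\<^sup>2)"
    by (rule integrable_dominated_convergence[OF _ _ Yi conv2 bd]) measurable
  have lim: "(\<lambda>N. expectation (\<lambda>\<omega>. (S N \<omega>)\<^sup>2)) \<longlonglongrightarrow> expectation (\<lambda>\<omega>. (lin_proc b \<xi> t \<omega>)\<^sup>2)"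
    by (rule integral_dominated_convergence[OF _ _ Yi conv2 bd]) measurable
  have ES: "expectation (\<lambda>\<omega>. (S N \<omega>)\<^sup>2) = \<sigma>2 * (\<Sum>k<N. (b k)\<^sup>2)" for N
    unfolding S_def sum_lag by (subst finite_sum_second_moment) (auto simp: sum_lag_sq)
  have "\<exists>k0. \<forall>k\<ge>k0. \<bar>b k\<bar> \<le> 1"
    using order_tendstoD(2)[OF summable_LIMSEQ_zero[OF b], of 1] by (auto simp: eventually_sequentially intro: less_imp_le)
  then show sb: "summable (\<lambda>k. (b k)\<^sup>2)"
  proof
    fix k0 assume k0: "\<forall>k\<ge>k0. \<bar>b k\<bar> \<le> 1"
    show ?thesis
    proof (rule summable_comparison_test[OF _ b], intro exI[of _ k0] allI impI)
      fix k assume "k0 \<le> k"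
      then have "\<bar>b k\<bar> * \<bar>b k\<bar> \<le> \<bar>b k\<bar> * 1" using k0 by (intro mult_left_mono) auto
      then show "norm ((b k)\<^sup>2) \<le> \<bar>b k\<bar>" by (simp add: power2_eq_square abs_mult)
    qed
  qed
  have "(\<lambda>N. \<sigma>2 * (\<Sum>k<N. (b k)\<^sup>2)) \<longlonglongrightarrow> \<sigma>2 * (\<Sum>k. (b k)\<^sup>2)" by (intro tendsto_intros summable_LIMSEQ sb)
  then show "expectation (\<lambda>\<omega>. (lin_proc b \<xi> t \<omega>)\<^sup>2) = \<sigma>2 * (\<Sum>k. (b k)\<^sup>2)"
    using LIMSEQ_unique[OF lim] unfolding ES by simp
  show "integrable M (lin_proc b \<xi> t)" by (rule square_integrable_imp_integrable[OF _ int2]) measurable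
  \<comment> \<open>First moments are dominated through \<open>|s| \<le> 1 + s^2\<close>.\<close>
  have Y1: "integrable M (\<lambda>\<omega>. 1 + Y \<omega>)" using Yi by simp
  have "(\<lambda>N. expectation (S N)) \<longlonglongrightarrow> expectation (lin_proc b \<xi> t)"
  proof (rule integral_dominated_convergence[OF _ _ Y1 conv])
    show "AE \<omega> in M. norm (S N \<omega>) \<le> 1 + Y \<omega>" for N using bound
    proof eventually_elim
      case (elim \<omega>)
      have "\<bar>S N \<omega>\<bar> \<le> 1 + (S N \<omega>)\<^sup>2" using zero_le_power2[of "\<bar>S N \<omega>\<bar> - 1"] by (simp add: power2_diff)
      then show ?case using elim by (simp add: add.commute) (meson add_mono order_refl order_trans)
    qed
  qed measurable
  moreover have "expectation (S N) = 0" for N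
    unfolding S_def by (subst Bochner_Integration.integral_sum) (auto simp: xi_moments(1,2))
  ultimately have "(\<lambda>N. 0) \<longlonglongrightarrow> expectation (lin_proc b \<xi> t)" by simp
  then show "expectation (lin_proc b \<xi> t) = 0" by (simp add: LIMSEQ_const_iff)
qed

definition shift :: "nat \<Rightarrow> (nat \<Rightarrow> real) \<Rightarrow> nat \<Rightarrow> real" where
  "shift d b k = (if d \<le> k then b (k - d) else 0)"

lemma shift_sums: "f sums s \<Longrightarrow> shift d f sums s" using sums_iff_shift[of "shift d f" d s] by (simp add: shift_def)

lemma lin_proc_shift:
  assumes "summable (\<lambda>k. \<bar>b k\<bar>)"
  shows "AE \<omega> in M. lin_proc b \<xi> t \<omega> = lin_proc (shift d b) \<xi> (t + int d) \<omega>" using AE_lin_proc_sums[OF assms, of t]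
proof eventually_elim
  case (elim \<omega>)
  have "shift d (\<lambda>k. b k * \<xi> (t - int k) \<omega>) = (\<lambda>k. shift d b k * \<xi> (t + int d - int k) \<omega>)"
    by (auto simp: shift_def fun_eq_iff of_nat_diff algebra_simps)
  then show ?case using sums_unique[OF shift_sums[OF elim, of d]] by (simp add: lin_proc_def)
qed

lemma summable_shift: "summable (\<lambda>k. \<bar>b k\<bar>) \<Longrightarrow> summable (\<lambda>k. \<bar>shift d b k\<bar>)"
  using summable_iff_shift[of "\<lambda>k. \<bar>shift d b k\<bar>" d] by (simp add: shift_def)

lemma lin_proc_split:
  assumes "summable (\<lambda>k. \<bar>b k\<bar>)"
  shows "AE \<omega> in M. lin_proc b \<xi> (s + int d) \<omega>
    = lin_proc (\<lambda>k. b (k + d)) \<xi> s \<omega> + (\<Sum>k<d. b k * \<xi> (s + int d - int k) \<omega>)"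
  using AE_lin_proc_sums[OF assms, of "s + int d"]
proof eventually_elim
  case (elim \<omega>)
  show ?case unfolding lin_proc_def
    using suminf_split_initial_segment[OF sums_summable[OF elim], of d] by (simp add: algebra_simps)
qed

text \<open>Both sides are functions of disjoint families of innovations. The past enters with two
  functionals, since a covariance involves the earlier variable and also the part of the later one
  that is known at time \<open>s\<close>; the constant 0 gives both sides the same type.\<close>

lemma indep_past_future:
  "indep_var (borel \<Otimes>\<^sub>M borel) (\<lambda>\<omega>. (lin_proc b1 \<xi> s \<omega>, lin_proc b2 \<xi> s \<omega>))
    (borel \<Otimes>\<^sub>M borel) (\<lambda>\<omega>. (\<Sum>k<d. b k * \<xi> (s + int d - int k) \<omega>, 0 :: real))"
proof -
  let ?P = "\<lambda>f. (\<Sum>k. b1 k * f (s - int k), \<Sum>k. b2 k * f (s - int k)) :: real \<times> real"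
  let ?F = "\<lambda>f. (\<Sum>k<d. b k * f (s + int d - int k), 0 :: real) :: real \<times> real"
  have mP: "?P \<in> PiM {..s} (\<lambda>_. borel) \<rightarrow>\<^sub>M borel \<Otimes>\<^sub>M borel"
  proof -
    have [measurable]: "(\<lambda>f. f (s - int k) :: real) \<in> PiM {..s} (\<lambda>_. borel) \<rightarrow>\<^sub>M borel" for k
      by (rule measurable_component_singleton) auto
    show ?thesis by measurable
  qed
  have mF: "?F \<in> PiM {s<..} (\<lambda>_. borel) \<rightarrow>\<^sub>M borel \<Otimes>\<^sub>M borel"
  proof -
    have "(\<lambda>f. f (s + int d - int k) :: real) \<in> PiM {s<..} (\<lambda>_. borel) \<rightarrow>\<^sub>M borel" if "k < d" for k
      by (rule measurable_component_singleton) (use that in auto)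
    then show ?thesis by (intro measurable_Pair borel_measurable_sum borel_measurable_times) auto
  qed
  have "indep_var (borel \<Otimes>\<^sub>M borel) (?P \<circ> (\<lambda>\<omega>. restrict (\<lambda>i. \<xi> i \<omega>) {..s}))
    (borel \<Otimes>\<^sub>M borel) (?F \<circ> (\<lambda>\<omega>. restrict (\<lambda>i. \<xi> i \<omega>) {s<..}))"
    by (rule indep_var_compose[OF indep_var_restrict[OF indep] mP mF]) auto
  moreover have "?P \<circ> (\<lambda>\<omega>. restrict (\<lambda>i. \<xi> i \<omega>) {..s}) = (\<lambda>\<omega>. (lin_proc b1 \<xi> s \<omega>, lin_proc b2 \<xi> s \<omega>))"
    by (auto simp: lin_proc_def fun_eq_iff)
  moreover have "?F \<circ> (\<lambda>\<omega>. restrict (\<lambda>i. \<xi> i \<omega>) {s<..}) = (\<lambda>\<omega>. (\<Sum>k<d. b k * \<xi> (s + int d - int k) \<omega>, 0))"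
    by (auto simp: fun_eq_iff intro!: sum.cong)
  ultimately show ?thesis by simp
qed

text \<open>Fourier inversion combined with \<open>prod_char_integral\<close>: the cutoff 1 bounds
  the density, the cutoff \<open>min 1 (|u| * (\<delta> / sqrt V))\<close> its increment over the
  distance \<open>\<delta>\<close>. The term \<open>1 / sqrt P\<close> is the contribution of the
  frequencies at which no Gaussian comparison is made.\<close>

lemma lag_sum_density:
  obtains C P0 :: real where "0 < C" "1 \<le> P0"
    "\<And>d (b :: nat \<Rightarrow> real) t V P. V = (\<Sum>k<d. (b k)\<^sup>2) \<Longrightarrow> 0 < V \<Longrightarrow> P0 \<le> P \<Longrightarrow> (\<And>k. k < d \<Longrightarrow> P * (b k)\<^sup>2 \<le> V) \<Longrightarrow>
      \<exists>p. p \<in> borel_measurable borel \<and> distr M borel (\<lambda>\<omega>. \<Sum>k<d. b k * \<xi> (t - int k) \<omega>) = density lborel p \<and>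
        (\<forall>z. 0 \<le> p z \<and> p z \<le> C / sqrt V) \<and>
        (\<forall>z z'. \<bar>p z - p z'\<bar> \<le> C / sqrt V * (min 1 (\<bar>z - z'\<bar> / sqrt V) + 1 / sqrt P))"
proof (rule law.prod_char_integral)
  fix c C P0 :: real assume c: "0 < c" "0 < C" "1 \<le> P0" and I:
    "\<And>(S :: nat set) a V P m. finite S \<Longrightarrow> V = (\<Sum>k\<in>S. (a k)\<^sup>2) \<Longrightarrow> 0 < V \<Longrightarrow> P0 \<le> P \<Longrightarrow> (\<And>k. k \<in> S \<Longrightarrow> P * (a k)\<^sup>2 \<le> V) \<Longrightarrow>
      m \<in> borel_measurable borel \<Longrightarrow> (\<And>u. 0 \<le> m u \<and> m u \<le> 1) \<Longrightarrow>
      (\<integral>\<^sup>+ l. ennreal ((\<Prod>k\<in>S. cmod (\<psi> (a k * l))) * m (sqrt V * l)) \<partial>lborel)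
        \<le> ennreal (1 / sqrt V) * (gauss_weight c m + ennreal (C / sqrt P))"
  \<comment> \<open>Moments of the dominating Gaussian: order 0 serves for the size of the density,
    order 1 for its slope.\<close>
  define K where "K j = enn2real (\<integral>\<^sup>+ u. ennreal (exp (- (c * u\<^sup>2)) * \<bar>u\<bar> ^ j) \<partial>lborel)" for j :: nat
  have K: "(\<integral>\<^sup>+ u. ennreal (exp (- (c * u\<^sup>2)) * \<bar>u\<bar> ^ j) \<partial>lborel) = ennreal (K j)" for j
    using law.nn_integral_gauss_moment_finite[OF c(1), of j] unfolding K_def infinity_ennreal_def
    by (rule ennreal_enn2real[symmetric])
  have K0: "K j \<ge> 0" for j by (simp only: K_def enn2real_nonneg)
  define C' where "C' = K 0 + K 1 + C"
  have C': "C' > 0" using K0[of 0] K0[of 1] c by (simp add: C'_def)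
  show ?thesis
  proof (rule that[of C' P0])
    show "0 < C'" "1 \<le> P0" by fact+
    fix d and b :: "nat \<Rightarrow> real" and t V P
    assume V: "V = (\<Sum>k<d. (b k)\<^sup>2)" "0 < V" and P: "P0 \<le> P" and bP: "\<And>k. k < d \<Longrightarrow> P * (b k)\<^sup>2 \<le> V"
    let ?Z = "\<lambda>\<omega>. \<Sum>k<d. b k * \<xi> (t - int k) \<omega>"
    have P1: "P \<ge> 1" using P c by linarith
    define \<nu> where "\<nu> = distr M borel ?Z"
    interpret \<nu>: real_distribution \<nu> unfolding \<nu>_def by (rule real_distribution_distr) measurable
    have ch: "cmod (char \<nu> l) = (\<Prod>k<d. cmod (\<psi> (b k * l)))" for l
      unfolding \<nu>_def char_lag_sum by (simp add: prod_norm)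
    have main: "(\<integral>\<^sup>+ l. ennreal (cmod (char \<nu> l) * m (sqrt V * l)) \<partial>lborel)
        \<le> ennreal (1 / sqrt V) * (gauss_weight c m + ennreal (C / sqrt P))"
      if "m \<in> borel_measurable borel" "\<And>u. 0 \<le> m u \<and> m u \<le> 1" for m :: "real \<Rightarrow> real"
      unfolding ch by (rule I[OF finite_lessThan V P _ that]) (simp add: bP)
    have b1: "(\<integral>\<^sup>+ l. ennreal (cmod (char \<nu> l)) \<partial>lborel) \<le> ennreal (1 / sqrt V * C')"
    proof -
      have "(\<integral>\<^sup>+ l. ennreal (cmod (char \<nu> l)) \<partial>lborel) \<le> ennreal (1 / sqrt V) * (ennreal (K 0) + ennreal (C / sqrt P))"
        using main[of "\<lambda>_. 1"] K[of 0] by simp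
      also have "\<dots> = ennreal (1 / sqrt V * (K 0 + C / sqrt P))"
        using V(2) c K0[of 0] P1 by (subst ennreal_mult) (auto simp flip: ennreal_plus)
      also have "\<dots> \<le> ennreal (1 / sqrt V * C')"
      proof (intro ennreal_leI mult_left_mono)
        have "C / sqrt P \<le> C / 1" using P1 c by (intro divide_left_mono) auto
        then show "K 0 + C / sqrt P \<le> C'" using K0[of 1] by (simp add: C'_def)
      qed (use V(2) in auto)
      finally show ?thesis .
    qed
    have ic: "integrable lborel (\<lambda>l. cmod (char \<nu> l))"
    proof (rule integrableI_bounded)
      show "(\<integral>\<^sup>+ l. ennreal (norm (cmod (char \<nu> l))) \<partial>lborel) < \<infinity>" using le_less_trans[OF b1 ennreal_less_top] by simp
    qed measurable
    have B1: "(\<integral>l. cmod (char \<nu> l) \<partial>lborel) \<le> 1 / sqrt V * C'"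
    proof -
      have "ennreal (\<integral>l. cmod (char \<nu> l) \<partial>lborel) \<le> ennreal (1 / sqrt V * C')"
        using b1 nn_integral_eq_integral[OF ic] by simp
      then show ?thesis using C' V(2) by (subst (asm) ennreal_le_iff) auto
    qed
    show "\<exists>p. p \<in> borel_measurable borel \<and> distr M borel ?Z = density lborel p \<and>
        (\<forall>z. 0 \<le> p z \<and> p z \<le> C' / sqrt V) \<and>
        (\<forall>z z'. \<bar>p z - p z'\<bar> \<le> C' / sqrt V * (min 1 (\<bar>z - z'\<bar> / sqrt V) + 1 / sqrt P))"
    proof (intro exI[of _ \<nu>.inversion_density] conjI allI)
      show "\<nu>.inversion_density \<in> borel_measurable borel" by (rule \<nu>.borel_measurable_inversion_density[OF ic])
      show "distr M borel ?Z = density lborel \<nu>.inversion_density"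
        using \<nu>.density_inversion_density[OF ic] by (simp add: \<nu>_def)
      show "0 \<le> \<nu>.inversion_density z" for z by (rule \<nu>.inversion_density_nonneg[OF ic])
      \<comment> \<open>The inversion formula carries \<open>1 / (2 * pi)\<close>; the weaker factor
        1/2 is convenient because it cancels the 2 in
        \<open>min 2 (|l| * \<delta>) \<le> 2 * min 1 (|l| * \<delta>)\<close>.\<close>
      have pi2: "x / (2 * pi) \<le> x / 2" if "x \<ge> 0" for x :: real using that pi_gt3 by (intro divide_left_mono) auto
      have half: "x / 2 \<le> y" if "x \<ge> 0" "x \<le> y" for x y :: real using that by simp
      show "\<nu>.inversion_density z \<le> C' / sqrt V" for z
      proof -
        have "\<nu>.inversion_density z \<le> (\<integral>l. cmod (char \<nu> l) \<partial>lborel) / (2 * pi)"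
          using \<nu>.inversion_density_abs_le[OF ic, of z] by simp
        also have "\<dots> \<le> C' / sqrt V" by (rule order_trans[OF pi2 half]) (use B1 in \<open>auto intro!: integral_nonneg_AE\<close>)
        finally show ?thesis .
      qed
      fix z z' :: real
      define \<delta> where "\<delta> = \<bar>z - z'\<bar>"
      define m where "m u = min 1 (\<bar>u\<bar> * (\<delta> / sqrt V))" for u :: real
      have [measurable]: "m \<in> borel_measurable borel" unfolding m_def by measurable
      have \<delta>: "\<delta> \<ge> 0" by (simp add: \<delta>_def)
      have m: "0 \<le> m u \<and> m u \<le> 1" for u using \<delta> V(2) by (auto simp: m_def)
      have mV: "m (sqrt V * l) = min 1 (\<bar>l\<bar> * \<delta>)" for l using V(2) by (simp add: m_def abs_mult)
      have im: "integrable lborel (\<lambda>l. cmod (char \<nu> l) * min 1 (\<bar>l\<bar> * \<delta>))"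
        by (rule Bochner_Integration.integrable_bound[OF ic]) (use \<delta> in \<open>auto intro!: AE_I2 mult_left_le simp: abs_mult\<close>)
      have m0: "gauss_weight c m \<le> ennreal (K 0)"
        unfolding K[symmetric] using m by (intro nn_integral_mono ennreal_leI) (auto intro!: mult_left_le)
      have m1: "gauss_weight c m \<le> ennreal (\<delta> / sqrt V * K 1)"
      proof -
        have "gauss_weight c m
          \<le> (\<integral>\<^sup>+ u. ennreal (\<delta> / sqrt V) * ennreal (exp (- (c * u\<^sup>2)) * \<bar>u\<bar> ^ 1) \<partial>lborel)"
        proof (rule nn_integral_mono)
          fix u
          have "exp (- (c * u\<^sup>2)) * m u \<le> exp (- (c * u\<^sup>2)) * (\<bar>u\<bar> * (\<delta> / sqrt V))"
            by (intro mult_left_mono) (auto simp: m_def)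
          also have "\<dots> = \<delta> / sqrt V * (exp (- (c * u\<^sup>2)) * \<bar>u\<bar> ^ 1)" by simp
          finally show "ennreal (exp (- (c * u\<^sup>2)) * m u) \<le> ennreal (\<delta> / sqrt V) * ennreal (exp (- (c * u\<^sup>2)) * \<bar>u\<bar> ^ 1)"
            using \<delta> V(2) by (subst ennreal_mult[symmetric]) (auto intro: ennreal_leI)
        qed
        also have "\<dots> = ennreal (\<delta> / sqrt V * K 1)"
          using \<delta> V(2) K0[of 1] by (subst nn_integral_cmult, measurable, subst K, intro ennreal_mult[symmetric]) auto
        finally show ?thesis .
      qed
      \<comment> \<open>The first moment serves for \<open>\<delta>\<close> below the scale
        \<open>sqrt V\<close>, the zeroth for \<open>\<delta>\<close> above it.\<close>
      have "gauss_weight c m \<le> ennreal (C' * min 1 (\<delta> / sqrt V))"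
      proof (cases "\<delta> / sqrt V \<le> 1")
        case True
        have "\<delta> / sqrt V * K 1 \<le> \<delta> / sqrt V * C'"
          using \<delta> V(2) K0[of 0] c by (intro mult_left_mono) (auto simp: C'_def)
        also have "\<dots> = C' * min 1 (\<delta> / sqrt V)" using True by (simp add: min_def)
        finally have "\<delta> / sqrt V * K 1 \<le> C' * min 1 (\<delta> / sqrt V)" .
        then show ?thesis using m1 by (meson ennreal_leI order_trans)
      next
        case False
        then have "K 0 \<le> C' * min 1 (\<delta> / sqrt V)"
          using K0[of 1] c by (simp add: C'_def min_def)
        then show ?thesis using m0 by (meson ennreal_leI order_trans)
      qed
      then have "ennreal (1 / sqrt V) * (gauss_weight c m + ennreal (C / sqrt P))
        \<le> ennreal (1 / sqrt V) * (ennreal (C' * min 1 (\<delta> / sqrt V)) + ennreal (C / sqrt P))"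
        by (intro mult_left_mono add_right_mono) auto
      also have "\<dots> = ennreal (1 / sqrt V * (C' * min 1 (\<delta> / sqrt V) + C / sqrt P))"
        using V(2) c C' \<delta> P1 by (subst ennreal_mult) (auto simp flip: ennreal_plus)
      finally have "(\<integral>\<^sup>+ l. ennreal (cmod (char \<nu> l) * min 1 (\<bar>l\<bar> * \<delta>)) \<partial>lborel)
         \<le> ennreal (1 / sqrt V * (C' * min 1 (\<delta> / sqrt V) + C / sqrt P))" using main[of m] m unfolding mV by simp
      then have "ennreal (\<integral>l. cmod (char \<nu> l) * min 1 (\<bar>l\<bar> * \<delta>) \<partial>lborel) \<le> ennreal (1 / sqrt V * (C' * min 1 (\<delta> / sqrt V) + C / sqrt P))"
        using nn_integral_eq_integral[OF im] \<delta> by simp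
      then have B2: "(\<integral>l. cmod (char \<nu> l) * min 1 (\<bar>l\<bar> * \<delta>) \<partial>lborel) \<le> 1 / sqrt V * (C' * min 1 (\<delta> / sqrt V) + C / sqrt P)"
        using V(2) c C' \<delta> P1 by (subst (asm) ennreal_le_iff) auto
      have "(\<integral>l. cmod (char \<nu> l) * min 2 (\<bar>l\<bar> * \<delta>) \<partial>lborel) \<le> (\<integral>l. 2 * (cmod (char \<nu> l) * min 1 (\<bar>l\<bar> * \<delta>)) \<partial>lborel)"
      proof (rule integral_mono[OF _ integrable_mult_right[OF im]])
        have le: "cmod (char \<nu> l) * min 2 (\<bar>l\<bar> * \<delta>) \<le> 2 * (cmod (char \<nu> l) * min 1 (\<bar>l\<bar> * \<delta>))" for l
        proof -
          have "min 2 (\<bar>l\<bar> * \<delta>) \<le> 2 * min 1 (\<bar>l\<bar> * \<delta>)" using \<delta> by (auto simp: min_def)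
          from mult_left_mono[OF this, of "cmod (char \<nu> l)"] show ?thesis by (simp add: mult_ac)
        qed
        then show "cmod (char \<nu> l) * min 2 (\<bar>l\<bar> * \<delta>) \<le> 2 * (cmod (char \<nu> l) * min 1 (\<bar>l\<bar> * \<delta>))" for l .
        show "integrable lborel (\<lambda>l. cmod (char \<nu> l) * min 2 (\<bar>l\<bar> * \<delta>))"
          by (rule Bochner_Integration.integrable_bound[OF integrable_mult_right[OF im, of 2]])
            (use \<delta> le in \<open>auto intro!: AE_I2 simp: abs_mult\<close>)
      qed
      then have B3: "(\<integral>l. cmod (char \<nu> l) * min 2 (\<bar>l\<bar> * \<delta>) \<partial>lborel) / 2 \<le> 1 / sqrt V * (C' * min 1 (\<delta> / sqrt V) + C / sqrt P)"
        using B2 unfolding integral_mult_right_zero by linarith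
      have "\<bar>\<nu>.inversion_density z - \<nu>.inversion_density z'\<bar> \<le> (\<integral>l. cmod (char \<nu> l) * min 2 (\<bar>l\<bar> * \<delta>) \<partial>lborel) / (2 * pi)"
        unfolding \<delta>_def by (rule \<nu>.inversion_density_diff_le[OF ic])
      also have "\<dots> \<le> (\<integral>l. cmod (char \<nu> l) * min 2 (\<bar>l\<bar> * \<delta>) \<partial>lborel) / 2"
        by (rule pi2) (use \<delta> in \<open>auto intro!: integral_nonneg_AE\<close>)
      also have "\<dots> \<le> 1 / sqrt V * (C' * min 1 (\<delta> / sqrt V) + C / sqrt P)" by (rule B3)
      also have "\<dots> \<le> 1 / sqrt V * (C' * min 1 (\<delta> / sqrt V) + C' / sqrt P)"
        using V(2) P1 K0[of 0] K0[of 1] by (intro mult_left_mono add_left_mono divide_right_mono) (auto simp: C'_def)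
      finally show "\<bar>\<nu>.inversion_density z - \<nu>.inversion_density z'\<bar> \<le> C' / sqrt V * (min 1 (\<bar>z - z'\<bar> / sqrt V) + 1 / sqrt P)"
        by (simp add: \<delta>_def algebra_simps)
    qed
  qed
qed

end

section \<open>Sums over gaps and over pairs of times\<close>

lemma sum_powr_le:
  fixes \<gamma> :: real
  assumes "0 \<le> \<gamma>" "\<gamma> < 1"
  shows "(\<Sum>d\<in>{1..n}. (real n / real d) powr \<gamma>) \<le> real n / (1 - \<gamma>)"
proof -
  \<comment> \<open>Comparison with increments of the antiderivative
    \<open>x powr (1 - \<gamma>) / (1 - \<gamma>)\<close>, through the mean value theorem.\<close>
  have *: "(\<Sum>d\<in>{1..m}. real d powr (- \<gamma>)) \<le> real m powr (1 - \<gamma>) / (1 - \<gamma>)" for m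
  proof (induction m)
    case (Suc m)
    have "(1 - \<gamma>) * real (Suc m) powr (- \<gamma>) \<le> real (Suc m) powr (1 - \<gamma>) - real m powr (1 - \<gamma>)"
    proof (cases "m = 0")
      case False
      define f where "f x = x powr (1 - \<gamma>)" for x :: real
      have "\<exists>z>real m. z < real (Suc m) \<and> f (real (Suc m)) - f (real m) = (real (Suc m) - real m) * ((1 - \<gamma>) * z powr (1 - \<gamma> - 1))"
        unfolding f_def by (rule MVT2) (use False in \<open>auto intro!: derivative_eq_intros\<close>)
      then obtain z where z: "real m < z" "z < real (Suc m)" "f (real (Suc m)) - f (real m) = (1 - \<gamma>) * z powr (- \<gamma>)" by auto
      have "real (Suc m) powr (- \<gamma>) \<le> z powr (- \<gamma>)" using z assms False by (intro powr_mono2') auto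
      then show ?thesis using z assms by (simp add: f_def mult_left_mono)
    qed (use assms in auto)
    then have "real (Suc m) powr (- \<gamma>) \<le> real (Suc m) powr (1 - \<gamma>) / (1 - \<gamma>) - real m powr (1 - \<gamma>) / (1 - \<gamma>)"
      using assms by (simp add: pos_le_divide_eq mult.commute flip: diff_divide_distrib)
    then show ?case using Suc by simp
  qed simp
  have "(\<Sum>d\<in>{1..n}. (real n / real d) powr \<gamma>) = real n powr \<gamma> * (\<Sum>d\<in>{1..n}. real d powr (- \<gamma>))"
    by (auto simp: sum_distrib_left powr_divide powr_minus_divide intro!: sum.cong)
  also have "\<dots> \<le> real n powr \<gamma> * (real n powr (1 - \<gamma>) / (1 - \<gamma>))" by (intro mult_left_mono *) auto
  also have "\<dots> = real n / (1 - \<gamma>)" by (cases "n = 0") (auto simp flip: powr_add)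
  finally show ?thesis .
qed

text \<open>For each \<open>s\<close> fewer than \<open>2 * m\<close> times are closer than
  \<open>m\<close>, and these pairs are paid by the diagonal bounds \<open>q\<close>. For the other
  pairs the bound is a function of the earlier time times a function of the gap, so the double sum
  is at most a product of single sums; symmetry accounts for the factor 2.\<close>

lemma double_sum_near_far:
  fixes c :: "nat \<Rightarrow> nat \<Rightarrow> real"
  assumes sym: "\<And>s t. c s t = c t s"
    and near: "\<And>s t. s \<in> {m..n} \<Longrightarrow> t \<in> {m..n} \<Longrightarrow> c s t \<le> (q s + q t) / 2"
    and far: "\<And>s d. s \<in> {m..n} \<Longrightarrow> m \<le> d \<Longrightarrow> s + d \<le> n \<Longrightarrow> c s (s + d) \<le> R s * G d"
    and q: "\<And>s. s \<in> {m..n} \<Longrightarrow> 0 \<le> q s" and R: "\<And>s. s \<in> {m..n} \<Longrightarrow> 0 \<le> R s" and G: "\<And>d. d \<in> {m..n} \<Longrightarrow> 0 \<le> G d"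
  shows "(\<Sum>s\<in>{m..n}. \<Sum>t\<in>{m..n}. c s t) \<le> 2 * real m * (\<Sum>s\<in>{m..n}. q s) + 2 * ((\<Sum>s\<in>{m..n}. R s) * (\<Sum>d\<in>{m..n}. G d))"
proof -
  let ?I = "{m..n}"
  define N where "N s t = (if s < t + m \<and> t < s + m then (q s + q t) / 2 else 0)" for s t
  define F where "F s t = (if s + m \<le> t then R s * G (t - s) else 0)" for s t
  have "c s t \<le> N s t + F s t + F t s" if st: "s \<in> ?I" "t \<in> ?I" for s t
  proof -
    have F0: "0 \<le> F s t" if "s \<in> ?I" "t \<in> ?I" for s t
    proof (cases "s + m \<le> t")
      case True
      then have "t - s \<in> ?I" using that by auto
      then show ?thesis using that R[of s] G[of "t - s"] by (simp add: F_def)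
    qed (simp add: F_def)
    have N0: "0 \<le> N s t" using q st by (auto simp: N_def)
    consider "s < t + m \<and> t < s + m" | "s + m \<le> t" | "t + m \<le> s" by linarith
    then show ?thesis
    proof cases
      case 1
      then have "N s t = (q s + q t) / 2" by (simp add: N_def)
      then show ?thesis using near[OF st] F0[OF st] F0[OF st(2,1)] by linarith
    next
      case 2
      then have "F s t = R s * G (t - s)" "c s t \<le> R s * G (t - s)"
        using far[of s "t - s"] st by (auto simp: F_def)
      then show ?thesis using F0[OF st(2,1)] N0 by linarith
    next
      case 3
      then have "F t s = R t * G (s - t)" "c t s \<le> R t * G (s - t)"
        using far[of t "s - t"] st by (auto simp: F_def)
      then show ?thesis using sym[of s t] F0[OF st] N0 by linarith
    qed
  qed
  then have "(\<Sum>s\<in>?I. \<Sum>t\<in>?I. c s t) \<le> (\<Sum>s\<in>?I. \<Sum>t\<in>?I. N s t + F s t + F t s)" by (intro sum_mono) auto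
  also have "\<dots> = (\<Sum>s\<in>?I. \<Sum>t\<in>?I. N s t) + (\<Sum>s\<in>?I. \<Sum>t\<in>?I. F s t) + (\<Sum>s\<in>?I. \<Sum>t\<in>?I. F t s)" by (simp add: sum.distrib)
  also have "(\<Sum>s\<in>?I. \<Sum>t\<in>?I. F t s) = (\<Sum>s\<in>?I. \<Sum>t\<in>?I. F s t)" by (rule sum.swap)
  also have "(\<Sum>s\<in>?I. \<Sum>t\<in>?I. F s t) \<le> (\<Sum>s\<in>?I. R s * (\<Sum>d\<in>?I. G d))"
  proof (rule sum_mono)
    fix s assume s: "s \<in> ?I"
    have "(\<Sum>t\<in>?I. F s t) = (\<Sum>t\<in>{s+m..n}. R s * G (t - s))"
      by (rule sum.mono_neutral_cong_right) (use s in \<open>auto simp: F_def\<close>)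
    also have "\<dots> = R s * (\<Sum>t\<in>{s+m..n}. G (t - s))" by (simp add: sum_distrib_left)
    also have "(\<Sum>t\<in>{s+m..n}. G (t - s)) = (\<Sum>d\<in>{m..n-s}. G d)"
      by (rule sum.reindex_bij_witness[of _ "\<lambda>d. d + s" "\<lambda>t. t - s"]) (use s in auto)
    also have "R s * \<dots> \<le> R s * (\<Sum>d\<in>?I. G d)" using s R G by (intro mult_left_mono sum_mono2) auto
    finally show "(\<Sum>t\<in>?I. F s t) \<le> R s * (\<Sum>d\<in>?I. G d)" .
  qed
  also have "\<dots> = (\<Sum>s\<in>?I. R s) * (\<Sum>d\<in>?I. G d)" by (simp add: sum_distrib_right)
  also have "(\<Sum>s\<in>?I. \<Sum>t\<in>?I. N s t) \<le> 2 * real m * (\<Sum>s\<in>?I. q s)"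
  proof -
    define P where "P s t = (if s < t + m \<and> t < s + m then q s / 2 else 0)" for s t
    have NP: "N s t = P s t + P t s" for s t by (auto simp: N_def P_def add_divide_distrib)
    have "(\<Sum>t\<in>?I. P s t) \<le> real m * q s" if s: "s \<in> ?I" for s
    proof -
      have "(\<Sum>t\<in>?I. P s t) = (\<Sum>t\<in>{t\<in>?I. s < t + m \<and> t < s + m}. q s / 2)"
        unfolding P_def by (rule sum.mono_neutral_cong_right) auto
      also have "\<dots> = real (card {t\<in>?I. s < t + m \<and> t < s + m}) * (q s / 2)" by simp
      also have "\<dots> \<le> real (2 * m) * (q s / 2)"
      proof (intro mult_right_mono)
        have "card {t\<in>?I. s < t + m \<and> t < s + m} \<le> card {s - m..<s + m}" by (rule card_mono) auto
        then show "real (card {t\<in>?I. s < t + m \<and> t < s + m}) \<le> real (2 * m)" by simp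
      qed (use q s in auto)
      finally show ?thesis by simp
    qed
    then have "(\<Sum>s\<in>?I. \<Sum>t\<in>?I. P s t) \<le> (\<Sum>s\<in>?I. real m * q s)" by (intro sum_mono)
    moreover have "(\<Sum>s\<in>?I. \<Sum>t\<in>?I. P t s) = (\<Sum>s\<in>?I. \<Sum>t\<in>?I. P s t)" by (rule sum.swap)
    ultimately show ?thesis unfolding NP sum.distrib sum_distrib_left[symmetric] by linarith
  qed
  finally show ?thesis by (simp add: mult.commute)
qed

section \<open>Integrating out the most recent innovations\<close>

context innovations
begin

text \<open>The block of innovations at the times \<open>s + 1\<close> to \<open>s + d\<close>, with
  the weights that it has in the process at time \<open>s + d\<close>.\<close>

abbreviation "lag_sum b d s \<equiv> (\<lambda>\<omega>. \<Sum>k<d. b k * \<xi> (s + int d - int k) \<omega>)"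

text \<open>Independence makes the joint law of past and block a product, and Fubini applies. The
  first form asks for no integrability and serves for bounds of nonnegative variables, the second
  handles signed ones.\<close>

lemma past_future_disintegration:
  fixes F :: "(real \<times> real) \<times> real \<Rightarrow> real" and b b1 b2 :: "nat \<Rightarrow> real" and s :: int and d :: nat
  assumes F [measurable]: "F \<in> borel_measurable ((borel \<Otimes>\<^sub>M borel) \<Otimes>\<^sub>M borel)"
  defines "U \<equiv> \<lambda>\<omega>. (lin_proc b1 \<xi> s \<omega>, lin_proc b2 \<xi> s \<omega>)" and "\<nu> \<equiv> distr M borel (lag_sum b d s)"
  shows "(\<integral>\<^sup>+ \<omega>. ennreal (F (U \<omega>, lag_sum b d s \<omega>)) \<partial>M) = (\<integral>\<^sup>+ \<omega>. (\<integral>\<^sup>+ z. ennreal (F (U \<omega>, z)) \<partial>\<nu>) \<partial>M)" (is ?nn)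
    and "integrable M (\<lambda>\<omega>. F (U \<omega>, lag_sum b d s \<omega>)) \<Longrightarrow>
      expectation (\<lambda>\<omega>. F (U \<omega>, lag_sum b d s \<omega>)) = expectation (\<lambda>\<omega>. \<integral>z. F (U \<omega>, z) \<partial>\<nu>)" (is "?int \<Longrightarrow> ?eq")
proof -
  let ?J = "borel \<Otimes>\<^sub>M borel :: (real \<times> real) measure"
  let ?Z = "lag_sum b d s"
  let ?Y = "\<lambda>\<omega>. (?Z \<omega>, 0 :: real)"
  have iv: "indep_var ?J U ?J ?Y" unfolding U_def by (rule indep_past_future)
  have Um [measurable]: "U \<in> M \<rightarrow>\<^sub>M ?J" unfolding U_def by measurable
  have Zm [measurable]: "?Z \<in> borel_measurable M" by measurable
  have Ym [measurable]: "?Y \<in> M \<rightarrow>\<^sub>M ?J" by measurable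
  have eq: "distr M ?J U \<Otimes>\<^sub>M distr M ?J ?Y = distr M (?J \<Otimes>\<^sub>M ?J) (\<lambda>\<omega>. (U \<omega>, ?Y \<omega>))"
    using iv unfolding indep_var_distribution_eq by blast
  interpret U: prob_space "distr M ?J U" by (rule prob_space_distr) measurable
  interpret Y: prob_space "distr M ?J ?Y" by (rule prob_space_distr) measurable
  interpret UY: pair_sigma_finite "distr M ?J U" "distr M ?J ?Y" ..
  have Gm [measurable]: "(\<lambda>p. F (fst p, fst (snd p))) \<in> borel_measurable (?J \<Otimes>\<^sub>M ?J)" by measurable
  have "(\<integral>\<^sup>+ \<omega>. ennreal (F (U \<omega>, ?Z \<omega>)) \<partial>M) = (\<integral>\<^sup>+ p. ennreal (F (fst p, fst (snd p))) \<partial>(distr M ?J U \<Otimes>\<^sub>M distr M ?J ?Y))"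
    unfolding eq by (subst nn_integral_distr) auto
  also have "\<dots> = (\<integral>\<^sup>+ u. \<integral>\<^sup>+ y. ennreal (F (u, fst y)) \<partial>distr M ?J ?Y \<partial>distr M ?J U)"
    by (subst Y.nn_integral_fst[symmetric]) auto
  also have "\<dots> = (\<integral>\<^sup>+ \<omega>. \<integral>\<^sup>+ y. ennreal (F (U \<omega>, fst y)) \<partial>distr M ?J ?Y \<partial>M)" by (subst nn_integral_distr) auto
  also have "\<dots> = (\<integral>\<^sup>+ \<omega>. (\<integral>\<^sup>+ z. ennreal (F (U \<omega>, z)) \<partial>\<nu>) \<partial>M)"
  proof (rule nn_integral_cong)
    fix \<omega> assume "\<omega> \<in> space M"
    then have "U \<omega> \<in> space ?J" by (simp add: space_pair_measure)
    then have [measurable]: "(\<lambda>z. F (U \<omega>, z)) \<in> borel_measurable borel" by measurable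
    have "(\<integral>\<^sup>+ y. ennreal (F (U \<omega>, fst y)) \<partial>distr M ?J ?Y) = (\<integral>\<^sup>+ \<omega>'. ennreal (F (U \<omega>, ?Z \<omega>')) \<partial>M)"
      by (subst nn_integral_distr) auto
    also have "\<dots> = (\<integral>\<^sup>+ z. ennreal (F (U \<omega>, z)) \<partial>\<nu>)" unfolding \<nu>_def by (subst nn_integral_distr) auto
    finally show "(\<integral>\<^sup>+ y. ennreal (F (U \<omega>, fst y)) \<partial>distr M ?J ?Y) = (\<integral>\<^sup>+ z. ennreal (F (U \<omega>, z)) \<partial>\<nu>)" .
  qed
  finally show ?nn .
  assume int: ?int
  have intP: "integrable (distr M ?J U \<Otimes>\<^sub>M distr M ?J ?Y) (\<lambda>p. F (fst p, fst (snd p)))"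
    unfolding eq by (subst integrable_distr_eq) (use int in auto)
  have "expectation (\<lambda>\<omega>. F (U \<omega>, ?Z \<omega>)) = (\<integral>p. F (fst p, fst (snd p)) \<partial>(distr M ?J U \<Otimes>\<^sub>M distr M ?J ?Y))"
    unfolding eq by (subst integral_distr) auto
  also have "\<dots> = (\<integral>u. (\<integral>y. F (u, fst y) \<partial>distr M ?J ?Y) \<partial>distr M ?J U)"
    by (subst UY.integral_fst'[OF intP, symmetric]) simp
  also have "\<dots> = expectation (\<lambda>\<omega>. \<integral>y. F (U \<omega>, fst y) \<partial>distr M ?J ?Y)" by (subst integral_distr) auto
  also have "\<dots> = expectation (\<lambda>\<omega>. \<integral>z. F (U \<omega>, z) \<partial>\<nu>)"
  proof (rule Bochner_Integration.integral_cong[OF refl])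
    fix \<omega> assume "\<omega> \<in> space M"
    then have "U \<omega> \<in> space ?J" by (simp add: space_pair_measure)
    then have [measurable]: "(\<lambda>z. F (U \<omega>, z)) \<in> borel_measurable borel" by measurable
    show "(\<integral>y. F (U \<omega>, fst y) \<partial>distr M ?J ?Y) = (\<integral>z. F (U \<omega>, z) \<partial>\<nu>)"
      unfolding \<nu>_def by (subst (1 2) integral_distr) auto
  qed
  finally show ?eq .
qed

text \<open>Given the past, the variable has a translate of \<open>p\<close> as density. A bound on
  \<open>p\<close> is therefore a bound on the law, whatever the past, because Lebesgue measure is
  invariant under translation.\<close>

lemma nn_integral_lin_proc_le:
  fixes g p :: "real \<Rightarrow> real" and b :: "nat \<Rightarrow> real"
  assumes b: "summable (\<lambda>k. \<bar>b k\<bar>)" and g [measurable]: "g \<in> borel_measurable borel"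
    and p [measurable]: "p \<in> borel_measurable borel" and dens: "distr M borel (lag_sum b d s) = density lborel p"
    and pC: "\<And>z. p z \<le> c"
  shows "(\<integral>\<^sup>+ \<omega>. ennreal (g (lin_proc b \<xi> (s + int d) \<omega>)) \<partial>M) \<le> ennreal c * (\<integral>\<^sup>+ y. ennreal (g y) \<partial>lborel)"
proof -
  let ?R = "lin_proc (\<lambda>k. b (k + d)) \<xi> s"
  let ?F = "\<lambda>q :: (real \<times> real) \<times> real. g (fst (fst q) + snd q)"
  have "(\<integral>\<^sup>+ \<omega>. ennreal (g (lin_proc b \<xi> (s + int d) \<omega>)) \<partial>M)
     = (\<integral>\<^sup>+ \<omega>. ennreal (g (?R \<omega> + lag_sum b d s \<omega>)) \<partial>M)"
    by (rule nn_integral_cong_AE, use lin_proc_split[OF b, of s d] in eventually_elim) simp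
  also have "\<dots> = (\<integral>\<^sup>+ \<omega>. (\<integral>\<^sup>+ z. ennreal (g (?R \<omega> + z)) \<partial>distr M borel (lag_sum b d s)) \<partial>M)"
    using past_future_disintegration(1)[of ?F "\<lambda>k. b (k + d)" s "\<lambda>k. b (k + d)" b d] by simp
  also have "\<dots> \<le> (\<integral>\<^sup>+ \<omega>. ennreal c * (\<integral>\<^sup>+ y. ennreal (g y) \<partial>lborel) \<partial>M)"
  proof (rule nn_integral_mono)
    fix \<omega>
    have "(\<integral>\<^sup>+ z. ennreal (g (?R \<omega> + z)) \<partial>distr M borel (lag_sum b d s)) = (\<integral>\<^sup>+ z. ennreal (p z) * ennreal (g (?R \<omega> + z)) \<partial>lborel)"
      unfolding dens by (subst nn_integral_density) auto
    also have "\<dots> \<le> (\<integral>\<^sup>+ z. ennreal c * ennreal (g (?R \<omega> + z)) \<partial>lborel)"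
      by (intro nn_integral_mono mult_right_mono ennreal_leI pC) auto
    also have "\<dots> = ennreal c * (\<integral>\<^sup>+ z. ennreal (g (?R \<omega> + z)) \<partial>lborel)" by (rule nn_integral_cmult) measurable
    also have "(\<integral>\<^sup>+ z. ennreal (g (?R \<omega> + z)) \<partial>lborel) = (\<integral>\<^sup>+ y. ennreal (g y) \<partial>lborel)"
      using nn_integral_real_affine[of "\<lambda>y. ennreal (g y)" 1 "?R \<omega>"] by simp
    finally show "(\<integral>\<^sup>+ z. ennreal (g (?R \<omega> + z)) \<partial>distr M borel (lag_sum b d s)) \<le> ennreal c * (\<integral>\<^sup>+ y. ennreal (g y) \<partial>lborel)" .
  qed
  also have "\<dots> = ennreal c * (\<integral>\<^sup>+ y. ennreal (g y) \<partial>lborel)" by (simp add: emeasure_space_1)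
  finally show ?thesis .
qed

text \<open>The earlier variable is known at time \<open>s\<close>. Integration over the block in
  between replaces \<open>D\<close> of the later variable by its smoothing against \<open>p\<close>,
  which is at most \<open>G\<close> in modulus for every value \<open>v\<close> of the known
  part.\<close>

lemma lin_proc_covariance_le:
  fixes D p :: "real \<Rightarrow> real" and b :: "nat \<Rightarrow> real"
  assumes b: "summable (\<lambda>k. \<bar>b k\<bar>)" and D [measurable]: "D \<in> borel_measurable borel"
    and p [measurable]: "p \<in> borel_measurable borel" and p0: "\<And>z. 0 \<le> p z"
    and dens: "distr M borel (lag_sum b d s) = density lborel p"
    and G: "\<And>v. \<bar>\<integral>z. p z * D (v + z) \<partial>lborel\<bar> \<le> G"
    and i1: "integrable M (\<lambda>\<omega>. D (lin_proc b1 \<xi> s \<omega>))"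
    and i2: "integrable M (\<lambda>\<omega>. D (lin_proc b1 \<xi> s \<omega>) * D (lin_proc b \<xi> (s + int d) \<omega>))"
  shows "expectation (\<lambda>\<omega>. D (lin_proc b1 \<xi> s \<omega>) * D (lin_proc b \<xi> (s + int d) \<omega>))
    \<le> expectation (\<lambda>\<omega>. \<bar>D (lin_proc b1 \<xi> s \<omega>)\<bar>) * G"
proof -
  let ?R = "lin_proc (\<lambda>k. b (k + d)) \<xi> s" and ?X = "lin_proc b1 \<xi> s" and ?Z = "lag_sum b d s"
  let ?F = "\<lambda>q :: (real \<times> real) \<times> real. D (fst (fst q)) * D (snd (fst q) + snd q)"
  have ae: "AE \<omega> in M. D (?X \<omega>) * D (lin_proc b \<xi> (s + int d) \<omega>) = ?F ((?X \<omega>, ?R \<omega>), ?Z \<omega>)"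
    using lin_proc_split[OF b, of s d] by eventually_elim simp
  have int: "integrable M (\<lambda>\<omega>. ?F ((?X \<omega>, ?R \<omega>), ?Z \<omega>))"
    by (subst integrable_cong_AE[OF _ _ ae, symmetric]) (use i2 in measurable)
  have G0: "0 \<le> G" using G[of 0] by linarith
  have inner: "(\<integral>z. ?F ((?X \<omega>, ?R \<omega>), z) \<partial>distr M borel ?Z) = D (?X \<omega>) * (\<integral>z. p z * D (?R \<omega> + z) \<partial>lborel)" for \<omega>
    unfolding dens using p0 by (subst integral_density) (auto simp: mult_ac simp flip: integral_mult_right_zero)
  have "expectation (\<lambda>\<omega>. D (?X \<omega>) * D (lin_proc b \<xi> (s + int d) \<omega>)) = expectation (\<lambda>\<omega>. ?F ((?X \<omega>, ?R \<omega>), ?Z \<omega>))"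
    by (rule integral_cong_AE[OF _ _ ae]) measurable
  also have "\<dots> = expectation (\<lambda>\<omega>. D (?X \<omega>) * (\<integral>z. p z * D (?R \<omega> + z) \<partial>lborel))"
    unfolding inner[symmetric] by (rule past_future_disintegration(2)[OF _ int]) measurable
  also have "\<dots> \<le> expectation (\<lambda>\<omega>. \<bar>D (?X \<omega>)\<bar> * G)"
  proof (rule integral_mono')
    show "integrable M (\<lambda>\<omega>. \<bar>D (?X \<omega>)\<bar> * G)" using i1 by auto
    show "D (?X \<omega>) * (\<integral>z. p z * D (?R \<omega> + z) \<partial>lborel) \<le> \<bar>D (?X \<omega>)\<bar> * G" for \<omega>
    proof -
      have "D (?X \<omega>) * (\<integral>z. p z * D (?R \<omega> + z) \<partial>lborel) \<le> \<bar>D (?X \<omega>)\<bar> * \<bar>\<integral>z. p z * D (?R \<omega> + z) \<partial>lborel\<bar>"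
        by (metis abs_ge_self abs_mult)
      also have "\<dots> \<le> \<bar>D (?X \<omega>)\<bar> * G" by (intro mult_left_mono G) auto
      finally show ?thesis .
    qed
    show "0 \<le> \<bar>D (?X \<omega>)\<bar> * G" for \<omega> using G0 by simp
  qed
  finally show ?thesis by simp
qed

end

section \<open>Replacing the kernel by a Gaussian density\<close>

lemma normal_density_le: "0 < e \<Longrightarrow> normal_density 0 e y \<le> 1 / e"
proof -
  assume e: "0 < e"
  have "1 \<le> 2 * pi" using pi_gt3 by simp
  then have "e\<^sup>2 * 1 \<le> e\<^sup>2 * (2 * pi)" by (intro mult_left_mono) auto
  then have "e \<le> sqrt (2 * pi * e\<^sup>2)" using e by (intro real_le_rsqrt) (simp add: mult_ac)
  moreover have "normal_density 0 e y \<le> 1 / sqrt (2 * pi * e\<^sup>2) * 1"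
    unfolding normal_density_def by (intro mult_left_mono) auto
  ultimately show ?thesis using e by (smt (verit, best) frac_le)
qed

lemma normal_first_abs_moment:
  assumes "0 < e"
  shows "integrable lborel (\<lambda>y. normal_density 0 e y * \<bar>y\<bar>)" "(\<integral>y. normal_density 0 e y * \<bar>y\<bar> \<partial>lborel) \<le> e"
proof -
  have h: "has_bochner_integral lborel (\<lambda>y. normal_density 0 e y * \<bar>y\<bar>) (e * sqrt (2 / pi))"
    using normal_moment_abs_odd[OF assms, of 0 0] by simp
  then show "integrable lborel (\<lambda>y. normal_density 0 e y * \<bar>y\<bar>)" by (rule integrable.intros)
  have "sqrt (2 / pi) \<le> 1" using pi_gt3 by simp
  then show "(\<integral>y. normal_density 0 e y * \<bar>y\<bar> \<partial>lborel) \<le> e"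
    using has_bochner_integral_integral_eq[OF h] assms by (simp add: mult_left_le)
qed

text \<open>The two functions in the difference have the same integral, so the constant
  \<open>q 0\<close> cancels and only the oscillation of the density around 0 counts: over the
  displacement \<open>x + h * u\<close> on the side of the kernel, over a displacement of order
  \<open>e\<close> on the side of the Gaussian. Each side contributes \<open>\<eta>\<close>
  once.\<close>

lemma smooth_density_test_bound:
  fixes p K :: "real \<Rightarrow> real"
  assumes p [measurable]: "p \<in> borel_measurable borel" and p0: "\<And>z. 0 \<le> p z" and pc: "\<And>z. p z \<le> c"
    and modulus: "\<And>z z'. \<bar>p z - p z'\<bar> \<le> c * (min 1 (\<bar>z - z'\<bar> / w) + \<eta>)"
    and w: "0 < w" and c: "0 \<le> c" and \<eta>: "0 \<le> \<eta>"
    and K: "integrable lborel K" and h: "0 < h" and e: "0 < e"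
  shows "\<bar>\<integral>z. p z * (K ((v + z - x) / h) - h * (\<integral>u. K u \<partial>lborel) * normal_density 0 e (v + z)) \<partial>lborel\<bar>
    \<le> c * h * ((\<integral>u. \<bar>K u\<bar> * min 1 (\<bar>x + h * u\<bar> / w) \<partial>lborel) + (\<integral>u. \<bar>K u\<bar> \<partial>lborel) * (e / w) + 2 * \<eta> * (\<integral>u. \<bar>K u\<bar> \<partial>lborel))"
proof -
  have Km [measurable]: "K \<in> borel_measurable borel" using K by (simp add: borel_measurable_integrable)
  let ?g = "normal_density 0 e"
  define J where "J = (\<integral>u. K u \<partial>lborel)"
  define A where "A = (\<integral>u. \<bar>K u\<bar> \<partial>lborel)"
  \<comment> \<open>The density of the block shifted by the known part \<open>v\<close>.\<close>
  define q where "q y = p (y - v)" for y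
  have [measurable]: "q \<in> borel_measurable borel" unfolding q_def by measurable
  have q0: "0 \<le> q y" "q y \<le> c" for y using p0 pc by (auto simp: q_def)
  have gi: "integrable lborel ?g" using e by simp
  have g1: "(\<integral>y. ?g y \<partial>lborel) = 1" using e by simp
  have g0: "0 \<le> ?g y" for y by simp
  have Kb: "integrable lborel (\<lambda>u. f u * K u)" if [measurable]: "f \<in> borel_measurable borel" and "\<And>u. \<bar>f u\<bar> \<le> B" for f :: "real \<Rightarrow> real" and B
    by (rule Bochner_Integration.integrable_bound[OF integrable_mult_right[OF integrable_abs[OF K], of B]])
      (use that in \<open>auto intro!: AE_I2 simp: abs_mult mult_right_mono order_trans[OF _ abs_ge_self]\<close>)
  have gb: "integrable lborel (\<lambda>u. f u * ?g u)" if [measurable]: "f \<in> borel_measurable borel" and "\<And>u. \<bar>f u\<bar> \<le> B" for f :: "real \<Rightarrow> real" and B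
    by (rule Bochner_Integration.integrable_bound[OF integrable_mult_right[OF gi, of B]])
      (use that in \<open>auto intro!: AE_I2 simp: abs_mult mult_right_mono order_trans[OF _ abs_ge_self]\<close>)
  have qc: "\<bar>q y\<bar> \<le> c" for y using q0[of y] by simp
  have qK: "integrable lborel (\<lambda>u. q (x + h * u) * K u)" by (rule Kb[of _ c]) (use qc in auto)
  have qg: "integrable lborel (\<lambda>y. q y * ?g y)" by (rule gb[of _ c]) (use qc in auto)
  have qk: "integrable lborel (\<lambda>y. q y * K ((y - x) / h))"
    using lborel_integrable_real_affine_iff[of h "\<lambda>y. q y * K ((y - x) / h)" x] h qK by simp
  have "(\<integral>z. p z * (K ((v + z - x) / h) - h * J * ?g (v + z)) \<partial>lborel) = (\<integral>y. q y * (K ((y - x) / h) - h * J * ?g y) \<partial>lborel)"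
    using lborel_integral_real_affine[of 1 "\<lambda>y. q y * (K ((y - x) / h) - h * J * ?g y)" v] by (simp add: q_def)
  also have "\<dots> = (\<integral>y. q y * K ((y - x) / h) - h * J * (q y * ?g y) \<partial>lborel)" by (simp add: algebra_simps)
  also have "\<dots> = (\<integral>y. q y * K ((y - x) / h) \<partial>lborel) - h * J * (\<integral>y. q y * ?g y \<partial>lborel)" using qk qg by simp
  also have "(\<integral>y. q y * K ((y - x) / h) \<partial>lborel) = h * (\<integral>u. q (x + h * u) * K u \<partial>lborel)"
    using lborel_integral_real_affine[of h "\<lambda>y. q y * K ((y - x) / h)" x] h by simp
  also have "(\<integral>u. q (x + h * u) * K u \<partial>lborel) = (\<integral>u. (q (x + h * u) - q 0) * K u \<partial>lborel) + q 0 * J"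
    unfolding J_def using qK K by (simp add: left_diff_distrib)
  also have "(\<integral>y. q y * ?g y \<partial>lborel) = (\<integral>y. (q y - q 0) * ?g y \<partial>lborel) + q 0"
    using qg gi g1 by (simp add: left_diff_distrib)
  finally have eq: "(\<integral>z. p z * (K ((v + z - x) / h) - h * J * ?g (v + z)) \<partial>lborel)
    = h * (\<integral>u. (q (x + h * u) - q 0) * K u \<partial>lborel) - h * J * (\<integral>y. (q y - q 0) * ?g y \<partial>lborel)"
    by (simp add: algebra_simps)
  have md: "\<bar>q y - q 0\<bar> \<le> c * (min 1 (\<bar>y\<bar> / w) + \<eta>)" for y using modulus[of "y - v" "- v"] by (simp add: q_def)
  have mdc: "\<bar>q y - q 0\<bar> \<le> c" for y using q0[of y] q0[of 0] by (simp add: abs_le_iff)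
  have Kmin: "integrable lborel (\<lambda>u. min 1 (\<bar>x + h * u\<bar> / w) * \<bar>K u\<bar>)"
    using integrable_abs[OF Kb[of "\<lambda>u. min 1 (\<bar>x + h * u\<bar> / w)" 1]] w by (simp add: abs_mult)
  have I1: "\<bar>\<integral>u. (q (x + h * u) - q 0) * K u \<partial>lborel\<bar> \<le> c * ((\<integral>u. \<bar>K u\<bar> * min 1 (\<bar>x + h * u\<bar> / w) \<partial>lborel) + \<eta> * A)"
  proof -
    have "norm (\<integral>u. (q (x + h * u) - q 0) * K u \<partial>lborel) \<le> (\<integral>u. c * (min 1 (\<bar>x + h * u\<bar> / w) * \<bar>K u\<bar> + \<eta> * \<bar>K u\<bar>) \<partial>lborel)"
    proof (rule Bochner_Integration.integral_norm_bound_integral)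
      show "integrable lborel (\<lambda>u. (q (x + h * u) - q 0) * K u)" by (rule Kb[of _ c]) (use mdc in auto)
      show "integrable lborel (\<lambda>u. c * (min 1 (\<bar>x + h * u\<bar> / w) * \<bar>K u\<bar> + \<eta> * \<bar>K u\<bar>))"
        using Kmin K by (intro integrable_mult_right Bochner_Integration.integrable_add) auto
      show "norm ((q (x + h * u) - q 0) * K u) \<le> c * (min 1 (\<bar>x + h * u\<bar> / w) * \<bar>K u\<bar> + \<eta> * \<bar>K u\<bar>)" for u
      proof -
        have "norm ((q (x + h * u) - q 0) * K u) = \<bar>q (x + h * u) - q 0\<bar> * \<bar>K u\<bar>" by (simp only: real_norm_def abs_mult)
        also have "\<dots> \<le> c * (min 1 (\<bar>x + h * u\<bar> / w) + \<eta>) * \<bar>K u\<bar>" by (rule mult_right_mono[OF md]) simp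
        also have "\<dots> = c * (min 1 (\<bar>x + h * u\<bar> / w) * \<bar>K u\<bar> + \<eta> * \<bar>K u\<bar>)" by (simp add: algebra_simps)
        finally show ?thesis .
      qed
    qed
    also have "\<dots> = c * ((\<integral>u. min 1 (\<bar>x + h * u\<bar> / w) * \<bar>K u\<bar> \<partial>lborel) + \<eta> * A)" using Kmin K by (simp add: A_def)
    finally show ?thesis by (simp add: mult.commute)
  qed
  have I2: "\<bar>\<integral>y. (q y - q 0) * ?g y \<partial>lborel\<bar> \<le> c * (e / w + \<eta>)"
  proof -
    have "norm (\<integral>y. (q y - q 0) * ?g y \<partial>lborel) \<le> (\<integral>y. c * (1 / w * (?g y * \<bar>y\<bar>) + \<eta> * ?g y) \<partial>lborel)"
    proof (rule Bochner_Integration.integral_norm_bound_integral)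
      show "integrable lborel (\<lambda>y. (q y - q 0) * ?g y)" by (rule gb[of _ c]) (use mdc in auto)
      show "integrable lborel (\<lambda>y. c * (1 / w * (?g y * \<bar>y\<bar>) + \<eta> * ?g y))"
        using normal_first_abs_moment(1)[OF e] gi by (intro integrable_mult_right Bochner_Integration.integrable_add) auto
      show "norm ((q y - q 0) * ?g y) \<le> c * (1 / w * (?g y * \<bar>y\<bar>) + \<eta> * ?g y)" for y
      proof -
        have "\<bar>q y - q 0\<bar> * ?g y \<le> c * (\<bar>y\<bar> / w + \<eta>) * ?g y"
          using md[of y] c g0[of y] by (intro mult_right_mono order_trans[OF md[of y]] mult_left_mono add_right_mono) auto
        also have "\<dots> = c * (1 / w * (?g y * \<bar>y\<bar>) + \<eta> * ?g y)" by (simp add: algebra_simps)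
        finally show ?thesis unfolding real_norm_def abs_mult by simp
      qed
    qed
    also have "\<dots> = c * (1 / w * (\<integral>y. ?g y * \<bar>y\<bar> \<partial>lborel) + \<eta>)" using normal_first_abs_moment(1)[OF e] gi g1 by simp
    also have "\<dots> \<le> c * (e / w + \<eta>)"
      using normal_first_abs_moment(2)[OF e] w c by (intro mult_left_mono add_right_mono) (auto simp: divide_right_mono)
    finally show ?thesis unfolding real_norm_def .
  qed
  have JA: "\<bar>J\<bar> \<le> A" unfolding J_def A_def by (rule integral_abs_bound)
  have "\<bar>\<integral>z. p z * (K ((v + z - x) / h) - h * J * ?g (v + z)) \<partial>lborel\<bar>
    \<le> h * \<bar>\<integral>u. (q (x + h * u) - q 0) * K u \<partial>lborel\<bar> + h * (\<bar>J\<bar> * \<bar>\<integral>y. (q y - q 0) * ?g y \<partial>lborel\<bar>)"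
    unfolding eq using h by (rule_tac order_trans[OF abs_triangle_ineq4]) (simp add: abs_mult)
  also have "\<dots> \<le> h * (c * ((\<integral>u. \<bar>K u\<bar> * min 1 (\<bar>x + h * u\<bar> / w) \<partial>lborel) + \<eta> * A)) + h * (A * (c * (e / w + \<eta>)))"
    using h JA I1 I2 by (intro add_mono mult_left_mono mult_mono) auto
  also have "\<dots> = c * h * ((\<integral>u. \<bar>K u\<bar> * min 1 (\<bar>x + h * u\<bar> / w) \<partial>lborel) + A * (e / w) + 2 * \<eta> * A)"
    by (simp add: algebra_simps)
  finally show ?thesis unfolding J_def A_def .
qed

text \<open>\<open>a n t k\<close> is the weight at lag \<open>k\<close> in the variable at time
  \<open>t\<close>. \<open>V_unbounded\<close> together with \<open>a_bound\<close> makes each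
  single weight negligible within a long block. \<open>V_lower\<close> with
  \<open>\<gamma> < 1\<close> makes the inverse variances of the blocks summable: multiplied by
  \<open>(\<beta> n)^2\<close> and added over the lengths from \<open>d0\<close> to \<open>n\<close>
  they are of order \<open>n\<close>, by \<open>sum_powr_le\<close>.\<close>

locale kernel_array = innovations M \<xi> \<sigma>2 \<theta>
  for M :: "'a measure" and \<xi> :: "int \<Rightarrow> 'a \<Rightarrow> real" and \<sigma>2 \<theta> +
  fixes a :: "nat \<Rightarrow> nat \<Rightarrow> nat \<Rightarrow> real" and \<beta> h :: "nat \<Rightarrow> real" and B C\<^sub>V \<gamma> :: real
    and K :: "real \<Rightarrow> real" and x :: real
  assumes a_summable: "1 \<le> t \<Longrightarrow> t \<le> n \<Longrightarrow> summable (\<lambda>k. \<bar>a n t k\<bar>)"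
    and a_lag: "k < t \<Longrightarrow> t \<le> n \<Longrightarrow> a n t k = a n n k"
    and a_bound: "1 \<le> n \<Longrightarrow> k < n \<Longrightarrow> \<bar>a n n k\<bar> \<le> B"
    and V_unbounded: "\<exists>d0. \<forall>n d. d0 \<le> d \<longrightarrow> d \<le> n \<longrightarrow> R \<le> (\<Sum>k<d. (a n n k)\<^sup>2)"
    and V_lower: "\<exists>d0. \<forall>n d. d0 \<le> d \<longrightarrow> d \<le> n \<longrightarrow> (\<beta> n)\<^sup>2 \<le> C\<^sub>V * (\<Sum>k<d. (a n n k)\<^sup>2) * (real n / real d) powr \<gamma>"
    and \<gamma>: "0 \<le> \<gamma>" "\<gamma> < 1" and C\<^sub>V: "1 \<le> C\<^sub>V"
    and \<beta>_pos: "1 \<le> n \<Longrightarrow> 0 < \<beta> n" and h_pos: "1 \<le> n \<Longrightarrow> 0 < h n"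
    and \<beta>_top: "filterlim \<beta> at_top sequentially"
    and h_small: "(\<lambda>n. h n / \<beta> n) \<longlonglongrightarrow> 0" and h_large: "(\<lambda>n. \<beta> n / (real n * h n)) \<longlonglongrightarrow> 0"
    and K_int: "integrable lborel K" and K2_int: "integrable lborel (\<lambda>u. (K u)\<^sup>2)"
begin

definition "X n t = lin_proc (a n t) \<xi> (int t)"
text \<open>The factor in front of the normal density gives both parts the same Lebesgue integral,
  which \<open>smooth_density_test_bound\<close> exploits.\<close>

definition "D \<epsilon> n y = K ((y - x) / h n) - h n * (\<integral>u. K u \<partial>lborel) * normal_density 0 (\<epsilon> * \<beta> n) y"
abbreviation "D_sum \<epsilon> m n \<omega> \<equiv> \<beta> n / (real n * h n) * (\<Sum>t\<in>{m..n}. D \<epsilon> n (X n t \<omega>))"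

lemma K_measurable [measurable]: "K \<in> borel_measurable borel" using K_int by (simp add: borel_measurable_integrable)

lemma X_measurable [measurable]: "X n t \<in> borel_measurable M" unfolding X_def by measurable

lemma D_measurable [measurable]: "D \<epsilon> n \<in> borel_measurable borel" unfolding D_def by measurable

definition "A = (\<integral>u. \<bar>K u\<bar> \<partial>lborel)"
definition "A2 = (\<integral>u. (K u)\<^sup>2 \<partial>lborel)"
text \<open>The error of treating the rescaled kernel as a point mass at 0, on the scale
  \<open>\<beta> n\<close>. The displacement is truncated at 1 so that integrability of
  \<open>K\<close> suffices.\<close>

definition "\<Theta> n = (\<integral>u. \<bar>K u\<bar> * min 1 (\<bar>x + h n * u\<bar> / \<beta> n) \<partial>lborel)"

lemma A_nonneg: "0 \<le> A" "0 \<le> A2" by (simp_all add: A_def A2_def)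

lemma Kmin_int:
  assumes "1 \<le> n" "0 < w"
  shows "integrable lborel (\<lambda>u. \<bar>K u\<bar> * min 1 (\<bar>x + h n * u\<bar> / w))"
  by (rule Bochner_Integration.integrable_bound[OF K_int]) (use assms in \<open>auto intro!: AE_I2 mult_left_le simp: abs_mult\<close>)

lemma \<Theta>_nonneg: "1 \<le> n \<Longrightarrow> 0 \<le> \<Theta> n" unfolding \<Theta>_def using \<beta>_pos[of n] by (intro integral_nonneg_AE) auto

lemma inverse_\<beta>_tendsto: "(\<lambda>n. 1 / \<beta> n) \<longlonglongrightarrow> 0" using tendsto_inverse_0_at_top[OF \<beta>_top] by (simp add: inverse_eq_divide)

lemma \<Theta>_tendsto: "\<Theta> \<longlonglongrightarrow> 0"
proof -
  \<comment> \<open>The modulus \<open>|\<beta> n|\<close> makes the domination hold for all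
    \<open>n\<close>; positivity of \<open>\<beta> n\<close> is available from 1 on.\<close>
  have "(\<lambda>n. \<integral>u. \<bar>K u\<bar> * min 1 (\<bar>x + h n * u\<bar> / \<bar>\<beta> n\<bar>) \<partial>lborel) \<longlonglongrightarrow> integral\<^sup>L lborel (\<lambda>u::real. 0::real)"
  proof (rule integral_dominated_convergence[where w="\<lambda>u. \<bar>K u\<bar>"])
    show "AE u in lborel. (\<lambda>n. \<bar>K u\<bar> * min 1 (\<bar>x + h n * u\<bar> / \<bar>\<beta> n\<bar>)) \<longlonglongrightarrow> 0"
    proof (rule AE_I2)
      fix u
      have "(\<lambda>n. \<bar>K u\<bar> * min 1 \<bar>x * (1 / \<beta> n) + h n / \<beta> n * u\<bar>) \<longlonglongrightarrow> \<bar>K u\<bar> * min 1 \<bar>x * 0 + 0 * u\<bar>"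
        by (intro tendsto_intros inverse_\<beta>_tendsto h_small)
      moreover have "\<bar>x * (1 / \<beta> n) + h n / \<beta> n * u\<bar> = \<bar>x + h n * u\<bar> / \<bar>\<beta> n\<bar>" for n
        by (simp add: add_divide_distrib flip: abs_divide)
      ultimately show "(\<lambda>n. \<bar>K u\<bar> * min 1 (\<bar>x + h n * u\<bar> / \<bar>\<beta> n\<bar>)) \<longlonglongrightarrow> 0" by simp
    qed
    show "AE u in lborel. norm (\<bar>K u\<bar> * min 1 (\<bar>x + h n * u\<bar> / \<bar>\<beta> n\<bar>)) \<le> \<bar>K u\<bar>" for n
      by (intro AE_I2) (auto simp: abs_mult intro!: mult_left_le)
  qed (use K_int in auto)
  then have "(\<lambda>n. \<integral>u. \<bar>K u\<bar> * min 1 (\<bar>x + h n * u\<bar> / \<bar>\<beta> n\<bar>) \<partial>lborel) \<longlonglongrightarrow> 0" by simp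
  moreover have "\<forall>\<^sub>F n in sequentially. (\<integral>u. \<bar>K u\<bar> * min 1 (\<bar>x + h n * u\<bar> / \<bar>\<beta> n\<bar>) \<partial>lborel) = \<Theta> n"
    using eventually_ge_at_top[of 1]
  proof eventually_elim
    case (elim n)
    then show ?case using \<beta>_pos[of n] by (simp add: \<Theta>_def)
  qed
  ultimately show ?thesis by (simp add: tendsto_cong)
qed

text \<open>Measuring the displacement by \<open>w\<close> instead of \<open>\<beta> n\<close> costs
  the ratio of the two, if that exceeds 1.\<close>

lemma \<Theta>_scale:
  assumes n: "1 \<le> n" and w: "0 < w"
  shows "(\<integral>u. \<bar>K u\<bar> * min 1 (\<bar>x + h n * u\<bar> / w) \<partial>lborel) \<le> max 1 (\<beta> n / w) * \<Theta> n"
proof -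
  have b: "0 < \<beta> n" using \<beta>_pos n by auto
  have "(\<integral>u. \<bar>K u\<bar> * min 1 (\<bar>x + h n * u\<bar> / w) \<partial>lborel) \<le> (\<integral>u. max 1 (\<beta> n / w) * (\<bar>K u\<bar> * min 1 (\<bar>x + h n * u\<bar> / \<beta> n)) \<partial>lborel)"
  proof (rule integral_mono[OF Kmin_int[OF n w] integrable_mult_right[OF Kmin_int[OF n b]]])
    fix u
    define y where "y = \<bar>x + h n * u\<bar>"
    have "min 1 (y / w) \<le> max 1 (\<beta> n / w) * min 1 (y / \<beta> n)"
    proof (cases "y \<le> \<beta> n")
      case True
      then have "min 1 (y / \<beta> n) = y / \<beta> n" using b by (simp add: min_def)
      moreover have "y / w = \<beta> n / w * (y / \<beta> n)" using b by simp
      moreover have "\<beta> n / w * (y / \<beta> n) \<le> max 1 (\<beta> n / w) * (y / \<beta> n)"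
        using b by (intro mult_right_mono) (auto simp: y_def)
      ultimately show ?thesis by simp
    next
      case False
      then have "min 1 (y / \<beta> n) = 1" using b by (simp add: min_def)
      then show ?thesis by simp
    qed
    from mult_left_mono[OF this, of "\<bar>K u\<bar>"]
    show "\<bar>K u\<bar> * min 1 (\<bar>x + h n * u\<bar> / w) \<le> max 1 (\<beta> n / w) * (\<bar>K u\<bar> * min 1 (\<bar>x + h n * u\<bar> / \<beta> n))"
      by (simp add: y_def mult_ac)
  qed
  then show ?thesis by (simp add: \<Theta>_def)
qed

lemma kernel_integrals:
  assumes n: "1 \<le> n"
  shows "(\<integral>\<^sup>+ y. ennreal \<bar>K ((y - x) / h n)\<bar> \<partial>lborel) = ennreal (h n * A)"
    and "(\<integral>\<^sup>+ y. ennreal ((K ((y - x) / h n))\<^sup>2) \<partial>lborel) = ennreal (h n * A2)"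
proof -
  have hn: "0 < h n" using h_pos n by auto
  show "(\<integral>\<^sup>+ y. ennreal \<bar>K ((y - x) / h n)\<bar> \<partial>lborel) = ennreal (h n * A)"
    using hn A_nonneg nn_integral_eq_integral[OF integrable_abs[OF K_int]]
    by (subst nn_integral_real_affine[of _ "h n" x]) (auto simp: A_def ennreal_mult)
  show "(\<integral>\<^sup>+ y. ennreal ((K ((y - x) / h n))\<^sup>2) \<partial>lborel) = ennreal (h n * A2)"
    using hn A_nonneg nn_integral_eq_integral[OF K2_int]
    by (subst nn_integral_real_affine[of _ "h n" x]) (auto simp: A2_def ennreal_mult)
qed

lemma D_abs_integral:
  assumes n: "1 \<le> n" and \<epsilon>: "0 < \<epsilon>"
  shows "(\<integral>\<^sup>+ y. ennreal \<bar>D \<epsilon> n y\<bar> \<partial>lborel) \<le> ennreal (2 * h n * A)"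
proof -
  define J where "J = (\<integral>u. K u \<partial>lborel)"
  define e where "e = \<epsilon> * \<beta> n"
  have e: "0 < e" using \<epsilon> \<beta>_pos[OF n] by (simp add: e_def)
  have hn: "0 < h n" using h_pos n by auto
  have JA: "\<bar>J\<bar> \<le> A" unfolding J_def A_def by (rule integral_abs_bound)
  have "(\<integral>\<^sup>+ y. ennreal \<bar>D \<epsilon> n y\<bar> \<partial>lborel)
    \<le> (\<integral>\<^sup>+ y. ennreal \<bar>K ((y - x) / h n)\<bar> + ennreal (h n * A) * ennreal (normal_density 0 e y) \<partial>lborel)"
  proof (rule nn_integral_mono)
    fix y
    have "\<bar>D \<epsilon> n y\<bar> \<le> \<bar>K ((y - x) / h n)\<bar> + \<bar>h n * J * normal_density 0 e y\<bar>"
      unfolding D_def J_def e_def by (rule abs_triangle_ineq4)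
    also have "\<bar>h n * J * normal_density 0 e y\<bar> = h n * \<bar>J\<bar> * normal_density 0 e y" using hn by (simp add: abs_mult)
    also have "\<dots> \<le> h n * A * normal_density 0 e y" using hn JA by (intro mult_right_mono mult_left_mono) auto
    finally have "\<bar>D \<epsilon> n y\<bar> \<le> \<bar>K ((y - x) / h n)\<bar> + h n * A * normal_density 0 e y" by simp
    then show "ennreal \<bar>D \<epsilon> n y\<bar> \<le> ennreal \<bar>K ((y - x) / h n)\<bar> + ennreal (h n * A) * ennreal (normal_density 0 e y)"
      using hn A_nonneg by (subst ennreal_mult[symmetric]) (auto simp flip: ennreal_plus intro: ennreal_leI)
  qed
  also have "\<dots> = ennreal (h n * A) + ennreal (h n * A) * (\<integral>\<^sup>+ y. ennreal (normal_density 0 e y) \<partial>lborel)"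
    using kernel_integrals(1)[OF n] by (subst nn_integral_add) (auto simp: nn_integral_cmult)
  also have "(\<integral>\<^sup>+ y. ennreal (normal_density 0 e y) \<partial>lborel) = 1"
    using nn_integral_eq_integral[OF integrable_normal_density[OF e, of 0]] integral_normal_density[OF e, of 0] by simp
  finally show ?thesis using hn A_nonneg by (simp flip: ennreal_plus add: mult_ac)
qed

text \<open>Everything follows from the bound \<open>c\<close> on the density of the block of all
  innovations after time 0. In the second moment the kernel part is of order \<open>c * h n\<close>,
  while the Gaussian part is bounded pointwise by \<open>normal_density_le\<close>.\<close>

lemma X_D_moments:
  fixes p :: "real \<Rightarrow> real"
  assumes n: "1 \<le> n" and t: "1 \<le> t" "t \<le> n" and \<epsilon>: "0 < \<epsilon>"
    and p: "p \<in> borel_measurable borel" "distr M borel (lag_sum (a n t) t 0) = density lborel p" "\<And>z. p z \<le> c" and c: "0 \<le> c"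
  shows "integrable M (\<lambda>\<omega>. (D \<epsilon> n (X n t \<omega>))\<^sup>2)" "integrable M (\<lambda>\<omega>. D \<epsilon> n (X n t \<omega>))"
    and "expectation (\<lambda>\<omega>. \<bar>D \<epsilon> n (X n t \<omega>)\<bar>) \<le> c * (2 * h n * A)"
    and "expectation (\<lambda>\<omega>. (D \<epsilon> n (X n t \<omega>))\<^sup>2) \<le> 2 * (c * (h n * A2)) + 2 * (h n * A / (\<epsilon> * \<beta> n))\<^sup>2"
proof -
  have hn: "0 < h n" using h_pos n by auto
  define e where "e = \<epsilon> * \<beta> n"
  have e: "0 < e" using \<epsilon> \<beta>_pos[OF n] by (simp add: e_def)
  define J where "J = (\<integral>u. K u \<partial>lborel)"
  have JA: "\<bar>J\<bar> \<le> A" unfolding J_def A_def by (rule integral_abs_bound)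
  have le: "(\<integral>\<^sup>+ \<omega>. ennreal (g (X n t \<omega>)) \<partial>M) \<le> ennreal c * (\<integral>\<^sup>+ y. ennreal (g y) \<partial>lborel)"
    if "g \<in> borel_measurable borel" for g :: "real \<Rightarrow> real"
    using nn_integral_lin_proc_le[OF a_summable[OF t] that p] by (simp add: X_def)
  have d2: "(D \<epsilon> n y)\<^sup>2 \<le> 2 * (K ((y - x) / h n))\<^sup>2 + 2 * (h n * A / e)\<^sup>2" for y
  proof -
    have "\<bar>h n * J * normal_density 0 e y\<bar> \<le> h n * A * (1 / e)"
      unfolding abs_mult using hn JA e normal_density_le[OF e, of y] by (intro mult_mono) auto
    then have "(h n * J * normal_density 0 e y)\<^sup>2 \<le> (h n * A / e)\<^sup>2"
      by (metis abs_le_square_iff abs_ge_zero abs_of_nonneg order_trans times_divide_eq_right mult.right_neutral)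
    moreover have "(D \<epsilon> n y)\<^sup>2 \<le> 2 * (K ((y - x) / h n))\<^sup>2 + 2 * (h n * J * normal_density 0 e y)\<^sup>2"
      using zero_le_power2[of "K ((y - x) / h n) + h n * J * normal_density 0 e y"]
      unfolding D_def J_def[symmetric] e_def[symmetric] by (simp add: power2_sum power2_diff)
    ultimately show ?thesis by linarith
  qed
  have nn2: "(\<integral>\<^sup>+ \<omega>. ennreal ((D \<epsilon> n (X n t \<omega>))\<^sup>2) \<partial>M) \<le> ennreal (2 * (c * (h n * A2)) + 2 * (h n * A / e)\<^sup>2)"
  proof -
    have "(\<integral>\<^sup>+ \<omega>. ennreal ((D \<epsilon> n (X n t \<omega>))\<^sup>2) \<partial>M)
      \<le> (\<integral>\<^sup>+ \<omega>. 2 * ennreal ((K ((X n t \<omega> - x) / h n))\<^sup>2) + ennreal (2 * (h n * A / e)\<^sup>2) \<partial>M)"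
    proof (rule nn_integral_mono)
      fix \<omega>
      have "ennreal ((D \<epsilon> n (X n t \<omega>))\<^sup>2) \<le> ennreal (2 * (K ((X n t \<omega> - x) / h n))\<^sup>2 + 2 * (h n * A / e)\<^sup>2)"
        by (rule ennreal_leI[OF d2])
      also have "\<dots> = 2 * ennreal ((K ((X n t \<omega> - x) / h n))\<^sup>2) + ennreal (2 * (h n * A / e)\<^sup>2)"
        by (subst ennreal_plus) (auto simp: ennreal_mult)
      finally show "ennreal ((D \<epsilon> n (X n t \<omega>))\<^sup>2) \<le> 2 * ennreal ((K ((X n t \<omega> - x) / h n))\<^sup>2) + ennreal (2 * (h n * A / e)\<^sup>2)" .
    qed
    also have "\<dots> = 2 * (\<integral>\<^sup>+ \<omega>. ennreal ((K ((X n t \<omega> - x) / h n))\<^sup>2) \<partial>M) + ennreal (2 * (h n * A / e)\<^sup>2)"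
      by (subst nn_integral_add) (auto simp: nn_integral_cmult emeasure_space_1)
    also have "(\<integral>\<^sup>+ \<omega>. ennreal ((K ((X n t \<omega> - x) / h n))\<^sup>2) \<partial>M) \<le> ennreal c * ennreal (h n * A2)"
      using le[of "\<lambda>y. (K ((y - x) / h n))\<^sup>2"] kernel_integrals(2)[OF n] by simp
    also have "2 * (ennreal c * ennreal (h n * A2)) + ennreal (2 * (h n * A / e)\<^sup>2) = ennreal (2 * (c * (h n * A2)) + 2 * (h n * A / e)\<^sup>2)"
      using c hn A_nonneg by (subst ennreal_plus) (auto simp: ennreal_mult)
    finally show ?thesis by (simp add: add_right_mono mult_left_mono)
  qed
  show i2: "integrable M (\<lambda>\<omega>. (D \<epsilon> n (X n t \<omega>))\<^sup>2)"
    by (rule integrableI_bounded) (use le_less_trans[OF nn2 ennreal_less_top] in auto)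
  show i1: "integrable M (\<lambda>\<omega>. D \<epsilon> n (X n t \<omega>))" by (rule square_integrable_imp_integrable[OF _ i2]) measurable
  have "ennreal (expectation (\<lambda>\<omega>. (D \<epsilon> n (X n t \<omega>))\<^sup>2)) \<le> ennreal (2 * (c * (h n * A2)) + 2 * (h n * A / e)\<^sup>2)"
    using nn2 nn_integral_eq_integral[OF i2] by simp
  then show "expectation (\<lambda>\<omega>. (D \<epsilon> n (X n t \<omega>))\<^sup>2) \<le> 2 * (c * (h n * A2)) + 2 * (h n * A / (\<epsilon> * \<beta> n))\<^sup>2"
    using c hn A_nonneg unfolding e_def by (subst (asm) ennreal_le_iff) auto
  have "(\<integral>\<^sup>+ \<omega>. ennreal \<bar>D \<epsilon> n (X n t \<omega>)\<bar> \<partial>M) \<le> ennreal c * (\<integral>\<^sup>+ y. ennreal \<bar>D \<epsilon> n y\<bar> \<partial>lborel)"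
    by (rule le) measurable
  also have "\<dots> \<le> ennreal c * ennreal (2 * h n * A)" by (intro mult_left_mono D_abs_integral n \<epsilon>) auto
  also have "\<dots> = ennreal (c * (2 * h n * A))" using c hn A_nonneg by (subst ennreal_mult) auto
  finally have "ennreal (expectation (\<lambda>\<omega>. \<bar>D \<epsilon> n (X n t \<omega>)\<bar>)) \<le> ennreal (c * (2 * h n * A))"
    using nn_integral_eq_integral[OF integrable_abs[OF i1]] by simp
  then show "expectation (\<lambda>\<omega>. \<bar>D \<epsilon> n (X n t \<omega>)\<bar>) \<le> c * (2 * h n * A)"
    using c hn A_nonneg by (subst (asm) ennreal_le_iff) auto
qed

text \<open>Expand the square. For a gap \<open>d\<close> of at least \<open>m\<close>, integration
  over the \<open>d\<close> innovations in between leaves the small factor \<open>G n d\<close>;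
  pairs closer than \<open>m\<close> disappear in the limit. \<open>Q\<close> is fixed before
  \<open>\<epsilon>\<close>, whereas \<open>m\<close> may grow as \<open>\<epsilon>\<close>
  decreases.\<close>

lemma second_moment_small:
  "\<exists>Q\<ge>0. \<forall>\<epsilon>>0. \<exists>m\<ge>1. \<forall>\<^sub>F n in sequentially.
    integrable M (\<lambda>\<omega>. (D_sum \<epsilon> m n \<omega>)\<^sup>2) \<and>
    expectation (\<lambda>\<omega>. (D_sum \<epsilon> m n \<omega>)\<^sup>2) \<le> Q * \<epsilon>"
proof (rule lag_sum_density)
  fix C P0 :: real
  assume C: "0 < C" and P0: "1 \<le> P0"
    and dens: "\<And>d (b :: nat \<Rightarrow> real) t V P. V = (\<Sum>k<d. (b k)\<^sup>2) \<Longrightarrow> 0 < V \<Longrightarrow> P0 \<le> P \<Longrightarrow> (\<And>k. k < d \<Longrightarrow> P * (b k)\<^sup>2 \<le> V) \<Longrightarrow>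
      \<exists>p. p \<in> borel_measurable borel \<and> distr M borel (\<lambda>\<omega>. \<Sum>k<d. b k * \<xi> (t - int k) \<omega>) = density lborel p \<and>
        (\<forall>z. 0 \<le> p z \<and> p z \<le> C / sqrt V) \<and>
        (\<forall>z z'. \<bar>p z - p z'\<bar> \<le> C / sqrt V * (min 1 (\<bar>z - z'\<bar> / sqrt V) + 1 / sqrt P))"
  define \<Gamma> where "\<Gamma> = 1 / (1 - \<gamma>)"
  have \<Gamma>: "0 < \<Gamma>" using \<gamma> by (simp add: \<Gamma>_def)
  define \<rho> where "\<rho> n d = (real n / real d) powr \<gamma>" for n d :: nat
  have \<rho>_sum: "(\<Sum>d\<in>{m..n}. \<rho> n d) \<le> real n * \<Gamma>" if "1 \<le> m" for m n
  proof -
    have "(\<Sum>d\<in>{m..n}. \<rho> n d) \<le> (\<Sum>d\<in>{1..n}. \<rho> n d)" by (rule sum_mono2) (use that in \<open>auto simp: \<rho>_def\<close>)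
    also have "\<dots> \<le> real n * \<Gamma>" unfolding \<rho>_def \<Gamma>_def using sum_powr_le[OF \<gamma>, of n] by simp
    finally show ?thesis .
  qed
  \<comment> \<open>The constant of the distant pairs: the product of the constants in
    \<open>R\<close> and \<open>G\<close> below, each summed over time by means of
    \<open>\<rho>_sum\<close>, and the factor 2 from symmetry.\<close>
  define Q1 where "Q1 = 4 * A * C\<^sup>2 * C\<^sub>V\<^sup>2 * \<Gamma>\<^sup>2"
  have Q1: "0 \<le> Q1" using A_nonneg by (simp add: Q1_def)
  show ?thesis
  proof (intro exI[of _ "Q1 * (1 + 3 * A) + 1"] conjI allI impI)
    show "0 \<le> Q1 * (1 + 3 * A) + 1" using Q1 A_nonneg by simp
    fix \<epsilon> :: real assume \<epsilon>: "0 < \<epsilon>"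
    \<comment> \<open>Large enough for the error \<open>1 / sqrt P\<close> in the modulus of
      continuity to be at most \<open>\<epsilon>\<close>.\<close>
    define P where "P = max P0 (1 / \<epsilon>\<^sup>2)"
    have P: "P0 \<le> P" "1 \<le> P" "1 / \<epsilon>\<^sup>2 \<le> P" using P0 by (auto simp: P_def)
    have P\<epsilon>: "1 / sqrt P \<le> \<epsilon>"
    proof -
      have "sqrt (1 / \<epsilon>\<^sup>2) \<le> sqrt P" using P by simp
      then have "1 / \<epsilon> \<le> sqrt P" using \<epsilon> by (simp add: real_sqrt_divide)
      then show ?thesis using \<epsilon> P by (simp add: field_simps)
    qed
    define V where "V n d = (\<Sum>k<d. (a n n k)\<^sup>2)" for n d
    obtain d1 where d1: "\<And>n d. d1 \<le> d \<Longrightarrow> d \<le> n \<Longrightarrow> max 1 (P * B\<^sup>2) \<le> V n d"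
      using V_unbounded[of "max 1 (P * B\<^sup>2)"] unfolding V_def by auto
    obtain d2 where d2: "\<And>n d. d2 \<le> d \<Longrightarrow> d \<le> n \<Longrightarrow> (\<beta> n)\<^sup>2 \<le> C\<^sub>V * V n d * \<rho> n d"
      using V_lower unfolding V_def \<rho>_def by auto
    \<comment> \<open>From the length \<open>m\<close> on, the partial sums of squares exceed
      \<open>P * B^2\<close>, so that no weight carries more than the fraction \<open>1 / P\<close>
      of them, and \<open>V_lower\<close> applies.\<close>
    define m where "m = max 1 (max d1 d2)"
    have m: "1 \<le> m" "d1 \<le> m" "d2 \<le> m" by (auto simp: m_def)
    have V1: "1 \<le> V n d" if "m \<le> d" "d \<le> n" for n d using d1[of d n] that m by auto
    have Va: "P * (a n n k)\<^sup>2 \<le> V n d" if "m \<le> d" "d \<le> n" "k < d" for n d k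
    proof -
      have "\<bar>a n n k\<bar> \<le> B" by (rule a_bound) (use that m in auto)
      then have "(a n n k)\<^sup>2 \<le> B\<^sup>2" by (metis abs_ge_zero power2_abs power_mono)
      then have "P * (a n n k)\<^sup>2 \<le> P * B\<^sup>2" using P by (intro mult_left_mono) auto
      then show ?thesis using d1[of d n] that m by auto
    qed
    \<comment> \<open>Up to a constant, the ratio of \<open>\<beta> n\<close> to the standard
      deviation of a block of length \<open>d\<close>. The bound on its square also bounds the ratio
      itself, because \<open>C\<^sub>V * \<rho> n d\<close> is at least 1.\<close>
    define r where "r n d = \<beta> n / sqrt (V n d)" for n d
    have r: "0 < r n d" "(r n d)\<^sup>2 \<le> C\<^sub>V * \<rho> n d" "r n d \<le> C\<^sub>V * \<rho> n d" "r n d * max 1 (r n d) \<le> C\<^sub>V * \<rho> n d" if "m \<le> d" "d \<le> n" for n d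
    proof -
      have v: "1 \<le> V n d" using V1 that by auto
      have b: "0 < \<beta> n" by (rule \<beta>_pos) (use that m in auto)
      show r0: "0 < r n d" using v b by (simp add: r_def)
      have "(r n d)\<^sup>2 = (\<beta> n)\<^sup>2 / V n d" using v by (simp add: r_def power_divide)
      also have "\<dots> \<le> C\<^sub>V * \<rho> n d" using d2[of d n] that m v by (simp add: pos_divide_le_eq mult_ac)
      finally show r2: "(r n d)\<^sup>2 \<le> C\<^sub>V * \<rho> n d" .
      have "1 \<le> \<rho> n d" unfolding \<rho>_def using \<gamma> that m by (intro ge_one_powr_ge_zero) auto
      then have c1: "1 \<le> C\<^sub>V * \<rho> n d" using C\<^sub>V mult_mono[of 1 C\<^sub>V 1 "\<rho> n d"] by auto
      show r1: "r n d \<le> C\<^sub>V * \<rho> n d"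
      proof (cases "r n d \<le> 1")
        case False
        then have "r n d * 1 \<le> r n d * r n d" by (intro mult_left_mono) auto
        then show ?thesis using r2 by (simp add: power2_eq_square)
      qed (use c1 in auto)
      show "r n d * max 1 (r n d) \<le> C\<^sub>V * \<rho> n d" using r1 r2 by (simp add: max_def power2_eq_square)
    qed
    have dens': "\<exists>p :: real \<Rightarrow> real. p \<in> borel_measurable borel \<and> distr M borel (lag_sum (a n t) d s) = density lborel p \<and>
        (\<forall>z. 0 \<le> p z \<and> p z \<le> C / sqrt (V n d)) \<and>
        (\<forall>z z'. \<bar>p z - p z'\<bar> \<le> C / sqrt (V n d) * (min 1 (\<bar>z - z'\<bar> / sqrt (V n d)) + 1 / sqrt P))"
      if "m \<le> d" "d \<le> t" "t \<le> n" for n d t s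
    proof -
      have ak: "a n t k = a n n k" if "k < d" for k using a_lag[of k t n] that \<open>d \<le> t\<close> \<open>t \<le> n\<close> by auto
      have v: "V n d = (\<Sum>k<d. (a n t k)\<^sup>2)" unfolding V_def by (intro sum.cong) (auto simp: ak)
      have v0: "0 < V n d" using V1[of d n] that by auto
      show ?thesis using dens[OF v v0 P(1), of "s + int d"] Va[of d n] ak that by auto
    qed
    define J where "J = (\<integral>u. K u \<partial>lborel)"
    \<comment> \<open>\<open>R\<close> bounds the mean modulus of \<open>D\<close> at one time,
      \<open>G\<close> its smoothing by a block of length \<open>d\<close>, and \<open>q\<close> its
      second moment.\<close>
    define R where "R n s = 2 * h n * A * C * C\<^sub>V / \<beta> n * \<rho> n s" for n s
    define G where "G n d = C * h n / \<beta> n * C\<^sub>V * (\<Theta> n + 3 * A * \<epsilon>) * \<rho> n d" for n d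
    define q where "q n t = 2 * C * A2 * (h n / \<beta> n) * C\<^sub>V * \<rho> n t + 2 * (h n * A / (\<epsilon> * \<beta> n))\<^sup>2" for n t
    have mom: "integrable M (\<lambda>\<omega>. (D \<epsilon> n (X n t \<omega>))\<^sup>2)" "integrable M (\<lambda>\<omega>. D \<epsilon> n (X n t \<omega>))"
      "expectation (\<lambda>\<omega>. \<bar>D \<epsilon> n (X n t \<omega>)\<bar>) \<le> R n t"
      "expectation (\<lambda>\<omega>. (D \<epsilon> n (X n t \<omega>))\<^sup>2) \<le> q n t" if t: "m \<le> t" "t \<le> n" for n t
    proof -
      have n1: "1 \<le> n" "1 \<le> t" using t m by auto
      have b: "0 < \<beta> n" and hn: "0 < h n" using \<beta>_pos h_pos n1 by auto
      obtain p :: "real \<Rightarrow> real" where p: "p \<in> borel_measurable borel" "distr M borel (lag_sum (a n t) t 0) = density lborel p"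
        "\<And>z. p z \<le> C / sqrt (V n t)" using dens'[OF t(1) order_refl t(2), of 0] by auto
      have c0: "0 \<le> C / sqrt (V n t)" using C V1[OF t] by simp
      note xd = X_D_moments[OF n1 t(2) \<epsilon> p c0]
      show "integrable M (\<lambda>\<omega>. (D \<epsilon> n (X n t \<omega>))\<^sup>2)" "integrable M (\<lambda>\<omega>. D \<epsilon> n (X n t \<omega>))" by (rule xd)+
      have cr: "C / sqrt (V n t) = C / \<beta> n * r n t" using b by (simp add: r_def)
      have "expectation (\<lambda>\<omega>. \<bar>D \<epsilon> n (X n t \<omega>)\<bar>) \<le> C / \<beta> n * r n t * (2 * h n * A)" using xd(3) unfolding cr .
      also have "\<dots> \<le> C / \<beta> n * (C\<^sub>V * \<rho> n t) * (2 * h n * A)"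
        using r(3)[OF t] C b hn A_nonneg by (intro mult_right_mono mult_left_mono) auto
      also have "\<dots> = R n t" by (simp add: R_def mult_ac)
      finally show "expectation (\<lambda>\<omega>. \<bar>D \<epsilon> n (X n t \<omega>)\<bar>) \<le> R n t" .
      have "expectation (\<lambda>\<omega>. (D \<epsilon> n (X n t \<omega>))\<^sup>2) \<le> 2 * (C / \<beta> n * r n t * (h n * A2)) + 2 * (h n * A / (\<epsilon> * \<beta> n))\<^sup>2"
        using xd(4) unfolding cr .
      also have "\<dots> \<le> 2 * (C / \<beta> n * (C\<^sub>V * \<rho> n t) * (h n * A2)) + 2 * (h n * A / (\<epsilon> * \<beta> n))\<^sup>2"
        using r(3)[OF t] C b hn A_nonneg by (intro add_right_mono mult_right_mono mult_left_mono) auto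
      also have "\<dots> = q n t" by (simp add: q_def mult_ac)
      finally show "expectation (\<lambda>\<omega>. (D \<epsilon> n (X n t \<omega>))\<^sup>2) \<le> q n t" .
    qed
    have prod_int: "integrable M (\<lambda>\<omega>. D \<epsilon> n (X n s \<omega>) * D \<epsilon> n (X n t \<omega>))"
      and prod_le: "expectation (\<lambda>\<omega>. D \<epsilon> n (X n s \<omega>) * D \<epsilon> n (X n t \<omega>)) \<le> (q n s + q n t) / 2"
      if "s \<in> {m..n}" "t \<in> {m..n}" for n s t
    proof -
      have i: "integrable M (\<lambda>\<omega>. (D \<epsilon> n (X n s \<omega>))\<^sup>2)" "integrable M (\<lambda>\<omega>. (D \<epsilon> n (X n t \<omega>))\<^sup>2)"
        using mom(1) that by auto
      then have i2: "integrable M (\<lambda>\<omega>. ((D \<epsilon> n (X n s \<omega>))\<^sup>2 + (D \<epsilon> n (X n t \<omega>))\<^sup>2) / 2)" by auto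
      have le: "\<bar>u * v\<bar> \<le> (u\<^sup>2 + v\<^sup>2) / 2" for u v :: real
        using zero_le_power2[of "\<bar>u\<bar> - \<bar>v\<bar>"] by (simp add: power2_diff abs_mult)
      show i3: "integrable M (\<lambda>\<omega>. D \<epsilon> n (X n s \<omega>) * D \<epsilon> n (X n t \<omega>))"
        by (rule Bochner_Integration.integrable_bound[OF i2]) (use le in auto)
      have "expectation (\<lambda>\<omega>. D \<epsilon> n (X n s \<omega>) * D \<epsilon> n (X n t \<omega>)) \<le> expectation (\<lambda>\<omega>. ((D \<epsilon> n (X n s \<omega>))\<^sup>2 + (D \<epsilon> n (X n t \<omega>))\<^sup>2) / 2)"
        by (rule integral_mono[OF i3 i2]) (use le abs_le_D1 in blast)
      also have "\<dots> = (expectation (\<lambda>\<omega>. (D \<epsilon> n (X n s \<omega>))\<^sup>2) + expectation (\<lambda>\<omega>. (D \<epsilon> n (X n t \<omega>))\<^sup>2)) / 2"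
        using i by simp
      also have "\<dots> \<le> (q n s + q n t) / 2" using mom(4)[of s n] mom(4)[of t n] that by auto
      finally show "expectation (\<lambda>\<omega>. D \<epsilon> n (X n s \<omega>) * D \<epsilon> n (X n t \<omega>)) \<le> (q n s + q n t) / 2" .
    qed
    have far: "expectation (\<lambda>\<omega>. D \<epsilon> n (X n s \<omega>) * D \<epsilon> n (X n (s + d) \<omega>)) \<le> R n s * G n d"
      if s: "s \<in> {m..n}" and d: "m \<le> d" "s + d \<le> n" for n s d
    proof -
      have n1: "1 \<le> n" "d \<le> n" using s d m by auto
      have b: "0 < \<beta> n" and hn: "0 < h n" using \<beta>_pos h_pos n1 by auto
      have V0: "0 < V n d" using V1[of d n] d n1 by auto
      have r0: "0 < r n d" using r(1)[of d n] d n1 by auto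
      obtain p :: "real \<Rightarrow> real" where p: "p \<in> borel_measurable borel" "distr M borel (lag_sum (a n (s + d)) d (int s)) = density lborel p"
        "\<And>z. 0 \<le> p z" "\<And>z. p z \<le> C / sqrt (V n d)"
        "\<And>z z'. \<bar>p z - p z'\<bar> \<le> C / sqrt (V n d) * (min 1 (\<bar>z - z'\<bar> / sqrt (V n d)) + 1 / sqrt P)"
        using dens'[of d "s + d" n "int s"] d by auto
      have G: "\<bar>\<integral>z. p z * D \<epsilon> n (v + z) \<partial>lborel\<bar> \<le> G n d" for v
      proof -
        have "\<bar>\<integral>z. p z * D \<epsilon> n (v + z) \<partial>lborel\<bar>
          \<le> C / sqrt (V n d) * h n * ((\<integral>u. \<bar>K u\<bar> * min 1 (\<bar>x + h n * u\<bar> / sqrt (V n d)) \<partial>lborel) + A * (\<epsilon> * \<beta> n / sqrt (V n d)) + 2 * (1 / sqrt P) * A)"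
          unfolding D_def A_def
          by (rule smooth_density_test_bound[OF p(1) p(3) p(4) p(5) _ _ _ K_int hn]) (use V0 C P \<epsilon> b in auto)
        also have "\<dots> \<le> C / sqrt (V n d) * h n * (max 1 (r n d) * \<Theta> n + A * (\<epsilon> * r n d) + 2 * \<epsilon> * A)"
          using \<Theta>_scale[OF n1(1), of "sqrt (V n d)"] P\<epsilon> A_nonneg C hn V0
          by (intro mult_left_mono add_mono mult_right_mono) (auto simp: r_def)
        also have "\<dots> = C * h n / \<beta> n * (r n d * max 1 (r n d) * \<Theta> n + A * \<epsilon> * (r n d)\<^sup>2 + 2 * A * \<epsilon> * r n d)"
        proof -
          have "C / sqrt (V n d) = C / \<beta> n * r n d" using b by (simp add: r_def)
          then show ?thesis by (simp add: algebra_simps power2_eq_square)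
        qed
        also have "\<dots> \<le> C * h n / \<beta> n * (C\<^sub>V * \<rho> n d * \<Theta> n + A * \<epsilon> * (C\<^sub>V * \<rho> n d) + 2 * A * \<epsilon> * (C\<^sub>V * \<rho> n d))"
          using r(2-4)[OF d(1) n1(2)] C hn b A_nonneg \<epsilon> \<Theta>_nonneg[OF n1(1)]
          by (intro mult_left_mono add_mono mult_right_mono) auto
        also have "\<dots> = G n d" by (simp add: G_def algebra_simps)
        finally show ?thesis .
      qed
      have G0: "0 \<le> G n d" using G[of 0] by linarith
      have "expectation (\<lambda>\<omega>. D \<epsilon> n (X n s \<omega>) * D \<epsilon> n (X n (s + d) \<omega>)) \<le> expectation (\<lambda>\<omega>. \<bar>D \<epsilon> n (X n s \<omega>)\<bar>) * G n d"
        using lin_proc_covariance_le[OF a_summable[of "s + d" n] D_measurable p(1) p(3) p(2) G, of "a n s"]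
          mom(2)[of s n] prod_int[of s n "s + d"] s d m by (simp add: X_def)
      also have "\<dots> \<le> R n s * G n d" using mom(3)[of s n] s G0 by (intro mult_right_mono) auto
      finally show ?thesis .
    qed
    \<comment> \<open>The share of the close pairs after normalisation. It vanishes because
      \<open>\<beta> n / (n * h n)\<close> and \<open>1 / n\<close> do.\<close>
    define near where "near n = 2 * real m * (2 * C * A2 * C\<^sub>V * \<Gamma> * (\<beta> n / (real n * h n)) + 2 * A\<^sup>2 / \<epsilon>\<^sup>2 * (1 / real n))" for n
    have "near \<longlonglongrightarrow> 2 * real m * (2 * C * A2 * C\<^sub>V * \<Gamma> * 0 + 2 * A\<^sup>2 / \<epsilon>\<^sup>2 * 0)"
      unfolding near_def by (intro tendsto_intros h_large lim_1_over_n)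
    then have near0: "\<forall>\<^sub>F n in sequentially. near n < \<epsilon>" using \<epsilon> by (intro order_tendstoD) auto
    have \<Theta>0: "\<forall>\<^sub>F n in sequentially. \<Theta> n < \<epsilon>" using \<Theta>_tendsto \<epsilon> by (intro order_tendstoD) auto
    have "\<forall>\<^sub>F n in sequentially.
      integrable M (\<lambda>\<omega>. (D_sum \<epsilon> m n \<omega>)\<^sup>2) \<and>
      expectation (\<lambda>\<omega>. (D_sum \<epsilon> m n \<omega>)\<^sup>2) \<le> (Q1 * (1 + 3 * A) + 1) * \<epsilon>" using near0 \<Theta>0 eventually_ge_at_top[of m]
    proof eventually_elim
      case (elim n)
      have n1: "1 \<le> n" using elim m by auto
      have b: "0 < \<beta> n" and hn: "0 < h n" using \<beta>_pos h_pos n1 by auto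
      let ?w = "\<beta> n / (real n * h n)"
      have eq: "(\<lambda>\<omega>. (?w * (\<Sum>t\<in>{m..n}. D \<epsilon> n (X n t \<omega>)))\<^sup>2) = (\<lambda>\<omega>. ?w\<^sup>2 * (\<Sum>s\<in>{m..n}. \<Sum>t\<in>{m..n}. D \<epsilon> n (X n s \<omega>) * D \<epsilon> n (X n t \<omega>)))"
        by (simp only: power_mult_distrib sum_product power2_eq_square[of "\<Sum>t\<in>{m..n}. f t" for f])
      have int1: "integrable M (\<lambda>\<omega>. \<Sum>t\<in>{m..n}. D \<epsilon> n (X n s \<omega>) * D \<epsilon> n (X n t \<omega>))" if "s \<in> {m..n}" for s
        by (rule Bochner_Integration.integrable_sum) (rule prod_int[OF that])
      have int2: "integrable M (\<lambda>\<omega>. \<Sum>s\<in>{m..n}. \<Sum>t\<in>{m..n}. D \<epsilon> n (X n s \<omega>) * D \<epsilon> n (X n t \<omega>))"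
        by (rule Bochner_Integration.integrable_sum) (rule int1)
      have R0: "0 \<le> R n s" and G0: "0 \<le> G n s" and q0: "0 \<le> q n s" for s
        using A_nonneg C C\<^sub>V hn b \<epsilon> \<Theta>_nonneg[OF n1] by (auto simp: R_def G_def q_def \<rho>_def)
      have "expectation (\<lambda>\<omega>. \<Sum>s\<in>{m..n}. \<Sum>t\<in>{m..n}. D \<epsilon> n (X n s \<omega>) * D \<epsilon> n (X n t \<omega>))
        = (\<Sum>s\<in>{m..n}. expectation (\<lambda>\<omega>. \<Sum>t\<in>{m..n}. D \<epsilon> n (X n s \<omega>) * D \<epsilon> n (X n t \<omega>)))"
        by (rule Bochner_Integration.integral_sum[OF int1])
      also have "\<dots> = (\<Sum>s\<in>{m..n}. \<Sum>t\<in>{m..n}. expectation (\<lambda>\<omega>. D \<epsilon> n (X n s \<omega>) * D \<epsilon> n (X n t \<omega>)))"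
        by (rule sum.cong[OF refl]) (rule Bochner_Integration.integral_sum[OF prod_int])
      also have "\<dots> \<le> 2 * real m * (\<Sum>s\<in>{m..n}. q n s) + 2 * ((\<Sum>s\<in>{m..n}. R n s) * (\<Sum>d\<in>{m..n}. G n d))"
        by (rule double_sum_near_far) (rule prod_le far R0 G0 q0 | assumption | simp only: mult.commute)+
      also have "\<dots> \<le> 2 * real m * (2 * C * A2 * (h n / \<beta> n) * C\<^sub>V * (real n * \<Gamma>) + real n * (2 * (h n * A / (\<epsilon> * \<beta> n))\<^sup>2))
          + 2 * ((2 * h n * A * C * C\<^sub>V / \<beta> n * (real n * \<Gamma>)) * (C * h n / \<beta> n * C\<^sub>V * (\<Theta> n + 3 * A * \<epsilon>) * (real n * \<Gamma>)))"
      proof (intro add_mono mult_left_mono mult_mono)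
        have "(\<Sum>s\<in>{m..n}. q n s) = 2 * C * A2 * (h n / \<beta> n) * C\<^sub>V * (\<Sum>s\<in>{m..n}. \<rho> n s) + real (card {m..n}) * (2 * (h n * A / (\<epsilon> * \<beta> n))\<^sup>2)"
          by (simp add: q_def sum.distrib sum_distrib_left)
        also have "\<dots> \<le> 2 * C * A2 * (h n / \<beta> n) * C\<^sub>V * (real n * \<Gamma>) + real n * (2 * (h n * A / (\<epsilon> * \<beta> n))\<^sup>2)"
          using A_nonneg C C\<^sub>V hn b m by (intro add_mono mult_left_mono mult_right_mono \<rho>_sum) auto
        finally show "(\<Sum>s\<in>{m..n}. q n s) \<le> 2 * C * A2 * (h n / \<beta> n) * C\<^sub>V * (real n * \<Gamma>) + real n * (2 * (h n * A / (\<epsilon> * \<beta> n))\<^sup>2)" .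
        show "(\<Sum>s\<in>{m..n}. R n s) \<le> 2 * h n * A * C * C\<^sub>V / \<beta> n * (real n * \<Gamma>)"
          unfolding R_def sum_distrib_left[symmetric] using A_nonneg C C\<^sub>V hn b m by (intro mult_left_mono \<rho>_sum) auto
        show "(\<Sum>d\<in>{m..n}. G n d) \<le> C * h n / \<beta> n * C\<^sub>V * (\<Theta> n + 3 * A * \<epsilon>) * (real n * \<Gamma>)"
          unfolding G_def sum_distrib_left[symmetric] using A_nonneg C C\<^sub>V hn b m \<epsilon> \<Theta>_nonneg[OF n1] by (intro mult_left_mono \<rho>_sum) auto
      qed (use A_nonneg C C\<^sub>V hn b \<Gamma> in \<open>auto intro!: sum_nonneg G0 mult_nonneg_nonneg\<close>)
      finally have "?w\<^sup>2 * expectation (\<lambda>\<omega>. \<Sum>s\<in>{m..n}. \<Sum>t\<in>{m..n}. D \<epsilon> n (X n s \<omega>) * D \<epsilon> n (X n t \<omega>))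
         \<le> ?w\<^sup>2 * (2 * real m * (2 * C * A2 * (h n / \<beta> n) * C\<^sub>V * (real n * \<Gamma>) + real n * (2 * (h n * A / (\<epsilon> * \<beta> n))\<^sup>2))
          + 2 * ((2 * h n * A * C * C\<^sub>V / \<beta> n * (real n * \<Gamma>)) * (C * h n / \<beta> n * C\<^sub>V * (\<Theta> n + 3 * A * \<epsilon>) * (real n * \<Gamma>))))"
        by (intro mult_left_mono) auto
      also have "\<dots> = near n + Q1 * (\<Theta> n + 3 * A * \<epsilon>)"
        unfolding near_def Q1_def using b hn n1 \<epsilon> by (simp add: field_simps power2_eq_square)
      also have "\<dots> \<le> \<epsilon> + Q1 * (\<epsilon> + 3 * A * \<epsilon>)" using elim Q1 A_nonneg by (intro add_mono mult_left_mono) auto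
      also have "\<dots> = (Q1 * (1 + 3 * A) + 1) * \<epsilon>" by (simp add: algebra_simps)
      finally show ?case unfolding eq using int2 by simp
    qed
    then show "\<exists>m\<ge>1. \<forall>\<^sub>F n in sequentially.
      integrable M (\<lambda>\<omega>. (D_sum \<epsilon> m n \<omega>)\<^sup>2) \<and>
      expectation (\<lambda>\<omega>. (D_sum \<epsilon> m n \<omega>)\<^sup>2) \<le> (Q1 * (1 + 3 * A) + 1) * \<epsilon>" using m(1) by blast
  qed
qed

end

section \<open>The averaged Gaussian density\<close>

lemma borel_measurable_cnj' [measurable]: "cnj \<in> borel_measurable borel"
  by (intro borel_measurable_continuous_onI continuous_intros)

text \<open>Completing the square: \<open>v = sqrt (1 + \<kappa>) * w\<close> turns the weight into
  the standard normal density, and the factor \<open>1 / sqrt (1 + \<kappa>)\<close> is the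
  Jacobian.\<close>

lemma normal_mixture_identity:
  assumes \<kappa>: "0 \<le> \<kappa>"
  shows "(CLINT w|std_normal_distribution. iexp (w * y) * of_real (exp (- (\<kappa> * w\<^sup>2 / 2)))) = of_real (1 / sqrt (1 + \<kappa>) * exp (- (y\<^sup>2 / (2 * (1 + \<kappa>)))))"
proof -
  let ?s = "sqrt (1 + \<kappa>)"
  define E where "E w = exp (- (\<kappa> * w\<^sup>2 / 2))" for w :: real
  have [measurable]: "E \<in> borel_measurable borel" unfolding E_def by measurable
  have s: "0 < ?s" "?s\<^sup>2 = 1 + \<kappa>" using \<kappa> by auto
  have key: "std_normal_density w * E w = std_normal_density v" if "w = 0 + 1 / ?s * v" for v w
  proof -
    have v: "v\<^sup>2 = (1 + \<kappa>) * w\<^sup>2" using s that by (simp add: power_divide power_mult_distrib)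
    have "exp (- w\<^sup>2 / 2) * E w = exp (- w\<^sup>2 / 2 + - (\<kappa> * w\<^sup>2 / 2))" unfolding E_def by (rule exp_add[symmetric])
    also have "- w\<^sup>2 / 2 + - (\<kappa> * w\<^sup>2 / 2) = - v\<^sup>2 / 2" unfolding v by (simp add: field_simps)
    finally show ?thesis by (simp add: std_normal_density_def)
  qed
  have "(CLINT w|std_normal_distribution. iexp (w * y) * of_real (E w))
    = (CLBINT w. std_normal_density w *\<^sub>R (iexp (w * y) * of_real (E w)))" by (subst integral_density) auto
  also have "\<dots> = (CLBINT w. of_real (std_normal_density w * E w) * iexp (w * y))"
    by (simp add: scaleR_conv_of_real mult_ac)
  also have "\<dots> = \<bar>1 / ?s\<bar> *\<^sub>R (CLBINT v. of_real (std_normal_density (0 + 1 / ?s * v) * E (0 + 1 / ?s * v)) * iexp ((0 + 1 / ?s * v) * y))"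
    by (rule lborel_integral_real_affine) (use s in auto)
  also have "\<dots> = \<bar>1 / ?s\<bar> *\<^sub>R (CLBINT v. of_real (std_normal_density v) * iexp ((0 + 1 / ?s * v) * y))"
    by (simp only: key[OF refl])
  also have "(CLBINT v. of_real (std_normal_density v) * iexp ((0 + 1 / ?s * v) * y)) = char std_normal_distribution (y / ?s)"
    unfolding char_def by (subst integral_density) (auto simp: scaleR_conv_of_real mult_ac)
  also have "\<dots> = of_real (exp (- ((y / ?s)\<^sup>2 / 2)))" by (simp add: char_std_normal_distribution)
  also have "(y / ?s)\<^sup>2 / 2 = y\<^sup>2 / (2 * (1 + \<kappa>))" using s by (simp add: power_divide)
  finally show ?thesis using s unfolding E_def by (simp add: scaleR_conv_of_real)
qed

text \<open>\<open>finite_sum_gauss_approx\<close> with the variance replaced by its target, since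
  \<open>exp (-x)\<close> is 1-Lipschitz on the half-line. One radius bounds both the weights and
  the deviation of the variance.\<close>

lemma (in innovations) finite_sum_gauss_limit:
  assumes \<eta>: "0 < \<eta>" and v: "0 \<le> v"
  shows "\<exists>r>0. \<forall>(I::int set) u. finite I \<longrightarrow> (\<forall>i\<in>I. \<bar>u i\<bar> \<le> r) \<longrightarrow> \<bar>\<sigma>2 * (\<Sum>i\<in>I. (u i)\<^sup>2) - v\<bar> \<le> r \<longrightarrow>
    cmod ((CLINT \<omega>|M. iexp (\<Sum>i\<in>I. u i * \<xi> i \<omega>)) - of_real (exp (- (v / 2)))) \<le> \<eta>"
proof -
  \<comment> \<open>Bounds the sum of squares as soon as the variance is within 1 of
    \<open>v\<close>.\<close>
  define S where "S = (v + 1) / \<sigma>2"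
  have S: "0 < S" using v law.var_pos by (simp add: S_def)
  obtain r where r: "0 < r" "\<And>(I::int set) u. finite I \<Longrightarrow> (\<And>i. i \<in> I \<Longrightarrow> \<bar>u i\<bar> \<le> r) \<Longrightarrow>
    cmod ((CLINT \<omega>|M. iexp (\<Sum>i\<in>I. u i * \<xi> i \<omega>)) - of_real (exp (- (\<sigma>2 * (\<Sum>i\<in>I. (u i)\<^sup>2) / 2)))) \<le> \<eta> / (2 * S) * (\<Sum>i\<in>I. (u i)\<^sup>2)"
    using finite_sum_gauss_approx[of "\<eta> / (2 * S)"] \<eta> S by auto
  define r' where "r' = min r (min 1 \<eta>)"
  show ?thesis
  proof (intro exI[of _ r'] conjI allI impI)
    show "0 < r'" using r \<eta> by (simp add: r'_def)
    fix I :: "int set" and u assume I: "finite I" and u: "\<forall>i\<in>I. \<bar>u i\<bar> \<le> r'" and Q: "\<bar>\<sigma>2 * (\<Sum>i\<in>I. (u i)\<^sup>2) - v\<bar> \<le> r'"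
    define q where "q = (\<Sum>i\<in>I. (u i)\<^sup>2)"
    have q0: "0 \<le> q" by (simp add: q_def sum_nonneg)
    have "\<sigma>2 * q \<le> v + 1" using Q by (simp add: q_def r'_def abs_le_iff)
    then have "q \<le> S" using law.var_pos by (simp add: S_def pos_le_divide_eq mult.commute)
    then have "\<eta> / (2 * S) * q \<le> \<eta> / (2 * S) * S" using \<eta> S by (intro mult_left_mono) auto
    then have 1: "cmod ((CLINT \<omega>|M. iexp (\<Sum>i\<in>I. u i * \<xi> i \<omega>)) - of_real (exp (- (\<sigma>2 * q / 2)))) \<le> \<eta> / 2"
      using r(2)[OF I, of u] u S unfolding q_def[symmetric] r'_def by auto
    have lip: "\<bar>exp (- a) - exp (- b)\<bar> \<le> \<bar>a - b\<bar>" if "0 \<le> a" "0 \<le> b" for a b :: real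
    proof -
      have *: "exp (- a) - exp (- b) \<le> b - a" if "0 \<le> a" "a \<le> b" for a b :: real
      proof -
        have "exp (- a) - exp (- b) = exp (- a) * (1 - exp (- (b - a)))" by (simp add: algebra_simps flip: exp_add)
        also have "\<dots> \<le> 1 * (b - a)"
          using that exp_ge_add_one_self[of "- (b - a)"] by (intro mult_mono) (auto simp del: exp_ge_add_one_self)
        finally show ?thesis by simp
      qed
      show ?thesis using *[of a b] *[of b a] that by (cases "a \<le> b") auto
    qed
    have "\<bar>exp (- (\<sigma>2 * q / 2)) - exp (- (v / 2))\<bar> \<le> \<bar>\<sigma>2 * q / 2 - v / 2\<bar>" using q0 law.var_pos v by (intro lip) auto
    also have "\<dots> = \<bar>\<sigma>2 * q - v\<bar> / 2" by (simp add: abs_divide flip: diff_divide_distrib)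
    also have "\<dots> \<le> \<eta> / 2" using Q unfolding q_def[symmetric] by (simp add: r'_def)
    finally have 2: "cmod (of_real (exp (- (\<sigma>2 * q / 2))) - of_real (exp (- (v / 2)))) \<le> \<eta> / 2"
      by (simp only: norm_of_real flip: of_real_diff)
    show "cmod ((CLINT \<omega>|M. iexp (\<Sum>i\<in>I. u i * \<xi> i \<omega>)) - of_real (exp (- (v / 2)))) \<le> \<eta>"
      using norm_triangle_ineq[of "(CLINT \<omega>|M. iexp (\<Sum>i\<in>I. u i * \<xi> i \<omega>)) - of_real (exp (- (\<sigma>2 * q / 2)))" "of_real (exp (- (\<sigma>2 * q / 2))) - of_real (exp (- (v / 2)))"] 1 2
      by simp
  qed
qed

text \<open>A lag \<open>k < t\<close> reaches an innovation after time 0, a lag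
  \<open>k \<ge> t\<close> the one at time \<open>-(k - t)\<close>. As \<open>g\<close> is indexed
  by \<open>k - t\<close>, the part up to time 0 is the same variable for every \<open>t\<close>; it
  is cut at \<open>n\<close> terms to remain a finite sum. Everything else is left to
  \<open>remainder\<close>, at times proportional to \<open>n\<close>.\<close>

locale gaussian_array = innovations M \<xi> \<sigma>2 \<theta>
  for M :: "'a measure" and \<xi> :: "int \<Rightarrow> 'a \<Rightarrow> real" and \<sigma>2 \<theta> +
  fixes a :: "nat \<Rightarrow> nat \<Rightarrow> nat \<Rightarrow> real" and \<beta> :: "nat \<Rightarrow> real"
    and f g :: "nat \<Rightarrow> nat \<Rightarrow> real" and B \<tau> :: real
  assumes sum_a: "1 \<le> t \<Longrightarrow> t \<le> n \<Longrightarrow> summable (\<lambda>k. \<bar>a n t k\<bar>)"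
    and f_bound: "1 \<le> n \<Longrightarrow> k < n \<Longrightarrow> \<bar>f n k\<bar> \<le> B" and g_bound: "1 \<le> n \<Longrightarrow> k < n \<Longrightarrow> \<bar>g n k\<bar> \<le> B"
    and pos_\<beta>: "1 \<le> n \<Longrightarrow> 0 < \<beta> n" and top_\<beta>: "filterlim \<beta> at_top sequentially"
    and \<tau>: "0 \<le> \<tau>" "\<tau> < 1"
    and f_norm: "0 < \<delta> \<Longrightarrow> 0 < \<eta> \<Longrightarrow> \<forall>\<^sub>F n in sequentially. \<forall>t. \<delta> * real n \<le> real t \<longrightarrow> t \<le> n \<longrightarrow>
        \<bar>\<sigma>2 * (\<Sum>k<t. (f n k)\<^sup>2) / (\<beta> n)\<^sup>2 - (1 - \<tau>)\<bar> \<le> \<eta>"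
    and remainder: "0 < \<delta> \<Longrightarrow> 0 < \<eta> \<Longrightarrow> \<forall>\<^sub>F n in sequentially. \<forall>t. \<delta> * real n \<le> real t \<longrightarrow> 1 \<le> t \<longrightarrow> t \<le> n \<longrightarrow>
        \<sigma>2 * (\<Sum>k. (a n t k - (if k < t then f n k else if k < t + n then g n (k - t) else 0))\<^sup>2) \<le> \<eta> * (\<beta> n)\<^sup>2"
    and g_norm: "(\<lambda>n. \<sigma>2 * (\<Sum>k<n. (g n k)\<^sup>2) / (\<beta> n)\<^sup>2) \<longlonglongrightarrow> \<tau>"
begin

section \<open>The split at time 0 and its asymptotic independence\<close>

definition "Xp n t = lin_proc (a n t) \<xi> (int t)"
definition "Fp n t \<omega> = (\<Sum>k<t. f n k * \<xi> (int t - int k) \<omega>)"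
definition "Yp n \<omega> = (\<Sum>k<n. g n k * \<xi> (- int k) \<omega>)"
abbreviation "err n t \<omega> \<equiv> \<bar>Xp n t \<omega> - (Fp n t \<omega> + Yp n \<omega>)\<bar>"

lemma measurable_XFY [measurable]:
  "Xp n t \<in> borel_measurable M" "Fp n t \<in> borel_measurable M" "Yp n \<in> borel_measurable M"
  unfolding Xp_def Fp_def[abs_def] Yp_def[abs_def] by measurable

text \<open>The second moment of the difference is the sum of squares in \<open>remainder\<close>,
  and \<open>|y| \<le> z + y^2 / z\<close> turns it into a first moment.\<close>

lemma remainder_small:
  assumes "0 < \<delta>" "0 < \<zeta>"
  shows "\<forall>\<^sub>F n in sequentially. \<forall>t. \<delta> * real n \<le> real t \<longrightarrow> 1 \<le> t \<longrightarrow> t \<le> n \<longrightarrow>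
    integrable M (\<lambda>\<omega>. err n t \<omega>) \<and> expectation (\<lambda>\<omega>. err n t \<omega>) \<le> \<zeta> * \<beta> n"
proof -
  have "0 < (\<zeta> / 2)\<^sup>2" using assms by simp
  from remainder[OF assms(1) this] eventually_ge_at_top[of 1] show ?thesis
  proof eventually_elim
  case (elim n)
  show ?case
  proof (intro allI impI)
    fix t assume t: "\<delta> * real n \<le> real t" "1 \<le> t" "t \<le> n"
    have b: "0 < \<beta> n" using pos_\<beta> t by auto
    define c where "c k = (if k < t then f n k else if k < t + n then g n (k - t) else 0)" for k
    define d where "d k = a n t k - c k" for k
    have cs: "summable (\<lambda>k. \<bar>c k\<bar>)" by (rule summable_finite[of "{..<t+n}"]) (auto simp: c_def)
    have sa: "summable (\<lambda>k. \<bar>a n t k\<bar>)" by (rule sum_a) (use t in auto)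
    have ds: "summable (\<lambda>k. \<bar>d k\<bar>)" by (rule summable_comparison_test'[OF summable_add[OF sa cs]]) (auto simp: d_def)
    have lc: "lin_proc c \<xi> (int t) \<omega> = Fp n t \<omega> + Yp n \<omega>" for \<omega>
    proof -
      have "lin_proc c \<xi> (int t) \<omega> = (\<Sum>k<t+n. c k * \<xi> (int t - int k) \<omega>)"
        unfolding lin_proc_def by (rule suminf_finite) (auto simp: c_def)
      also have "\<dots> = (\<Sum>k<t. c k * \<xi> (int t - int k) \<omega>) + (\<Sum>k\<in>{t..<t+n}. c k * \<xi> (int t - int k) \<omega>)"
        by (subst sum.union_disjoint[symmetric]) (auto intro: sum.cong)
      also have "(\<Sum>k\<in>{t..<t+n}. c k * \<xi> (int t - int k) \<omega>) = (\<Sum>k<n. c (k + t) * \<xi> (int t - int (k + t)) \<omega>)"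
        by (rule sum.reindex_bij_witness[of _ "\<lambda>k. k + t" "\<lambda>k. k - t"]) auto
      also have "(\<Sum>k<t. c k * \<xi> (int t - int k) \<omega>) + (\<Sum>k<n. c (k + t) * \<xi> (int t - int (k + t)) \<omega>) = Fp n t \<omega> + Yp n \<omega>"
        unfolding Fp_def Yp_def by (intro arg_cong2[where f="(+)"] sum.cong) (auto simp: c_def)
      finally show ?thesis .
    qed
    have ae: "AE \<omega> in M. Xp n t \<omega> - (Fp n t \<omega> + Yp n \<omega>) = lin_proc d \<xi> (int t) \<omega>"
      using AE_lin_proc_sums[OF sa, of "int t"] AE_lin_proc_sums[OF cs, of "int t"]
    proof eventually_elim
      case (elim \<omega>)
      from sums_diff[OF elim] have "(\<lambda>k. d k * \<xi> (int t - int k) \<omega>) sums (lin_proc (a n t) \<xi> (int t) \<omega> - lin_proc c \<xi> (int t) \<omega>)"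
        by (simp add: d_def left_diff_distrib)
      then show ?case unfolding Xp_def lc[symmetric] by (simp add: lin_proc_def sums_iff)
    qed
    note m2 = lin_proc_second_moment(1)[OF ds, of "int t"] lin_proc_second_moment(3)[OF ds, of "int t"]
      lin_proc_second_moment(4)[OF ds, of "int t"]
    have i1: "integrable M (\<lambda>\<omega>. err n t \<omega>)"
      by (subst integrable_cong_AE[where g="\<lambda>\<omega>. \<bar>lin_proc d \<xi> (int t) \<omega>\<bar>"]) (use ae m2(3) in auto)
    \<comment> \<open>With this \<open>z\<close> the mean of \<open>y^2\<close> is at most
      \<open>z^2\<close>, so both parts of the bound are at most \<open>z\<close>.\<close>
    define z where "z = \<zeta> / 2 * \<beta> n"
    have z: "0 < z" using assms b by (simp add: z_def)
    have "expectation (\<lambda>\<omega>. err n t \<omega>) = expectation (\<lambda>\<omega>. \<bar>lin_proc d \<xi> (int t) \<omega>\<bar>)"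
      by (rule integral_cong_AE) (use ae in auto)
    also have "\<dots> \<le> expectation (\<lambda>\<omega>. z + (lin_proc d \<xi> (int t) \<omega>)\<^sup>2 / z)"
    proof (rule integral_mono)
      show "integrable M (\<lambda>\<omega>. \<bar>lin_proc d \<xi> (int t) \<omega>\<bar>)" using m2(3) by auto
      show "integrable M (\<lambda>\<omega>. z + (lin_proc d \<xi> (int t) \<omega>)\<^sup>2 / z)" using m2(1) by auto
      show "\<bar>lin_proc d \<xi> (int t) \<omega>\<bar> \<le> z + (lin_proc d \<xi> (int t) \<omega>)\<^sup>2 / z" for \<omega>
      proof (cases "\<bar>lin_proc d \<xi> (int t) \<omega>\<bar> \<le> z")
        case False
        then have "\<bar>lin_proc d \<xi> (int t) \<omega>\<bar> * z \<le> \<bar>lin_proc d \<xi> (int t) \<omega>\<bar> * \<bar>lin_proc d \<xi> (int t) \<omega>\<bar>" by (intro mult_left_mono) auto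
        then have "\<bar>lin_proc d \<xi> (int t) \<omega>\<bar> \<le> (lin_proc d \<xi> (int t) \<omega>)\<^sup>2 / z"
          using z by (simp add: pos_le_divide_eq power2_eq_square)
        then show ?thesis using z by linarith
      qed (use z in \<open>auto intro: order_trans add_increasing2\<close>)
    qed
    also have "\<dots> = z + \<sigma>2 * (\<Sum>k. (d k)\<^sup>2) / z" using m2 by (simp add: prob_space)
    also have "\<dots> \<le> z + ((\<zeta> / 2)\<^sup>2 * (\<beta> n)\<^sup>2) / z"
      using elim(1) t z unfolding d_def c_def by (intro add_left_mono divide_right_mono) auto
    also have "\<dots> = \<zeta> * \<beta> n" using z unfolding z_def by (simp add: field_simps power2_eq_square)
    finally show "integrable M (\<lambda>\<omega>. err n t \<omega>) \<and> expectation (\<lambda>\<omega>. err n t \<omega>) \<le> \<zeta> * \<beta> n" using i1 by simp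
  qed
  qed
qed

text \<open>The weight indexed by the time of the innovation and extended by 0 beyond
  \<open>s\<close>, so that all \<open>Fp n s\<close> become sums over the same index set.\<close>

definition "U n s i = (if i \<le> int s then f n (nat (int s - i)) else 0)" for i :: int

lemma Fp_eq: "s \<le> n \<Longrightarrow> Fp n s \<omega> = (\<Sum>i\<in>{1..int n}. U n s i * \<xi> i \<omega>)"
proof -
  assume s: "s \<le> n"
  have "(\<Sum>i\<in>{1..int n}. U n s i * \<xi> i \<omega>) = (\<Sum>i\<in>{1..int s}. U n s i * \<xi> i \<omega>)"
    by (rule sum.mono_neutral_right) (use s in \<open>auto simp: U_def\<close>)
  also have "\<dots> = Fp n s \<omega>" unfolding Fp_def
    by (rule sum.reindex_bij_witness[of _ "\<lambda>k. int s - int k" "\<lambda>i. nat (int s - i)"]) (auto simp: U_def)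
  finally show ?thesis ..
qed

lemma U_sq: "s \<le> n \<Longrightarrow> (\<Sum>i\<in>{1..int n}. (U n s i)\<^sup>2) = (\<Sum>k<s. (f n k)\<^sup>2)"
proof -
  assume s: "s \<le> n"
  have "(\<Sum>i\<in>{1..int n}. (U n s i)\<^sup>2) = (\<Sum>i\<in>{1..int s}. (U n s i)\<^sup>2)"
    by (rule sum.mono_neutral_right) (use s in \<open>auto simp: U_def\<close>)
  also have "\<dots> = (\<Sum>k<s. (f n k)\<^sup>2)"
    by (rule sum.reindex_bij_witness[of _ "\<lambda>k. int s - int k" "\<lambda>i. nat (int s - i)"]) (auto simp: U_def)
  finally show ?thesis .
qed

text \<open>The covariance of \<open>Fp n s\<close> and \<open>Fp n t\<close> pairs the weights with
  their shift by the gap. After Cauchy-Schwarz the shifted factor is the increment of the partial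
  variance from \<open>t - s\<close> to \<open>t\<close>, which is negligible once the gap is a
  fraction of \<open>n\<close>. This is the source of the asymptotic independence.\<close>

lemma U_cross:
  assumes "s \<le> t" "t \<le> n"
  shows "(\<Sum>i\<in>{1..int n}. U n s i * U n t i)\<^sup>2 \<le> (\<Sum>k<s. (f n k)\<^sup>2) * ((\<Sum>k<t. (f n k)\<^sup>2) - (\<Sum>k<t - s. (f n k)\<^sup>2))"
proof -
  have "(\<Sum>i\<in>{1..int n}. U n s i * U n t i) = (\<Sum>i\<in>{1..int s}. U n s i * U n t i)"
    by (rule sum.mono_neutral_right) (use assms in \<open>auto simp: U_def\<close>)
  also have "\<dots> = (\<Sum>k<s. f n k * f n (k + (t - s)))"
    by (rule sum.reindex_bij_witness[of _ "\<lambda>k. int s - int k" "\<lambda>i. nat (int s - i)"])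
      (use assms in \<open>auto simp: U_def of_nat_diff intro!: arg_cong[where f="f n"]\<close>)
  finally have "(\<Sum>i\<in>{1..int n}. U n s i * U n t i)\<^sup>2 \<le> (\<Sum>k<s. (f n k)\<^sup>2) * (\<Sum>k<s. (f n (k + (t - s)))\<^sup>2)"
    using Cauchy_Schwarz_ineq_sum[of "f n" "\<lambda>k. f n (k + (t - s))" "{..<s}"] by simp
  also have "(\<Sum>k<s. (f n (k + (t - s)))\<^sup>2) = (\<Sum>k\<in>{t - s..<t}. (f n k)\<^sup>2)"
    by (rule sum.reindex_bij_witness[of _ "\<lambda>k. k - (t - s)" "\<lambda>k. k + (t - s)"]) (use assms in auto)
  also have "\<dots> = (\<Sum>k<t. (f n k)\<^sup>2) - (\<Sum>k<t - s. (f n k)\<^sup>2)"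
  proof -
    have "{..<t} = {..<t - s} \<union> {t - s..<t}" by auto
    then have "(\<Sum>k<t. (f n k)\<^sup>2) = (\<Sum>k<t - s. (f n k)\<^sup>2) + (\<Sum>k\<in>{t - s..<t}. (f n k)\<^sup>2)"
      by (simp add: sum.union_disjoint ivl_disj_int)
    then show ?thesis by simp
  qed
  finally show ?thesis .
qed

text \<open>Pairs with an early member or a short gap are a fraction of order
  \<open>\<delta>\<close> of all pairs. The bound 4 on them, with the shares
  \<open>\<delta>\<close>, \<open>\<delta>\<close> and \<open>2 * \<delta>\<close>, makes up
  \<open>16 * \<delta>\<close>; the term \<open>4 * n\<close> comes from the diagonal.\<close>

lemma double_sum_separated:
  fixes c :: "nat \<Rightarrow> nat \<Rightarrow> real"
  assumes c4: "\<And>s t. c s t \<le> 4" and \<delta>: "0 < \<delta>" and \<eta>: "0 \<le> \<eta>"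
    and good: "\<And>s t. s \<le> n \<Longrightarrow> t \<le> n \<Longrightarrow> \<delta> * real n \<le> real s \<Longrightarrow> \<delta> * real n \<le> real t \<Longrightarrow>
      \<delta> * real n \<le> \<bar>real s - real t\<bar> \<Longrightarrow> c s t \<le> \<eta>"
  shows "(\<Sum>s\<in>{1..n}. \<Sum>t\<in>{1..n}. c s t) \<le> real n * real n * \<eta> + 16 * \<delta> * (real n * real n) + 4 * real n"
proof -
  let ?I = "{1..n}"
  define D where "D = nat \<lfloor>\<delta> * real n\<rfloor>"
  have D: "real D \<le> \<delta> * real n" using \<delta> by (simp add: D_def)
  have small: "j \<le> D" if "real j < \<delta> * real n" for j using that unfolding D_def by linarith
  have le: "c s t \<le> \<eta> + 4 * indicator {..D} s + 4 * indicator {..D} t + 4 * indicator {s - D..s + D} t" if st: "s \<in> ?I" "t \<in> ?I" for s t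
  proof (cases "\<delta> * real n \<le> real s \<and> \<delta> * real n \<le> real t \<and> \<delta> * real n \<le> \<bar>real s - real t\<bar>")
    case True
    then have "c s t \<le> \<eta>" using st by (intro good) auto
    then show ?thesis by (simp add: indicator_def)
  next
    case False
    then consider "s \<le> D" | "t \<le> D" | "\<bar>real s - real t\<bar> < \<delta> * real n" using small[of s] small[of t] by linarith
    then show ?thesis
    proof cases
      case 3
      then have "t \<in> {s - D..s + D}" using small[of "s - t"] small[of "t - s"] by (cases "s \<le> t") (auto simp: of_nat_diff)
      then have "4 \<le> \<eta> + 4 * indicator {..D} s + 4 * indicator {..D} t + 4 * (indicator {s - D..s + D} t :: real)"
        using \<eta> by (auto simp: indicator_def)
      then show ?thesis using c4[of s t] by linarith
    next
      case 1
      then show ?thesis using c4[of s t] \<eta> by (simp add: indicator_def)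
    next
      case 2
      then show ?thesis using c4[of s t] \<eta> by (simp add: indicator_def)
    qed
  qed
  have card1: "(\<Sum>t\<in>?I. indicator {..D} t :: real) \<le> \<delta> * real n"
  proof -
    have "(\<Sum>t\<in>?I. indicator {..D} t :: real) = (\<Sum>t\<in>{..D} \<inter> ?I. 1)"
      by (rule sum.mono_neutral_cong_right) (auto simp: indicator_def)
    also have "\<dots> = real (card ({..D} \<inter> ?I))" by (rule real_of_card[symmetric])
    also have "\<dots> \<le> real (card {1..D})" by (intro of_nat_mono card_mono) auto
    finally show ?thesis using D by simp
  qed
  have card2: "(\<Sum>t\<in>?I. indicator {s - D..s + D} t :: real) \<le> 2 * \<delta> * real n + 1" for s
  proof -
    have "(\<Sum>t\<in>?I. indicator {s - D..s + D} t :: real) = (\<Sum>t\<in>{s - D..s + D} \<inter> ?I. 1)"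
      by (rule sum.mono_neutral_cong_right) (auto simp: indicator_def)
    also have "\<dots> = real (card ({s - D..s + D} \<inter> ?I))" by (rule real_of_card[symmetric])
    also have "\<dots> \<le> real (card {s - D..s + D})" by (intro of_nat_mono card_mono) auto
    also have "\<dots> \<le> 2 * real D + 1" by simp
    finally show ?thesis using D by simp
  qed
  have "(\<Sum>s\<in>?I. \<Sum>t\<in>?I. c s t) \<le> (\<Sum>s\<in>?I. \<Sum>t\<in>?I. \<eta> + 4 * indicator {..D} s + 4 * indicator {..D} t + 4 * indicator {s - D..s + D} t)"
    by (intro sum_mono le)
  also have "\<dots> = (\<Sum>s\<in>?I. real n * \<eta> + 4 * real n * indicator {..D} s + 4 * (\<Sum>t\<in>?I. indicator {..D} t) + 4 * (\<Sum>t\<in>?I. indicator {s - D..s + D} t))"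
    by (rule sum.cong[OF refl]) (simp only: sum.distrib sum_distrib_left sum_constant card_atLeastAtMost, simp)
  also have "\<dots> \<le> (\<Sum>s\<in>?I. real n * \<eta> + 4 * real n * indicator {..D} s + 4 * (\<delta> * real n) + 4 * (2 * \<delta> * real n + 1))"
    by (intro sum_mono add_mono mult_left_mono card1 card2) auto
  also have "\<dots> = (\<Sum>s\<in>?I. real n * \<eta>) + (\<Sum>s\<in>?I. 4 * real n * indicator {..D} s) + (\<Sum>s\<in>?I. 4 * (\<delta> * real n)) + (\<Sum>s\<in>?I. 4 * (2 * \<delta> * real n + 1))"
    by (simp only: sum.distrib)
  also have "(\<Sum>s\<in>?I. 4 * real n * indicator {..D} s) = 4 * real n * (\<Sum>s\<in>?I. indicator {..D} s)"
    by (rule sum_distrib_left[symmetric])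
  also have "(\<Sum>s\<in>?I. real n * \<eta>) + 4 * real n * (\<Sum>s\<in>?I. indicator {..D} s) + (\<Sum>s\<in>?I. 4 * (\<delta> * real n)) + (\<Sum>s\<in>?I. 4 * (2 * \<delta> * real n + 1))
    = real n * (real n * \<eta>) + 4 * real n * (\<Sum>s\<in>?I. indicator {..D} s) + real n * (4 * (\<delta> * real n) + 4 * (2 * \<delta> * real n + 1))"
    by (simp only: sum_constant card_atLeastAtMost diff_Suc_1 add_Suc_right add_0_right Suc_eq_plus1[symmetric]) (simp only: One_nat_def add_Suc_right add_0_right diff_Suc_1 distrib_left add.assoc)
  also have "\<dots> \<le> real n * (real n * \<eta>) + 4 * real n * (\<delta> * real n) + real n * (4 * (\<delta> * real n) + 4 * (2 * \<delta> * real n + 1))"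
    by (intro add_mono mult_left_mono card1) (use \<delta> in auto)
  finally show ?thesis by (simp add: algebra_simps)
qed

definition "e\<^sub>F l n t \<omega> = iexp (l * (Fp n t \<omega> / \<beta> n))"
text \<open>The characteristic function of \<open>N[0, 1 - \<tau>]\<close>.\<close>

definition "\<gamma>\<^sub>F l = exp (- ((1 - \<tau>) * l\<^sup>2 / 2))"

lemma \<gamma>F_bounds: "0 < \<gamma>\<^sub>F l" "\<gamma>\<^sub>F l \<le> 1" using \<tau> by (auto simp: \<gamma>\<^sub>F_def)

lemma \<gamma>F_sq: "\<gamma>\<^sub>F l * \<gamma>\<^sub>F l = exp (- (2 * ((1 - \<tau>) * l\<^sup>2) / 2))" by (simp add: \<gamma>\<^sub>F_def flip: exp_add)

lemma eF_measurable [measurable]: "e\<^sub>F l n t \<in> borel_measurable M" unfolding e\<^sub>F_def[abs_def] by measurable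

lemma eF_norm: "cmod (e\<^sub>F l n t \<omega>) = 1" by (simp add: e\<^sub>F_def del: of_real_mult of_real_divide)

lemma bounded_integrable: "h \<in> borel_measurable M \<Longrightarrow> (\<And>\<omega>. norm (h \<omega>) \<le> c) \<Longrightarrow> integrable M h"
  for h :: "'a \<Rightarrow> 'x :: {banach, second_countable_topology}" by (rule integrable_const_bound[of _ c]) auto

lemma U_bound: "1 \<le> n \<Longrightarrow> s \<le> n \<Longrightarrow> i \<in> {1..int n} \<Longrightarrow> \<bar>U n s i\<bar> \<le> B"
proof -
  assume a: "1 \<le> n" "s \<le> n" "i \<in> {1..int n}"
  have "0 \<le> B" using f_bound[of n 0] a by auto
  then show ?thesis using a f_bound[of n "nat (int s - i)"] by (auto simp: U_def)
qed

text \<open>Both parts are instances of \<open>finite_sum_gauss_limit\<close>. The variance of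
  \<open>Fp n t / \<beta> n\<close> is near \<open>1 - \<tau>\<close>. That of the scaled difference
  of \<open>Fp n s\<close> and \<open>Fp n t\<close> is near twice this value because the covariance
  is small, and so the mean of the product splits.\<close>

lemma eF_limits:
  assumes \<delta>: "0 < \<delta>" and \<eta>: "0 < \<eta>"
  shows "\<forall>\<^sub>F n in sequentially.
    (\<forall>t. \<delta> * real n \<le> real t \<longrightarrow> t \<le> n \<longrightarrow> cmod (expectation (e\<^sub>F l n t) - \<gamma>\<^sub>F l) \<le> \<eta>) \<and>
    (\<forall>s t. \<delta> * real n \<le> real s \<longrightarrow> s \<le> t \<longrightarrow> t \<le> n \<longrightarrow> \<delta> * real n \<le> real t - real s \<longrightarrow>
      cmod (expectation (\<lambda>\<omega>. e\<^sub>F l n s \<omega> * cnj (e\<^sub>F l n t \<omega>)) - \<gamma>\<^sub>F l * \<gamma>\<^sub>F l) \<le> \<eta>)"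
proof -
  have v: "0 \<le> (1 - \<tau>) * l\<^sup>2" "0 \<le> 2 * ((1 - \<tau>) * l\<^sup>2)" using \<tau> by auto
  obtain r1 where r1pos: "0 < r1" and r1all: "\<forall>(I::int set) u. finite I \<longrightarrow> (\<forall>i\<in>I. \<bar>u i\<bar> \<le> r1) \<longrightarrow> \<bar>\<sigma>2 * (\<Sum>i\<in>I. (u i)\<^sup>2) - (1 - \<tau>) * l\<^sup>2\<bar> \<le> r1 \<longrightarrow>
    cmod ((CLINT \<omega>|M. iexp (\<Sum>i\<in>I. u i * \<xi> i \<omega>)) - of_real (exp (- ((1 - \<tau>) * l\<^sup>2 / 2)))) \<le> \<eta>"
    using finite_sum_gauss_limit[OF \<eta> v(1)] by blast
  have r1_le: "finite (I::int set) \<Longrightarrow> (\<And>i. i \<in> I \<Longrightarrow> \<bar>u i\<bar> \<le> r1) \<Longrightarrow> \<bar>\<sigma>2 * (\<Sum>i\<in>I. (u i)\<^sup>2) - (1 - \<tau>) * l\<^sup>2\<bar> \<le> r1 \<Longrightarrow>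
    cmod ((CLINT \<omega>|M. iexp (\<Sum>i\<in>I. u i * \<xi> i \<omega>)) - of_real (exp (- ((1 - \<tau>) * l\<^sup>2 / 2)))) \<le> \<eta>"
    for I and u :: "int \<Rightarrow> real" using r1all by blast
  obtain r2 where r2pos: "0 < r2" and r2all: "\<forall>(I::int set) u. finite I \<longrightarrow> (\<forall>i\<in>I. \<bar>u i\<bar> \<le> r2) \<longrightarrow> \<bar>\<sigma>2 * (\<Sum>i\<in>I. (u i)\<^sup>2) - 2 * ((1 - \<tau>) * l\<^sup>2)\<bar> \<le> r2 \<longrightarrow>
    cmod ((CLINT \<omega>|M. iexp (\<Sum>i\<in>I. u i * \<xi> i \<omega>)) - of_real (exp (- (2 * ((1 - \<tau>) * l\<^sup>2) / 2)))) \<le> \<eta>"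
    using finite_sum_gauss_limit[OF \<eta> v(2)] by blast
  have r2_le: "finite (I::int set) \<Longrightarrow> (\<And>i. i \<in> I \<Longrightarrow> \<bar>u i\<bar> \<le> r2) \<Longrightarrow> \<bar>\<sigma>2 * (\<Sum>i\<in>I. (u i)\<^sup>2) - 2 * ((1 - \<tau>) * l\<^sup>2)\<bar> \<le> r2 \<Longrightarrow>
    cmod ((CLINT \<omega>|M. iexp (\<Sum>i\<in>I. u i * \<xi> i \<omega>)) - of_real (exp (- (2 * ((1 - \<tau>) * l\<^sup>2) / 2)))) \<le> \<eta>"
    for I and u :: "int \<Rightarrow> real" using r2all by blast
  define r where "r = min r1 r2"
  have r: "0 < r" "r \<le> r1" "r \<le> r2" using r1pos r2pos by (auto simp: r_def)
  \<comment> \<open>The variances below miss their targets by at most \<open>6 * l^2 * z\<close>,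
    which must not exceed \<open>r\<close>.\<close>
  define z where "z = min 1 (r / (6 * l\<^sup>2 + 1))"
  have lz: "0 < 6 * l\<^sup>2 + 1" by (simp add: add_nonneg_pos)
  have z: "0 < z" "z \<le> 1" using r lz by (auto simp: z_def)
  have zr: "6 * l\<^sup>2 * z \<le> r"
  proof -
    have "6 * l\<^sup>2 * z \<le> (6 * l\<^sup>2 + 1) * z" using z by (intro mult_right_mono) auto
    also have "\<dots> \<le> (6 * l\<^sup>2 + 1) * (r / (6 * l\<^sup>2 + 1))" using lz by (intro mult_left_mono) (auto simp: z_def)
    also have "\<dots> = r" using lz by simp
    finally show ?thesis .
  qed
  define B' where "B' = max B 0"
  have "\<forall>\<^sub>F n in sequentially. 2 * \<bar>l\<bar> * B' / r \<le> \<beta> n" using top_\<beta> by (auto simp: filterlim_at_top)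
  note b_large = this
  \<comment> \<open>The partial variances are needed up to \<open>z^2\<close>, because the bound on
    the covariance takes a square root.\<close>
  have z2: "0 < z\<^sup>2" using z by simp
  from b_large f_norm[OF \<delta> z2] eventually_ge_at_top[of 1] show ?thesis
  proof eventually_elim
    case (elim n)
    have b: "0 < \<beta> n" using pos_\<beta> elim by auto
    define W where "W t = \<sigma>2 * (\<Sum>k<t. (f n k)\<^sup>2) / (\<beta> n)\<^sup>2" for t
    have W: "\<bar>W t - (1 - \<tau>)\<bar> \<le> z\<^sup>2" if "\<delta> * real n \<le> real t" "t \<le> n" for t using elim z that by (auto simp: W_def)
    have zz: "z\<^sup>2 \<le> z" using z by (simp add: power2_eq_square mult_left_le)
    have lb: "\<bar>l\<bar> * (2 * B) / \<beta> n \<le> r"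
    proof -
      have "2 * \<bar>l\<bar> * B' \<le> r * \<beta> n" using elim(1) r by (simp add: pos_divide_le_eq mult.commute)
      moreover have "\<bar>l\<bar> * (2 * B) \<le> \<bar>l\<bar> * (2 * B')" by (intro mult_left_mono) (auto simp: B'_def)
      ultimately have "\<bar>l\<bar> * (2 * B) \<le> r * \<beta> n" by linarith
      then show ?thesis using b by (simp add: pos_divide_le_eq)
    qed
    have B0: "0 \<le> B" using f_bound[of n 0] elim by auto
    have 1: "cmod (expectation (e\<^sub>F l n t) - \<gamma>\<^sub>F l) \<le> \<eta>" if t: "\<delta> * real n \<le> real t" "t \<le> n" for t
    proof -
      define u where "u i = l / \<beta> n * U n t i" for i
      have e: "e\<^sub>F l n t \<omega> = iexp (\<Sum>i\<in>{1..int n}. u i * \<xi> i \<omega>)" for \<omega>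
      proof -
        have "l * (Fp n t \<omega> / \<beta> n) = (\<Sum>i\<in>{1..int n}. u i * \<xi> i \<omega>)"
          unfolding Fp_eq[OF t(2)] u_def by (simp add: sum_distrib_left sum_divide_distrib mult_ac)
        then show ?thesis unfolding e\<^sub>F_def by simp
      qed
      have ub: "\<bar>u i\<bar> \<le> r1" if "i \<in> {1..int n}" for i
      proof -
        have "\<bar>u i\<bar> = \<bar>l\<bar> * \<bar>U n t i\<bar> / \<beta> n" using b by (simp add: u_def abs_mult)
        also have "\<dots> \<le> \<bar>l\<bar> * (2 * B) / \<beta> n"
          using U_bound[of n t i] elim t that b B0 by (intro divide_right_mono mult_left_mono) auto
        finally show ?thesis using lb r by linarith
      qed
      have "\<sigma>2 * (\<Sum>i\<in>{1..int n}. (u i)\<^sup>2) = l\<^sup>2 * W t"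
        unfolding u_def power_mult_distrib sum_distrib_left[symmetric] U_sq[OF t(2)] W_def by (simp add: power_divide)
      then have "\<sigma>2 * (\<Sum>i\<in>{1..int n}. (u i)\<^sup>2) - (1 - \<tau>) * l\<^sup>2 = l\<^sup>2 * (W t - (1 - \<tau>))"
        by (simp add: algebra_simps)
      then have "\<bar>\<sigma>2 * (\<Sum>i\<in>{1..int n}. (u i)\<^sup>2) - (1 - \<tau>) * l\<^sup>2\<bar> = l\<^sup>2 * \<bar>W t - (1 - \<tau>)\<bar>"
        by (simp only: abs_mult abs_power2)
      also have "\<dots> \<le> l\<^sup>2 * z" using W[OF t] zz by (intro mult_left_mono) auto
      also have "\<dots> \<le> r1" using zr r z mult_nonneg_nonneg[of "l\<^sup>2" z] by simp
      finally have dev: "\<bar>\<sigma>2 * (\<Sum>i\<in>{1..int n}. (u i)\<^sup>2) - (1 - \<tau>) * l\<^sup>2\<bar> \<le> r1" .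
      have "e\<^sub>F l n t = (\<lambda>\<omega>. iexp (\<Sum>i\<in>{1..int n}. u i * \<xi> i \<omega>))" using e by (rule ext)
      then show ?thesis unfolding \<gamma>\<^sub>F_def using r1_le[OF finite_atLeastAtMost_int ub dev] by (simp only:)
    qed
    have 2: "cmod (expectation (\<lambda>\<omega>. e\<^sub>F l n s \<omega> * cnj (e\<^sub>F l n t \<omega>)) - \<gamma>\<^sub>F l * \<gamma>\<^sub>F l) \<le> \<eta>"
      if s: "\<delta> * real n \<le> real s" "s \<le> t" "t \<le> n" and d: "\<delta> * real n \<le> real t - real s" for s t
    proof -
      have t: "\<delta> * real n \<le> real t" "s \<le> n" using s by auto
      define u where "u i = l / \<beta> n * (U n s i - U n t i)" for i
      have e: "e\<^sub>F l n s \<omega> * cnj (e\<^sub>F l n t \<omega>) = iexp (\<Sum>i\<in>{1..int n}. u i * \<xi> i \<omega>)" for \<omega>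
      proof -
        have "l * (Fp n s \<omega> / \<beta> n) - l * (Fp n t \<omega> / \<beta> n) = (\<Sum>i\<in>{1..int n}. u i * \<xi> i \<omega>)"
          unfolding Fp_eq[OF t(2)] Fp_eq[OF s(3)] u_def
          by (simp add: sum_distrib_left sum_divide_distrib mult_ac left_diff_distrib right_diff_distrib sum_subtractf)
        moreover have "e\<^sub>F l n s \<omega> * cnj (e\<^sub>F l n t \<omega>) = iexp (l * (Fp n s \<omega> / \<beta> n) - l * (Fp n t \<omega> / \<beta> n))"
          unfolding e\<^sub>F_def by (simp add: exp_cnj right_diff_distrib exp_diff exp_minus divide_inverse)
        ultimately show ?thesis by simp
      qed
      have ub: "\<bar>u i\<bar> \<le> r2" if "i \<in> {1..int n}" for i
      proof -
        have "\<bar>u i\<bar> = \<bar>l\<bar> * \<bar>U n s i - U n t i\<bar> / \<beta> n" using b by (simp add: u_def abs_mult)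
        also have "\<dots> \<le> \<bar>l\<bar> * (2 * B) / \<beta> n"
          using U_bound[of n t i] U_bound[of n s i] elim s t that b by (intro divide_right_mono mult_left_mono) auto
        finally show ?thesis using lb r by linarith
      qed
      define X where "X = \<sigma>2 * (\<Sum>i\<in>{1..int n}. U n s i * U n t i) / (\<beta> n)\<^sup>2"
      have X: "\<bar>X\<bar> \<le> 2 * z"
      proof -
        have ts: "\<delta> * real n \<le> real (t - s)" "t - s \<le> n" using d s by (auto simp: of_nat_diff)
        have "X\<^sup>2 = (\<sigma>2 / (\<beta> n)\<^sup>2)\<^sup>2 * (\<Sum>i\<in>{1..int n}. U n s i * U n t i)\<^sup>2" by (simp add: X_def power_mult_distrib power_divide)
        also have "\<dots> \<le> (\<sigma>2 / (\<beta> n)\<^sup>2)\<^sup>2 * ((\<Sum>k<s. (f n k)\<^sup>2) * ((\<Sum>k<t. (f n k)\<^sup>2) - (\<Sum>k<t - s. (f n k)\<^sup>2)))"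
          by (intro mult_left_mono U_cross s) auto
        also have "\<dots> = W s * (W t - W (t - s))" by (simp add: W_def power2_eq_square diff_divide_distrib algebra_simps)
        also have "\<dots> \<le> 2 * (2 * z\<^sup>2)"
        proof (rule mult_mono)
          show "W s \<le> 2" using W[OF s(1) t(2)] \<tau> zz z by linarith
          show "W t - W (t - s) \<le> 2 * z\<^sup>2" using W[OF t(1) s(3)] W[OF ts] by linarith
          have "(\<Sum>k<t - s. (f n k)\<^sup>2) \<le> (\<Sum>k<t. (f n k)\<^sup>2)" by (rule sum_mono2) auto
          then show "0 \<le> W t - W (t - s)"
            using b law.var_pos unfolding W_def by (simp add: divide_right_mono)
        qed simp
        also have "\<dots> = (2 * z)\<^sup>2" by (simp add: power2_eq_square)
        finally have "\<bar>X\<bar> \<le> \<bar>2 * z\<bar>" unfolding abs_le_square_iff .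
        then show ?thesis using z by simp
      qed
      have "\<sigma>2 * (\<Sum>i\<in>{1..int n}. (u i)\<^sup>2) = l\<^sup>2 * (W s + W t - 2 * X)"
      proof -
        have "(\<Sum>i\<in>{1..int n}. (u i)\<^sup>2) = (l / \<beta> n)\<^sup>2 * (\<Sum>i\<in>{1..int n}. (U n s i)\<^sup>2 + (U n t i)\<^sup>2 - 2 * (U n s i * U n t i))"
          unfolding u_def power_mult_distrib power2_diff sum_distrib_left by (simp only: mult.assoc)
        also have "(\<Sum>i\<in>{1..int n}. (U n s i)\<^sup>2 + (U n t i)\<^sup>2 - 2 * (U n s i * U n t i))
          = (\<Sum>k<s. (f n k)\<^sup>2) + (\<Sum>k<t. (f n k)\<^sup>2) - 2 * (\<Sum>i\<in>{1..int n}. U n s i * U n t i)"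
          by (simp add: sum.distrib sum_subtractf U_sq[OF t(2)] U_sq[OF s(3)] flip: sum_distrib_left)
        finally have "\<sigma>2 * (\<Sum>i\<in>{1..int n}. (u i)\<^sup>2) = \<sigma>2 * ((l / \<beta> n)\<^sup>2 * ((\<Sum>k<s. (f n k)\<^sup>2) + (\<Sum>k<t. (f n k)\<^sup>2) - 2 * (\<Sum>i\<in>{1..int n}. U n s i * U n t i)))"
          by (rule arg_cong)
        then show ?thesis
          by (simp only: W_def X_def power_divide) (simp add: add_divide_distrib diff_divide_distrib algebra_simps)
      qed
      then have "\<sigma>2 * (\<Sum>i\<in>{1..int n}. (u i)\<^sup>2) - 2 * ((1 - \<tau>) * l\<^sup>2) = l\<^sup>2 * ((W s - (1 - \<tau>)) + (W t - (1 - \<tau>)) - 2 * X)"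
        by (simp add: algebra_simps)
      then have "\<bar>\<sigma>2 * (\<Sum>i\<in>{1..int n}. (u i)\<^sup>2) - 2 * ((1 - \<tau>) * l\<^sup>2)\<bar> = l\<^sup>2 * \<bar>(W s - (1 - \<tau>)) + (W t - (1 - \<tau>)) - 2 * X\<bar>"
        by (simp only: abs_mult abs_power2)
      also have "\<dots> \<le> l\<^sup>2 * (6 * z)"
        using W[OF s(1) t(2)] W[OF t(1) s(3)] zz X by (intro mult_left_mono) (linarith, simp)
      also have "\<dots> \<le> r2" using zr r by (simp add: mult_ac)
      finally have dev: "\<bar>\<sigma>2 * (\<Sum>i\<in>{1..int n}. (u i)\<^sup>2) - 2 * ((1 - \<tau>) * l\<^sup>2)\<bar> \<le> r2" .
      have "(\<lambda>\<omega>. e\<^sub>F l n s \<omega> * cnj (e\<^sub>F l n t \<omega>)) = (\<lambda>\<omega>. iexp (\<Sum>i\<in>{1..int n}. u i * \<xi> i \<omega>))" using e by (rule ext)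
      then show ?thesis unfolding of_real_mult[symmetric] \<gamma>F_sq using r2_le[OF finite_atLeastAtMost_int ub dev] by (simp only:)
    qed
    show ?case using 1 2 by blast
  qed
qed

section \<open>Time averages of complex exponentials and of Gaussian densities\<close>

definition "S\<^sub>F l n \<omega> = (\<Sum>t\<in>{1..n}. e\<^sub>F l n t \<omega> - \<gamma>\<^sub>F l) / of_nat n"

lemma SF_measurable [measurable]: "S\<^sub>F l n \<in> borel_measurable M" unfolding S\<^sub>F_def[abs_def] by measurable

text \<open>A weak law of large numbers: well separated pairs have nearly vanishing covariances by
  \<open>eF_limits\<close>, and the others are few by \<open>double_sum_separated\<close>.\<close>

lemma SF_second_moment: "(\<lambda>n. expectation (\<lambda>\<omega>. (cmod (S\<^sub>F l n \<omega>))\<^sup>2)) \<longlonglongrightarrow> 0"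
proof (rule LIMSEQ_I)
  fix \<zeta> :: real assume \<zeta>: "0 < \<zeta>"
  \<comment> \<open>Together with the choice of \<open>\<eta>\<close>, this makes both
    \<open>16 * \<delta>\<close> and \<open>3 * \<eta>\<close> equal to
    \<open>\<zeta> / 4\<close>.\<close>
  define \<delta> where "\<delta> = \<zeta> / 64"
  define \<eta> where "\<eta> = \<zeta> / 12"
  have \<delta>: "0 < \<delta>" and \<eta>: "0 < \<eta>" using \<zeta> by (auto simp: \<delta>_def \<eta>_def)
  have "\<forall>\<^sub>F n in sequentially. 4 * (1 / real n) < \<zeta> / 4"
    using \<zeta> tendsto_mult_left[OF lim_1_over_n, of 4] by (intro order_tendstoD) auto
  then have "\<forall>\<^sub>F n in sequentially. norm (expectation (\<lambda>\<omega>. (cmod (S\<^sub>F l n \<omega>))\<^sup>2) - 0) < \<zeta>"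
    using eF_limits[OF \<delta> \<eta>, of l] eventually_ge_at_top[of 1]
  proof eventually_elim
    case (elim n)
    define E where "E t = expectation (e\<^sub>F l n t)" for t
    define P where "P s t = expectation (\<lambda>\<omega>. e\<^sub>F l n s \<omega> * cnj (e\<^sub>F l n t \<omega>))" for s t
    define d where "d t \<omega> = e\<^sub>F l n t \<omega> - \<gamma>\<^sub>F l" for t \<omega>
    have [measurable]: "d t \<in> borel_measurable M" for t unfolding d_def[abs_def] by measurable
    have dn: "cmod (d t \<omega>) \<le> 2" for t \<omega>
    proof -
      have "cmod (d t \<omega>) \<le> cmod (e\<^sub>F l n t \<omega>) + cmod (of_real (\<gamma>\<^sub>F l))" unfolding d_def by (rule norm_triangle_ineq4)
      then show ?thesis using \<gamma>F_bounds[of l] by (simp add: eF_norm)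
    qed
    have ddn: "cmod (d s \<omega> * cnj (d t \<omega>)) \<le> 4" for s t \<omega>
      using mult_mono[OF dn[of s \<omega>] dn[of t \<omega>]] by (simp add: norm_mult)
    have ddi: "complex_integrable M (\<lambda>\<omega>. d s \<omega> * cnj (d t \<omega>))" for s t
      by (rule bounded_integrable[OF _ ddn]) measurable
    define c where "c s t = Re (expectation (\<lambda>\<omega>. d s \<omega> * cnj (d t \<omega>)))" for s t
    have ei: "complex_integrable M (e\<^sub>F l n t)" for t by (rule bounded_integrable[of _ 1]) (auto simp: eF_norm)
    have eci: "complex_integrable M (\<lambda>\<omega>. cnj (e\<^sub>F l n t \<omega>))" for t
      by (rule bounded_integrable[of _ 1]) (auto simp: eF_norm)
    have pi: "complex_integrable M (\<lambda>\<omega>. e\<^sub>F l n s \<omega> * cnj (e\<^sub>F l n t \<omega>))" for s t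
      by (rule bounded_integrable[of _ 1]) (auto simp: eF_norm norm_mult)
    have dd: "expectation (\<lambda>\<omega>. d s \<omega> * cnj (d t \<omega>)) = P s t - \<gamma>\<^sub>F l * E s - \<gamma>\<^sub>F l * cnj (E t) + \<gamma>\<^sub>F l * \<gamma>\<^sub>F l" for s t
    proof -
      have "(\<lambda>\<omega>. d s \<omega> * cnj (d t \<omega>)) = (\<lambda>\<omega>. e\<^sub>F l n s \<omega> * cnj (e\<^sub>F l n t \<omega>) - \<gamma>\<^sub>F l * e\<^sub>F l n s \<omega> - \<gamma>\<^sub>F l * cnj (e\<^sub>F l n t \<omega>) + \<gamma>\<^sub>F l * \<gamma>\<^sub>F l)"
        by (simp add: d_def algebra_simps fun_eq_iff)
      then show ?thesis using pi ei eci unfolding P_def E_def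
        by (simp add: prob_space)
    qed
    have c4: "c s t \<le> 4" for s t
    proof -
      have "c s t \<le> cmod (expectation (\<lambda>\<omega>. d s \<omega> * cnj (d t \<omega>)))" unfolding c_def by (rule complex_Re_le_cmod)
      also have "\<dots> \<le> expectation (\<lambda>\<omega>. cmod (d s \<omega> * cnj (d t \<omega>)))" by (rule integral_norm_bound)
      also have "\<dots> \<le> expectation (\<lambda>\<omega>. 4 :: real)"
        by (rule integral_mono[OF integrable_norm[OF ddi]]) (use ddn in auto)
      finally show ?thesis by (simp add: prob_space)
    qed
    have csym: "c s t = c t s" for s t
    proof -
      have "expectation (\<lambda>\<omega>. d s \<omega> * cnj (d t \<omega>)) = cnj (expectation (\<lambda>\<omega>. d t \<omega> * cnj (d s \<omega>)))"
        by (subst Bochner_Integration.integral_cnj[symmetric]) (simp add: mult.commute)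
      then show ?thesis by (simp add: c_def)
    qed
    have good: "c s t \<le> 3 * \<eta>" if st: "s \<le> t" "t \<le> n" and s: "\<delta> * real n \<le> real s" and sep: "\<delta> * real n \<le> real t - real s" for s t
    proof -
      have t: "\<delta> * real n \<le> real t" "s \<le> n" using s st by auto
      have E1: "cmod (E s - \<gamma>\<^sub>F l) \<le> \<eta>" "cmod (E t - \<gamma>\<^sub>F l) \<le> \<eta>" "cmod (P s t - \<gamma>\<^sub>F l * \<gamma>\<^sub>F l) \<le> \<eta>"
        using elim(2) st s t sep unfolding E_def P_def by blast+
      have R: "\<gamma>\<^sub>F l - \<eta> \<le> Re (E s)" "\<gamma>\<^sub>F l - \<eta> \<le> Re (E t)" "Re (P s t) \<le> \<gamma>\<^sub>F l * \<gamma>\<^sub>F l + \<eta>"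
        using order_trans[OF abs_Re_le_cmod E1(1)] order_trans[OF abs_Re_le_cmod E1(2)] order_trans[OF abs_Re_le_cmod E1(3)]
        by (auto simp: abs_le_iff)
      have "c s t = Re (P s t) - \<gamma>\<^sub>F l * Re (E s) - \<gamma>\<^sub>F l * Re (E t) + \<gamma>\<^sub>F l * \<gamma>\<^sub>F l" unfolding c_def dd by simp
      also have "\<dots> \<le> (\<gamma>\<^sub>F l * \<gamma>\<^sub>F l + \<eta>) - \<gamma>\<^sub>F l * (\<gamma>\<^sub>F l - \<eta>) - \<gamma>\<^sub>F l * (\<gamma>\<^sub>F l - \<eta>) + \<gamma>\<^sub>F l * \<gamma>\<^sub>F l"
        using R \<gamma>F_bounds[of l] by (intro add_mono diff_mono mult_left_mono) auto
      also have "\<dots> = \<eta> + 2 * (\<gamma>\<^sub>F l * \<eta>)" by (simp add: algebra_simps)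
      also have "\<dots> \<le> \<eta> + 2 * (1 * \<eta>)" using \<gamma>F_bounds[of l] \<eta> by (intro add_mono mult_left_mono mult_right_mono) auto
      finally show ?thesis by simp
    qed
    have n: "0 < real n" using elim by simp
    have sq: "(cmod (S\<^sub>F l n \<omega>))\<^sup>2 = (\<Sum>s\<in>{1..n}. \<Sum>t\<in>{1..n}. Re (d s \<omega> * cnj (d t \<omega>))) / (real n)\<^sup>2" for \<omega>
    proof -
      have "complex_of_real ((cmod (\<Sum>t\<in>{1..n}. d t \<omega>))\<^sup>2) = (\<Sum>t\<in>{1..n}. d t \<omega>) * cnj (\<Sum>t\<in>{1..n}. d t \<omega>)"
        by (rule complex_norm_square)
      also have "\<dots> = (\<Sum>s\<in>{1..n}. \<Sum>t\<in>{1..n}. d s \<omega> * cnj (d t \<omega>))" by (simp add: sum_product)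
      finally have "(cmod (\<Sum>t\<in>{1..n}. d t \<omega>))\<^sup>2 = Re (\<Sum>s\<in>{1..n}. \<Sum>t\<in>{1..n}. d s \<omega> * cnj (d t \<omega>))"
        by (metis Re_complex_of_real)
      then show ?thesis unfolding S\<^sub>F_def d_def[symmetric] by (simp only: norm_divide power_divide norm_of_nat Re_sum)
    qed
    have "expectation (\<lambda>\<omega>. (cmod (S\<^sub>F l n \<omega>))\<^sup>2) = (\<Sum>s\<in>{1..n}. \<Sum>t\<in>{1..n}. expectation (\<lambda>\<omega>. Re (d s \<omega> * cnj (d t \<omega>)))) / (real n)\<^sup>2"
      unfolding sq by (simp add: Bochner_Integration.integral_sum Bochner_Integration.integrable_sum integrable_Re[OF ddi] del: Re_complex_div_eq_0 times_complex.sel)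
    also have "\<dots> = (\<Sum>s\<in>{1..n}. \<Sum>t\<in>{1..n}. c s t) / (real n)\<^sup>2" unfolding c_def by (simp only: integral_Re[OF ddi])
    also have "\<dots> \<le> (real n * real n * (3 * \<eta>) + 16 * \<delta> * (real n * real n) + 4 * real n) / (real n)\<^sup>2"
    proof (intro divide_right_mono double_sum_separated c4 \<delta>)
      fix s t assume st: "s \<le> n" "t \<le> n" "\<delta> * real n \<le> real s" "\<delta> * real n \<le> real t" "\<delta> * real n \<le> \<bar>real s - real t\<bar>"
      show "c s t \<le> 3 * \<eta>"
      proof (cases "s \<le> t")
        case True then show ?thesis by (intro good) (use st in auto)
      next
        case False then show ?thesis unfolding csym[of s t] by (intro good) (use st in auto)
      qed
    qed (use \<eta> in auto)
    also have "\<dots> = 3 * \<eta> + 16 * \<delta> + 4 * (1 / real n)" using n by (simp add: add_divide_distrib power2_eq_square)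
    also have "\<dots> < \<zeta>" using elim(1) \<zeta> by (simp add: \<eta>_def \<delta>_def)
    finally show ?case by simp
  qed
  then show "\<exists>no. \<forall>n\<ge>no. norm (expectation (\<lambda>\<omega>. (cmod (S\<^sub>F l n \<omega>))\<^sup>2) - 0) < \<zeta>" by (simp add: eventually_sequentially)
qed

text \<open>The standard deviation of the Gaussian window convolved with the limit law of
  \<open>Fp n t / \<beta> n\<close>.\<close>

definition "\<nu> \<epsilon> = sqrt (\<epsilon>\<^sup>2 + (1 - \<tau>))"

definition "H l n \<omega> = (\<Sum>t\<in>{1..n}. iexp (l * (Xp n t \<omega> / \<beta> n))) / of_nat n - of_real (\<gamma>\<^sub>F l) * iexp (l * (Yp n \<omega> / \<beta> n))"

lemma H_measurable [measurable]: "(\<lambda>(l, \<omega>). H l n \<omega>) \<in> borel_measurable (borel \<Otimes>\<^sub>M M)"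
  unfolding H_def \<gamma>\<^sub>F_def by measurable

lemma H_measurable2 [measurable]: "H l n \<in> borel_measurable M" unfolding H_def[abs_def] by measurable

lemma norm_iexp [simp]: "cmod (iexp y) = 1" by (simp del: of_real_mult of_real_divide)

lemma H_bound: "1 \<le> n \<Longrightarrow> cmod (H l n \<omega>) \<le> 2"
proof -
  assume n: "1 \<le> n"
  have "cmod (\<Sum>t\<in>{1..n}. iexp (l * (Xp n t \<omega> / \<beta> n))) \<le> (\<Sum>t\<in>{1..n}. cmod (iexp (l * (Xp n t \<omega> / \<beta> n))))" by (rule norm_sum)
  also have "\<dots> = real n" by (simp del: of_real_mult of_real_divide)
  finally have "cmod ((\<Sum>t\<in>{1..n}. iexp (l * (Xp n t \<omega> / \<beta> n))) / of_nat n) \<le> 1" using n by (simp add: norm_divide del: of_real_mult of_real_divide)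
  moreover have "cmod (of_real (\<gamma>\<^sub>F l) * iexp (l * (Yp n \<omega> / \<beta> n))) \<le> 1"
    using \<gamma>F_bounds[of l] by (simp add: norm_mult del: of_real_mult of_real_divide)
  ultimately show ?thesis unfolding H_def by (intro order_trans[OF norm_triangle_ineq4]) linarith
qed

text \<open>Replacing \<open>Xp\<close> by \<open>Fp + Yp\<close> costs at most 2 at times before
  \<open>\<delta> * n\<close> and the small remainder afterwards. The exponential of
  \<open>Yp\<close> then leaves the average as a common factor, and \<open>S\<^sub>F\<close> is what
  remains.\<close>

lemma H_tendsto: "(\<lambda>n. expectation (\<lambda>\<omega>. cmod (H l n \<omega>))) \<longlonglongrightarrow> 0"
proof (rule LIMSEQ_I)
  fix \<zeta> :: real assume \<zeta>: "0 < \<zeta>"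
  \<comment> \<open>The errors add up to \<open>2 * \<delta> + \<zeta> / 8 + 2 * w\<close>, that is
    \<open>5 / 8 * \<zeta>\<close>.\<close>
  define \<delta> where "\<delta> = \<zeta> / 8"
  define z where "z = \<zeta> / (8 * (\<bar>l\<bar> + 1))"
  define w where "w = \<zeta> / 8"
  have \<delta>: "0 < \<delta>" and z: "0 < z" and w: "0 < w" using \<zeta> by (auto simp: \<delta>_def z_def w_def)
  have "\<forall>\<^sub>F n in sequentially. expectation (\<lambda>\<omega>. (cmod (S\<^sub>F l n \<omega>))\<^sup>2) < w * w"
    using SF_second_moment[of l] w by (intro order_tendstoD) auto
  then have "\<forall>\<^sub>F n in sequentially. norm (expectation (\<lambda>\<omega>. cmod (H l n \<omega>)) - 0) < \<zeta>"
    using remainder_small[OF \<delta> z] eventually_ge_at_top[of 1]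
  proof eventually_elim
    case (elim n)
    have n: "1 \<le> n" "0 < real n" using elim by auto
    have b: "0 < \<beta> n" using pos_\<beta> n by auto
    define R where "R t \<omega> = min 2 (\<bar>l\<bar> / \<beta> n * err n t \<omega>)" for t \<omega>
    have [measurable]: "R t \<in> borel_measurable M" for t unfolding R_def[abs_def] by measurable
    have R0: "0 \<le> R t \<omega>" "R t \<omega> \<le> 2" for t \<omega> using b by (auto simp: R_def)
    have Ri: "integrable M (R t)" for t by (rule bounded_integrable[of _ 2]) (use R0 in auto)
    have Rt: "cmod (iexp (l * (Xp n t \<omega> / \<beta> n)) - iexp (l * (Yp n \<omega> / \<beta> n)) * e\<^sub>F l n t \<omega>) \<le> R t \<omega>" for t \<omega>
    proof -
      let ?x = "l * (Xp n t \<omega> / \<beta> n)" and ?y = "l * ((Fp n t \<omega> + Yp n \<omega>) / \<beta> n)"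
      have e: "iexp (l * (Yp n \<omega> / \<beta> n)) * e\<^sub>F l n t \<omega> = iexp ?y"
        unfolding e\<^sub>F_def by (simp add: add_divide_distrib distrib_left flip: exp_add) (simp add: add.commute)
      have "cmod (iexp ?x - iexp ?y) \<le> 2" by (rule order_trans[OF norm_triangle_ineq4]) (simp only: norm_iexp)
      moreover have "cmod (iexp ?x - iexp ?y) \<le> \<bar>?x - ?y\<bar>" by (rule cmod_iexp_diff_le)
      moreover have "?x - ?y = l / \<beta> n * (Xp n t \<omega> - (Fp n t \<omega> + Yp n \<omega>))" by (simp add: right_diff_distrib diff_divide_distrib)
      ultimately show ?thesis unfolding e R_def using b by (simp add: abs_mult)
    qed
    have Hle: "cmod (H l n \<omega>) \<le> (\<Sum>t\<in>{1..n}. R t \<omega>) / real n + (w + (cmod (S\<^sub>F l n \<omega>))\<^sup>2 / w)" for \<omega>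
    proof -
      let ?Y = "iexp (l * (Yp n \<omega> / \<beta> n))"
      have "H l n \<omega> = (\<Sum>t\<in>{1..n}. iexp (l * (Xp n t \<omega> / \<beta> n)) - ?Y * e\<^sub>F l n t \<omega>) / of_nat n + ?Y * S\<^sub>F l n \<omega>"
      proof -
        have gen: "SA / N - g * Y = (SA - Y * SE) / N + Y * ((SE - N * g) / N)" if "N \<noteq> 0" for SA SE Y g N :: complex
          using that by (simp add: field_simps)
        have 1: "(\<Sum>t\<in>{1..n}. A t - ?Y * e\<^sub>F l n t \<omega>) = (\<Sum>t\<in>{1..n}. A t) - ?Y * (\<Sum>t\<in>{1..n}. e\<^sub>F l n t \<omega>)" for A
          by (simp only: sum_subtractf sum_distrib_left)
        have 2: "(\<Sum>t\<in>{1..n}. e\<^sub>F l n t \<omega> - of_real (\<gamma>\<^sub>F l)) = (\<Sum>t\<in>{1..n}. e\<^sub>F l n t \<omega>) - of_nat n * of_real (\<gamma>\<^sub>F l)"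
          by (simp add: sum_subtractf)
        show ?thesis unfolding H_def S\<^sub>F_def 1 2 by (rule gen) (use n in simp)
      qed
      then have "cmod (H l n \<omega>) \<le> cmod ((\<Sum>t\<in>{1..n}. iexp (l * (Xp n t \<omega> / \<beta> n)) - ?Y * e\<^sub>F l n t \<omega>) / of_nat n) + cmod (?Y * S\<^sub>F l n \<omega>)"
        by (simp only: norm_triangle_ineq)
      also have "cmod (?Y * S\<^sub>F l n \<omega>) = cmod (S\<^sub>F l n \<omega>)" by (simp only: norm_mult norm_iexp mult_1)
      also have "cmod ((\<Sum>t\<in>{1..n}. iexp (l * (Xp n t \<omega> / \<beta> n)) - ?Y * e\<^sub>F l n t \<omega>) / of_nat n) \<le> (\<Sum>t\<in>{1..n}. R t \<omega>) / real n"
        unfolding norm_divide norm_of_nat by (intro divide_right_mono order_trans[OF norm_sum] sum_mono Rt) auto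
      also have "cmod (S\<^sub>F l n \<omega>) \<le> w + (cmod (S\<^sub>F l n \<omega>))\<^sup>2 / w"
      proof (cases "cmod (S\<^sub>F l n \<omega>) \<le> w")
        case True
        then show ?thesis using w by (simp add: add_increasing2)
      next
        case False
        then have "cmod (S\<^sub>F l n \<omega>) * w \<le> cmod (S\<^sub>F l n \<omega>) * cmod (S\<^sub>F l n \<omega>)" by (intro mult_left_mono) auto
        then have "cmod (S\<^sub>F l n \<omega>) \<le> (cmod (S\<^sub>F l n \<omega>))\<^sup>2 / w" using w by (simp add: pos_le_divide_eq power2_eq_square)
        then show ?thesis using w by linarith
      qed
      finally show ?thesis by simp
    qed
    have Sb: "cmod (S\<^sub>F l n \<omega>) \<le> 2" for \<omega>
    proof -
      have "cmod (\<Sum>t\<in>{1..n}. e\<^sub>F l n t \<omega> - of_real (\<gamma>\<^sub>F l)) \<le> (\<Sum>t\<in>{1..n}. 2)"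
      proof (rule order_trans[OF norm_sum], rule sum_mono)
        fix t
        have "cmod (e\<^sub>F l n t \<omega> - of_real (\<gamma>\<^sub>F l)) \<le> cmod (e\<^sub>F l n t \<omega>) + cmod (of_real (\<gamma>\<^sub>F l))" by (rule norm_triangle_ineq4)
        then show "cmod (e\<^sub>F l n t \<omega> - of_real (\<gamma>\<^sub>F l)) \<le> 2" using \<gamma>F_bounds[of l] by (simp add: eF_norm)
      qed
      then show ?thesis using n unfolding S\<^sub>F_def by (simp add: norm_divide pos_divide_le_eq mult.commute)
    qed
    have S2i: "integrable M (\<lambda>\<omega>. (cmod (S\<^sub>F l n \<omega>))\<^sup>2)"
      by (rule bounded_integrable[of _ 4]) (use power_mono[OF Sb, of _ 2] in auto)
    have Hi: "integrable M (\<lambda>\<omega>. cmod (H l n \<omega>))" by (rule bounded_integrable[of _ 2]) (use H_bound[OF n(1)] in auto)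
    have ER: "expectation (R t) \<le> (if real t < \<delta> * real n then 2 else \<bar>l\<bar> * z)" if t: "t \<in> {1..n}" for t
    proof (cases "real t < \<delta> * real n")
      case True
      have "expectation (R t) \<le> expectation (\<lambda>_. 2 :: real)" by (rule integral_mono[OF Ri]) (use R0 in auto)
      then show ?thesis using True by (simp add: prob_space)
    next
      case False
      then have i: "integrable M (\<lambda>\<omega>. err n t \<omega>)"
        and le: "expectation (\<lambda>\<omega>. err n t \<omega>) \<le> z * \<beta> n" using elim(2) t by auto
      have "expectation (R t) \<le> expectation (\<lambda>\<omega>. \<bar>l\<bar> / \<beta> n * err n t \<omega>)"
        by (rule integral_mono[OF Ri integrable_mult_right[OF i]]) (simp add: R_def)
      also have "\<dots> = \<bar>l\<bar> / \<beta> n * expectation (\<lambda>\<omega>. err n t \<omega>)" by (rule integral_mult_right_zero)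
      also have "\<dots> \<le> \<bar>l\<bar> / \<beta> n * (z * \<beta> n)" using b by (intro mult_left_mono le) auto
      also have "\<dots> = \<bar>l\<bar> * z" using b by simp
      finally show ?thesis using False by simp
    qed
    have sumER: "(\<Sum>t\<in>{1..n}. expectation (R t)) \<le> 2 * (\<delta> * real n) + real n * (\<bar>l\<bar> * z)"
    proof -
      have "(\<Sum>t\<in>{1..n}. expectation (R t)) \<le> (\<Sum>t\<in>{1..n}. 2 * indicator {t. real t < \<delta> * real n} t + \<bar>l\<bar> * z)"
        by (rule sum_mono, rule order_trans[OF ER]) (use z in \<open>auto simp: indicator_def\<close>)
      also have "\<dots> = 2 * (\<Sum>t\<in>{1..n}. indicator {t. real t < \<delta> * real n} t) + real n * (\<bar>l\<bar> * z)"
        unfolding sum.distrib sum_distrib_left by simp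
      also have "(\<Sum>t\<in>{1..n}. indicator {t. real t < \<delta> * real n} t :: real) = (\<Sum>t\<in>{t\<in>{1..n}. real t < \<delta> * real n}. 1)"
        by (rule sum.mono_neutral_cong_right) (auto simp: indicator_def)
      also have "\<dots> = real (card {t\<in>{1..n}. real t < \<delta> * real n})" by (rule real_of_card[symmetric])
      also have "\<dots> \<le> real (card {1..nat \<lfloor>\<delta> * real n\<rfloor>})"
      proof (intro of_nat_mono card_mono subsetI)
        fix t assume t: "t \<in> {t\<in>{1..n}. real t < \<delta> * real n}"
        then have "t \<le> nat \<lfloor>\<delta> * real n\<rfloor>" by (auto intro: le_nat_floor)
        then show "t \<in> {1..nat \<lfloor>\<delta> * real n\<rfloor>}" using t by auto
      qed auto
      also have "\<dots> \<le> \<delta> * real n" using \<delta> by simp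
      finally show ?thesis by simp
    qed
    have "expectation (\<lambda>\<omega>. cmod (H l n \<omega>)) \<le> expectation (\<lambda>\<omega>. (\<Sum>t\<in>{1..n}. R t \<omega>) / real n + (w + (cmod (S\<^sub>F l n \<omega>))\<^sup>2 / w))"
      by (rule integral_mono[OF Hi _ Hle])
        (intro Bochner_Integration.integrable_add integrable_divide Bochner_Integration.integrable_sum Ri S2i integrable_const)
    also have "\<dots> = (\<Sum>t\<in>{1..n}. expectation (R t)) / real n + (w + expectation (\<lambda>\<omega>. (cmod (S\<^sub>F l n \<omega>))\<^sup>2) / w)"
      using Ri S2i by (simp add: prob_space Bochner_Integration.integrable_sum Bochner_Integration.integral_sum)
    also have "\<dots> \<le> (2 * (\<delta> * real n) + real n * (\<bar>l\<bar> * z)) / real n + (w + w * w / w)"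
      using elim(1) w n by (intro add_mono divide_right_mono sumER) auto
    also have "\<dots> = 2 * \<delta> + \<bar>l\<bar> * z + 2 * w" using n w by (simp add: add_divide_distrib)
    also have "\<bar>l\<bar> * z \<le> \<zeta> / 8"
    proof -
      have "\<bar>l\<bar> * z \<le> (\<bar>l\<bar> + 1) * z" using z by (intro mult_right_mono) auto
      also have "\<dots> = \<zeta> / 8" by (simp add: z_def field_simps)
      finally show ?thesis .
    qed
    also have "2 * \<delta> + \<zeta> / 8 + 2 * w < \<zeta>" using \<zeta> by (simp add: \<delta>_def w_def)
    finally have "expectation (\<lambda>\<omega>. cmod (H l n \<omega>)) < \<zeta>" by simp
    moreover have "0 \<le> expectation (\<lambda>\<omega>. cmod (H l n \<omega>))" by simp
    ultimately show ?case by simp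
  qed
  then show "\<exists>no. \<forall>n\<ge>no. norm (expectation (\<lambda>\<omega>. cmod (H l n \<omega>)) - 0) < \<zeta>" by (simp add: eventually_sequentially)
qed

text \<open>Both densities are integrals over one standard normal variable \<open>w\<close> at the
  frequency \<open>w / \<epsilon>\<close>; the wider one has the extra factor
  \<open>\<gamma>\<^sub>F\<close>. Comparing the averaged density with the mixture thus amounts to
  integrating \<open>H\<close>.\<close>

lemma normal_density_fourier:
  assumes \<epsilon>: "0 < \<epsilon>"
  shows "complex_of_real (normal_density 0 \<epsilon> y) = of_real (1 / (\<epsilon> * sqrt (2 * pi))) * (CLINT w|std_normal_distribution. iexp (w * (y / \<epsilon>)))"
    and "complex_of_real (normal_density 0 (\<nu> \<epsilon>) y) = of_real (1 / (\<epsilon> * sqrt (2 * pi))) *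
      (CLINT w|std_normal_distribution. iexp (w * (y / \<epsilon>)) * of_real (\<gamma>\<^sub>F (w / \<epsilon>)))"
proof -
  have "(CLINT w|std_normal_distribution. iexp (w * (y / \<epsilon>))) = of_real (exp (- ((y / \<epsilon>)\<^sup>2) / 2))"
    using fun_cong[OF char_std_normal_distribution, of "y / \<epsilon>"] by (simp add: char_def mult.commute)
  then show "complex_of_real (normal_density 0 \<epsilon> y) = of_real (1 / (\<epsilon> * sqrt (2 * pi))) * (CLINT w|std_normal_distribution. iexp (w * (y / \<epsilon>)))"
    using \<epsilon> by (simp add: normal_density_def real_sqrt_mult power_divide mult.commute)
  define \<kappa> where "\<kappa> = (1 - \<tau>) / \<epsilon>\<^sup>2"
  have \<kappa>: "0 \<le> \<kappa>" using \<tau> by (simp add: \<kappa>_def)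
  have g: "\<gamma>\<^sub>F (w / \<epsilon>) = exp (- (\<kappa> * w\<^sup>2 / 2))" for w by (simp add: \<gamma>\<^sub>F_def \<kappa>_def power_divide)
  have "(\<nu> \<epsilon>)\<^sup>2 = \<epsilon>\<^sup>2 + (1 - \<tau>)" unfolding \<nu>_def using \<tau> by (intro real_sqrt_pow2 add_nonneg_nonneg) auto
  also have "\<dots> = \<epsilon>\<^sup>2 * (1 + \<kappa>)" using \<epsilon> by (simp add: \<kappa>_def distrib_left)
  finally have \<nu>2: "(\<nu> \<epsilon>)\<^sup>2 = \<epsilon>\<^sup>2 * (1 + \<kappa>)" .
  have "sqrt (2 * pi * (\<nu> \<epsilon>)\<^sup>2) = sqrt (2 * pi) * (\<epsilon> * sqrt (1 + \<kappa>))"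
    unfolding \<nu>2 using \<epsilon> by (simp add: real_sqrt_mult)
  moreover have "- (y - 0)\<^sup>2 / (2 * (\<nu> \<epsilon>)\<^sup>2) = - ((y / \<epsilon>)\<^sup>2 / (2 * (1 + \<kappa>)))"
    unfolding \<nu>2 by (simp add: power_divide mult_ac)
  ultimately have "normal_density 0 (\<nu> \<epsilon>) y = 1 / (\<epsilon> * sqrt (2 * pi)) * (1 / sqrt (1 + \<kappa>) * exp (- ((y / \<epsilon>)\<^sup>2 / (2 * (1 + \<kappa>)))))"
    unfolding normal_density_def by simp
  then show "complex_of_real (normal_density 0 (\<nu> \<epsilon>) y) = of_real (1 / (\<epsilon> * sqrt (2 * pi))) *
      (CLINT w|std_normal_distribution. iexp (w * (y / \<epsilon>)) * of_real (\<gamma>\<^sub>F (w / \<epsilon>)))"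
    unfolding g normal_mixture_identity[OF \<kappa>] by (simp only: of_real_mult)
qed

text \<open>By \<open>normal_density_fourier\<close> the difference is a constant times the integral
  of \<open>H (w / \<epsilon>)\<close> over a probability law in \<open>w\<close>. \<open>H\<close>
  is bounded by 2 and tends to 0 in mean at each frequency, so dominated convergence
  applies.\<close>

lemma smoothed_average:
  assumes \<epsilon>: "0 < \<epsilon>"
  shows "(\<lambda>n. expectation (\<lambda>\<omega>. \<bar>(\<Sum>t\<in>{1..n}. normal_density 0 \<epsilon> (Xp n t \<omega> / \<beta> n)) / real n - normal_density 0 (\<nu> \<epsilon>) (Yp n \<omega> / \<beta> n)\<bar>)) \<longlonglongrightarrow> 0"
proof -
  let ?\<Phi> = std_normal_distribution
  interpret \<Phi>: real_distribution ?\<Phi> by (rule real_dist_normal_dist)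
  interpret P: pair_prob_space M ?\<Phi> ..
  define c where "c = 1 / (\<epsilon> * sqrt (2 * pi))"
  have c: "0 < c" using \<epsilon> by (simp add: c_def)
  define d where "d n \<omega> = (\<Sum>t\<in>{1..n}. normal_density 0 \<epsilon> (Xp n t \<omega> / \<beta> n)) / real n - normal_density 0 (\<nu> \<epsilon>) (Yp n \<omega> / \<beta> n)" for n \<omega>
  have [measurable]: "d n \<in> borel_measurable M" for n unfolding d_def[abs_def] by measurable
  have ii: "complex_integrable ?\<Phi> (\<lambda>w. iexp (w * y))" for y
    by (rule \<Phi>.integrable_const_bound[of _ 1]) (auto simp del: of_real_mult)
  have ig: "complex_integrable ?\<Phi> (\<lambda>w. iexp (w * y) * of_real (\<gamma>\<^sub>F (w / \<epsilon>)))" for y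
  proof (rule \<Phi>.integrable_const_bound[of _ 1])
    show "AE w in ?\<Phi>. cmod (iexp (w * y) * of_real (\<gamma>\<^sub>F (w / \<epsilon>))) \<le> 1"
    proof (rule AE_I2)
      fix w
      show "cmod (iexp (w * y) * of_real (\<gamma>\<^sub>F (w / \<epsilon>))) \<le> 1"
        using \<gamma>F_bounds[of "w / \<epsilon>"] by (simp add: norm_mult del: of_real_mult of_real_divide)
    qed
    show "(\<lambda>w. iexp (w * y) * of_real (\<gamma>\<^sub>F (w / \<epsilon>))) \<in> borel_measurable ?\<Phi>" unfolding \<gamma>\<^sub>F_def by measurable
  qed
  have dH: "complex_of_real (d n \<omega>) = of_real c * (CLINT w|?\<Phi>. H (w / \<epsilon>) n \<omega>)" if n: "1 \<le> n" for n \<omega>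
  proof -
    have "complex_of_real (d n \<omega>) = (\<Sum>t\<in>{1..n}. of_real c * (CLINT w|?\<Phi>. iexp (w * (Xp n t \<omega> / \<beta> n / \<epsilon>)))) / of_nat n
      - of_real c * (CLINT w|?\<Phi>. iexp (w * (Yp n \<omega> / \<beta> n / \<epsilon>)) * of_real (\<gamma>\<^sub>F (w / \<epsilon>)))"
      unfolding d_def of_real_diff of_real_divide of_real_sum normal_density_fourier[OF \<epsilon>] c_def of_real_of_nat_eq ..
    also have "\<dots> = of_real c * ((\<Sum>t\<in>{1..n}. (CLINT w|?\<Phi>. iexp (w * (Xp n t \<omega> / \<beta> n / \<epsilon>)))) / of_nat n
      - (CLINT w|?\<Phi>. iexp (w * (Yp n \<omega> / \<beta> n / \<epsilon>)) * of_real (\<gamma>\<^sub>F (w / \<epsilon>))))"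
      by (simp only: sum_distrib_left[symmetric] right_diff_distrib times_divide_eq_right)
    also have "(\<Sum>t\<in>{1..n}. (CLINT w|?\<Phi>. iexp (w * (Xp n t \<omega> / \<beta> n / \<epsilon>)))) / of_nat n
      = (CLINT w|?\<Phi>. (\<Sum>t\<in>{1..n}. iexp (w * (Xp n t \<omega> / \<beta> n / \<epsilon>))) / of_nat n)"
      by (subst integral_divide_zero) (subst Bochner_Integration.integral_sum[OF ii], rule refl)
    also have "\<dots> - (CLINT w|?\<Phi>. iexp (w * (Yp n \<omega> / \<beta> n / \<epsilon>)) * of_real (\<gamma>\<^sub>F (w / \<epsilon>)))
      = (CLINT w|?\<Phi>. (\<Sum>t\<in>{1..n}. iexp (w * (Xp n t \<omega> / \<beta> n / \<epsilon>))) / of_nat n - iexp (w * (Yp n \<omega> / \<beta> n / \<epsilon>)) * of_real (\<gamma>\<^sub>F (w / \<epsilon>)))"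
      by (rule Bochner_Integration.integral_diff[symmetric]; intro integrable_divide Bochner_Integration.integrable_sum ii ig)
    also have "\<dots> = (CLINT w|?\<Phi>. H (w / \<epsilon>) n \<omega>)"
    proof (rule Bochner_Integration.integral_cong[OF refl])
      fix w
      have "w * (y / \<epsilon>) = w / \<epsilon> * y" for y by simp
      then show "(\<Sum>t\<in>{1..n}. iexp (w * (Xp n t \<omega> / \<beta> n / \<epsilon>))) / of_nat n - iexp (w * (Yp n \<omega> / \<beta> n / \<epsilon>)) * of_real (\<gamma>\<^sub>F (w / \<epsilon>)) = H (w / \<epsilon>) n \<omega>"
        unfolding H_def by (simp only: mult.commute)
    qed
    finally show ?thesis .
  qed
  have Hm [measurable]: "(\<lambda>p. H (snd p / \<epsilon>) n (fst p)) \<in> borel_measurable (M \<Otimes>\<^sub>M ?\<Phi>)" for n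
  proof -
    have "(\<lambda>p. (snd p / \<epsilon>, fst p)) \<in> M \<Otimes>\<^sub>M ?\<Phi> \<rightarrow>\<^sub>M borel \<Otimes>\<^sub>M M" by measurable
    from measurable_compose[OF this H_measurable, of n] show ?thesis by simp
  qed
  have Hi: "integrable (M \<Otimes>\<^sub>M ?\<Phi>) (\<lambda>(\<omega>, w). cmod (H (w / \<epsilon>) n \<omega>))" if n: "1 \<le> n" for n
  proof (rule P.integrable_const_bound[of _ 2])
    show "AE p in M \<Otimes>\<^sub>M ?\<Phi>. norm (case p of (\<omega>, w) \<Rightarrow> cmod (H (w / \<epsilon>) n \<omega>)) \<le> 2"
      by (rule AE_I2) (use H_bound[OF n] in \<open>auto split: prod.split\<close>)
    have "(\<lambda>p. cmod (H (snd p / \<epsilon>) n (fst p))) \<in> borel_measurable (M \<Otimes>\<^sub>M ?\<Phi>)" by measurable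
    then show "(\<lambda>(\<omega>, w). cmod (H (w / \<epsilon>) n \<omega>)) \<in> borel_measurable (M \<Otimes>\<^sub>M ?\<Phi>)" by (simp add: split_beta')
  qed
  have bound: "expectation (\<lambda>\<omega>. \<bar>d n \<omega>\<bar>) \<le> c * (\<integral>w. expectation (\<lambda>\<omega>. cmod (H (w / \<epsilon>) n \<omega>)) \<partial>?\<Phi>)" if n: "1 \<le> n" for n
  proof -
    have i1: "integrable M (\<lambda>\<omega>. \<integral>w. cmod (H (w / \<epsilon>) n \<omega>) \<partial>?\<Phi>)" using P.integrable_fst[OF Hi[OF n]] .
    have "expectation (\<lambda>\<omega>. \<bar>d n \<omega>\<bar>) \<le> expectation (\<lambda>\<omega>. c * (\<integral>w. cmod (H (w / \<epsilon>) n \<omega>) \<partial>?\<Phi>))"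
    proof (rule integral_mono')
      show "integrable M (\<lambda>\<omega>. c * (\<integral>w. cmod (H (w / \<epsilon>) n \<omega>) \<partial>?\<Phi>))" using i1 by simp
      fix \<omega>
      have "\<bar>d n \<omega>\<bar> = cmod (of_real (d n \<omega>))" by simp
      also have "\<dots> = c * cmod (CLINT w|?\<Phi>. H (w / \<epsilon>) n \<omega>)" unfolding dH[OF n] using c by (simp add: norm_mult)
      also have "\<dots> \<le> c * (\<integral>w. cmod (H (w / \<epsilon>) n \<omega>) \<partial>?\<Phi>)" using c by (intro mult_left_mono integral_norm_bound) auto
      finally show "\<bar>d n \<omega>\<bar> \<le> c * (\<integral>w. cmod (H (w / \<epsilon>) n \<omega>) \<partial>?\<Phi>)" .
      show "0 \<le> c * (\<integral>w. cmod (H (w / \<epsilon>) n \<omega>) \<partial>?\<Phi>)" using c by simp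
    qed
    also have "\<dots> = c * expectation (\<lambda>\<omega>. \<integral>w. cmod (H (w / \<epsilon>) n \<omega>) \<partial>?\<Phi>)" by simp
    also have "expectation (\<lambda>\<omega>. \<integral>w. cmod (H (w / \<epsilon>) n \<omega>) \<partial>?\<Phi>) = (\<integral>w. expectation (\<lambda>\<omega>. cmod (H (w / \<epsilon>) n \<omega>)) \<partial>?\<Phi>)"
      by (rule P.Fubini_integral[OF Hi[OF n], symmetric])
    finally show ?thesis .
  qed
  \<comment> \<open>The index is shifted because the bound on \<open>H\<close> holds from 1
    on.\<close>
  have lim: "(\<lambda>n. \<integral>w. expectation (\<lambda>\<omega>. cmod (H (w / \<epsilon>) (Suc n) \<omega>)) \<partial>?\<Phi>) \<longlonglongrightarrow> (\<integral>w. 0 \<partial>?\<Phi>)"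
  proof (rule integral_dominated_convergence[where w="\<lambda>_. 2"])
    show "AE w in ?\<Phi>. (\<lambda>n. expectation (\<lambda>\<omega>. cmod (H (w / \<epsilon>) (Suc n) \<omega>))) \<longlonglongrightarrow> 0" by (intro AE_I2 LIMSEQ_Suc H_tendsto)
    show "(\<lambda>w. expectation (\<lambda>\<omega>. cmod (H (w / \<epsilon>) (Suc n) \<omega>))) \<in> borel_measurable ?\<Phi>" for n
      using borel_measurable_integrable[OF P.integrable_snd[OF Hi[of "Suc n"]]] by simp
    show "AE w in ?\<Phi>. norm (expectation (\<lambda>\<omega>. cmod (H (w / \<epsilon>) (Suc n) \<omega>))) \<le> 2" for n
    proof (rule AE_I2)
      fix w
      have "expectation (\<lambda>\<omega>. cmod (H (w / \<epsilon>) (Suc n) \<omega>)) \<le> expectation (\<lambda>_. 2 :: real)"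
        by (rule integral_mono') (use H_bound[of "Suc n"] in auto)
      then show "norm (expectation (\<lambda>\<omega>. cmod (H (w / \<epsilon>) (Suc n) \<omega>))) \<le> 2" by (simp add: prob_space)
    qed
  qed auto
  have "(\<lambda>n. expectation (\<lambda>\<omega>. \<bar>d (Suc n) \<omega>\<bar>)) \<longlonglongrightarrow> 0"
  proof (rule tendsto_sandwich[OF _ _ tendsto_const])
    show "(\<lambda>n. c * (\<integral>w. expectation (\<lambda>\<omega>. cmod (H (w / \<epsilon>) (Suc n) \<omega>)) \<partial>?\<Phi>)) \<longlonglongrightarrow> 0"
      using tendsto_mult_left[OF lim, of c] by simp
  qed (auto intro!: always_eventually bound)
  then have "(\<lambda>n. expectation (\<lambda>\<omega>. \<bar>d n \<omega>\<bar>)) \<longlonglongrightarrow> 0" by (rule LIMSEQ_imp_Suc)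
  then show ?thesis unfolding d_def .
qed

text \<open>\<open>finite_sum_gauss_limit\<close> applies because the weights are bounded and
  \<open>\<beta> n\<close> tends to infinity. For \<open>\<tau> = 0\<close> the limit is 1, so that
  \<open>Yp n / \<beta> n\<close> tends to 0 in distribution.\<close>

lemma Yp_char_tendsto: "(\<lambda>n. CLINT \<omega>|M. iexp (u * (Yp n \<omega> / \<beta> n))) \<longlonglongrightarrow> of_real (exp (- (\<tau> * u\<^sup>2 / 2)))"
proof (rule LIMSEQ_I)
  fix \<zeta> :: real assume \<zeta>: "0 < \<zeta>"
  have v: "0 \<le> \<tau> * u\<^sup>2" and h\<zeta>: "0 < \<zeta> / 2" using \<tau> \<zeta> by auto
  obtain r where rpos: "0 < r" and rall: "\<forall>(I::int set) w. finite I \<longrightarrow> (\<forall>i\<in>I. \<bar>w i\<bar> \<le> r) \<longrightarrow> \<bar>\<sigma>2 * (\<Sum>i\<in>I. (w i)\<^sup>2) - \<tau> * u\<^sup>2\<bar> \<le> r \<longrightarrow>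
    cmod ((CLINT \<omega>|M. iexp (\<Sum>i\<in>I. w i * \<xi> i \<omega>)) - of_real (exp (- (\<tau> * u\<^sup>2 / 2)))) \<le> \<zeta> / 2"
    using finite_sum_gauss_limit[OF h\<zeta> v] by blast
  define B' where "B' = max B 0"
  have e1: "\<forall>\<^sub>F n in sequentially. \<bar>u\<bar> * B' / r \<le> \<beta> n" using top_\<beta> by (auto simp: filterlim_at_top)
  have "(\<lambda>n. u\<^sup>2 * (\<sigma>2 * (\<Sum>k<n. (g n k)\<^sup>2) / (\<beta> n)\<^sup>2)) \<longlonglongrightarrow> u\<^sup>2 * \<tau>" by (intro tendsto_intros g_norm)
  then have e2: "\<forall>\<^sub>F n in sequentially. dist (u\<^sup>2 * (\<sigma>2 * (\<Sum>k<n. (g n k)\<^sup>2) / (\<beta> n)\<^sup>2)) (u\<^sup>2 * \<tau>) < r"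
    using rpos by (rule tendstoD)
  have "\<forall>\<^sub>F n in sequentially. norm ((CLINT \<omega>|M. iexp (u * (Yp n \<omega> / \<beta> n))) - of_real (exp (- (\<tau> * u\<^sup>2 / 2)))) < \<zeta>"
    using e1 e2 eventually_ge_at_top[of 1]
  proof eventually_elim
    case (elim n)
    have b: "0 < \<beta> n" using pos_\<beta> elim by auto
    define I where "I = (\<lambda>k. - int k) ` {..<n}"
    define w where "w i = u / \<beta> n * g n (nat (- i))" for i
    have inj: "inj_on (\<lambda>k. - int k) {..<n}" by (auto simp: inj_on_def)
    have e: "u * (Yp n \<omega> / \<beta> n) = (\<Sum>i\<in>I. w i * \<xi> i \<omega>)" for \<omega>
      unfolding I_def sum.reindex[OF inj] Yp_def w_def by (simp add: sum_distrib_left sum_divide_distrib mult_ac)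
    have q: "\<sigma>2 * (\<Sum>i\<in>I. (w i)\<^sup>2) = u\<^sup>2 * (\<sigma>2 * (\<Sum>k<n. (g n k)\<^sup>2) / (\<beta> n)\<^sup>2)"
      unfolding I_def sum.reindex[OF inj] w_def by (simp add: power_mult_distrib power_divide sum_distrib_left mult_ac sum_divide_distrib)
    have "\<bar>\<sigma>2 * (\<Sum>i\<in>I. (w i)\<^sup>2) - \<tau> * u\<^sup>2\<bar> \<le> r" using elim(2) unfolding q by (simp add: dist_real_def mult.commute)
    moreover have "\<forall>i\<in>I. \<bar>w i\<bar> \<le> r"
    proof
      fix i assume "i \<in> I"
      then have "\<bar>g n (nat (- i))\<bar> \<le> B'" using g_bound[of n "nat (- i)"] elim by (auto simp: I_def B'_def)
      then have "\<bar>w i\<bar> \<le> \<bar>u\<bar> * B' / \<beta> n" using b unfolding w_def by (simp add: abs_mult mult_left_mono divide_right_mono)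
      also have "\<dots> \<le> r" using elim(1) b rpos by (simp add: field_simps)
      finally show "\<bar>w i\<bar> \<le> r" .
    qed
    moreover have "finite I" by (simp add: I_def)
    ultimately have "cmod ((CLINT \<omega>|M. iexp (\<Sum>i\<in>I. w i * \<xi> i \<omega>)) - of_real (exp (- (\<tau> * u\<^sup>2 / 2)))) \<le> \<zeta> / 2" using rall by blast
    then show ?case unfolding e using \<zeta> by simp
  qed
  then show "\<exists>no. \<forall>n\<ge>no. norm ((CLINT \<omega>|M. iexp (u * (Yp n \<omega> / \<beta> n))) - of_real (exp (- (\<tau> * u\<^sup>2 / 2)))) < \<zeta>"
    by (simp add: eventually_sequentially)
qed

end

section \<open>The limit of the kernel sum\<close>

text \<open>This removes \<open>\<epsilon>\<close> from the variance at a cost linear in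
  \<open>\<epsilon>\<close> and uniform in \<open>y\<close>: the exponential changes by at most
  \<open>exp (-a) * a * (r - 1)\<close>, and \<open>exp (-a) * a \<le> 1\<close>.\<close>

lemma normal_density_spread_le:
  assumes s0: "0 < s0" and \<epsilon>: "0 < \<epsilon>" "\<epsilon> \<le> 1"
  shows "\<bar>normal_density 0 (sqrt (\<epsilon>\<^sup>2 + s0\<^sup>2)) y - normal_density 0 s0 y\<bar> \<le> (1 / s0\<^sup>2 + 1 / s0 ^ 3) * \<epsilon>"
proof -
  define s where "s = sqrt (\<epsilon>\<^sup>2 + s0\<^sup>2)"
  have s2: "s\<^sup>2 = \<epsilon>\<^sup>2 + s0\<^sup>2" by (simp add: s_def)
  have s: "s0 \<le> s" "s \<le> s0 + \<epsilon>" "0 < s"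
  proof -
    show "s0 \<le> s" unfolding s_def by (rule real_le_rsqrt) simp
    show "s \<le> s0 + \<epsilon>" unfolding s_def by (rule real_le_lsqrt) (use s0 \<epsilon> in \<open>auto simp: power2_sum\<close>)
    then show "0 < s" using \<open>s0 \<le> s\<close> s0 by simp
  qed
  define c where "c = 1 / sqrt (2 * pi)"
  have c: "0 \<le> c" "c \<le> 1"
  proof -
    have "1 \<le> sqrt (2 * pi)" using pi_gt3 by (intro real_le_rsqrt) simp
    then show "c \<le> 1" by (simp add: c_def)
  qed (simp add: c_def)
  define E where "E t = exp (- (y\<^sup>2 / (2 * t\<^sup>2)))" for t :: real
  have nd: "normal_density 0 t y = c * (1 / t * E t)" if "0 < t" for t
    using that by (simp add: normal_density_def c_def E_def real_sqrt_mult)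
  have E01: "0 \<le> E t" "E t \<le> 1" for t by (auto simp: E_def)
  define a where "a = y\<^sup>2 / (2 * s\<^sup>2)"
  define r where "r = s\<^sup>2 / s0\<^sup>2"
  have a0: "0 \<le> a" by (simp add: a_def)
  have r1: "1 \<le> r" using s s0 by (simp add: r_def power_mono)
  have "y\<^sup>2 / (2 * s0\<^sup>2) = a * r" using s s0 by (simp add: a_def r_def)
  then have Es: "E s = exp (- a)" "E s0 = exp (- (a * r))" by (auto simp: E_def a_def)
  have diffE: "0 \<le> E s - E s0" "E s - E s0 \<le> r - 1"
  proof -
    show "0 \<le> E s - E s0" unfolding Es using a0 r1 by (simp add: mult_le_cancel_left1)
    have "E s - E s0 = exp (- a) * (1 - exp (- (a * (r - 1))))"
      unfolding Es by (simp add: algebra_simps flip: exp_add)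
    also have "\<dots> \<le> exp (- a) * (a * (r - 1))"
      using exp_ge_add_one_self[of "- (a * (r - 1))"] by (intro mult_left_mono) (linarith, simp)
    also have "\<dots> = (exp (- a) * a) * (r - 1)" by simp
    also have "exp (- a) * a \<le> 1"
    proof -
      have "a \<le> exp a" using exp_ge_add_one_self[of a] by linarith
      then show ?thesis by (simp add: exp_minus field_simps)
    qed
    finally show "E s - E s0 \<le> r - 1" using r1 by (simp add: mult_right_mono)
  qed
  have "normal_density 0 s y - normal_density 0 s0 y = c * (1 / s0 * (E s - E s0) - (1 / s0 - 1 / s) * E s)"
    unfolding nd[OF s(3)] nd[OF s0] by (simp add: algebra_simps)
  also have "\<bar>\<dots>\<bar> \<le> 1 * (1 / s0 * (r - 1) + (1 / s0 - 1 / s) * 1)" unfolding abs_mult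
  proof (rule mult_mono)
    have i: "0 \<le> 1 / s0 - 1 / s" using s s0 by (simp add: frac_le)
    have "\<bar>1 / s0 * (E s - E s0) - (1 / s0 - 1 / s) * E s\<bar> \<le> \<bar>1 / s0 * (E s - E s0)\<bar> + \<bar>(1 / s0 - 1 / s) * E s\<bar>"
      by (rule abs_triangle_ineq4)
    also have "\<dots> = 1 / s0 * (E s - E s0) + (1 / s0 - 1 / s) * E s" using diffE(1) s0 i E01[of s] by simp
    also have "\<dots> \<le> 1 / s0 * (r - 1) + (1 / s0 - 1 / s) * 1"
      using diffE s0 i E01[of s] by (intro add_mono mult_left_mono) auto
    finally show "\<bar>1 / s0 * (E s - E s0) - (1 / s0 - 1 / s) * E s\<bar> \<le> 1 / s0 * (r - 1) + (1 / s0 - 1 / s) * 1" .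
  qed (use c in auto)
  also have "1 / s0 * (r - 1) = \<epsilon>\<^sup>2 / s0 ^ 3"
  proof -
    have "r - 1 = \<epsilon>\<^sup>2 / s0\<^sup>2" unfolding r_def s2 using s0 by (simp add: add_divide_distrib)
    then show ?thesis by (simp add: power2_eq_square power3_eq_cube)
  qed
  also have "\<epsilon>\<^sup>2 / s0 ^ 3 \<le> \<epsilon> / s0 ^ 3" using \<epsilon> s0 by (intro divide_right_mono) (auto simp: power2_eq_square mult_left_le)
  also have "1 / s0 - 1 / s = (s - s0) / (s0 * s)" using s s0 by (simp add: field_simps)
  also have "\<dots> \<le> \<epsilon> / (s0 * s0)" using s s0 \<epsilon> by (intro frac_le mult_left_mono) auto
  finally show ?thesis by (simp add: s_def power2_eq_square algebra_simps)
qed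

locale kernel_gauss = kernel_array M \<xi> \<sigma>2 \<theta> a \<beta> h B C\<^sub>V \<gamma> K x + gaussian_array M \<xi> \<sigma>2 \<theta> a \<beta> f g B\<^sub>f \<tau>
  for M :: "'a measure" and \<xi> :: "int \<Rightarrow> 'a \<Rightarrow> real" and \<sigma>2 \<theta> a \<beta> h B C\<^sub>V \<gamma> K x f g B\<^sub>f \<tau>
begin

text \<open>The number \<open>m\<close> of terms is kept apart from \<open>n\<close>, as (iii)
  concerns a fixed number of terms.\<close>

definition "T m n \<omega> = \<beta> n / (real n * h n) * (\<Sum>t\<in>{1..m}. K ((X n t \<omega> - x) / h n))"
definition "J = (\<integral>u. K u \<partial>lborel)"
definition "G y = J * normal_density 0 (sqrt (1 - \<tau>)) y"

lemma T_measurable [measurable]: "T m n \<in> borel_measurable M" unfolding T_def[abs_def] by measurable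

lemma X_eq_Xp: "X n t = Xp n t" by (simp add: X_def Xp_def)

lemma G_measurable [measurable]: "G \<in> borel_measurable borel" unfolding G_def[abs_def] by measurable

text \<open>The errors of the successive replacements: the first \<open>m - 1\<close> kernel terms,
  kernel against window at the other times, time average against mixture, the first
  \<open>m - 1\<close> windows, which were added to complete the average, and finally the width of
  the window in the variance.\<close>

lemma T_minus_limit_le:
  assumes m: "1 \<le> m" "m \<le> n" and \<epsilon>: "0 < \<epsilon>" "\<epsilon> \<le> 1"
  shows "\<bar>T n n \<omega> - G (Yp n \<omega> / \<beta> n)\<bar> \<le> \<bar>T (m - 1) n \<omega>\<bar> + \<bar>D_sum \<epsilon> m n \<omega>\<bar>
    + \<bar>J\<bar> * \<bar>(\<Sum>t\<in>{1..n}. normal_density 0 \<epsilon> (Xp n t \<omega> / \<beta> n)) / real n - normal_density 0 (\<nu> \<epsilon>) (Yp n \<omega> / \<beta> n)\<bar>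
    + \<bar>J\<bar> * (real m / \<epsilon> * (1 / real n)) + \<bar>J\<bar> * ((1 / (1 - \<tau>) + 1 / (sqrt (1 - \<tau>)) ^ 3) * \<epsilon>)"
proof -
  have n: "1 \<le> n" "0 < real n" using m by auto
  have b: "0 < \<beta> n" and hn: "0 < h n" using \<beta>_pos h_pos n by auto
  define w where "w = \<beta> n / (real n * h n)"
  define N where "N t = normal_density 0 \<epsilon> (Xp n t \<omega> / \<beta> n)" for t
  have N: "0 \<le> N t" "N t \<le> 1 / \<epsilon>" for t unfolding N_def using normal_density_le[OF \<epsilon>(1)] by auto
  \<comment> \<open>The density with standard deviation \<open>\<epsilon> * \<beta> n\<close> is
    \<open>1 / \<beta> n\<close> times the one with \<open>\<epsilon>\<close> at the rescaled point;
    the normalising factor thus turns the Gaussian part into an average of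
    \<open>N t\<close>.\<close>
  have D: "w * D \<epsilon> n (X n t \<omega>) = w * K ((X n t \<omega> - x) / h n) - J * (N t / real n)" for t
  proof -
    have "normal_density 0 (\<epsilon> * \<beta> n) (X n t \<omega>) = N t / \<beta> n"
      unfolding N_def X_eq_Xp normal_density_def using b \<epsilon> by (simp add: power_mult_distrib power_divide real_sqrt_mult mult_ac)
    then show ?thesis unfolding D_def J_def[symmetric] w_def using b hn n by (simp add: field_simps)
  qed
  have split: "(\<Sum>t\<in>{1..n}. F t) = (\<Sum>t\<in>{1..m - 1}. F t) + (\<Sum>t\<in>{m..n}. F t)" for F :: "nat \<Rightarrow> real"
  proof -
    have "{1..n} = {1..m - 1} \<union> {m..n}" using m by auto
    then show ?thesis by (simp add: sum.union_disjoint)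
  qed
  have "T n n \<omega> = T (m - 1) n \<omega> + w * (\<Sum>t\<in>{m..n}. K ((X n t \<omega> - x) / h n))"
    unfolding T_def w_def split by (simp add: distrib_left)
  also have "w * (\<Sum>t\<in>{m..n}. K ((X n t \<omega> - x) / h n)) = w * (\<Sum>t\<in>{m..n}. D \<epsilon> n (X n t \<omega>)) + J * ((\<Sum>t\<in>{m..n}. N t) / real n)"
  proof -
    have "(\<Sum>t\<in>{m..n}. w * D \<epsilon> n (X n t \<omega>)) = (\<Sum>t\<in>{m..n}. w * K ((X n t \<omega> - x) / h n)) - (\<Sum>t\<in>{m..n}. J * (N t / real n))"
      unfolding D by (rule sum_subtractf)
    then show ?thesis by (simp add: sum_distrib_left sum_divide_distrib)
  qed
  also have "(\<Sum>t\<in>{m..n}. N t) / real n = (\<Sum>t\<in>{1..n}. N t) / real n - (\<Sum>t\<in>{1..m - 1}. N t) / real n"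
    unfolding split[of N] by (simp add: add_divide_distrib)
  finally have eq: "T n n \<omega> - G (Yp n \<omega> / \<beta> n) = T (m - 1) n \<omega> + w * (\<Sum>t\<in>{m..n}. D \<epsilon> n (X n t \<omega>))
    + J * ((\<Sum>t\<in>{1..n}. N t) / real n - normal_density 0 (\<nu> \<epsilon>) (Yp n \<omega> / \<beta> n)) - J * ((\<Sum>t\<in>{1..m - 1}. N t) / real n)
    + J * (normal_density 0 (\<nu> \<epsilon>) (Yp n \<omega> / \<beta> n) - normal_density 0 (sqrt (1 - \<tau>)) (Yp n \<omega> / \<beta> n))"
    by (simp add: G_def algebra_simps)
  have s0: "0 < sqrt (1 - \<tau>)" "(sqrt (1 - \<tau>))\<^sup>2 = 1 - \<tau>" using \<tau> by auto
  have "\<bar>J * ((\<Sum>t\<in>{1..m - 1}. N t) / real n)\<bar> \<le> \<bar>J\<bar> * (real m / \<epsilon> * (1 / real n))"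
  proof -
    have "(\<Sum>t\<in>{1..m - 1}. N t) \<le> (\<Sum>t\<in>{1..m - 1}. 1 / \<epsilon>)" by (intro sum_mono N)
    also have "\<dots> \<le> real m / \<epsilon>" using \<epsilon> by (simp add: divide_right_mono)
    finally have "(\<Sum>t\<in>{1..m - 1}. N t) / real n \<le> real m / \<epsilon> * (1 / real n)"
      using divide_right_mono[of "\<Sum>t\<in>{1..m - 1}. N t" "real m / \<epsilon>" "real n"] by simp
    moreover have "0 \<le> (\<Sum>t\<in>{1..m - 1}. N t) / real n" using N by (simp add: sum_nonneg)
    ultimately show ?thesis unfolding abs_mult by (intro mult_left_mono) auto
  qed
  moreover have "\<bar>J * (normal_density 0 (\<nu> \<epsilon>) (Yp n \<omega> / \<beta> n) - normal_density 0 (sqrt (1 - \<tau>)) (Yp n \<omega> / \<beta> n))\<bar>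
    \<le> \<bar>J\<bar> * ((1 / (1 - \<tau>) + 1 / (sqrt (1 - \<tau>)) ^ 3) * \<epsilon>)"
    unfolding abs_mult using normal_density_spread_le[OF s0(1) \<epsilon>] unfolding s0(2) \<nu>_def by (intro mult_left_mono) auto
  ultimately show ?thesis unfolding eq w_def[symmetric] N_def[symmetric] abs_mult[of J "(\<Sum>t\<in>{1..n}. N t) / real n - normal_density 0 (\<nu> \<epsilon>) (Yp n \<omega> / \<beta> n)", symmetric]
    by linarith
qed

text \<open>Passing to characteristic functions lets the two kinds of error be combined: the first
  kernel terms, small only in probability, cost at most 2 on an unlikely event, and all other errors
  enter through their means.\<close>

lemma expectation_char_diff_tendsto:
  assumes iii: "\<And>m \<eta>. 0 < \<eta> \<Longrightarrow> (\<lambda>n. prob {\<omega> \<in> space M. \<eta> < \<bar>T m n \<omega>\<bar>}) \<longlonglongrightarrow> 0"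
  shows "(\<lambda>n. (CLINT \<omega>|M. iexp (u * T n n \<omega>)) - (CLINT \<omega>|M. iexp (u * G (Yp n \<omega> / \<beta> n)))) \<longlonglongrightarrow> 0"
proof (rule LIMSEQ_I)
  fix \<zeta> :: real assume \<zeta>: "0 < \<zeta>"
  obtain Q where Q: "0 \<le> Q" and sm: "\<forall>\<epsilon>>0. \<exists>m\<ge>1. \<forall>\<^sub>F n in sequentially.
    integrable M (\<lambda>\<omega>. (D_sum \<epsilon> m n \<omega>)\<^sup>2) \<and>
    expectation (\<lambda>\<omega>. (D_sum \<epsilon> m n \<omega>)\<^sup>2) \<le> Q * \<epsilon>" using second_moment_small by blast
  define C where "C = 1 / (1 - \<tau>) + 1 / (sqrt (1 - \<tau>)) ^ 3"
  have C: "0 \<le> C" using \<tau> by (simp add: C_def)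
  define Q' where "Q' = 1 + Q + \<bar>J\<bar> * C"
  have Q': "0 < Q'" using Q C by (auto simp: Q'_def intro!: add_pos_nonneg)
  \<comment> \<open>The scale of the final error, with \<open>Q'\<close> collecting the constants
    that multiply it.\<close>
  define q where "q = min 1 (\<zeta> / (8 * (\<bar>u\<bar> + 1) * Q'))"
  have q: "0 < q" "q \<le> 1" using \<zeta> Q' by (auto simp: q_def)
  have uq: "\<bar>u\<bar> * (Q' * q) \<le> \<zeta> / 8"
  proof -
    have "\<bar>u\<bar> * (Q' * q) \<le> (\<bar>u\<bar> + 1) * (Q' * q)" using Q' q by (intro mult_right_mono) auto
    also have "\<dots> \<le> (\<bar>u\<bar> + 1) * (Q' * (\<zeta> / (8 * (\<bar>u\<bar> + 1) * Q')))" using Q' by (intro mult_left_mono) (auto simp: q_def)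
    also have "\<dots> = \<zeta> / 8"
    proof -
      have v: "v * (Q' * (\<zeta> / (8 * v * Q'))) = \<zeta> / 8" if "v \<noteq> 0" for v using that Q' by simp
      show ?thesis by (rule v) linarith
    qed
    finally show ?thesis .
  qed
  \<comment> \<open>With \<open>\<epsilon> = q^2\<close> the bound
    \<open>|Z| \<le> q + Z^2 / q\<close> has a mean of at most
    \<open>q + Q * \<epsilon> / q = (1 + Q) * q\<close>.\<close>
  define \<epsilon> where "\<epsilon> = q\<^sup>2"
  have \<epsilon>: "0 < \<epsilon>" "\<epsilon> \<le> 1" "\<epsilon> \<le> q" using q power_le_one[of q 2] mult_left_le[of q q] by (auto simp: \<epsilon>_def power2_eq_square)
  obtain m where m: "1 \<le> m" and ev: "\<forall>\<^sub>F n in sequentially.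
    integrable M (\<lambda>\<omega>. (D_sum \<epsilon> m n \<omega>)\<^sup>2) \<and>
    expectation (\<lambda>\<omega>. (D_sum \<epsilon> m n \<omega>)\<^sup>2) \<le> Q * \<epsilon>" using sm \<epsilon>(1) by blast
  define \<eta> where "\<eta> = \<zeta> / (8 * (\<bar>u\<bar> + 1))"
  have \<eta>: "0 < \<eta>" using \<zeta> by (simp add: \<eta>_def)
  have u\<eta>: "\<bar>u\<bar> * \<eta> \<le> \<zeta> / 8" using \<zeta> by (simp add: \<eta>_def field_simps)
  define d where "d n \<omega> = \<bar>(\<Sum>t\<in>{1..n}. normal_density 0 \<epsilon> (Xp n t \<omega> / \<beta> n)) / real n - normal_density 0 (\<nu> \<epsilon>) (Yp n \<omega> / \<beta> n)\<bar>" for n \<omega>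
  have dm [measurable]: "d n \<in> borel_measurable M" for n unfolding d_def[abs_def] by measurable
  have "(\<lambda>n. \<bar>u\<bar> * \<bar>J\<bar> * expectation (d n) + \<bar>u\<bar> * \<bar>J\<bar> * (real m / \<epsilon> * (1 / real n)) + 2 * prob {\<omega> \<in> space M. \<eta> < \<bar>T (m - 1) n \<omega>\<bar>})
    \<longlonglongrightarrow> \<bar>u\<bar> * \<bar>J\<bar> * 0 + \<bar>u\<bar> * \<bar>J\<bar> * (real m / \<epsilon> * 0) + 2 * 0"
    unfolding d_def by (intro tendsto_intros smoothed_average \<epsilon> lim_1_over_n iii \<eta>)
  then have "\<forall>\<^sub>F n in sequentially. \<bar>u\<bar> * \<bar>J\<bar> * expectation (d n) + \<bar>u\<bar> * \<bar>J\<bar> * (real m / \<epsilon> * (1 / real n)) + 2 * prob {\<omega> \<in> space M. \<eta> < \<bar>T (m - 1) n \<omega>\<bar>} < \<zeta> / 8"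
    using \<zeta> by (intro order_tendstoD) auto
  then have "\<forall>\<^sub>F n in sequentially. norm ((CLINT \<omega>|M. iexp (u * T n n \<omega>)) - (CLINT \<omega>|M. iexp (u * G (Yp n \<omega> / \<beta> n))) - 0) < \<zeta>"
    using ev eventually_ge_at_top[of m]
  proof eventually_elim
    case (elim n)
    define Z where "Z \<omega> = D_sum \<epsilon> m n \<omega>" for \<omega>
    have [measurable]: "Z \<in> borel_measurable M" unfolding Z_def[abs_def] by measurable
    have Z2: "integrable M (\<lambda>\<omega>. (Z \<omega>)\<^sup>2)" "expectation (\<lambda>\<omega>. (Z \<omega>)\<^sup>2) \<le> Q * \<epsilon>" using elim(2) by (auto simp: Z_def)
    have n: "1 \<le> n" "0 < real n" using elim m by auto
    have Nb: "0 \<le> normal_density 0 \<epsilon> y" "normal_density 0 \<epsilon> y \<le> 1 / \<epsilon>" for y using normal_density_le[OF \<epsilon>(1)] by auto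
    have \<nu>0: "0 < \<nu> \<epsilon>" unfolding \<nu>_def using \<tau> by (simp add: add_nonneg_pos)
    have di: "integrable M (d n)"
    proof (rule bounded_integrable[OF dm])
      fix \<omega>
      have "(\<Sum>t\<in>{1..n}. normal_density 0 \<epsilon> (Xp n t \<omega> / \<beta> n)) \<le> (\<Sum>t\<in>{1..n}. 1 / \<epsilon>)" by (intro sum_mono Nb)
      then have "(\<Sum>t\<in>{1..n}. normal_density 0 \<epsilon> (Xp n t \<omega> / \<beta> n)) / real n \<le> 1 / \<epsilon>" using n by (simp add: pos_divide_le_eq mult.commute)
      moreover have "0 \<le> (\<Sum>t\<in>{1..n}. normal_density 0 \<epsilon> (Xp n t \<omega> / \<beta> n)) / real n" by (intro divide_nonneg_nonneg sum_nonneg) auto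
      moreover have "0 \<le> normal_density 0 (\<nu> \<epsilon>) (Yp n \<omega> / \<beta> n)" "normal_density 0 (\<nu> \<epsilon>) (Yp n \<omega> / \<beta> n) \<le> 1 / \<nu> \<epsilon>"
        using normal_density_le[OF \<nu>0] by auto
      moreover have "0 < 1 / \<nu> \<epsilon>" "0 < 1 / \<epsilon>" using \<nu>0 \<epsilon> by auto
      ultimately show "norm (d n \<omega>) \<le> 1 / \<epsilon> + 1 / \<nu> \<epsilon>" unfolding d_def real_norm_def abs_idempotent by linarith
    qed
    define c0 where "c0 = \<bar>J\<bar> * (real m / \<epsilon> * (1 / real n)) + \<bar>J\<bar> * (C * \<epsilon>)"
    let ?I = "indicator {\<omega> \<in> space M. \<eta> < \<bar>T (m - 1) n \<omega>\<bar>} :: 'a \<Rightarrow> real"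
    have Ii: "integrable M ?I" by (rule bounded_integrable[of _ 1]) (auto simp: indicator_def)
    define R where "R \<omega> = 2 * ?I \<omega> + \<bar>u\<bar> * (\<eta> + (q + (Z \<omega>)\<^sup>2 / q) + \<bar>J\<bar> * d n \<omega> + c0)" for \<omega>
    have Ri: "integrable M R" unfolding R_def
      by (intro Bochner_Integration.integrable_add integrable_mult_right integrable_divide Ii Z2 di integrable_const)
    have le: "cmod (iexp (u * T n n \<omega>) - iexp (u * G (Yp n \<omega> / \<beta> n))) \<le> R \<omega>" if \<omega>: "\<omega> \<in> space M" for \<omega>
    proof -
      have Zq: "\<bar>Z \<omega>\<bar> \<le> q + (Z \<omega>)\<^sup>2 / q"
      proof (cases "\<bar>Z \<omega>\<bar> \<le> q")
        case False
        then have "\<bar>Z \<omega>\<bar> * q \<le> \<bar>Z \<omega>\<bar> * \<bar>Z \<omega>\<bar>" by (intro mult_left_mono) auto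
        then have "\<bar>Z \<omega>\<bar> \<le> (Z \<omega>)\<^sup>2 / q" using q by (simp add: pos_le_divide_eq power2_eq_square)
        then show ?thesis using q by linarith
      qed (use q in \<open>auto intro: add_increasing2\<close>)
      have d0: "0 \<le> d n \<omega>" by (simp add: d_def)
      have c00: "0 \<le> c0" using \<epsilon> C by (simp add: c0_def)
      have rest0: "0 \<le> (q + (Z \<omega>)\<^sup>2 / q) + \<bar>J\<bar> * d n \<omega> + c0" using q d0 c00 by simp
      show ?thesis
      proof (cases "\<eta> < \<bar>T (m - 1) n \<omega>\<bar>")
        case True
        have "cmod (iexp (u * T n n \<omega>) - iexp (u * G (Yp n \<omega> / \<beta> n))) \<le> 2"
          by (rule order_trans[OF norm_triangle_ineq4]) (simp only: norm_iexp)
        moreover have "0 \<le> \<bar>u\<bar> * (\<eta> + (q + (Z \<omega>)\<^sup>2 / q) + \<bar>J\<bar> * d n \<omega> + c0)"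
          using rest0 \<eta> by (intro mult_nonneg_nonneg) auto
        ultimately show ?thesis using True \<omega> by (simp add: R_def)
      next
        case False
        have "cmod (iexp (u * T n n \<omega>) - iexp (u * G (Yp n \<omega> / \<beta> n))) \<le> \<bar>u * T n n \<omega> - u * G (Yp n \<omega> / \<beta> n)\<bar>" by (rule cmod_iexp_diff_le)
        also have "\<dots> = \<bar>u\<bar> * \<bar>T n n \<omega> - G (Yp n \<omega> / \<beta> n)\<bar>" by (simp add: abs_mult flip: right_diff_distrib)
        also have "\<dots> \<le> \<bar>u\<bar> * (\<eta> + (q + (Z \<omega>)\<^sup>2 / q) + \<bar>J\<bar> * d n \<omega> + c0)"
          using T_minus_limit_le[OF m elim(3) \<epsilon>(1,2), of \<omega>] False Zq
          unfolding d_def[symmetric] Z_def[symmetric] C_def[symmetric] by (intro mult_left_mono) (auto simp: c0_def)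
        finally show ?thesis using False by (simp add: R_def)
      qed
    qed
    have ii: "complex_integrable M (\<lambda>\<omega>. iexp (u * T n n \<omega>))" "complex_integrable M (\<lambda>\<omega>. iexp (u * G (Yp n \<omega> / \<beta> n)))"
      by (rule bounded_integrable[of _ 1]; simp del: of_real_mult)+
    have "cmod ((CLINT \<omega>|M. iexp (u * T n n \<omega>)) - (CLINT \<omega>|M. iexp (u * G (Yp n \<omega> / \<beta> n))))
      = cmod (CLINT \<omega>|M. iexp (u * T n n \<omega>) - iexp (u * G (Yp n \<omega> / \<beta> n)))"
      by (subst Bochner_Integration.integral_diff[OF ii]) (rule refl)
    also have "\<dots> \<le> expectation R"
    proof (rule order_trans[OF integral_norm_bound], rule integral_mono[OF _ Ri])
      show "integrable M (\<lambda>\<omega>. cmod (iexp (u * T n n \<omega>) - iexp (u * G (Yp n \<omega> / \<beta> n))))"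
        by (intro integrable_norm Bochner_Integration.integrable_diff ii)
    qed (rule le)
    also have "expectation R = 2 * prob {\<omega> \<in> space M. \<eta> < \<bar>T (m - 1) n \<omega>\<bar>} + \<bar>u\<bar> * (\<eta> + (q + expectation (\<lambda>\<omega>. (Z \<omega>)\<^sup>2) / q) + \<bar>J\<bar> * expectation (d n) + c0)"
      unfolding R_def using Ii Z2 di by (simp add: prob_space)
    also have "\<dots> \<le> 2 * prob {\<omega> \<in> space M. \<eta> < \<bar>T (m - 1) n \<omega>\<bar>} + \<bar>u\<bar> * (\<eta> + (q + Q * \<epsilon> / q) + \<bar>J\<bar> * expectation (d n) + c0)"
      using Z2 q by (intro add_mono mult_left_mono divide_right_mono) auto
    also have "\<dots> = (\<bar>u\<bar> * \<bar>J\<bar> * expectation (d n) + \<bar>u\<bar> * \<bar>J\<bar> * (real m / \<epsilon> * (1 / real n)) + 2 * prob {\<omega> \<in> space M. \<eta> < \<bar>T (m - 1) n \<omega>\<bar>})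
       + \<bar>u\<bar> * \<eta> + \<bar>u\<bar> * (q + Q * q + \<bar>J\<bar> * (C * \<epsilon>))"
      using q by (simp add: c0_def \<epsilon>_def power2_eq_square algebra_simps)
    also have "\<dots> \<le> \<zeta> / 8 + \<zeta> / 8 + \<zeta> / 8"
    proof (intro add_mono)
      have "\<bar>u\<bar> * (q + Q * q + \<bar>J\<bar> * (C * \<epsilon>)) \<le> \<bar>u\<bar> * (q + Q * q + \<bar>J\<bar> * (C * q))"
        using \<epsilon> C by (intro mult_left_mono add_left_mono) auto
      also have "\<dots> = \<bar>u\<bar> * (Q' * q)" by (simp add: Q'_def algebra_simps)
      finally show "\<bar>u\<bar> * (q + Q * q + \<bar>J\<bar> * (C * \<epsilon>)) \<le> \<zeta> / 8" using uq by linarith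
    qed (use elim(1) u\<eta> in auto)
    also have "\<dots> < \<zeta>" using \<zeta> by simp
    finally show ?case by simp
  qed
  then show "\<exists>no. \<forall>n\<ge>no. norm ((CLINT \<omega>|M. iexp (u * T n n \<omega>)) - (CLINT \<omega>|M. iexp (u * G (Yp n \<omega> / \<beta> n))) - 0) < \<zeta>"
    by (simp add: eventually_sequentially)
qed

text \<open>Levy's continuity theorem is used twice: for \<open>Yp n / \<beta> n\<close>, whose
  limit \<open>\<rho>\<close> is given by its characteristic function and may be degenerate, and for
  the kernel sums after the bounded continuous map \<open>G\<close> has carried the first limit
  over.\<close>

theorem kernel_sum_weak_limit:
  assumes iii: "\<And>m \<eta>. 0 < \<eta> \<Longrightarrow> (\<lambda>n. prob {\<omega> \<in> space M. \<eta> < \<bar>T m n \<omega>\<bar>}) \<longlonglongrightarrow> 0"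
    and \<rho>: "real_distribution \<rho>" and char_\<rho>: "\<And>u. char \<rho> u = of_real (exp (- (\<tau> * u\<^sup>2 / 2)))"
  shows "weak_conv_m (\<lambda>n. distr M borel (T n n)) (distr \<rho> borel G)"
proof -
  interpret \<rho>: real_distribution \<rho> by fact
  define \<mu> where "\<mu> n = distr M borel (\<lambda>\<omega>. Yp n \<omega> / \<beta> n)" for n
  have \<mu>: "real_distribution (\<mu> n)" for n unfolding \<mu>_def by (rule real_distribution_distr) measurable
  have wc: "weak_conv_m \<mu> \<rho>"
  proof (rule levy_continuity[OF \<mu> \<rho>])
    fix u
    have "char (\<mu> n) u = (CLINT \<omega>|M. iexp (u * (Yp n \<omega> / \<beta> n)))" for n
      unfolding char_def \<mu>_def by (rule integral_distr) measurable
    then show "(\<lambda>n. char (\<mu> n) u) \<longlonglongrightarrow> char \<rho> u" unfolding char_\<rho> using Yp_char_tendsto[of u] by simp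
  qed
  show ?thesis
  proof (rule levy_continuity)
    show "real_distribution (distr M borel (T n n))" for n by (rule real_distribution_distr) measurable
    show "real_distribution (distr \<rho> borel G)" by (rule \<rho>.real_distribution_distr) measurable
    fix u
    have Gc: "isCont G y" for y unfolding G_def normal_density_def using \<tau> by (intro continuous_intros) auto
    have "(\<lambda>n. CLINT y|\<mu> n. iexp (u * G y)) \<longlonglongrightarrow> (CLINT y|\<rho>. iexp (u * G y))"
    proof (rule weak_conv_imp_integral_bdd_continuous_conv[OF \<mu> \<rho> wc])
      show "isCont (\<lambda>y. iexp (u * G y)) y" for y by (intro continuous_intros Gc)
      show "norm (iexp (u * G y)) \<le> 1" for y by (simp del: of_real_mult)
    qed
    moreover have "(CLINT y|\<mu> n. iexp (u * G y)) = (CLINT \<omega>|M. iexp (u * G (Yp n \<omega> / \<beta> n)))" for n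
      unfolding \<mu>_def by (rule integral_distr) measurable
    ultimately have "(\<lambda>n. CLINT \<omega>|M. iexp (u * G (Yp n \<omega> / \<beta> n))) \<longlonglongrightarrow> (CLINT y|\<rho>. iexp (u * G y))" by simp
    from tendsto_add[OF expectation_char_diff_tendsto[OF iii] this, of u]
    have "(\<lambda>n. CLINT \<omega>|M. iexp (u * T n n \<omega>)) \<longlonglongrightarrow> (CLINT y|\<rho>. iexp (u * G y))" by simp
    moreover have "char (distr M borel (T n n)) u = (CLINT \<omega>|M. iexp (u * T n n \<omega>))" for n
      unfolding char_def by (rule integral_distr) measurable
    moreover have "char (distr \<rho> borel G) u = (CLINT y|\<rho>. iexp (u * G y))"
      unfolding char_def by (rule integral_distr) measurable
    ultimately show "(\<lambda>n. char (distr M borel (T n n)) u) \<longlonglongrightarrow> char (distr \<rho> borel G) u" by simp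
  qed
qed

end

section \<open>Slow variation\<close>

text \<open>The uniform convergence theorem for slowly varying functions. Logarithmic increments,
  truncated at 1 and integrated over the factor \<open>y\<close>, tend to 0 by dominated
  convergence. For given \<open>r\<close>, both \<open>x\<close> and \<open>r * x\<close> are
  compared with the third point \<open>r * x * w\<close>, and averaging over \<open>w\<close> bounds
  the increment.\<close>

lemma slowly_varying_uniform:
  assumes sv: "slowly_varying l" and \<eta>: "0 < \<eta>"
  shows "\<exists>X\<ge>1. \<forall>x\<ge>X. 0 < l x \<and> (\<forall>r\<in>{1..2}. \<bar>ln (l (r * x)) - ln (l x)\<bar> \<le> \<eta>)"
proof -
  obtain a0 where meas: "set_borel_measurable lebesgue {a0..} l" and pos: "\<And>x. a0 \<le> x \<Longrightarrow> 0 < l x"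
    using sv by (auto simp: slowly_varying_def)
  have rat: "((\<lambda>x. l (r * x) / l x) \<longlongrightarrow> 1) at_top" if "r > 0" for r using sv that by (auto simp: slowly_varying_def)
  define a where "a = max a0 1"
  \<comment> \<open>Measurability is available on \<open>{a0..}\<close> only, so \<open>l\<close> is
    cut off below.\<close>
  define L where "L x = indicator {a0..} x *\<^sub>R l x" for x
  have [measurable]: "L \<in> borel_measurable lebesgue" using meas unfolding L_def set_borel_measurable_def .
  have Leq: "L (x * y) = l (x * y)" "a0 \<le> x * y" if "a \<le> x" "1 \<le> y" for x y
  proof -
    have "x * 1 \<le> x * y" using that by (intro mult_left_mono) (auto simp: a_def)
    moreover have "a0 \<le> x" using that by (simp add: a_def)
    ultimately show "a0 \<le> x * y" by linarith
    then show "L (x * y) = l (x * y)" by (simp add: L_def)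
  qed
  have Leq1: "L x = l x" if "a \<le> x" for x using Leq[OF that, of 1] by simp
  \<comment> \<open>The range of \<open>y\<close> extends to 4 because \<open>r * w\<close> is a
    product of two factors from \<open>[1, 2]\<close>.\<close>
  define \<phi> where "\<phi> x y = indicator {1..4} y * min 1 \<bar>ln (L (x * y)) - ln (L x)\<bar>" for x y :: real
  have Lx: "(\<lambda>y. L (x * y)) \<in> borel_measurable lebesgue" for x
    using measurable_compose[OF lebesgue_measurable_scaling[of x], of L borel] by simp
  have \<phi>m [measurable]: "\<phi> x \<in> borel_measurable lebesgue" for x unfolding \<phi>_def
    by (intro borel_measurable_times borel_measurable_min borel_measurable_abs borel_measurable_diff
        borel_measurable_ln borel_measurable_const borel_measurable_indicator Lx) auto
  have \<phi>le: "norm (\<phi> x y) \<le> indicator {1..4} y" for x y by (auto simp: \<phi>_def indicator_def)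
  have ind: "integrable lebesgue (indicator {1..4::real} :: real \<Rightarrow> real)" by (rule integrable_real_indicator) auto
  have \<phi>i: "integrable lebesgue (\<lambda>y. \<phi> x y)" for x
    by (rule Bochner_Integration.integrable_bound[OF ind]) (use \<phi>le in auto)
  define I where "I x = (\<integral>y. \<phi> x y \<partial>lebesgue)" for x
  have "((\<lambda>x. \<integral>y. \<phi> x y \<partial>lebesgue) \<longlongrightarrow> (\<integral>y. 0 \<partial>(lebesgue :: real measure))) at_top"
  proof (rule integral_dominated_convergence_at_top[where w="indicator {1..4}"])
    show "AE y in lebesgue. ((\<lambda>x. \<phi> x y) \<longlongrightarrow> 0) at_top"
    proof (rule AE_I2)
      fix y :: real
      show "((\<lambda>x. \<phi> x y) \<longlongrightarrow> 0) at_top"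
      proof (cases "y \<in> {1..4}")
        case True
        have "((\<lambda>x. ln (l (y * x) / l x)) \<longlongrightarrow> ln 1) at_top" by (rule tendsto_ln[OF rat]) (use True in auto)
        then have "((\<lambda>x. min 1 \<bar>ln (l (y * x) / l x)\<bar>) \<longlongrightarrow> min 1 \<bar>ln 1\<bar>) at_top"
          by (intro tendsto_min tendsto_rabs tendsto_const)
        moreover have "\<forall>\<^sub>F x in at_top. min 1 \<bar>ln (l (y * x) / l x)\<bar> = \<phi> x y" using eventually_ge_at_top[of a]
        proof eventually_elim
          case (elim x)
          have "0 < l x" "0 < l (x * y)" using pos[of x] pos[of "x * y"] Leq[OF elim, of y] True elim
            by (auto simp: a_def)
          then show ?case using True Leq[OF elim, of y] Leq1[OF elim]
            by (simp add: \<phi>_def ln_div mult.commute)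
        qed
        ultimately show ?thesis by (simp add: tendsto_cong)
      qed (simp add: \<phi>_def)
    qed
  qed (use ind \<phi>le in auto)
  then have I0: "(I \<longlongrightarrow> 0) at_top" by (simp add: I_def[abs_def])
  \<comment> \<open>Below 1, a bound on \<open>min 1 d\<close> is a bound on
    \<open>d\<close>.\<close>
  define \<eta>' where "\<eta>' = min \<eta> (1/2)"
  have \<eta>': "0 < \<eta>'" "\<eta>' \<le> \<eta>" "\<eta>' < 1" using \<eta> by (auto simp: \<eta>'_def)
  have "\<forall>\<^sub>F x in at_top. I x < \<eta>' / 2" using order_tendstoD(2)[OF I0, of "\<eta>'/2"] \<eta>' by simp
  then obtain X0 where X0: "\<And>x. X0 \<le> x \<Longrightarrow> I x < \<eta>' / 2" by (auto simp: eventually_at_top_linorder)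
  have Ipos: "0 \<le> I x" for x unfolding I_def by (intro integral_nonneg_AE) (auto simp: \<phi>_def)
  show ?thesis
  proof (intro exI[of _ "max X0 a"] conjI allI impI ballI)
    show "1 \<le> max X0 a" by (auto simp: a_def)
    fix x assume x: "max X0 a \<le> x"
    show "0 < l x" using x pos[of x] by (auto simp: a_def)
    fix r :: real assume r: "r \<in> {1..2}"
    define d where "d = \<bar>ln (l (r * x)) - ln (l x)\<bar>"
    have x1: "1 \<le> x" using x by (auto simp: a_def)
    have "1 * x \<le> r * x" using r x1 by (intro mult_right_mono) auto
    then have rx: "a \<le> r * x" "X0 \<le> r * x" "a \<le> x" using x by auto
    \<comment> \<open>The triangle inequality through the value at \<open>r * x * w\<close>; the
      left side is constant in \<open>w\<close> on the unit interval \<open>[1, 2]\<close>.\<close>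
    have pt: "indicator {1..2} w * min 1 d \<le> \<phi> x (0 + r * w) + \<phi> (r * x) w" for w
    proof (cases "w \<in> {1..2}")
      case True
      have "1 * 1 \<le> r * w" "r * w \<le> 2 * 2" using True r mult_mono[of 1 r 1 w] mult_mono[of r 2 w 2] by auto
      then have "r * w \<in> {1..4}" "w \<in> {1..4}" using True by auto
      then have e: "\<phi> x (0 + r * w) = min 1 \<bar>ln (L (r * x * w)) - ln (l x)\<bar>"
          "\<phi> (r * x) w = min 1 \<bar>ln (L (r * x * w)) - ln (l (r * x))\<bar>"
        using Leq1[of "r * x"] Leq1[of x] rx by (simp_all add: \<phi>_def mult_ac)
      have "min 1 \<bar>A - B\<bar> \<le> min 1 \<bar>C - B\<bar> + min 1 \<bar>C - A\<bar>" for A B C :: real by (auto simp: min_def)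
      then show ?thesis unfolding e d_def using True by simp
    qed (auto simp: \<phi>_def)
    have \<phi>ri: "integrable lebesgue (\<lambda>w. \<phi> x (0 + r * w))"
      by (rule lebesgue_integrable_real_affine[OF \<phi>i]) (use r in auto)
    have "min 1 d = (\<integral>w. indicator {1..2::real} w * min 1 d \<partial>lebesgue)" by simp
    also have "\<dots> \<le> (\<integral>w. \<phi> x (0 + r * w) + \<phi> (r * x) w \<partial>lebesgue)" by (rule integral_mono[OF _ _ pt])
        (auto intro!: integrable_mult_left integrable_real_indicator Bochner_Integration.integrable_add \<phi>i \<phi>ri simp del: add_0)
    also have "\<dots> = (\<integral>w. \<phi> x (0 + r * w) \<partial>lebesgue) + I (r * x)"
      unfolding I_def by (rule Bochner_Integration.integral_add[OF \<phi>ri \<phi>i])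
    also have "(\<integral>w. \<phi> x (0 + r * w) \<partial>lebesgue) \<le> r * (\<integral>w. \<phi> x (0 + r * w) \<partial>lebesgue)"
      using r by (intro mult_right_mono[of 1 r, simplified] integral_nonneg_AE) (auto simp: \<phi>_def)
    also have "\<dots> = I x" unfolding I_def using lebesgue_integral_real_affine[of r "\<phi> x" 0] r by simp
    finally have "min 1 d \<le> I x + I (r * x)" by simp
    then have "min 1 d \<le> \<eta>'" using X0[of x] X0[of "r * x"] rx x by auto
    then show "\<bar>ln (l (r * x)) - ln (l x)\<bar> \<le> \<eta>" using \<eta>' by (auto simp: d_def)
  qed
qed

text \<open>A factor of up to 4 is reached through an intermediate point \<open>z\<close> by two
  factors of at most 2, each costing half of \<open>ln (1 + \<eta>)\<close>.\<close>

lemma slowly_varying_ratio: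
  assumes sv: "slowly_varying l" and \<eta>: "0 < \<eta>"
  shows "\<exists>X\<ge>1. \<forall>x\<ge>X. \<forall>y. x \<le> y \<and> y \<le> 4 * x \<longrightarrow> 0 < l x \<and> l y \<le> (1 + \<eta>) * l x \<and> l x \<le> (1 + \<eta>) * l y"
proof -
  obtain X where X: "X \<ge> 1" "\<And>x r. X \<le> x \<Longrightarrow> 0 < l x"
    "\<And>x r. X \<le> x \<Longrightarrow> r \<in> {1..2} \<Longrightarrow> \<bar>ln (l (r * x)) - ln (l x)\<bar> \<le> ln (1 + \<eta>) / 2"
    using slowly_varying_uniform[OF sv, of "ln (1 + \<eta>) / 2"] \<eta> by auto
  show ?thesis
  proof (intro exI[of _ X] conjI allI impI, fact)
    fix x y assume x: "X \<le> x" and y: "x \<le> y \<and> y \<le> 4 * x"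
    have x1: "x \<ge> 1" using X x by simp
    define z where "z = min y (2 * x)"
    have z: "x \<le> z" "z \<le> y" "z / x \<in> {1..2}" "y / z \<in> {1..2}" using y x1 by (auto simp: z_def min_def field_simps)
    have "\<bar>ln (l z) - ln (l x)\<bar> \<le> ln (1 + \<eta>) / 2" using X(3)[OF x z(3)] x1 by simp
    moreover have "\<bar>ln (l y) - ln (l z)\<bar> \<le> ln (1 + \<eta>) / 2" using X(3)[of z "y / z"] z x x1 by simp
    ultimately have "\<bar>ln (l y) - ln (l x)\<bar> \<le> ln (1 + \<eta>)" by linarith
    moreover have "0 < l x" "0 < l y" using X(2) x y by auto
    ultimately have "ln (l y) \<le> ln ((1 + \<eta>) * l x)" "ln (l x) \<le> ln ((1 + \<eta>) * l y)" using \<eta> by (auto simp: ln_mult)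
    then show "0 < l x" "l y \<le> (1 + \<eta>) * l x" "l x \<le> (1 + \<eta>) * l y"
      using \<open>0 < l x\<close> \<open>0 < l y\<close> \<eta> by (subst (asm) ln_le_cancel_iff; auto intro!: mult_pos_pos)+
  qed
qed

section \<open>The scale function of FR1 and FR2\<close>

context
  fixes l :: "real \<Rightarrow> real"
  assumes scale: "FR_scale l"
begin

lemma FR_pos: "0 < x \<Longrightarrow> 0 < l x" using scale by (auto simp: FR_scale_def)

lemma FR_sv: "slowly_varying l" using scale by (auto simp: FR_scale_def)

text \<open>The discrete counterpart of \<open>L(n)\<close>.\<close>

definition "FR_sum n = (\<Sum>k\<in>{1..<n}. (l (real k))\<^sup>2 / real k)"

lemma FR_ratio:
  assumes "0 < \<eta>"
  obtains K :: nat where "1 \<le> K"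
    "\<And>k m. K \<le> k \<Longrightarrow> k \<le> m \<Longrightarrow> m \<le> 4 * k \<Longrightarrow> l (real m) \<le> (1 + \<eta>) * l (real k) \<and> l (real k) \<le> (1 + \<eta>) * l (real m)"
proof -
  obtain X where X: "X \<ge> 1" "\<And>x y. X \<le> x \<Longrightarrow> x \<le> y \<Longrightarrow> y \<le> 4 * x \<Longrightarrow> l y \<le> (1 + \<eta>) * l x \<and> l x \<le> (1 + \<eta>) * l y"
    using slowly_varying_ratio[OF FR_sv assms] by auto
  show ?thesis
  proof (rule that[of "nat \<lceil>X\<rceil>"])
    show "1 \<le> nat \<lceil>X\<rceil>" using X(1) by linarith
    fix k m :: nat assume "nat \<lceil>X\<rceil> \<le> k" "k \<le> m" "m \<le> 4 * k"
    then show "l (real m) \<le> (1 + \<eta>) * l (real k) \<and> l (real k) \<le> (1 + \<eta>) * l (real m)"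
      by (intro X(2)) linarith+
  qed
qed

text \<open>On the interval from \<open>n\<close> to \<open>n + 1\<close> the function
  \<open>l\<close> is at most twice its value at \<open>n\<close>, so the integral grows by at most
  four times the summand.\<close>

lemma FR_sum_at_top: "filterlim FR_sum at_top sequentially"
proof -
  define G where "G n = (LINT x:{1..real n}|lebesgue. (l x)\<^sup>2 / x)" for n :: nat
  have G: "filterlim G at_top sequentially" using scale unfolding FR_scale_def G_def by blast
  obtain X where X: "X \<ge> 1" "\<And>x y. X \<le> x \<Longrightarrow> x \<le> y \<Longrightarrow> y \<le> 4 * x \<Longrightarrow> l y \<le> (1 + 1) * l x \<and> l x \<le> (1 + 1) * l y"
    using slowly_varying_ratio[OF FR_sv, of 1] by auto
  have "\<forall>\<^sub>F n in sequentially. 0 < G n" using G by (auto simp: filterlim_at_top_dense)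
  then obtain N0 where N0: "\<And>n. N0 \<le> n \<Longrightarrow> 0 < G n" by (auto simp: eventually_sequentially)
  define N where "N = max N0 (nat \<lceil>X\<rceil>)"
  have step: "G (Suc n) \<le> G n + 4 * ((l (real n))\<^sup>2 / real n)" if n: "N \<le> n" for n
  proof -
    have nX: "X \<le> real n" "1 \<le> real n" using n X(1) unfolding N_def by linarith+
    \<comment> \<open>A divergent integral would have the default value 0, against the positivity of
      \<open>G\<close> for large arguments.\<close>
    have i: "set_integrable lebesgue {1..real (Suc n)} (\<lambda>x. (l x)\<^sup>2 / x)"
    proof (rule ccontr)
      assume "\<not> ?thesis"
      then have "G (Suc n) = 0"
        unfolding G_def set_lebesgue_integral_def set_integrable_def by (rule not_integrable_integral_eq)
      then show False using N0[of "Suc n"] n by (auto simp: N_def)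
    qed
    have u: "{1..real (Suc n)} = {1..real n} \<union> {real n<..real (Suc n)}" using nX by auto
    have i1: "set_integrable lebesgue {1..real n} (\<lambda>x. (l x)\<^sup>2 / x)" by (rule set_integrable_subset[OF i]) auto
    have i2: "set_integrable lebesgue {real n<..real (Suc n)} (\<lambda>x. (l x)\<^sup>2 / x)"
      by (rule set_integrable_subset[OF i]) (use nX in auto)
    have "G (Suc n) = G n + (LINT x:{real n<..real (Suc n)}|lebesgue. (l x)\<^sup>2 / x)"
      unfolding G_def u by (rule set_integral_Un[OF _ i1 i2]) auto
    also have "(LINT x:{real n<..real (Suc n)}|lebesgue. (l x)\<^sup>2 / x)
      \<le> (LINT x:{real n<..real (Suc n)}|lebesgue. 4 * ((l (real n))\<^sup>2 / real n))"
    proof (rule set_integral_mono[OF i2])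
      show "set_integrable lebesgue {real n<..real (Suc n)} (\<lambda>x. 4 * ((l (real n))\<^sup>2 / real n))"
        unfolding set_integrable_def by (intro integrable_scaleR_left integrable_real_indicator) auto
      fix x assume x: "x \<in> {real n<..real (Suc n)}"
      have "l x \<le> (1 + 1) * l (real n)" using X(2)[of "real n" x] nX x by auto
      then have "(l x)\<^sup>2 \<le> (2 * l (real n))\<^sup>2" using FR_pos[of x] x nX by (intro power_mono) auto
      then show "(l x)\<^sup>2 / x \<le> 4 * ((l (real n))\<^sup>2 / real n)"
        using x nX frac_le[of "4 * (l (real n))\<^sup>2" "(l x)\<^sup>2" "real n" x] by (simp add: power_mult_distrib)
    qed
    also have "\<dots> = 4 * ((l (real n))\<^sup>2 / real n)" by (simp add: set_lebesgue_integral_def)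
    finally show ?thesis by simp
  qed
  have N1: "1 \<le> N" using X(1) unfolding N_def by linarith
  have bound: "G n \<le> G N + 4 * FR_sum n" if "N \<le> n" for n using that
  proof (induction n rule: dec_induct)
    case base
    have "0 \<le> FR_sum N" unfolding FR_sum_def by (intro sum_nonneg) auto
    then show ?case by simp
  next
    case (step n)
    have "FR_sum (Suc n) = FR_sum n + (l (real n))\<^sup>2 / real n"
      unfolding FR_sum_def using step N1 by (subst sum.atLeastLessThan_Suc) auto
    then show ?case using step \<open>\<And>n. N \<le> n \<Longrightarrow> G (Suc n) \<le> G n + 4 * ((l (real n))\<^sup>2 / real n)\<close>[of n] by auto
  qed
  show ?thesis unfolding filterlim_at_top
  proof
    fix Z
    have "\<forall>\<^sub>F n in sequentially. G N + 4 * Z \<le> G n" using G by (auto simp: filterlim_at_top)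
    then show "\<forall>\<^sub>F n in sequentially. Z \<le> FR_sum n"
      using eventually_ge_at_top[of N] by eventually_elim (use bound in fastforce)
  qed
qed

text \<open>\<open>l(n)^2\<close> is negligible against the sum: every dyadic block not far below
  \<open>n\<close> contributes at least a fixed multiple of it, and the number of such blocks is
  unbounded. Each induction step adds one block.\<close>

lemma FR_sum_dominates: "\<exists>N\<ge>1. \<forall>n\<ge>N. real j / 4 * (l (real n))\<^sup>2 \<le> FR_sum n"
proof (induction j)
  case 0
  have "0 \<le> FR_sum n" for n unfolding FR_sum_def by (intro sum_nonneg) auto
  then show ?case by auto
next
  case (Suc j)
  then obtain N where N: "N \<ge> 1" "\<And>n. N \<le> n \<Longrightarrow> real j / 4 * (l (real n))\<^sup>2 \<le> FR_sum n" by auto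
  \<comment> \<open>The block from \<open>n / 2\<close> to \<open>n\<close> adds
    \<open>1 / 2\<close> to \<open>j / 4\<close>. The loss \<open>q\<close> through the variation of
    \<open>l\<close> is chosen so that \<open>(j + 2) / 4 / q = (j + 1) / 4\<close>.\<close>
  define q where "q = (real j + 2) / (real j + 1)"
  have q: "q > 1" by (simp add: q_def field_simps)
  obtain K where K: "1 \<le> K" "\<And>k m. K \<le> k \<Longrightarrow> k \<le> m \<Longrightarrow> m \<le> 4 * k \<Longrightarrow> l (real m) \<le> (1 + (sqrt q - 1)) * l (real k) \<and> l (real k) \<le> (1 + (sqrt q - 1)) * l (real m)"
    using FR_ratio[of "sqrt q - 1"] q by auto
  show ?case
  proof (intro exI[of _ "2 * max N K"] conjI allI impI)
    show "1 \<le> 2 * max N K" using N(1) by simp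
    fix n assume n: "2 * max N K \<le> n"
    define m where "m = n div 2"
    have m: "N \<le> m" "K \<le> m" "m \<le> n" "n \<le> 4 * m" "1 \<le> m" "n \<le> 2 * (n - m)" using n N K unfolding m_def by linarith+
    have up: "(l (real n))\<^sup>2 / q \<le> (l (real k))\<^sup>2" if k: "m \<le> k" "k \<le> n" for k
    proof -
      have "l (real n) \<le> sqrt q * l (real k)" using K(2)[of k n] k m by auto
      then have "(l (real n))\<^sup>2 \<le> (sqrt q * l (real k))\<^sup>2"
        using FR_pos[of "real n"] m by (intro power_mono) auto
      then show ?thesis using q by (simp add: power_mult_distrib field_simps)
    qed
    have "FR_sum n = FR_sum m + (\<Sum>k\<in>{m..<n}. (l (real k))\<^sup>2 / real k)"
      unfolding FR_sum_def using m by (subst sum.atLeastLessThan_concat) auto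
    moreover have "(\<Sum>k\<in>{m..<n}. (l (real k))\<^sup>2 / real k) \<ge> (\<Sum>k\<in>{m..<n}. (l (real n))\<^sup>2 / q / real n)"
      using up m q by (intro sum_mono frac_le) auto
    moreover have "(\<Sum>k\<in>{m..<n}. (l (real n))\<^sup>2 / q / real n) = ((l (real n))\<^sup>2 / q) * (real (n - m) / real n)" by simp
    moreover have "((l (real n))\<^sup>2 / q) * (real (n - m) / real n) \<ge> ((l (real n))\<^sup>2 / q) * (1 / 2)"
      using m q by (intro mult_left_mono) (auto simp: field_simps)
    moreover have "FR_sum m \<ge> real j / 4 * ((l (real n))\<^sup>2 / q)"
      using N(2)[of m] m up[of m] mult_left_mono[of "(l (real n))\<^sup>2 / q" "(l (real m))\<^sup>2" "real j / 4"] by linarith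
    ultimately have "FR_sum n \<ge> (real j / 4 + 1 / 2) * ((l (real n))\<^sup>2 / q)" by (simp add: algebra_simps)
    also have "(real j / 4 + 1 / 2) * ((l (real n))\<^sup>2 / q) = real (Suc j) / 4 * (l (real n))\<^sup>2"
      unfolding q_def by (simp add: field_simps)
    finally show "real (Suc j) / 4 * (l (real n))\<^sup>2 \<le> FR_sum n" .
  qed
qed

end

section \<open>The weights of the array\<close>

lemma nonneg_suminf_le:
  fixes f :: "nat \<Rightarrow> real"
  assumes "\<And>k. 0 \<le> f k" "\<And>K. (\<Sum>k<K. f k) \<le> B"
  shows "summable f" "suminf f \<le> B"
proof -
  show "summable f" using assms by (rule summableI_nonneg_bounded)
  then show "suminf f \<le> B" using assms(2) by (rule suminf_le_const)
qed

text \<open>The convolution of \<open>c\<close> with the weights \<open>p\<close> cut off at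
  \<open>t\<close>: the weight at lag \<open>k\<close> in the variable at time
  \<open>t\<close>.\<close>

definition coef :: "(nat \<Rightarrow> real) \<Rightarrow> (nat \<Rightarrow> real) \<Rightarrow> nat \<Rightarrow> nat \<Rightarrow> real" where
  "coef p c t k = (\<Sum>j\<le>k. (if j < t then p j else 0) * c (k - j))"

lemma summable_coef:
  assumes "summable (\<lambda>i. \<bar>c i\<bar>)"
  shows "summable (\<lambda>k. \<bar>coef p c t k\<bar>)"
proof (rule summable_comparison_test')
  have "summable (\<lambda>j. norm (if j < t then p j else 0))" by (rule summable_finite[of "{..<t}"]) auto
  then show "summable (\<lambda>k. \<Sum>j\<le>k. \<bar>if j < t then p j else 0\<bar> * \<bar>c (k - j)\<bar>)"
    using assms by (intro summable_Cauchy_product) auto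
  show "norm \<bar>coef p c t k\<bar> \<le> (\<Sum>j\<le>k. \<bar>if j < t then p j else 0\<bar> * \<bar>c (k - j)\<bar>)" for k
    unfolding coef_def real_norm_def abs_idempotent by (rule order_trans[OF sum_abs]) (simp add: abs_mult)
qed

lemma coef_lag: "k < t \<Longrightarrow> t \<le> n \<Longrightarrow> coef p c t k = coef p c n k" unfolding coef_def by (intro sum.cong) auto

lemma coef_bound:
  assumes c: "summable (\<lambda>i. \<bar>c i\<bar>)" and p: "\<And>j. \<bar>p j\<bar> \<le> B"
  shows "\<bar>coef p c t k\<bar> \<le> B * (\<Sum>i. \<bar>c i\<bar>)"
proof -
  have B: "0 \<le> B" using p[of 0] by linarith
  have "\<bar>coef p c t k\<bar> \<le> (\<Sum>j<Suc k. B * \<bar>c (Suc k - Suc j)\<bar>)" unfolding coef_def lessThan_Suc_atMost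
    by (rule order_trans[OF sum_abs]) (use p B in \<open>auto intro!: sum_mono mult_right_mono simp: abs_mult\<close>)
  also have "\<dots> = (\<Sum>i<Suc k. B * \<bar>c i\<bar>)" by (rule sum.nat_diff_reindex)
  also have "\<dots> \<le> B * (\<Sum>i. \<bar>c i\<bar>)"
    unfolding sum_distrib_left[symmetric] by (intro mult_left_mono B sum_le_suminf c) auto
  finally show ?thesis .
qed

lemma sum_shift_le:
  fixes r :: "nat \<Rightarrow> real"
  assumes "\<And>m. 0 \<le> r m" "\<And>m. t \<le> m \<Longrightarrow> r m = 0"
  shows "(\<Sum>k<K. if i \<le> k then r (k - i) else 0) \<le> (\<Sum>m<t. r m)"
proof -
  have "(\<Sum>k<K. if i \<le> k then r (k - i) else 0) = (\<Sum>m<K - i. r m)" by (induction K) (auto simp: Suc_diff_le)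
  also have "\<dots> \<le> (\<Sum>m<max (K - i) t. r m)" using assms by (intro sum_mono2) auto
  also have "\<dots> = (\<Sum>m<t. r m)" using assms by (intro sum.mono_neutral_right) auto
  finally show ?thesis .
qed

text \<open>Cauchy-Schwarz with \<open>c i\<close> split into \<open>sqrt |c i|\<close> and
  \<open>sgn (c i) * sqrt |c i|\<close>, for partial sums and then in the limit.\<close>

lemma weighted_series_square_le:
  fixes c y :: "nat \<Rightarrow> real"
  assumes c: "summable (\<lambda>i. \<bar>c i\<bar>)" and y: "\<And>i. \<bar>y i\<bar> \<le> Y"
  shows "summable (\<lambda>i. c i * y i)" "summable (\<lambda>i. \<bar>c i\<bar> * (y i)\<^sup>2)"
    and "(\<Sum>i. c i * y i)\<^sup>2 \<le> (\<Sum>i. \<bar>c i\<bar>) * (\<Sum>i. \<bar>c i\<bar> * (y i)\<^sup>2)"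
proof -
  show s1: "summable (\<lambda>i. c i * y i)"
    by (rule summable_comparison_test'[OF summable_mult2[OF c, of Y]]) (auto simp: abs_mult intro!: mult_left_mono y)
  have y2: "(y i)\<^sup>2 \<le> Y\<^sup>2" for i using power_mono[OF y[of i], of 2] by simp
  show s2: "summable (\<lambda>i. \<bar>c i\<bar> * (y i)\<^sup>2)"
    by (rule summable_comparison_test'[OF summable_mult2[OF c, of "Y\<^sup>2"]]) (auto simp: abs_mult intro!: mult_left_mono y2)
  have fin: "(\<Sum>i<m. c i * y i)\<^sup>2 \<le> (\<Sum>i<m. \<bar>c i\<bar>) * (\<Sum>i<m. \<bar>c i\<bar> * (y i)\<^sup>2)" for m
  proof -
    have "c i * y i = sqrt \<bar>c i\<bar> * (sgn (c i) * sqrt \<bar>c i\<bar> * y i)" for i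
    proof -
      have "sqrt \<bar>c i\<bar> * (sgn (c i) * sqrt \<bar>c i\<bar> * y i) = (sqrt \<bar>c i\<bar> * sqrt \<bar>c i\<bar>) * sgn (c i) * y i" by (simp only: mult_ac)
      also have "\<dots> = c i * y i" by (simp add: abs_mult_sgn)
      finally show ?thesis by (rule sym)
    qed
    then have "(\<Sum>i<m. c i * y i)\<^sup>2 = (\<Sum>i<m. sqrt \<bar>c i\<bar> * (sgn (c i) * sqrt \<bar>c i\<bar> * y i))\<^sup>2"
      by (intro arg_cong[where f = "\<lambda>z. z\<^sup>2"] sum.cong refl)
    also have "\<dots> \<le> (\<Sum>i<m. (sqrt \<bar>c i\<bar>)\<^sup>2) * (\<Sum>i<m. (sgn (c i) * sqrt \<bar>c i\<bar> * y i)\<^sup>2)"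
      by (rule Cauchy_Schwarz_ineq_sum)
    also have "(\<lambda>i. (sgn (c i) * sqrt \<bar>c i\<bar> * y i)\<^sup>2) = (\<lambda>i. \<bar>c i\<bar> * (y i)\<^sup>2)"
      by (auto simp: power_mult_distrib sgn_if)
    finally show ?thesis by simp
  qed
  show "(\<Sum>i. c i * y i)\<^sup>2 \<le> (\<Sum>i. \<bar>c i\<bar>) * (\<Sum>i. \<bar>c i\<bar> * (y i)\<^sup>2)"
    by (rule LIMSEQ_le[OF tendsto_power[OF summable_LIMSEQ[OF s1]] tendsto_mult[OF summable_LIMSEQ[OF c] summable_LIMSEQ[OF s2]]])
      (use fin in blast)
qed

text \<open>A filter with absolutely summable weights \<open>c\<close> acts on a sequence whose increments are small
  in \<open>\<ell>\<^sup>2\<close> almost like multiplication by \<open>\<Sum>c\<close>.\<close>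

lemma coef_minus_multiple_small:
  assumes c: "summable (\<lambda>i. \<bar>c i\<bar>)" and \<eta>: "0 < \<eta>"
  shows "\<exists>e>0. \<forall>p t. (\<Sum>k\<le>t. ((if k = 0 then 0 else p (k - 1)) - (if k < t then p k else 0))\<^sup>2) \<le> e * (\<Sum>k<t. (p k)\<^sup>2) \<longrightarrow>
    summable (\<lambda>k. (coef p c t k - suminf c * (if k < t then p k else 0))\<^sup>2) \<and>
    (\<Sum>k. (coef p c t k - suminf c * (if k < t then p k else 0))\<^sup>2) \<le> \<eta> * (\<Sum>k<t. (p k)\<^sup>2)"
proof -
  define N where "N = (\<Sum>i. \<bar>c i\<bar>)"
  have N0: "0 \<le> N" unfolding N_def by (rule suminf_nonneg[OF c]) simp
  have "(\<lambda>m. \<Sum>i. \<bar>c (i + m)\<bar>) \<longlonglongrightarrow> 0" using suminf_exist_split2[OF c] by simp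
  then have "\<forall>\<^sub>F m in sequentially. (\<Sum>i. \<bar>c (i + m)\<bar>) < \<eta> / (8 * (N + 1))"
    using \<eta> N0 by (intro order_tendstoD) auto
  \<comment> \<open>Delays from \<open>m\<close> on have a small total weight and will be estimated
    crudely by \<open>4 * W\<close>.\<close>
  then obtain m where m: "(\<Sum>i. \<bar>c (i + m)\<bar>) < \<eta> / (8 * (N + 1))" by (auto simp: eventually_sequentially)
  \<comment> \<open>The distances of the first \<open>m\<close> delays grow like \<open>2^i\<close>;
    this \<open>e\<close> limits their cost to half of \<open>\<eta> * W\<close>.\<close>
  define e where "e = \<eta> / (2 * (N + 1) * (N + 1) * 2 ^ (m + 1))"
  show ?thesis
  proof (intro exI[of _ e] conjI allI impI)
    show "0 < e" using \<eta> N0 by (simp add: e_def)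
    fix p :: "nat \<Rightarrow> real" and t
    define W where "W = (\<Sum>k<t. (p k)\<^sup>2)"
    \<comment> \<open>\<open>q\<close> is \<open>p\<close> extended by 0 beyond the cutoff,
      \<open>s i\<close> its delay by \<open>i\<close>, and \<open>r\<close> the squared increments,
      including those at both ends.\<close>
    define q where "q k = (if k < t then p k else 0)" for k
    define s where "s i k = (if i \<le> k then q (k - i) else 0)" for i k
    define r where "r k = (s 1 k - q k)\<^sup>2" for k
    assume "(\<Sum>k\<le>t. ((if k = 0 then 0 else p (k - 1)) - (if k < t then p k else 0))\<^sup>2) \<le> e * (\<Sum>k<t. (p k)\<^sup>2)"
    also have "(\<Sum>k\<le>t. ((if k = 0 then 0 else p (k - 1)) - (if k < t then p k else 0))\<^sup>2) = (\<Sum>k<Suc t. r k)"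
      unfolding lessThan_Suc_atMost by (intro sum.cong) (auto simp: r_def s_def q_def)
    finally have \<delta>: "(\<Sum>k<Suc t. r k) \<le> e * W" by (simp add: W_def)
    have W0: "0 \<le> W" by (simp add: W_def sum_nonneg)
    have Wq: "W = (\<Sum>k<t. (q k)\<^sup>2)" by (simp add: W_def q_def)
    obtain Y where Y: "\<And>k. \<bar>q k\<bar> \<le> Y"
    proof (rule that)
      fix k show "\<bar>q k\<bar> \<le> (\<Sum>j<t. \<bar>p j\<bar>)"
      proof (cases "k < t")
        case True
        then show ?thesis using member_le_sum[of k "{..<t}" "\<lambda>j. \<bar>p j\<bar>"] by (simp add: q_def)
      qed (simp add: q_def sum_nonneg)
    qed
    have Y0: "0 \<le> Y" using Y[of 0] by linarith
    have y: "\<bar>s i k - q k\<bar> \<le> 2 * Y" for i k using Y[of k] Y[of "k - i"] Y0 by (auto simp: s_def abs_le_iff)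
    have conv: "coef p c t k - suminf c * q k = (\<Sum>i. c i * (s i k - q k))" for k
    proof -
      have "coef p c t k = (\<Sum>j<Suc k. q j * c (k - j))" by (simp add: coef_def q_def lessThan_Suc_atMost)
      also have "\<dots> = (\<Sum>j<Suc k. q (k - (Suc k - Suc j)) * c (Suc k - Suc j))" by (intro sum.cong) auto
      also have "\<dots> = (\<Sum>i<Suc k. q (k - i) * c i)" by (rule sum.nat_diff_reindex[of "\<lambda>i. q (k - i) * c i"])
      also have "\<dots> = (\<Sum>i<Suc k. c i * s i k)" by (intro sum.cong) (auto simp: s_def)
      also have "\<dots> = (\<Sum>i. c i * s i k)" by (rule suminf_finite[symmetric]) (auto simp: s_def)
      finally have "coef p c t k = (\<Sum>i. c i * s i k)" .
      moreover have "summable (\<lambda>i. c i * s i k)" by (rule summable_finite[of "{..k}"]) (auto simp: s_def)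
      moreover have "summable c" using c by (rule summable_rabs_cancel)
      ultimately show ?thesis by (simp add: right_diff_distrib suminf_diff suminf_mult2 summable_mult2)
    qed
    note ws = weighted_series_square_le[OF c y]
    have part: "(\<Sum>k<K. (coef p c t k - suminf c * q k)\<^sup>2) \<le> \<eta> * W" for K
    proof -
      define D where "D i = (\<Sum>k<K. (s i k - q k)\<^sup>2)" for i
      have sq: "(a - b)\<^sup>2 \<le> 2 * a\<^sup>2 + 2 * b\<^sup>2" for a b :: real
        using zero_le_power2[of "a + b"] by (simp add: power2_eq_square algebra_simps)
      have D4: "D i \<le> 4 * W" for i
      proof -
        have S: "(\<Sum>k<K. (s j k)\<^sup>2) \<le> W" for j
        proof -
          have "(\<Sum>k<K. (s j k)\<^sup>2) = (\<Sum>k<K. if j \<le> k then (q (k - j))\<^sup>2 else 0)" by (intro sum.cong) (auto simp: s_def)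
          also have "\<dots> \<le> W" unfolding Wq by (rule sum_shift_le) (auto simp: q_def)
          finally show ?thesis .
        qed
        have "q = s 0" by (auto simp: s_def)
        have "D i \<le> (\<Sum>k<K. 2 * (s i k)\<^sup>2 + 2 * (q k)\<^sup>2)" unfolding D_def by (intro sum_mono sq)
        also have "\<dots> = 2 * (\<Sum>k<K. (s i k)\<^sup>2) + 2 * (\<Sum>k<K. (q k)\<^sup>2)" by (simp add: sum.distrib sum_distrib_left)
        also have "\<dots> \<le> 4 * W" using S[of i] S[of 0] unfolding \<open>q = s 0\<close> by linarith
        finally show ?thesis .
      qed
      \<comment> \<open>One more unit of delay gives
        \<open>D (i + 1) \<le> 2 * (e * W) + 2 * D i\<close>, which is solved by the factor
        \<open>2^(i + 1) - 2\<close>.\<close>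
      have Dd: "D i \<le> (2 ^ (i + 1) - 2) * (e * W)" for i
      proof (induction i)
        case (Suc i)
        have "(\<Sum>k<K. (s (Suc i) k - s i k)\<^sup>2) = (\<Sum>k<K. if i \<le> k then r (k - i) else 0)"
        proof (intro sum.cong refl)
          fix k show "(s (Suc i) k - s i k)\<^sup>2 = (if i \<le> k then r (k - i) else 0)"
            by (cases "k = i") (auto simp: s_def r_def)
        qed
        also have "\<dots> \<le> (\<Sum>k<Suc t. r k)" by (rule sum_shift_le) (auto simp: r_def s_def q_def)
        finally have i: "(\<Sum>k<K. (s (Suc i) k - s i k)\<^sup>2) \<le> e * W" using \<delta> by linarith
        have "D (Suc i) \<le> (\<Sum>k<K. 2 * (s (Suc i) k - s i k)\<^sup>2 + 2 * (s i k - q k)\<^sup>2)" unfolding D_def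
        proof (intro sum_mono)
          fix k show "(s (Suc i) k - q k)\<^sup>2 \<le> 2 * (s (Suc i) k - s i k)\<^sup>2 + 2 * (s i k - q k)\<^sup>2"
            using sq[of "s (Suc i) k - s i k" "q k - s i k"] by (simp add: power2_commute)
        qed
        also have "\<dots> = 2 * (\<Sum>k<K. (s (Suc i) k - s i k)\<^sup>2) + 2 * D i" by (simp add: D_def sum.distrib sum_distrib_left)
        also have "\<dots> \<le> 2 * (e * W) + 2 * ((2 ^ (i + 1) - 2) * (e * W))" using i Suc.IH by linarith
        also have "\<dots> = (2 ^ (Suc i + 1) - 2) * (e * W)" by (simp add: algebra_simps)
        finally show ?case .
      qed (simp add: D_def s_def)
      have eW: "0 \<le> e * W" using \<open>0 < e\<close> W0 by simp
      have sD: "summable (\<lambda>i. \<bar>c i\<bar> * D i)" by (rule summable_comparison_test'[OF summable_mult2[OF c, of "4 * W"]])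
          (auto simp: abs_mult D_def sum_nonneg intro!: mult_left_mono D4[unfolded D_def])
      have "(\<Sum>k<K. (coef p c t k - suminf c * q k)\<^sup>2) \<le> (\<Sum>k<K. N * (\<Sum>i. \<bar>c i\<bar> * (s i k - q k)\<^sup>2))"
        unfolding conv N_def by (intro sum_mono ws)
      also have "\<dots> = N * (\<Sum>i. \<Sum>k<K. \<bar>c i\<bar> * (s i k - q k)\<^sup>2)"
        by (subst suminf_sum) (auto intro: ws simp: sum_distrib_left)
      also have "\<dots> = N * (\<Sum>i. \<bar>c i\<bar> * D i)" by (simp add: D_def sum_distrib_left)
      also have "(\<Sum>i. \<bar>c i\<bar> * D i) = (\<Sum>i. \<bar>c (i + m)\<bar> * D (i + m)) + (\<Sum>i<m. \<bar>c i\<bar> * D i)"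
        by (rule suminf_split_initial_segment[OF sD])
      also have "(\<Sum>i. \<bar>c (i + m)\<bar> * D (i + m)) \<le> (\<Sum>i. \<bar>c (i + m)\<bar> * (4 * W))"
        using sD c by (intro suminf_le mult_left_mono D4 summable_mult2)
          (auto simp: summable_iff_shift[of "\<lambda>i. \<bar>c i\<bar>"] summable_iff_shift[of "\<lambda>i. \<bar>c i\<bar> * D i"])
      also have "\<dots> = (\<Sum>i. \<bar>c (i + m)\<bar>) * (4 * W)"
        using c by (intro suminf_mult2[symmetric]) (auto simp: summable_iff_shift[of "\<lambda>i. \<bar>c i\<bar>"])
      also have "\<dots> \<le> \<eta> / (8 * (N + 1)) * (4 * W)" using m W0 by (intro mult_right_mono) auto
      also have "(\<Sum>i<m. \<bar>c i\<bar> * D i) \<le> (\<Sum>i<m. \<bar>c i\<bar> * (2 ^ (m + 1) * (e * W)))"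
      proof (intro sum_mono mult_left_mono)
        fix i assume "i \<in> {..<m}"
        then have "(2::real) ^ (i + 1) \<le> 2 ^ (m + 1)" using power_increasing[of "i + 1" "m + 1" "2::real"] by auto
        then have "(2 ^ (i + 1) - 2) * (e * W) \<le> 2 ^ (m + 1) * (e * W)" using eW by (intro mult_right_mono) linarith+
        then show "D i \<le> 2 ^ (m + 1) * (e * W)" using Dd[of i] by linarith
      qed simp
      also have "\<dots> = (\<Sum>i<m. \<bar>c i\<bar>) * (2 ^ (m + 1) * (e * W))" by (simp add: sum_distrib_right)
      also have "\<dots> \<le> N * (2 ^ (m + 1) * (e * W))"
        unfolding N_def using eW by (intro mult_right_mono sum_le_suminf c) auto
      finally have "(\<Sum>k<K. (coef p c t k - suminf c * q k)\<^sup>2) \<le> N * (\<eta> / (8 * (N + 1)) * (4 * W) + N * (2 ^ (m + 1) * (e * W)))"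
        using N0 by (simp add: mult_left_mono)
      also have "\<dots> \<le> (N + 1) * (\<eta> / (8 * (N + 1)) * (4 * W) + (N + 1) * (2 ^ (m + 1) * (e * W)))"
        using N0 eW W0 \<eta> less_imp_le[OF \<open>0 < e\<close>] by (intro mult_mono add_mono mult_right_mono add_nonneg_nonneg mult_nonneg_nonneg) auto
      also have "\<dots> = \<eta> * W"
      proof -
        define z where "z = N + 1"
        have z: "z > 0" using N0 by (simp add: z_def)
        have e: "e = \<eta> / (2 * z * z * 2 ^ (m + 1))" by (simp add: e_def z_def)
        have "z * (\<eta> / (8 * z) * (4 * W)) = \<eta> * W / 2" using z by simp
        moreover have "z * (z * (2 ^ (m + 1) * (e * W))) = \<eta> * W / 2" unfolding e using z by simp
        ultimately show ?thesis unfolding z_def[symmetric] by (simp only: distrib_left)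
      qed
      finally show ?thesis .
    qed
    show "summable (\<lambda>k. (coef p c t k - suminf c * (if k < t then p k else 0))\<^sup>2)"
      "(\<Sum>k. (coef p c t k - suminf c * (if k < t then p k else 0))\<^sup>2) \<le> \<eta> * (\<Sum>k<t. (p k)\<^sup>2)"
      using nonneg_suminf_le[of "\<lambda>k. (coef p c t k - suminf c * q k)\<^sup>2", OF _ part] by (auto simp: q_def W_def)
  qed
qed

text \<open>From \<open>k0\<close> on the increments are small relative to the weights. The first
  \<open>k0\<close> increments, the initial jump and the drop at the cutoff are bounded one by one;
  the divergence of the sum of squares makes them negligible, which is where \<open>d0\<close> comes
  from.\<close>

lemma coef_smooth_remainder:
  assumes c: "summable (\<lambda>i. \<bar>c i\<bar>)" and B: "\<And>n j. 1 \<le> n \<Longrightarrow> \<bar>\<phi> n j\<bar> \<le> B"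
    and div: "\<And>R. \<exists>d0. \<forall>n t. d0 \<le> t \<longrightarrow> t \<le> n \<longrightarrow> R \<le> (\<Sum>k<t. (\<phi> n k)\<^sup>2)"
    and smooth: "\<And>e. 0 < e \<Longrightarrow> \<exists>k0. \<forall>n k. k0 \<le> n \<longrightarrow> k0 \<le> k \<longrightarrow> \<bar>\<phi> n (Suc k) - \<phi> n k\<bar> \<le> e * \<bar>\<phi> n k\<bar>"
    and \<eta>: "0 < \<eta>"
  shows "\<exists>d0\<ge>1. \<forall>n t. d0 \<le> t \<longrightarrow> t \<le> n \<longrightarrow>
    summable (\<lambda>k. (coef (\<phi> n) c t k - suminf c * (if k < t then \<phi> n k else 0))\<^sup>2) \<and>
    (\<Sum>k. (coef (\<phi> n) c t k - suminf c * (if k < t then \<phi> n k else 0))\<^sup>2) \<le> \<eta> * (\<Sum>k<t. (\<phi> n k)\<^sup>2)"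
proof -
  obtain e where e: "0 < e" and E: "\<And>p t. (\<Sum>k\<le>t. ((if k = 0 then 0 else p (k - 1)) - (if k < t then p k else 0))\<^sup>2) \<le> e * (\<Sum>k<t. (p k)\<^sup>2) \<longrightarrow>
    summable (\<lambda>k. (coef p c t k - suminf c * (if k < t then p k else 0))\<^sup>2) \<and>
    (\<Sum>k. (coef p c t k - suminf c * (if k < t then p k else 0))\<^sup>2) \<le> \<eta> * (\<Sum>k<t. (p k)\<^sup>2)"
    using coef_minus_multiple_small[OF c \<eta>] by blast
  define e' where "e' = sqrt (e / 2)"
  have e': "0 < e'" "e'\<^sup>2 = e / 2" using e by (auto simp: e'_def)
  obtain k0 where k0: "\<And>n k. k0 \<le> n \<Longrightarrow> k0 \<le> k \<Longrightarrow> \<bar>\<phi> n (Suc k) - \<phi> n k\<bar> \<le> e' * \<bar>\<phi> n k\<bar>" using smooth[OF e'(1)] by blast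
  \<comment> \<open>A bound for any squared increment of the weights cut off at
    \<open>t\<close>.\<close>
  define b where "b = 4 * B\<^sup>2"
  obtain d1 where d1: "\<And>n t. d1 \<le> t \<Longrightarrow> t \<le> n \<Longrightarrow> (b * real k0 + b + b) / (e / 2) \<le> (\<Sum>k<t. (\<phi> n k)\<^sup>2)" using div by blast
  show ?thesis
  proof (intro exI[of _ "max 1 (max k0 d1)"] conjI[OF max.cobounded1] allI impI)
    fix n t assume t: "max 1 (max k0 d1) \<le> t" and n: "t \<le> n"
    have n1: "1 \<le> n" "k0 \<le> n" using t n by auto
    define W where "W = (\<Sum>k<t. (\<phi> n k)\<^sup>2)"
    define q where "q k = (if k < t then \<phi> n k else 0)" for k
    have B2: "(\<phi> n j)\<^sup>2 \<le> B\<^sup>2" for j using power_mono[OF B[OF n1(1), of j], of 2] by simp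
    have q2: "(q j)\<^sup>2 \<le> B\<^sup>2" for j using B2 by (simp add: q_def)
    have b0: "0 \<le> b" by (simp add: b_def)
    have inc: "(q k - q (Suc k))\<^sup>2 \<le> e / 2 * (\<phi> n k)\<^sup>2 + ((if k < k0 then b else 0) + (if k = t - 1 then b else 0))" if "k < t" for k
    proof (cases "k0 \<le> k \<and> Suc k < t")
      case True
      then have "\<bar>q k - q (Suc k)\<bar> \<le> e' * \<bar>\<phi> n k\<bar>" using k0[OF n1(2), of k] by (simp add: q_def abs_minus_commute)
      then have "\<bar>q k - q (Suc k)\<bar>\<^sup>2 \<le> (e' * \<bar>\<phi> n k\<bar>)\<^sup>2" by (intro power_mono) auto
      then have "(q k - q (Suc k))\<^sup>2 \<le> e / 2 * (\<phi> n k)\<^sup>2" by (simp add: power_mult_distrib e')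
      then show ?thesis using b0 by (intro add_increasing2) auto
    next
      case False
      have "(q k - q (Suc k))\<^sup>2 \<le> 2 * (q k)\<^sup>2 + 2 * (q (Suc k))\<^sup>2"
        using zero_le_power2[of "q k + q (Suc k)"] by (simp add: power2_eq_square algebra_simps)
      then have "(q k - q (Suc k))\<^sup>2 \<le> b" using q2[of k] q2[of "Suc k"] by (simp add: b_def)
      moreover have "b \<le> (if k < k0 then b else 0) + (if k = t - 1 then b else 0)" using False that b0 by auto
      moreover have "0 \<le> e / 2 * (\<phi> n k)\<^sup>2" using e by simp
      ultimately show ?thesis by linarith
    qed
    have "(\<Sum>k\<le>t. ((if k = 0 then 0 else \<phi> n (k - 1)) - (if k < t then \<phi> n k else 0))\<^sup>2)
      = (q 0)\<^sup>2 + (\<Sum>k<t. (q k - q (Suc k))\<^sup>2)"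
      unfolding lessThan_Suc_atMost[symmetric] sum.lessThan_Suc_shift by (simp add: q_def)
    also have "\<dots> \<le> b + (\<Sum>k<t. e / 2 * (\<phi> n k)\<^sup>2 + ((if k < k0 then b else 0) + (if k = t - 1 then b else 0)))"
    proof (intro add_mono sum_mono inc)
      have "0 \<le> B\<^sup>2" by simp
      then show "(q 0)\<^sup>2 \<le> b" using q2[of 0] unfolding b_def by linarith
    qed simp
    also have "\<dots> = b + (e / 2 * W + ((\<Sum>k<t. if k < k0 then b else 0) + (\<Sum>k<t. if k = t - 1 then b else 0)))"
      by (simp add: sum.distrib W_def sum_distrib_left)
    also have "(\<Sum>k<t. if k < k0 then b else 0) \<le> b * real k0"
    proof -
      have "(\<Sum>k<t. if k < k0 then b else 0) = b * real (min t k0)"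
        by (induction t) (auto simp: min_def algebra_simps le_less_Suc_eq)
      then show ?thesis using b0 by (simp add: mult_left_mono)
    qed
    also have "(\<Sum>k<t. if k = t - 1 then b else 0) \<le> b" using b0 by simp
    also have "b + (e / 2 * W + (b * real k0 + b)) \<le> e * W"
      using d1[of t n] t n e by (simp add: W_def pos_divide_le_eq algebra_simps)
    finally show "summable (\<lambda>k. (coef (\<phi> n) c t k - suminf c * (if k < t then \<phi> n k else 0))\<^sup>2) \<and>
    (\<Sum>k. (coef (\<phi> n) c t k - suminf c * (if k < t then \<phi> n k else 0))\<^sup>2) \<le> \<eta> * (\<Sum>k<t. (\<phi> n k)\<^sup>2)"
      using E[of "\<phi> n" t] by (simp add: W_def)
  qed
qed

section \<open>Conditions on the weights and their consequences for the variance\<close>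

lemma sum_lessThan_add: "(\<Sum>k<m + n. v k) = (\<Sum>k<m. v k) + (\<Sum>k<n. v (k + m :: nat))"
  for v :: "nat \<Rightarrow> 'b :: comm_monoid_add" by (induction n) (simp_all add: ac_simps)

text \<open>The common ground of the three models. \<open>near\<close> compares the weights at short
  lags, whereas \<open>rem\<close> speaks of times proportional to \<open>n\<close>. In
  \<open>g_mass\<close> the ratio \<open>\<tau> / (1 - \<tau>)\<close> means that the innovations up
  to time 0 have the share \<open>\<tau>\<close> of the variance.\<close>

locale coef_array =
  fixes \<phi> :: "nat \<Rightarrow> nat \<Rightarrow> real" and c :: "nat \<Rightarrow> real" and f g :: "nat \<Rightarrow> nat \<Rightarrow> real" and B\<^sub>\<phi> B\<^sub>f \<tau> \<gamma> :: real
  assumes c_summable: "summable (\<lambda>i. \<bar>c i\<bar>)"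
    and \<phi>_bound: "1 \<le> n \<Longrightarrow> \<bar>\<phi> n j\<bar> \<le> B\<^sub>\<phi>"
    and f_bound: "1 \<le> n \<Longrightarrow> k < n \<Longrightarrow> \<bar>f n k\<bar> \<le> B\<^sub>f" and g_bound: "1 \<le> n \<Longrightarrow> k < n \<Longrightarrow> \<bar>g n k\<bar> \<le> B\<^sub>f"
    and \<tau>: "0 \<le> \<tau>" "\<tau> < 1" and \<gamma>: "0 \<le> \<gamma>" "\<gamma> < 1"
    and f_div: "\<exists>d0. \<forall>n t. d0 \<le> t \<longrightarrow> t \<le> n \<longrightarrow> R \<le> (\<Sum>k<t. (f n k)\<^sup>2)"
    and f_flat: "0 < \<delta> \<Longrightarrow> 0 < \<eta> \<Longrightarrow> \<forall>\<^sub>F n in sequentially. \<forall>t. \<delta> * real n \<le> real t \<longrightarrow> t \<le> n \<longrightarrow>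
      (1 - \<eta>) * (\<Sum>k<n. (f n k)\<^sup>2) \<le> (\<Sum>k<t. (f n k)\<^sup>2)"
    and f_growth: "\<exists>C d0. \<forall>n d. d0 \<le> d \<longrightarrow> d \<le> n \<longrightarrow>
      (\<Sum>k<n. (f n k)\<^sup>2) \<le> C * (\<Sum>k<d. (f n k)\<^sup>2) * (real n / real d) powr \<gamma>"
    and near: "\<exists>d0. \<forall>n d. d0 \<le> d \<longrightarrow> d \<le> n \<longrightarrow> (\<Sum>k<d. (f n k)\<^sup>2) \<le> 4 * (\<Sum>k<d. (coef (\<phi> n) c n k)\<^sup>2)"
    and rem: "0 < \<delta> \<Longrightarrow> 0 < \<eta> \<Longrightarrow> \<forall>\<^sub>F n in sequentially. \<forall>t. \<delta> * real n \<le> real t \<longrightarrow> 1 \<le> t \<longrightarrow> t \<le> n \<longrightarrow>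
      (\<Sum>k. (coef (\<phi> n) c t k - (if k < t then f n k else if k < t + n then g n (k - t) else 0))\<^sup>2) \<le> \<eta> * (\<Sum>k<n. (f n k)\<^sup>2)"
    and g_mass: "(\<lambda>n. (\<Sum>k<n. (g n k)\<^sup>2) / (\<Sum>k<n. (f n k)\<^sup>2)) \<longlonglongrightarrow> \<tau> / (1 - \<tau>)"
begin

definition "W n = (\<Sum>k<n. (f n k)\<^sup>2)"
definition "A n = (\<Sum>k. (coef (\<phi> n) c n k)\<^sup>2)"

lemma summable_coef_square: "summable (\<lambda>k. (coef p c t k)\<^sup>2)"
proof -
  have s: "summable (\<lambda>k. \<bar>coef p c t k\<bar>)" by (rule summable_coef[OF c_summable])
  have "(\<lambda>k. \<bar>coef p c t k\<bar>) \<longlonglongrightarrow> 0" by (rule summable_LIMSEQ_zero[OF s])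
  then have "\<forall>\<^sub>F k in sequentially. \<bar>coef p c t k\<bar> < 1" by (rule order_tendstoD) simp
  then obtain m where m: "\<And>k. m \<le> k \<Longrightarrow> \<bar>coef p c t k\<bar> < 1" by (auto simp: eventually_sequentially)
  show ?thesis
  proof (rule summable_comparison_test'[OF s, of m])
    fix k assume "m \<le> k"
    then have "\<bar>coef p c t k\<bar> * \<bar>coef p c t k\<bar> \<le> \<bar>coef p c t k\<bar>" using m[of k] by (intro mult_left_le) auto
    then show "norm ((coef p c t k)\<^sup>2) \<le> \<bar>coef p c t k\<bar>" by (simp add: power2_eq_square abs_mult)
  qed
qed

lemma W_at_top: "filterlim W at_top sequentially"
proof -
  have "\<forall>\<^sub>F n in sequentially. R \<le> W n" for R
  proof -
    obtain d0 where "\<forall>n t. d0 \<le> t \<longrightarrow> t \<le> n \<longrightarrow> R \<le> (\<Sum>k<t. (f n k)\<^sup>2)" using f_div by blast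
    then show ?thesis unfolding eventually_sequentially W_def by blast
  qed
  then show ?thesis by (simp add: filterlim_at_top)
qed

lemma W_pos: "\<forall>\<^sub>F n in sequentially. 0 < W n" using W_at_top by (auto simp: filterlim_at_top_dense)

text \<open>With \<open>w = x - y\<close>, the cross term obeys
  \<open>2 * |w * y| \<le> w^2 / e + e * y^2\<close>; the pointwise bound is then summed over the
  lags.\<close>

lemma square_sum_perturb:
  fixes u v :: "nat \<Rightarrow> real"
  assumes u: "summable (\<lambda>k. (u k)\<^sup>2)" and v: "\<And>k. m \<le> k \<Longrightarrow> v k = 0" and e: "0 < e"
  shows "\<bar>(\<Sum>k. (u k)\<^sup>2) - (\<Sum>k<m. (v k)\<^sup>2)\<bar> \<le> (1 + 1 / e) * (\<Sum>k. (u k - v k)\<^sup>2) + e * (\<Sum>k<m. (v k)\<^sup>2)"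
proof -
  have sv: "(\<lambda>k. (v k)\<^sup>2) sums (\<Sum>k<m. (v k)\<^sup>2)" by (rule sums_finite) (auto simp: v)
  have su: "(\<lambda>k. (u k)\<^sup>2) sums (\<Sum>k. (u k)\<^sup>2)" using u by (rule summable_sums)
  have d: "summable (\<lambda>k. (u k - v k)\<^sup>2)"
  proof (rule iffD1[OF summable_iff_shift[of _ m]])
    have "summable (\<lambda>k. (u (k + m))\<^sup>2)" using u by (simp add: summable_iff_shift[of "\<lambda>k. (u k)\<^sup>2"])
    then show "summable (\<lambda>k. (u (k + m) - v (k + m))\<^sup>2)" by (simp add: v)
  qed
  have sd: "(\<lambda>k. (1 + 1 / e) * (u k - v k)\<^sup>2 + e * (v k)\<^sup>2) sums ((1 + 1 / e) * (\<Sum>k. (u k - v k)\<^sup>2) + e * (\<Sum>k<m. (v k)\<^sup>2))"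
    by (intro sums_add sums_mult summable_sums d sv)
  have pt: "\<bar>x\<^sup>2 - y\<^sup>2\<bar> \<le> (1 + 1 / e) * (x - y)\<^sup>2 + e * y\<^sup>2" for x y :: real
  proof -
    define w where "w = x - y"
    have x: "x\<^sup>2 - y\<^sup>2 = w\<^sup>2 + 2 * (w * y)" unfolding w_def by (simp add: power2_eq_square algebra_simps)
    have "0 \<le> (\<bar>w\<bar> - e * \<bar>y\<bar>)\<^sup>2" by simp
    then have "e * (2 * \<bar>w * y\<bar>) \<le> w\<^sup>2 + e\<^sup>2 * y\<^sup>2" by (simp add: power2_diff power_mult_distrib abs_mult algebra_simps)
    also have "\<dots> = e * (w\<^sup>2 / e + e * y\<^sup>2)" using e by (simp add: power2_eq_square algebra_simps)
    finally have "2 * \<bar>w * y\<bar> \<le> w\<^sup>2 / e + e * y\<^sup>2" using e by simp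
    moreover have "\<bar>w\<^sup>2 + 2 * (w * y)\<bar> \<le> w\<^sup>2 + 2 * \<bar>w * y\<bar>" by (rule order_trans[OF abs_triangle_ineq]) (simp add: abs_mult)
    ultimately show ?thesis unfolding x w_def[symmetric] by (simp add: algebra_simps)
  qed
  have "(\<Sum>k. (u k)\<^sup>2) - (\<Sum>k<m. (v k)\<^sup>2) \<le> (1 + 1 / e) * (\<Sum>k. (u k - v k)\<^sup>2) + e * (\<Sum>k<m. (v k)\<^sup>2)"
    by (rule sums_le[OF _ sums_diff[OF su sv] sd]) (use pt in \<open>simp add: abs_le_iff\<close>)
  moreover have "(\<Sum>k<m. (v k)\<^sup>2) - (\<Sum>k. (u k)\<^sup>2) \<le> (1 + 1 / e) * (\<Sum>k. (u k - v k)\<^sup>2) + e * (\<Sum>k<m. (v k)\<^sup>2)"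
    by (rule sums_le[OF _ sums_diff[OF sv su] sd]) (use pt in \<open>simp add: abs_le_iff\<close>)
  ultimately show ?thesis by (simp add: abs_le_iff)
qed

text \<open>Up to the remainder at \<open>t = n\<close>, the total of squares is that of
  \<open>f\<close> plus that of \<open>g\<close>, and
  \<open>1 + \<tau> / (1 - \<tau>) = 1 / (1 - \<tau>)\<close>.\<close>

lemma A_over_W: "(\<lambda>n. A n / W n) \<longlonglongrightarrow> 1 / (1 - \<tau>)"
proof -
  define L where "L = 1 / (1 - \<tau>)"
  define T where "T n = W n + (\<Sum>k<n. (g n k)\<^sup>2)" for n
  have TW: "(\<lambda>n. T n / W n) \<longlonglongrightarrow> L"
  proof -
    have "(\<lambda>n. 1 + (\<Sum>k<n. (g n k)\<^sup>2) / W n) \<longlonglongrightarrow> 1 + \<tau> / (1 - \<tau>)" unfolding W_def by (intro tendsto_intros g_mass)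
    moreover have "1 + \<tau> / (1 - \<tau>) = L" using \<tau> by (simp add: L_def field_simps)
    moreover have "\<forall>\<^sub>F n in sequentially. 1 + (\<Sum>k<n. (g n k)\<^sup>2) / W n = T n / W n"
      using W_pos by eventually_elim (simp add: T_def add_divide_distrib)
    ultimately show ?thesis by (simp add: tendsto_cong)
  qed
  have L0: "0 < L" using \<tau> by (simp add: L_def)
  have "(\<lambda>n. A n / W n - T n / W n) \<longlonglongrightarrow> 0"
  proof (rule LIMSEQ_I)
    fix \<zeta> :: real assume \<zeta>: "0 < \<zeta>"
    \<comment> \<open>A remainder of at most \<open>e^2 * W n\<close> costs
      \<open>2 * e * W n + e * T n\<close> in \<open>square_sum_perturb\<close>, and
      \<open>T n\<close> is eventually at most \<open>(L + 1) * W n\<close>; together this is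
      \<open>e * (L + 3) * W n\<close>.\<close>
    define e where "e = min 1 (\<zeta> / (2 * (L + 3)))"
    have e: "0 < e" "e \<le> 1" using \<zeta> L0 by (auto simp: e_def)
    have eL: "e * (L + 3) < \<zeta>"
    proof -
      have "e * (L + 3) \<le> \<zeta> / (2 * (L + 3)) * (L + 3)" using L0 by (intro mult_right_mono) (auto simp: e_def)
      also have "\<dots> = \<zeta> / 2"
      proof -
        have v: "\<zeta> / (2 * v) * v = \<zeta> / 2" if "v \<noteq> 0" for v using that by simp
        show ?thesis by (rule v) (use L0 in linarith)
      qed
      finally show ?thesis using \<zeta> by linarith
    qed
    have "\<forall>\<^sub>F n in sequentially. T n / W n < L + 1" using TW by (rule order_tendstoD) simp
    moreover have "\<forall>\<^sub>F n in sequentially. \<forall>t. 1 * real n \<le> real t \<longrightarrow> 1 \<le> t \<longrightarrow> t \<le> n \<longrightarrow>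
      (\<Sum>k. (coef (\<phi> n) c t k - (if k < t then f n k else if k < t + n then g n (k - t) else 0))\<^sup>2) \<le> e\<^sup>2 * (\<Sum>k<n. (f n k)\<^sup>2)"
      using e by (intro rem) auto
    ultimately have "\<forall>\<^sub>F n in sequentially. norm (A n / W n - T n / W n - 0) < \<zeta>"
      using W_pos eventually_ge_at_top[of 1]
    proof eventually_elim
      case (elim n)
      define v where "v k = (if k < n then f n k else if k < n + n then g n (k - n) else 0)" for k
      have Tv: "(\<Sum>k<n + n. (v k)\<^sup>2) = T n"
      proof -
        have "(\<Sum>k<n + n. (v k)\<^sup>2) = (\<Sum>k<n. (v k)\<^sup>2) + (\<Sum>k<n. (v (k + n))\<^sup>2)" by (rule sum_lessThan_add)
        then show ?thesis by (simp add: v_def T_def W_def)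
      qed
      have R: "(\<Sum>k. (coef (\<phi> n) c n k - v k)\<^sup>2) \<le> e\<^sup>2 * W n" using elim unfolding v_def W_def by auto
      have "\<bar>A n - T n\<bar> \<le> (1 + 1 / e) * (\<Sum>k. (coef (\<phi> n) c n k - v k)\<^sup>2) + e * T n"
        unfolding A_def Tv[symmetric] by (rule square_sum_perturb[OF summable_coef_square _ e(1)]) (simp add: v_def)
      also have "\<dots> \<le> (1 + 1 / e) * (e\<^sup>2 * W n) + e * T n" using R e by (intro add_right_mono mult_left_mono) auto
      also have "(1 + 1 / e) * (e\<^sup>2 * W n) = (e\<^sup>2 + e) * W n" using e by (simp add: power2_eq_square field_simps)
      also have "(e\<^sup>2 + e) * W n \<le> (e + e) * W n" using e elim by (intro mult_right_mono add_right_mono) (auto simp: power2_eq_square mult_left_le)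
      also have "e * T n \<le> e * ((L + 1) * W n)" using elim e by (intro mult_left_mono) (auto simp: pos_divide_less_eq)
      finally have "\<bar>A n - T n\<bar> \<le> e * (L + 3) * W n" by (simp add: algebra_simps)
      then have "\<bar>A n - T n\<bar> / W n \<le> e * (L + 3)" using elim by (simp add: pos_divide_le_eq)
      then show ?case using eL elim by (simp add: abs_divide flip: diff_divide_distrib)
    qed
    then show "\<exists>no. \<forall>n\<ge>no. norm (A n / W n - T n / W n - 0) < \<zeta>" by (simp add: eventually_sequentially)
  qed
  from tendsto_add[OF this TW] show ?thesis by (simp add: L_def)
qed

lemma W_over_A: "(\<lambda>n. W n / A n) \<longlonglongrightarrow> 1 - \<tau>" using tendsto_inverse[OF A_over_W] \<tau> by simp

lemma A_le_W: "\<forall>\<^sub>F n in sequentially. 0 < A n \<and> W n \<le> 2 * A n \<and> A n \<le> (1 / (1 - \<tau>) + 1) * W n"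
proof -
  have "\<forall>\<^sub>F n in sequentially. A n / W n < 1 / (1 - \<tau>) + 1" "\<forall>\<^sub>F n in sequentially. 1 / 2 < A n / W n"
    by (rule order_tendstoD[OF A_over_W]; use \<tau> in \<open>simp add: field_simps\<close>)+
  then show ?thesis using W_pos
  proof eventually_elim
    case (elim n)
    then have "W n < 2 * A n" "A n < (1 / (1 - \<tau>) + 1) * W n" by (simp_all add: pos_divide_less_eq pos_less_divide_eq)
    then show ?case using elim by linarith
  qed
qed

end

locale normed_coef = coef_array +
  fixes \<sigma>2 :: real and \<beta> :: "nat \<Rightarrow> real"
  assumes \<sigma>2: "0 < \<sigma>2" and \<beta>_pos: "1 \<le> n \<Longrightarrow> 0 < \<beta> n"
    and \<beta>_eq: "1 \<le> n \<Longrightarrow> (\<beta> n)\<^sup>2 = \<sigma>2 * (\<Sum>k. (coef (\<phi> n) c n k)\<^sup>2)"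
begin

lemma \<beta>_A: "1 \<le> n \<Longrightarrow> (\<beta> n)\<^sup>2 = \<sigma>2 * A n" by (simp add: \<beta>_eq A_def)

lemma \<beta>_at_top: "filterlim \<beta> at_top sequentially" unfolding filterlim_at_top
proof
  fix R :: real
  have "\<forall>\<^sub>F n in sequentially. 2 * (R\<^sup>2 / \<sigma>2) \<le> W n" using W_at_top by (simp add: filterlim_at_top)
  then show "\<forall>\<^sub>F n in sequentially. R \<le> \<beta> n" using A_le_W eventually_ge_at_top[of 1]
  proof eventually_elim
    case (elim n)
    then have "R\<^sup>2 / \<sigma>2 \<le> A n" by linarith
    then have "R\<^sup>2 \<le> (\<beta> n)\<^sup>2" using \<beta>_A[OF elim(3)] \<sigma>2 by (simp add: pos_divide_le_eq mult.commute)
    then show ?case using \<beta>_pos[OF elim(3)] by (rule power2_le_imp_le[OF _ less_imp_le])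
  qed
qed

lemma f_norm:
  assumes "0 < \<delta>" "0 < \<eta>"
  shows "\<forall>\<^sub>F n in sequentially. \<forall>t. \<delta> * real n \<le> real t \<longrightarrow> t \<le> n \<longrightarrow>
    \<bar>\<sigma>2 * (\<Sum>k<t. (f n k)\<^sup>2) / (\<beta> n)\<^sup>2 - (1 - \<tau>)\<bar> \<le> \<eta>"
proof -
  have "\<forall>\<^sub>F n in sequentially. \<bar>W n / A n - (1 - \<tau>)\<bar> < \<eta> / 2"
    unfolding dist_real_def[symmetric] using assms by (intro tendstoD[OF W_over_A]) simp
  moreover have "\<forall>\<^sub>F n in sequentially. \<forall>t. \<delta> * real n \<le> real t \<longrightarrow> t \<le> n \<longrightarrow> (1 - \<eta> / 4) * (\<Sum>k<n. (f n k)\<^sup>2) \<le> (\<Sum>k<t. (f n k)\<^sup>2)"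
    using assms by (intro f_flat) auto
  ultimately show ?thesis using A_le_W eventually_ge_at_top[of 1]
  proof eventually_elim
    case (elim n)
    show ?case
    proof (intro allI impI)
      fix t assume t: "\<delta> * real n \<le> real t" "t \<le> n"
      define w where "w = (\<Sum>k<t. (f n k)\<^sup>2)"
      have a: "0 < A n" "W n \<le> 2 * A n" using elim by auto
      have "w \<le> W n" unfolding w_def W_def using t by (intro sum_mono2) auto
      moreover have "(1 - \<eta> / 4) * W n \<le> w" using elim t unfolding w_def W_def by auto
      ultimately have "w / A n \<le> W n / A n" "(1 - \<eta> / 4) * W n / A n \<le> w / A n" using a by (auto intro: divide_right_mono)
      moreover have "(1 - \<eta> / 4) * W n / A n = W n / A n - \<eta> / 4 * (W n / A n)" using a by (simp add: field_simps)
      moreover have "\<eta> / 4 * (W n / A n) \<le> \<eta> / 4 * 2" using a assms by (intro mult_left_mono) (auto simp: pos_divide_le_eq)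
      moreover have "\<sigma>2 * w / (\<beta> n)\<^sup>2 = w / A n" using \<sigma>2 elim by (simp add: \<beta>_A)
      ultimately show "\<bar>\<sigma>2 * (\<Sum>k<t. (f n k)\<^sup>2) / (\<beta> n)\<^sup>2 - (1 - \<tau>)\<bar> \<le> \<eta>"
          using elim(1) unfolding w_def[symmetric] abs_le_iff abs_less_iff by linarith
    qed
  qed
qed

lemma remainder:
  assumes "0 < \<delta>" "0 < \<eta>"
  shows "\<forall>\<^sub>F n in sequentially. \<forall>t. \<delta> * real n \<le> real t \<longrightarrow> 1 \<le> t \<longrightarrow> t \<le> n \<longrightarrow>
    \<sigma>2 * (\<Sum>k. (coef (\<phi> n) c t k - (if k < t then f n k else if k < t + n then g n (k - t) else 0))\<^sup>2) \<le> \<eta> * (\<beta> n)\<^sup>2"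
proof -
  have "\<forall>\<^sub>F n in sequentially. \<forall>t. \<delta> * real n \<le> real t \<longrightarrow> 1 \<le> t \<longrightarrow> t \<le> n \<longrightarrow>
      (\<Sum>k. (coef (\<phi> n) c t k - (if k < t then f n k else if k < t + n then g n (k - t) else 0))\<^sup>2) \<le> \<eta> / 2 * (\<Sum>k<n. (f n k)\<^sup>2)"
    using assms by (intro rem) auto
  then show ?thesis using A_le_W eventually_ge_at_top[of 1]
  proof eventually_elim
    case (elim n)
    show ?case
    proof (intro allI impI)
      fix t assume t: "\<delta> * real n \<le> real t" "1 \<le> t" "t \<le> n"
      have "(\<Sum>k. (coef (\<phi> n) c t k - (if k < t then f n k else if k < t + n then g n (k - t) else 0))\<^sup>2) \<le> \<eta> / 2 * W n"
        using elim t unfolding W_def by auto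
      also have "\<dots> \<le> \<eta> / 2 * (2 * A n)" using elim assms by (intro mult_left_mono) auto
      finally have "\<sigma>2 * (\<Sum>k. (coef (\<phi> n) c t k - (if k < t then f n k else if k < t + n then g n (k - t) else 0))\<^sup>2) \<le> \<sigma>2 * (\<eta> / 2 * (2 * A n))"
        using \<sigma>2 by (intro mult_left_mono) auto
      also have "\<dots> = \<eta> * (\<beta> n)\<^sup>2" using elim by (simp add: \<beta>_A)
      finally show "\<sigma>2 * (\<Sum>k. (coef (\<phi> n) c t k - (if k < t then f n k else if k < t + n then g n (k - t) else 0))\<^sup>2) \<le> \<eta> * (\<beta> n)\<^sup>2" .
    qed
  qed
qed

lemma g_norm: "(\<lambda>n. \<sigma>2 * (\<Sum>k<n. (g n k)\<^sup>2) / (\<beta> n)\<^sup>2) \<longlonglongrightarrow> \<tau>"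
proof -
  have "(\<lambda>n. (\<Sum>k<n. (g n k)\<^sup>2) / W n * (W n / A n)) \<longlonglongrightarrow> \<tau> / (1 - \<tau>) * (1 - \<tau>)"
    unfolding W_def by (intro tendsto_mult g_mass W_over_A[unfolded W_def])
  moreover have "\<forall>\<^sub>F n in sequentially. (\<Sum>k<n. (g n k)\<^sup>2) / W n * (W n / A n) = \<sigma>2 * (\<Sum>k<n. (g n k)\<^sup>2) / (\<beta> n)\<^sup>2"
    using W_pos eventually_ge_at_top[of 1] by eventually_elim (use \<sigma>2 in \<open>simp add: \<beta>_A\<close>)
  ultimately show ?thesis using \<tau> by (simp add: tendsto_cong)
qed

lemma V_unbounded: "\<exists>d0. \<forall>n d. d0 \<le> d \<longrightarrow> d \<le> n \<longrightarrow> R \<le> (\<Sum>k<d. (coef (\<phi> n) c n k)\<^sup>2)"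
proof -
  obtain d1 where d1: "\<And>n t. d1 \<le> t \<Longrightarrow> t \<le> n \<Longrightarrow> 4 * R \<le> (\<Sum>k<t. (f n k)\<^sup>2)" using f_div by blast
  obtain d2 where d2: "\<And>n d. d2 \<le> d \<Longrightarrow> d \<le> n \<Longrightarrow> (\<Sum>k<d. (f n k)\<^sup>2) \<le> 4 * (\<Sum>k<d. (coef (\<phi> n) c n k)\<^sup>2)" using near by blast
  show ?thesis
  proof (intro exI[of _ "max d1 d2"] allI impI)
    fix n d assume "max d1 d2 \<le> d" "d \<le> n"
    then show "R \<le> (\<Sum>k<d. (coef (\<phi> n) c n k)\<^sup>2)" using d1[of d n] d2[of d n] by simp
  qed
qed

lemma V_lower: "\<exists>C\<ge>1. \<exists>d0. \<forall>n d. d0 \<le> d \<longrightarrow> d \<le> n \<longrightarrow> (\<beta> n)\<^sup>2 \<le> C * (\<Sum>k<d. (coef (\<phi> n) c n k)\<^sup>2) * (real n / real d) powr \<gamma>"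
proof -
  obtain C d1 where d1: "\<And>n d. d1 \<le> d \<Longrightarrow> d \<le> n \<Longrightarrow> (\<Sum>k<n. (f n k)\<^sup>2) \<le> C * (\<Sum>k<d. (f n k)\<^sup>2) * (real n / real d) powr \<gamma>"
    using f_growth by blast
  obtain d2 where d2: "\<And>n d. d2 \<le> d \<Longrightarrow> d \<le> n \<Longrightarrow> (\<Sum>k<d. (f n k)\<^sup>2) \<le> 4 * (\<Sum>k<d. (coef (\<phi> n) c n k)\<^sup>2)" using near by blast
  define L where "L = \<sigma>2 * (1 / (1 - \<tau>) + 1)"
  have L: "0 < L" using \<tau> \<sigma>2 by (simp add: L_def add_pos_pos)
  obtain d3 where d3: "\<And>n. d3 \<le> n \<Longrightarrow> A n \<le> (1 / (1 - \<tau>) + 1) * W n" using A_le_W by (auto simp: eventually_sequentially)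
  define C' where "C' = max 1 (L * \<bar>C\<bar> * 4)"
  show ?thesis
  proof (intro exI[of _ C'] conjI exI[of _ "max 1 (max d1 (max d2 d3))"] allI impI)
    show "1 \<le> C'" by (simp add: C'_def)
    fix n d assume d: "max 1 (max d1 (max d2 d3)) \<le> d" "d \<le> n"
    define P where "P = (real n / real d) powr \<gamma>"
    define V where "V = (\<Sum>k<d. (coef (\<phi> n) c n k)\<^sup>2)"
    have P0: "0 \<le> P" and V0: "0 \<le> V" by (auto simp: P_def V_def sum_nonneg)
    have "(\<beta> n)\<^sup>2 \<le> L * W n" using d d3[of n] \<sigma>2 by (simp add: \<beta>_A L_def)
    also have "W n \<le> C * (\<Sum>k<d. (f n k)\<^sup>2) * P" using d1[of d n] d by (simp add: W_def P_def)
    also have "C * (\<Sum>k<d. (f n k)\<^sup>2) * P \<le> \<bar>C\<bar> * (4 * V) * P"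
      using d2[of d n] d P0 by (intro mult_right_mono mult_mono) (auto simp: V_def sum_nonneg)
    also have "L * (\<bar>C\<bar> * (4 * V) * P) = (L * \<bar>C\<bar> * 4) * (V * P)" by simp
    also have "\<dots> \<le> C' * (V * P)" using P0 V0 by (intro mult_right_mono) (auto simp: C'_def)
    finally show "(\<beta> n)\<^sup>2 \<le> C' * (\<Sum>k<d. (coef (\<phi> n) c n k)\<^sup>2) * (real n / real d) powr \<gamma>"
      using L by (simp add: V_def P_def mult.assoc mult_left_mono)
  qed
qed

end

section \<open>Growth of sequences under halving of the argument\<close>

lemma halving_bound:
  fixes w :: "nat \<Rightarrow> real"
  assumes w: "\<And>n. 0 \<le> w n" and e: "0 \<le> e" and q: "0 \<le> q" "q \<le> 2 powr e" and N: "2 \<le> N"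
    and step: "\<And>n. N \<le> n \<Longrightarrow> w n \<le> q * w (n div 2)"
  shows "\<exists>C\<ge>0. \<forall>n\<ge>1. w n \<le> C * real n powr e"
proof -
  define C where "C = (\<Sum>k<N. w k)"
  have C: "0 \<le> C" using w by (simp add: C_def sum_nonneg)
  have "w n \<le> C * real n powr e" if "1 \<le> n" for n using that
  proof (induction n rule: less_induct)
    case (less n)
    show ?case
    proof (cases "n < N")
      case True
      then have "w n \<le> C * 1" unfolding C_def using w by (simp add: member_le_sum)
      also have "\<dots> \<le> C * real n powr e" using less.prems e C by (intro mult_left_mono ge_one_powr_ge_zero) auto
      finally show ?thesis .
    next
      case False
      have "w n \<le> q * w (n div 2)" using False by (intro step) simp
      also have "\<dots> \<le> 2 powr e * (C * real (n div 2) powr e)"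
        using less.IH[of "n div 2"] False N q w by (intro mult_mono) auto
      also have "\<dots> \<le> 2 powr e * (C * (real n / 2) powr e)"
        using C e by (intro mult_left_mono powr_mono2) (use of_nat_div_le_of_nat[of n 2, where 'a = real] in auto)
      also have "\<dots> = C * real n powr e" by (simp add: powr_divide)
      finally show ?thesis .
    qed
  qed
  then show ?thesis using C by blast
qed

text \<open>\<open>w\<close> stands for the partial sums of the squared weights; \<open>slow\<close>
  is slow variation along halvings.\<close>

context
  fixes w :: "nat \<Rightarrow> real"
  assumes nonneg: "\<And>n. 0 \<le> w n" and mono: "\<And>m n. m \<le> n \<Longrightarrow> w m \<le> w n"
    and slow: "\<And>\<eta>. 0 < \<eta> \<Longrightarrow> \<forall>\<^sub>F n in sequentially. w n \<le> (1 + \<eta>) * w (n div 2)"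
begin

text \<open>Finitely many halvings lead below \<open>\<delta> * n\<close>. Each costs a factor close
  to 1, and monotonicity covers the times above the last point.\<close>

lemma slow_growth_flat:
  assumes \<delta>: "0 < \<delta>" and \<eta>: "0 < \<eta>"
  shows "\<forall>\<^sub>F n in sequentially. \<forall>t. \<delta> * real n \<le> real t \<longrightarrow> t \<le> n \<longrightarrow> (1 - \<eta>) * w n \<le> w t"
proof -
  have dyadic: "\<forall>\<^sub>F n in sequentially. (1 - \<eta>) * w n \<le> w (n div 2 ^ r)" if "0 < \<eta>" for \<eta> r using that
  proof (induction r arbitrary: \<eta>)
    case 0
    then show ?case using nonneg by (intro always_eventually) (auto simp: algebra_simps)
  next
    case (Suc r)
    obtain N where N: "\<And>n. N \<le> n \<Longrightarrow> w n \<le> (1 + \<eta> / 2) * w (n div 2)"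
      using slow[of "\<eta> / 2"] Suc.prems by (auto simp: eventually_sequentially)
    have "\<forall>\<^sub>F n in sequentially. (1 - \<eta> / 2) * w n \<le> w (n div 2 ^ r)" using Suc by simp
    then show ?case using eventually_ge_at_top[of "N * 2 ^ r"]
    proof eventually_elim
      case (elim n)
      have "N \<le> n div 2 ^ r" using elim by (simp add: less_eq_div_iff_mult_less_eq)
      have "(1 + \<eta> / 2) * ((1 - \<eta>) * w n) \<le> (1 - \<eta> / 2) * w n"
      proof -
        have "(1 + \<eta> / 2) * (1 - \<eta>) \<le> 1 - \<eta> / 2" using Suc.prems by (simp add: algebra_simps)
        from mult_right_mono[OF this nonneg[of n]] show ?thesis by (simp only: mult.assoc)
      qed
      also have "\<dots> \<le> (1 + \<eta> / 2) * w (n div 2 ^ r div 2)" using N[OF \<open>N \<le> n div 2 ^ r\<close>] elim by linarith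
      also have "n div 2 ^ r div 2 = n div 2 ^ Suc r" by (simp only: div_mult2_eq[symmetric] power_Suc2)
      finally show ?case using Suc.prems by simp
    qed
  qed
  obtain r where r: "(1 / 2) ^ r < \<delta>" using real_arch_pow_inv[OF \<delta>, of "1 / 2"] by auto
  from dyadic[OF \<eta>, of r] show ?thesis
  proof eventually_elim
    case (elim n)
    show ?case
    proof (intro allI impI)
      fix t assume t: "\<delta> * real n \<le> real t" "t \<le> n"
      have "real (n div 2 ^ r) \<le> real n / real (2 ^ r)" by (rule of_nat_div_le_of_nat)
      also have "\<dots> = (1 / 2) ^ r * real n" by (simp add: power_divide)
      also have "\<dots> \<le> \<delta> * real n" using r by (intro mult_right_mono) auto
      finally have "n div 2 ^ r \<le> t" using t by simp
      then show "(1 - \<eta>) * w n \<le> w t" using elim mono[of "n div 2 ^ r" t] by linarith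
    qed
  qed
qed

text \<open>A halving costs at most \<open>4 / 3\<close>, which is less than
  \<open>2 powr (1 / 2)\<close>; the leading factor 2 absorbs the last, incomplete halving.\<close>

lemma slow_growth_powr:
  "\<exists>d0\<ge>1. \<forall>n d. d0 \<le> d \<longrightarrow> d \<le> n \<longrightarrow> w n \<le> 2 * w d * (real n / real d) powr (1 / 2)"
proof -
  obtain N where N: "\<And>n. N \<le> n \<Longrightarrow> w n \<le> (1 + 1 / 3) * w (n div 2)"
    using slow[of "1 / 3"] by (auto simp: eventually_sequentially)
  have "w n \<le> 2 * w d * (real n / real d) powr (1 / 2)" if d: "max 1 N \<le> d" and "d \<le> n" for n d using \<open>d \<le> n\<close>
  proof (induction n rule: less_induct)
    case (less n)
    have wn: "w n \<le> 4 / 3 * w (n div 2)" using N[of n] d less.prems by simp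
    have d1: "0 < real d" using d by simp
    show ?case
    proof (cases "n div 2 < d")
      case True
      have "w n \<le> 4 / 3 * w d" using wn mono[of "n div 2" d] True by simp
      also have "\<dots> \<le> 2 * w d * 1" using nonneg[of d] by simp
      also have "\<dots> \<le> 2 * w d * (real n / real d) powr (1 / 2)"
        using less.prems d1 nonneg[of d] by (intro mult_left_mono ge_one_powr_ge_zero) auto
      finally show ?thesis .
    next
      case False
      then have IH: "w (n div 2) \<le> 2 * w d * (real (n div 2) / real d) powr (1 / 2)" using less.IH[of "n div 2"] d by auto
      have sq: "(4 / 3 :: real) \<le> 2 powr (1 / 2)"
      proof -
        have "4 / 3 \<le> sqrt 2" by (rule real_le_rsqrt) (simp add: power2_eq_square)
        moreover have "2 powr (1 / 2) = sqrt 2" by (simp add: powr_half_sqrt)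
        ultimately show ?thesis by linarith
      qed
      have "(real (n div 2) / real d) powr (1 / 2) \<le> (real n / real d / 2) powr (1 / 2)"
        using d1 of_nat_div_le_of_nat[of n 2, where 'a = real] by (intro powr_mono2) (auto simp: field_simps)
      also have "\<dots> = (real n / real d) powr (1 / 2) / 2 powr (1 / 2)" by (rule powr_divide)
      also have "\<dots> \<le> (real n / real d) powr (1 / 2) / (4 / 3)" using sq by (intro divide_left_mono) auto
      finally have "2 * w d * (real (n div 2) / real d) powr (1 / 2) \<le> 2 * w d * ((real n / real d) powr (1 / 2) / (4 / 3))"
        using nonneg[of d] by (intro mult_left_mono) auto
      then show ?thesis using wn IH by simp
    qed
  qed
  then show ?thesis by (intro exI[of _ "max 1 N"]) auto
qed

end

section \<open>Squared weights comparable with the squared scale function\<close>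

lemma asymp_equiv_pos:
  fixes f g :: "nat \<Rightarrow> real"
  assumes "f \<sim>[sequentially] g" and g: "\<And>n. 1 \<le> n \<Longrightarrow> 0 < g n"
  shows "(\<lambda>n. f n / g n) \<longlonglongrightarrow> 1" "\<forall>\<^sub>F n in sequentially. g n / 2 \<le> f n \<and> f n \<le> 2 * g n"
proof -
  have "\<forall>\<^sub>F n in sequentially. (if f n = 0 \<and> g n = 0 then 1 else f n / g n) = f n / g n"
    using eventually_ge_at_top[of 1] by eventually_elim (use g in force)
  from tendsto_cong[OF this] show lim: "(\<lambda>n. f n / g n) \<longlonglongrightarrow> 1" using asymp_equivD[OF assms(1)] by simp
  have "\<forall>\<^sub>F n in sequentially. 1 / 2 < f n / g n" "\<forall>\<^sub>F n in sequentially. f n / g n < 2"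
    by (rule order_tendstoD[OF lim], simp)+
  then show "\<forall>\<^sub>F n in sequentially. g n / 2 \<le> f n \<and> f n \<le> 2 * g n"
    using eventually_ge_at_top[of 1]
  proof eventually_elim
    case (elim n)
    then show ?case using g[of n] by (simp add: pos_less_divide_eq pos_divide_less_eq)
  qed
qed

text \<open>The squares of the weights \<open>\<phi>\<close> under FR2 and of the partial sums of
  \<open>c\<close> under FR1 have this form.\<close>

context
  fixes l :: "real \<Rightarrow> real" and v :: "nat \<Rightarrow> real" and a b :: real
  assumes scale: "FR_scale l" and v: "\<And>k. 0 \<le> v k" and a: "0 < a"
    and cmp: "\<forall>\<^sub>F k in sequentially. a * ((l (real k))\<^sup>2 / real k) \<le> v k \<and> v k \<le> b * ((l (real k))\<^sup>2 / real k)"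
begin

text \<open>The terms before the comparison sets in are at most half of the divergent sum
  \<open>FR_sum\<close>.\<close>

lemma FR_comparable_lower: "\<forall>\<^sub>F n in sequentially. a / 2 * FR_sum l n \<le> (\<Sum>k<n. v k)"
proof -
  obtain N where N: "\<And>k. N \<le> k \<Longrightarrow> a * ((l (real k))\<^sup>2 / real k) \<le> v k" using cmp by (auto simp: eventually_sequentially)
  define N1 where "N1 = max 1 N"
  have "\<forall>\<^sub>F n in sequentially. 2 * FR_sum l N1 \<le> FR_sum l n"
    using FR_sum_at_top[OF scale] by (simp add: filterlim_at_top)
  then show ?thesis using eventually_ge_at_top[of N1]
  proof eventually_elim
    case (elim n)
    have "FR_sum l n = FR_sum l N1 + (\<Sum>k\<in>{N1..<n}. (l (real k))\<^sup>2 / real k)"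
      unfolding FR_sum_def[OF scale] using elim by (intro sum.atLeastLessThan_concat[symmetric]) (auto simp: N1_def)
    then have "a / 2 * FR_sum l n \<le> a * (\<Sum>k\<in>{N1..<n}. (l (real k))\<^sup>2 / real k)" using elim a by simp
    also have "\<dots> = (\<Sum>k\<in>{N1..<n}. a * ((l (real k))\<^sup>2 / real k))" by (rule sum_distrib_left)
    also have "\<dots> \<le> (\<Sum>k\<in>{N1..<n}. v k)" using N by (intro sum_mono) (auto simp: N1_def)
    also have "\<dots> \<le> (\<Sum>k<n. v k)" using v by (intro sum_mono2) auto
    finally show ?case .
  qed
qed

lemma FR_comparable_at_top: "filterlim (\<lambda>n. \<Sum>k<n. v k) at_top sequentially"
proof (rule filterlim_at_top_mono[OF _ FR_comparable_lower])
  show "filterlim (\<lambda>n. a / 2 * FR_sum l n) at_top sequentially"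
    using a by (intro filterlim_tendsto_pos_mult_at_top[OF tendsto_const _ FR_sum_at_top[OF scale]]) simp
qed

lemma FR_comparable_dominates:
  assumes e: "0 < e"
  shows "\<forall>\<^sub>F n in sequentially. (l (real n))\<^sup>2 \<le> e * (\<Sum>k<n. v k)"
proof -
  obtain j :: nat where j: "8 / (a * e) < real j" using reals_Archimedean2 by blast
  then have j0: "0 < real j" using a e by (smt (verit) divide_pos_pos mult_pos_pos)
  obtain N where N: "\<And>n. N \<le> n \<Longrightarrow> real j / 4 * (l (real n))\<^sup>2 \<le> FR_sum l n" using FR_sum_dominates[OF scale, of j] by blast
  show ?thesis using FR_comparable_lower eventually_ge_at_top[of N]
  proof eventually_elim
    case (elim n)
    have "a * real j / 8 * (l (real n))\<^sup>2 = a / 2 * (real j / 4 * (l (real n))\<^sup>2)" by simp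
    also have "\<dots> \<le> a / 2 * FR_sum l n" using N[OF elim(2)] a by (intro mult_left_mono) auto
    also have "\<dots> \<le> (\<Sum>k<n. v k)" by (rule elim)
    finally have 1: "e * (a * real j / 8 * (l (real n))\<^sup>2) \<le> e * (\<Sum>k<n. v k)" using e by simp
    have "1 \<le> a * e * real j / 8" using j a e by (simp add: pos_divide_less_eq mult.commute)
    from mult_right_mono[OF this, of "(l (real n))\<^sup>2"] 1 show ?case by (simp add: mult_ac)
  qed
qed

text \<open>The block from \<open>n / 2\<close> to \<open>n\<close> adds only a multiple of
  \<open>l(n)^2\<close>, which is small against the whole by
  \<open>FR_comparable_dominates\<close>.\<close>

lemma FR_comparable_slow:
  assumes \<eta>: "0 < \<eta>"
  shows "\<forall>\<^sub>F n in sequentially. (\<Sum>k<n. v k) \<le> (1 + \<eta>) * (\<Sum>k<n div 2. v k)"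
proof -
  obtain N where N: "\<And>k. N \<le> k \<Longrightarrow> a * ((l (real k))\<^sup>2 / real k) \<le> v k \<and> v k \<le> b * ((l (real k))\<^sup>2 / real k)"
    using cmp by (auto simp: eventually_sequentially)
  obtain K where K: "1 \<le> K" "\<And>k m. K \<le> k \<Longrightarrow> k \<le> m \<Longrightarrow> m \<le> 4 * k \<Longrightarrow> l (real m) \<le> (1 + 1) * l (real k) \<and> l (real k) \<le> (1 + 1) * l (real m)"
    by (rule FR_ratio[OF scale, of 1]) auto
  have b: "0 \<le> b"
  proof -
    have "0 < (l (real (max N 1)))\<^sup>2 / real (max N 1)" by (intro divide_pos_pos zero_less_power FR_pos[OF scale]) auto
    moreover have "a * ((l (real (max N 1)))\<^sup>2 / real (max N 1)) \<le> b * ((l (real (max N 1)))\<^sup>2 / real (max N 1))"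
      using N[of "max N 1"] by linarith
    ultimately have "a \<le> b" using mult_le_cancel_right_pos by blast
    then show ?thesis using a by simp
  qed
  have "\<forall>\<^sub>F n in sequentially. (l (real n))\<^sup>2 \<le> \<eta> / ((1 + \<eta>) * (16 * b + 1)) * (\<Sum>k<n. v k)"
    using \<eta> b by (intro FR_comparable_dominates) simp
  then show ?thesis using eventually_ge_at_top[of "2 * (N + K + 1)"]
  proof eventually_elim
    case (elim n)
    define w where "w n = (\<Sum>k<n. v k)" for n
    have n: "0 < real n" "2 \<le> n" using elim by auto
    have "w n = w (n div 2) + (\<Sum>k\<in>{n div 2..<n}. v k)"
      unfolding w_def lessThan_atLeast0 by (intro sum.atLeastLessThan_concat[symmetric]) auto
    \<comment> \<open>The factor 16 is \<open>2^2\<close> from the variation of \<open>l\<close>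
      times 4 from \<open>n \<le> 4 * k\<close>.\<close>
    also have "(\<Sum>k\<in>{n div 2..<n}. v k) \<le> (\<Sum>k\<in>{n div 2..<n}. 16 * b * (l (real n))\<^sup>2 / real n)"
    proof (intro sum_mono)
      fix k assume k: "k \<in> {n div 2..<n}"
      have kn: "N \<le> k" "K \<le> k" "k \<le> n" "n \<le> 4 * k" "1 \<le> k" using k elim by auto
      have "l (real k) \<le> 2 * l (real n)" using K(2)[of k n] kn by auto
      then have "(l (real k))\<^sup>2 \<le> (2 * l (real n))\<^sup>2" using FR_pos[OF scale, of "real k"] kn by (intro power_mono) auto
      then have "(l (real k))\<^sup>2 / real k \<le> 4 * (l (real n))\<^sup>2 / (real n / 4)"
        using kn n by (intro frac_le) (auto simp: power_mult_distrib)
      then have "b * ((l (real k))\<^sup>2 / real k) \<le> b * (4 * (l (real n))\<^sup>2 / (real n / 4))" using b by (rule mult_left_mono)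
      then show "v k \<le> 16 * b * (l (real n))\<^sup>2 / real n" using N[OF kn(1)] by (simp add: mult_ac)
    qed
    also have "\<dots> \<le> real n * (16 * b * (l (real n))\<^sup>2 / real n)"
      using b by (simp only: sum_constant) (intro mult_right_mono, auto)
    also have "\<dots> = 16 * b * (l (real n))\<^sup>2" using n by simp
    also have "\<dots> \<le> (16 * b + 1) * (l (real n))\<^sup>2" by (intro mult_right_mono) auto
    also have "\<dots> \<le> (16 * b + 1) * (\<eta> / ((1 + \<eta>) * (16 * b + 1)) * w n)" using elim b unfolding w_def by (intro mult_left_mono) auto
    also have "\<dots> = \<eta> / (1 + \<eta>) * w n" using b \<eta> by simp
    finally have "w n \<le> w (n div 2) + \<eta> / (1 + \<eta>) * w n" by simp
    then have "(1 + \<eta>) * w n \<le> (1 + \<eta>) * (w (n div 2) + \<eta> / (1 + \<eta>) * w n)" using \<eta> by (intro mult_left_mono) auto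
    also have "\<dots> = (1 + \<eta>) * w (n div 2) + \<eta> * w n" using \<eta> by (simp add: distrib_left)
    finally have "w n \<le> (1 + \<eta>) * w (n div 2)" by (simp add: algebra_simps)
    then show ?case by (simp add: w_def)
  qed
qed

lemma FR_comparable_bounded: "\<exists>B. \<forall>k. v k \<le> B"
proof -
  obtain N where N: "\<And>k. N \<le> k \<Longrightarrow> v k \<le> b * ((l (real k))\<^sup>2 / real k)" using cmp by (auto simp: eventually_sequentially)
  \<comment> \<open>As \<open>(4 / 3)^2 \<le> 2\<close>, the quotient \<open>l(k)^2 / k\<close> at
    \<open>n\<close> is at most its value at \<open>n div 2\<close>, and
    \<open>halving_bound\<close> with exponent 0 applies.\<close>
  obtain K where K: "1 \<le> K" "\<And>k m. K \<le> k \<Longrightarrow> k \<le> m \<Longrightarrow> m \<le> 4 * k \<Longrightarrow> l (real m) \<le> (1 + 1 / 3) * l (real k) \<and> l (real k) \<le> (1 + 1 / 3) * l (real m)"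
    by (rule FR_ratio[OF scale, of "1 / 3"]) auto
  define u where "u k = (l (real k))\<^sup>2 / real k" for k
  have "\<exists>C\<ge>0. \<forall>n\<ge>1. u n \<le> C * real n powr 0"
  proof (rule halving_bound[where q = 1 and N = "2 * K + 2"])
    fix n assume n: "2 * K + 2 \<le> n"
    define m where "m = n div 2"
    have m: "1 \<le> m" "K \<le> m" "m \<le> n" "n \<le> 4 * m" "2 * m \<le> n" using n by (auto simp: m_def)
    have "(l (real n))\<^sup>2 \<le> (4 / 3 * l (real m))\<^sup>2" using K(2)[of m n] m FR_pos[OF scale, of "real n"] by (intro power_mono) auto
    also have "\<dots> \<le> 2 * (l (real m))\<^sup>2" by (simp add: power_divide power_mult_distrib)
    finally have "u n \<le> 2 * (l (real m))\<^sup>2 / (2 * real m)" unfolding u_def using m by (intro frac_le) auto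
    then show "u n \<le> 1 * u (n div 2)" by (simp add: u_def m_def)
  qed (auto simp: u_def)
  then obtain C where C: "0 \<le> C" "\<And>n. 1 \<le> n \<Longrightarrow> u n \<le> C" by auto
  have "v k \<le> (\<Sum>k<Suc N. v k) + \<bar>b\<bar> * C" for k
  proof (cases "k < Suc N")
    case True
    then have "v k \<le> (\<Sum>k<Suc N. v k)" using v by (intro member_le_sum) auto
    then show ?thesis using C by (simp add: add_increasing2)
  next
    case False
    have "v k \<le> b * u k" using N[of k] False by (simp add: u_def)
    also have "\<dots> \<le> \<bar>b\<bar> * C" using C(2)[of k] False by (intro mult_mono) (auto simp: u_def)
    finally show ?thesis using sum_nonneg[of "{..<Suc N}" v] v by simp
  qed
  then show ?thesis by blast
qed

end

text \<open>The filter \<open>c\<close> acts almost as multiplication by its sum, which is the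
  factor in \<open>f\<close>. The lags from \<open>t\<close> on belong entirely to the small
  remainder, hence \<open>g = 0\<close> and \<open>\<tau> = 0\<close>.\<close>

lemma smooth_coef_array:
  assumes c: "summable (\<lambda>i. \<bar>c i\<bar>)" and C: "suminf c \<noteq> 0" and B: "\<And>n j. 1 \<le> n \<Longrightarrow> \<bar>\<phi> n j\<bar> \<le> B" and \<gamma>: "0 \<le> \<gamma>" "\<gamma> < 1"
    and div: "\<And>R. \<exists>d0. \<forall>n t. d0 \<le> t \<longrightarrow> t \<le> n \<longrightarrow> R \<le> (\<Sum>k<t. (\<phi> n k)\<^sup>2)"
    and smooth: "\<And>e. 0 < e \<Longrightarrow> \<exists>k0. \<forall>n k. k0 \<le> n \<longrightarrow> k0 \<le> k \<longrightarrow> \<bar>\<phi> n (Suc k) - \<phi> n k\<bar> \<le> e * \<bar>\<phi> n k\<bar>"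
    and flat: "\<And>\<delta> \<eta>. 0 < \<delta> \<Longrightarrow> 0 < \<eta> \<Longrightarrow> \<forall>\<^sub>F n in sequentially. \<forall>t. \<delta> * real n \<le> real t \<longrightarrow> t \<le> n \<longrightarrow>
      (1 - \<eta>) * (\<Sum>k<n. (\<phi> n k)\<^sup>2) \<le> (\<Sum>k<t. (\<phi> n k)\<^sup>2)"
    and growth: "\<exists>C d0. \<forall>n d. d0 \<le> d \<longrightarrow> d \<le> n \<longrightarrow>
      (\<Sum>k<n. (\<phi> n k)\<^sup>2) \<le> C * (\<Sum>k<d. (\<phi> n k)\<^sup>2) * (real n / real d) powr \<gamma>"
  shows "coef_array \<phi> c (\<lambda>n k. suminf c * \<phi> n k) (\<lambda>_ _. 0) B (\<bar>suminf c\<bar> * B) 0 \<gamma>"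
proof -
  define s where "s = suminf c"
  have s2: "0 < s\<^sup>2" using C by (simp add: s_def)
  have fs: "(\<Sum>k<m. (s * \<phi> n k)\<^sup>2) = s\<^sup>2 * (\<Sum>k<m. (\<phi> n k)\<^sup>2)" for n m by (simp add: power_mult_distrib sum_distrib_left)
  note small = coef_smooth_remainder[OF c B div smooth, folded s_def]
  have "coef_array \<phi> c (\<lambda>n k. s * \<phi> n k) (\<lambda>_ _. 0) B (\<bar>s\<bar> * B) 0 \<gamma>"
  proof (unfold_locales, unfold fs)
    fix R show "\<exists>d0. \<forall>n t. d0 \<le> t \<longrightarrow> t \<le> n \<longrightarrow> R \<le> s\<^sup>2 * (\<Sum>k<t. (\<phi> n k)\<^sup>2)"
      using div[of "R / s\<^sup>2"] s2 by (simp add: pos_divide_le_eq mult.commute)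
  next
    fix \<delta> \<eta> :: real assume "0 < \<delta>" "0 < \<eta>"
    from flat[OF this] show "\<forall>\<^sub>F n in sequentially. \<forall>t. \<delta> * real n \<le> real t \<longrightarrow> t \<le> n \<longrightarrow>
        (1 - \<eta>) * (s\<^sup>2 * (\<Sum>k<n. (\<phi> n k)\<^sup>2)) \<le> s\<^sup>2 * (\<Sum>k<t. (\<phi> n k)\<^sup>2)"
      by eventually_elim (use s2 in \<open>simp add: mult.left_commute[of _ "s\<^sup>2"]\<close>)
  next
    obtain C' d0 where g: "\<And>n d. d0 \<le> d \<Longrightarrow> d \<le> n \<Longrightarrow> (\<Sum>k<n. (\<phi> n k)\<^sup>2) \<le> C' * (\<Sum>k<d. (\<phi> n k)\<^sup>2) * (real n / real d) powr \<gamma>"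
      using growth by blast
    show "\<exists>C d0. \<forall>n d. d0 \<le> d \<longrightarrow> d \<le> n \<longrightarrow> s\<^sup>2 * (\<Sum>k<n. (\<phi> n k)\<^sup>2) \<le> C * (s\<^sup>2 * (\<Sum>k<d. (\<phi> n k)\<^sup>2)) * (real n / real d) powr \<gamma>"
    proof (intro exI[of _ C'] exI[of _ d0] allI impI)
      fix n d assume "d0 \<le> d" "d \<le> n"
      from mult_left_mono[OF g[OF this] less_imp_le[OF s2]]
      show "s\<^sup>2 * (\<Sum>k<n. (\<phi> n k)\<^sup>2) \<le> C' * (s\<^sup>2 * (\<Sum>k<d. (\<phi> n k)\<^sup>2)) * (real n / real d) powr \<gamma>" by (simp add: mult_ac)
    qed
  next
    \<comment> \<open>With the error \<open>s^2 / 4\<close>, the inequality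
      \<open>x^2 \<le> 2 * (y - x)^2 + 2 * y^2\<close> bounds the squares of \<open>f\<close> by
      half of themselves plus twice those of \<open>coef\<close>; hence the constant 4 in
      \<open>near\<close>.\<close>
    obtain d0 where d0: "\<And>n t. d0 \<le> t \<Longrightarrow> t \<le> n \<Longrightarrow>
      summable (\<lambda>k. (coef (\<phi> n) c t k - s * (if k < t then \<phi> n k else 0))\<^sup>2) \<and>
      (\<Sum>k. (coef (\<phi> n) c t k - s * (if k < t then \<phi> n k else 0))\<^sup>2) \<le> s\<^sup>2 / 4 * (\<Sum>k<t. (\<phi> n k)\<^sup>2)"
      using small[of "s\<^sup>2 / 4"] s2 by auto
    show "\<exists>d0. \<forall>n d. d0 \<le> d \<longrightarrow> d \<le> n \<longrightarrow> s\<^sup>2 * (\<Sum>k<d. (\<phi> n k)\<^sup>2) \<le> 4 * (\<Sum>k<d. (coef (\<phi> n) c n k)\<^sup>2)"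
    proof (intro exI[of _ d0] allI impI)
      fix n d assume d: "d0 \<le> d" "d \<le> n"
      have "s\<^sup>2 * (\<Sum>k<d. (\<phi> n k)\<^sup>2) = (\<Sum>k<d. (s * \<phi> n k)\<^sup>2)" by (rule fs[symmetric])
      also have "\<dots> \<le> (\<Sum>k<d. 2 * (coef (\<phi> n) c d k - s * (if k < d then \<phi> n k else 0))\<^sup>2 + 2 * (coef (\<phi> n) c n k)\<^sup>2)"
      proof (intro sum_mono)
        fix k assume k: "k \<in> {..<d}"
        have sq: "x\<^sup>2 \<le> 2 * (y - x)\<^sup>2 + 2 * y\<^sup>2" for x y :: real
          using zero_le_power2[of "x - 2 * y"] by (simp add: power2_eq_square algebra_simps)
        show "(s * \<phi> n k)\<^sup>2 \<le> 2 * (coef (\<phi> n) c d k - s * (if k < d then \<phi> n k else 0))\<^sup>2 + 2 * (coef (\<phi> n) c n k)\<^sup>2"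
          using sq[of "s * \<phi> n k" "coef (\<phi> n) c n k"] k coef_lag[of k d n "\<phi> n" c] d by simp
      qed
      also have "\<dots> = 2 * (\<Sum>k<d. (coef (\<phi> n) c d k - s * (if k < d then \<phi> n k else 0))\<^sup>2) + 2 * (\<Sum>k<d. (coef (\<phi> n) c n k)\<^sup>2)"
        by (simp add: sum.distrib sum_distrib_left)
      also have "(\<Sum>k<d. (coef (\<phi> n) c d k - s * (if k < d then \<phi> n k else 0))\<^sup>2) \<le> s\<^sup>2 / 4 * (\<Sum>k<d. (\<phi> n k)\<^sup>2)"
        by (rule order_trans[OF sum_le_suminf]) (use d0[OF d] in auto)
      finally show "s\<^sup>2 * (\<Sum>k<d. (\<phi> n k)\<^sup>2) \<le> 4 * (\<Sum>k<d. (coef (\<phi> n) c n k)\<^sup>2)" by simp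
    qed
  next
    fix \<delta> \<eta> :: real assume \<delta>: "0 < \<delta>" and \<eta>: "0 < \<eta>"
    obtain d0 where d0: "\<And>n t. d0 \<le> t \<Longrightarrow> t \<le> n \<Longrightarrow>
      (\<Sum>k. (coef (\<phi> n) c t k - s * (if k < t then \<phi> n k else 0))\<^sup>2) \<le> \<eta> * s\<^sup>2 * (\<Sum>k<t. (\<phi> n k)\<^sup>2)"
      using small[of "\<eta> * s\<^sup>2"] s2 \<eta> by auto
    have z: "(if k < t then s * \<phi> n k else if k < t + n then 0 else 0) = s * (if k < t then \<phi> n k else 0)" for k t n by simp
    show "\<forall>\<^sub>F n in sequentially. \<forall>t. \<delta> * real n \<le> real t \<longrightarrow> 1 \<le> t \<longrightarrow> t \<le> n \<longrightarrow>
      (\<Sum>k. (coef (\<phi> n) c t k - (if k < t then s * \<phi> n k else if k < t + n then 0 else 0))\<^sup>2) \<le> \<eta> * (s\<^sup>2 * (\<Sum>k<n. (\<phi> n k)\<^sup>2))"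
      unfolding z using eventually_ge_at_top[of "nat \<lceil>real d0 / \<delta>\<rceil>"]
    proof eventually_elim
      case (elim n)
      show ?case
      proof (intro allI impI)
        fix t assume t: "\<delta> * real n \<le> real t" "1 \<le> t" "t \<le> n"
        have "real d0 / \<delta> \<le> real n" using elim by linarith
        then have "d0 \<le> t" using t \<delta> by (simp add: pos_divide_le_eq mult.commute)
        then have "(\<Sum>k. (coef (\<phi> n) c t k - s * (if k < t then \<phi> n k else 0))\<^sup>2) \<le> \<eta> * s\<^sup>2 * (\<Sum>k<t. (\<phi> n k)\<^sup>2)" using t by (intro d0)
        also have "\<dots> \<le> \<eta> * s\<^sup>2 * (\<Sum>k<n. (\<phi> n k)\<^sup>2)" using \<eta> t by (intro mult_left_mono sum_mono2) auto
        finally show "(\<Sum>k. (coef (\<phi> n) c t k - s * (if k < t then \<phi> n k else 0))\<^sup>2) \<le> \<eta> * (s\<^sup>2 * (\<Sum>k<n. (\<phi> n k)\<^sup>2))" by (simp add: mult.assoc)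
      qed
    qed
  qed (use c B \<gamma> in \<open>auto simp: abs_mult intro!: mult_left_mono mult_nonneg_nonneg order_trans[OF abs_ge_zero B]\<close>)
  then show ?thesis by (simp add: s_def)
qed

text \<open>The squared weights are comparable with \<open>l(k)^2 / k\<close>, which yields
  divergence, slow growth and boundedness. The ratio of successive weights tends to 1 because
  \<open>l\<close> varies slowly, which yields smoothness.\<close>

lemma FR2_coef_array:
  assumes "assumption_FR2 \<phi> c"
  shows "\<exists>B B'. coef_array \<phi> c (\<lambda>n k. suminf c * \<phi> n k) (\<lambda>_ _. 0) B B' 0 (1 / 2)"
proof -
  obtain l p where scale: "FR_scale l" and \<phi>: "\<forall>n\<ge>1. \<forall>j. \<phi> n j = p j"
    and p: "p \<sim>[sequentially] (\<lambda>j. l (real j) * real j powr (- 1 / 2))"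
    and c: "summable (\<lambda>s. \<bar>c s\<bar>)" "suminf c \<noteq> 0" using assms unfolding assumption_FR2_def by blast
  define u where "u j = l (real j) * real j powr (- 1 / 2)" for j :: nat
  have u: "0 < u j" if "1 \<le> j" for j using that FR_pos[OF scale, of "real j"] by (simp add: u_def)
  have pu: "(\<lambda>n. p n / u n) \<longlonglongrightarrow> 1" "\<forall>\<^sub>F n in sequentially. u n / 2 \<le> p n \<and> p n \<le> 2 * u n"
    by (rule asymp_equiv_pos[OF p[folded u_def]], erule u)+
  have u2: "(u j)\<^sup>2 = (l (real j))\<^sup>2 / real j" for j
  proof (cases "j = 0")
    case False
    have "(real j powr (- 1 / 2))\<^sup>2 = real j powr (- 1)" using False by (simp add: powr_power)
    then show ?thesis unfolding u_def power_mult_distrib by (simp only:) (simp add: powr_minus_divide)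
  qed (simp add: u_def)
  have cmp: "\<forall>\<^sub>F k in sequentially. 1 / 4 * ((l (real k))\<^sup>2 / real k) \<le> (p k)\<^sup>2 \<and> (p k)\<^sup>2 \<le> 4 * ((l (real k))\<^sup>2 / real k)"
    using pu(2) eventually_ge_at_top[of 1]
  proof eventually_elim
    case (elim k)
    have "(u k / 2)\<^sup>2 \<le> (p k)\<^sup>2" "(p k)\<^sup>2 \<le> (2 * u k)\<^sup>2" by (rule power_mono; use elim u[of k] in linarith)+
    then show ?case unfolding u2[symmetric] by (simp add: power_mult_distrib power_divide)
  qed
  note FR = FR_comparable_at_top[OF scale _ _ cmp, simplified] FR_comparable_slow[OF scale _ _ cmp, simplified] FR_comparable_bounded[OF scale _ _ cmp, simplified]
  define w where "w n = (\<Sum>k<n. (p k)\<^sup>2)" for n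
  have w: "0 \<le> w n" "m \<le> n \<Longrightarrow> w m \<le> w n" for m n by (auto simp: w_def sum_nonneg intro: sum_mono2)
  have slow: "0 < \<eta> \<Longrightarrow> \<forall>\<^sub>F n in sequentially. w n \<le> (1 + \<eta>) * w (n div 2)" for \<eta> unfolding w_def by (rule FR(2))
  have W: "(\<Sum>k<t. (\<phi> n k)\<^sup>2) = w t" if "1 \<le> n" for n t using that \<phi> by (simp add: w_def)
  obtain B where B: "\<And>k. (p k)\<^sup>2 \<le> B" using FR(3) by blast
  have B': "\<bar>p k\<bar> \<le> sqrt B" for k using real_sqrt_le_mono[OF B[of k]] by simp
  have ratio: "(\<lambda>k. p (Suc k) / p k) \<longlonglongrightarrow> 1"
  proof -
    have l: "(\<lambda>k. l (real (Suc k)) / l (real k)) \<longlonglongrightarrow> 1"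
    proof (rule LIMSEQ_I)
      fix e :: real assume e: "0 < e"
      obtain K where K: "1 \<le> K" "\<And>k m. K \<le> k \<Longrightarrow> k \<le> m \<Longrightarrow> m \<le> 4 * k \<Longrightarrow> l (real m) \<le> (1 + e / 2) * l (real k) \<and> l (real k) \<le> (1 + e / 2) * l (real m)"
        by (rule FR_ratio[OF scale, of "e / 2"]) (use e in auto)
      have "norm (l (real (Suc k)) / l (real k) - 1) < e" if k: "K \<le> k" for k
      proof -
        define x where "x = l (real k)"
        define y where "y = l (real (Suc k))"
        have xy: "0 < x" "0 < y" using FR_pos[OF scale] K(1) k by (auto simp: x_def y_def)
        have "Suc k \<le> 4 * k" using K(1) k by simp
        then have 1: "y \<le> (1 + e / 2) * x" "x \<le> (1 + e / 2) * y" using K(2)[of k "Suc k"] k by (auto simp: x_def y_def)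
        have "x - y \<le> e / 2 * x"
        proof (cases "y \<le> x")
          case True
          then have "e / 2 * y \<le> e / 2 * x" using e by (intro mult_left_mono) auto
          then show ?thesis using 1 by (simp add: algebra_simps)
        next
          case False
          then show ?thesis using xy e by (smt (verit) mult_pos_pos half_gt_zero)
        qed
        moreover have "y - x \<le> e / 2 * x" using 1 by (simp add: algebra_simps)
        ultimately have "\<bar>y - x\<bar> \<le> e / 2 * x" by linarith
        then have "\<bar>y / x - 1\<bar> \<le> e / 2" using xy by (simp add: abs_le_iff field_simps)
        then show ?thesis using e by (simp add: x_def y_def)
      qed
      then show "\<exists>no. \<forall>n\<ge>no. norm (l (real (Suc n)) / l (real n) - 1) < e" by blast
    qed
    have "(\<lambda>k. (real (Suc k) / real k) powr (- 1 / 2)) \<longlonglongrightarrow> 1 powr (- 1 / 2)"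
      by (intro tendsto_powr LIMSEQ_Suc_n_over_n tendsto_const) simp
    then have "(\<lambda>k. l (real (Suc k)) / l (real k) * (real (Suc k) / real k) powr (- 1 / 2)) \<longlonglongrightarrow> 1 * 1"
      using l by (intro tendsto_mult) auto
    then have uu: "(\<lambda>k. u (Suc k) / u k) \<longlonglongrightarrow> 1" by (simp add: u_def powr_divide)
    have "(\<lambda>k. (p (Suc k) / u (Suc k)) * (u (Suc k) / u k) * inverse (p k / u k)) \<longlonglongrightarrow> 1 * 1 * inverse 1"
      by (intro tendsto_mult tendsto_inverse uu LIMSEQ_Suc[OF pu(1)] pu(1)) auto
    moreover have "\<forall>\<^sub>F k in sequentially. (p (Suc k) / u (Suc k)) * (u (Suc k) / u k) * inverse (p k / u k) = p (Suc k) / p k"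
      using eventually_ge_at_top[of 1]
    proof eventually_elim
      case (elim k)
      then show ?case using u[of k] u[of "Suc k"] by simp
    qed
    ultimately have "(\<lambda>k. p (Suc k) / p k) \<longlonglongrightarrow> 1 * 1 * inverse 1" by (rule Lim_transform_eventually)
    then show ?thesis by simp
  qed
  have "coef_array \<phi> c (\<lambda>n k. suminf c * \<phi> n k) (\<lambda>_ _. 0) (sqrt B) (\<bar>suminf c\<bar> * sqrt B) 0 (1 / 2)"
  proof (rule smooth_coef_array[OF c])
    show "1 \<le> n \<Longrightarrow> \<bar>\<phi> n j\<bar> \<le> sqrt B" for n j using \<phi> B' by simp
    show "\<exists>d0. \<forall>n t. d0 \<le> t \<longrightarrow> t \<le> n \<longrightarrow> R \<le> (\<Sum>k<t. (\<phi> n k)\<^sup>2)" for R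
    proof -
      have "\<forall>\<^sub>F n in sequentially. R \<le> w n" using FR(1) by (simp add: filterlim_at_top w_def)
      then obtain N where N: "\<And>n. N \<le> n \<Longrightarrow> R \<le> w n" by (auto simp: eventually_sequentially)
      show ?thesis by (intro exI[of _ "max 1 N"]) (auto simp: W N)
    qed
    fix e :: real assume e: "0 < e"
    have "\<forall>\<^sub>F k in sequentially. \<bar>p (Suc k) / p k - 1\<bar> < e" using tendstoD[OF ratio e] by (simp add: dist_real_def)
    moreover have "\<forall>\<^sub>F k in sequentially. 0 < p k" using pu(2) eventually_ge_at_top[of 1]
    proof eventually_elim
      case (elim k)
      then show ?case using u[of k] by linarith
    qed
    ultimately have "\<forall>\<^sub>F k in sequentially. \<bar>p (Suc k) - p k\<bar> \<le> e * \<bar>p k\<bar>"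
    proof eventually_elim
      case (elim k)
      then have "\<bar>p (Suc k) - p k\<bar> = \<bar>p (Suc k) / p k - 1\<bar> * p k" by (simp add: abs_mult_pos[symmetric] field_simps)
      then show ?case using elim by simp
    qed
    then obtain k0 where "\<And>k. k0 \<le> k \<Longrightarrow> \<bar>p (Suc k) - p k\<bar> \<le> e * \<bar>p k\<bar>" by (auto simp: eventually_sequentially)
    then show "\<exists>k0. \<forall>n k. k0 \<le> n \<longrightarrow> k0 \<le> k \<longrightarrow> \<bar>\<phi> n (Suc k) - \<phi> n k\<bar> \<le> e * \<bar>\<phi> n k\<bar>"
      using \<phi> by (intro exI[of _ "max 1 k0"]) auto
  next
    fix \<delta> \<eta> :: real assume d: "0 < \<delta>" "0 < \<eta>"
    have "\<forall>\<^sub>F n in sequentially. \<forall>t. \<delta> * real n \<le> real t \<longrightarrow> t \<le> n \<longrightarrow> (1 - \<eta>) * w n \<le> w t"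
      by (rule slow_growth_flat[OF w slow d])
    with eventually_ge_at_top[of 1]
    show "\<forall>\<^sub>F n in sequentially. \<forall>t. \<delta> * real n \<le> real t \<longrightarrow> t \<le> n \<longrightarrow> (1 - \<eta>) * (\<Sum>k<n. (\<phi> n k)\<^sup>2) \<le> (\<Sum>k<t. (\<phi> n k)\<^sup>2)"
      by eventually_elim (simp add: W)
  next
    obtain d0 where d0: "1 \<le> d0" "\<And>n d. d0 \<le> d \<Longrightarrow> d \<le> n \<Longrightarrow> w n \<le> 2 * w d * (real n / real d) powr (1 / 2)"
      using slow_growth_powr[OF w slow] by blast
    show "\<exists>C d0. \<forall>n d. d0 \<le> d \<longrightarrow> d \<le> n \<longrightarrow> (\<Sum>k<n. (\<phi> n k)\<^sup>2) \<le> C * (\<Sum>k<d. (\<phi> n k)\<^sup>2) * (real n / real d) powr (1 / 2)"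
    proof (intro exI[of _ "2 :: real"] exI[of _ d0] allI impI)
      fix n d assume "d0 \<le> d" "d \<le> n"
      then show "(\<Sum>k<n. (\<phi> n k)\<^sup>2) \<le> 2 * (\<Sum>k<d. (\<phi> n k)\<^sup>2) * (real n / real d) powr (1 / 2)"
        using d0 by (simp add: W)
    qed
  qed auto
  then show ?thesis by blast
qed

text \<open>The partial sums of squared weights are geometric, of the order of the smaller of
  \<open>t\<close> and \<open>\<kappa> n\<close>. As \<open>\<kappa> n\<close> is at most a multiple
  of \<open>n^\<gamma>\<close> with \<open>\<gamma> < 1\<close>, they are saturated at times
  proportional to \<open>n\<close>.\<close>

lemma MI_coef_array:
  assumes "assumption_MI \<phi> c"
  shows "\<exists>\<gamma> B B'. coef_array \<phi> c (\<lambda>n k. suminf c * \<phi> n k) (\<lambda>_ _. 0) B B' 0 \<gamma>"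
proof -
  obtain \<kappa> :: "nat \<Rightarrow> real" and \<alpha> l where \<phi>: "\<forall>n\<ge>1. \<forall>j. \<phi> n j = (1 - inverse (\<kappa> n)) ^ j"
    and c: "summable (\<lambda>s. \<bar>c s\<bar>)" "suminf c \<noteq> 0"
    and \<kappa>: "\<forall>n\<ge>1. \<kappa> n > 1 \<and> \<kappa> n = real n powr \<alpha> * l (real n)"
    and sv: "slowly_varying l" and \<alpha>: "0 \<le> \<alpha>" "\<alpha> < 1" and \<kappa>_top: "filterlim \<kappa> at_top sequentially"
    using assms unfolding assumption_MI_def by blast
  \<comment> \<open>Midway between \<open>\<alpha>\<close> and 1: the surplus
    \<open>\<gamma> - \<alpha>\<close> absorbs the slowly varying factor.\<close>
  define \<gamma> where "\<gamma> = (\<alpha> + 1) / 2"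
  have \<gamma>: "0 \<le> \<gamma>" "\<gamma> < 1" "\<alpha> < \<gamma>" using \<alpha> by (auto simp: \<gamma>_def)
  obtain C where C: "0 \<le> C" "\<And>n. 1 \<le> n \<Longrightarrow> \<kappa> n \<le> C * real n powr \<gamma>"
  proof -
    \<comment> \<open>One doubling multiplies \<open>n powr (\<gamma> - \<alpha>)\<close> by exactly
      \<open>1 + \<eta>\<close>.\<close>
    define \<eta> where "\<eta> = 2 powr (\<gamma> - \<alpha>) - 1"
    have \<eta>: "0 < \<eta>" using \<gamma> by (simp add: \<eta>_def)
    obtain X where X: "X \<ge> 1" "\<And>x y. X \<le> x \<Longrightarrow> x \<le> y \<and> y \<le> 4 * x \<Longrightarrow> 0 < l x \<and> l y \<le> (1 + \<eta>) * l x"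
      using slowly_varying_ratio[OF sv \<eta>] by blast
    define Y where "Y = nat \<lceil>X\<rceil>"
    have "\<exists>C\<ge>0. \<forall>n\<ge>1. \<bar>l (real n)\<bar> \<le> C * real n powr (\<gamma> - \<alpha>)"
    proof (rule halving_bound[where q = "1 + \<eta>" and N = "2 * Y + 2"])
      fix n assume n: "2 * Y + 2 \<le> n"
      define m where "m = n div 2"
      have m: "m \<le> n" "n \<le> 4 * m" "Y \<le> m" using n by (auto simp: m_def)
      have m': "X \<le> real m" "X \<le> real n" using m unfolding Y_def by linarith+
      have "real n \<le> 4 * real m" "real m \<le> real n" using m by linarith+
      then have "0 < l (real m)" "l (real n) \<le> (1 + \<eta>) * l (real m)" "0 < l (real n)"
        using X(2)[of "real m" "real n"] X(2)[of "real n" "real n"] m' X(1) by auto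
      then show "\<bar>l (real n)\<bar> \<le> (1 + \<eta>) * \<bar>l (real (n div 2))\<bar>" by (simp add: m_def)
    qed (use \<gamma> in \<open>auto simp: \<eta>_def\<close>)
    then obtain C where C: "0 \<le> C" "\<And>n. 1 \<le> n \<Longrightarrow> \<bar>l (real n)\<bar> \<le> C * real n powr (\<gamma> - \<alpha>)" by blast
    show ?thesis
    proof (rule that[OF C(1)])
      fix n :: nat assume n: "1 \<le> n"
      have "\<kappa> n = real n powr \<alpha> * l (real n)" using \<kappa> n by blast
      also have "\<dots> \<le> real n powr \<alpha> * (C * real n powr (\<gamma> - \<alpha>))" using C(2)[OF n] by (intro mult_left_mono) auto
      also have "\<dots> = C * real n powr \<gamma>" by (simp add: mult.left_commute flip: powr_add)
      finally show "\<kappa> n \<le> C * real n powr \<gamma>" .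
    qed
  qed
  define \<rho> where "\<rho> n = 1 - inverse (\<kappa> n)" for n
  have \<kappa>1: "1 < \<kappa> n" if "1 \<le> n" for n using \<kappa> that by blast
  have \<rho>: "0 < \<rho> n" "\<rho> n < 1" if "1 \<le> n" for n using \<kappa>1[OF that] by (auto simp: \<rho>_def field_simps)
  define w where "w n t = (\<Sum>k<t. ((\<rho> n)\<^sup>2) ^ k)" for n t
  have W: "(\<Sum>k<t. (\<phi> n k)\<^sup>2) = w n t" if "1 \<le> n" for n t using that \<phi> by (simp add: w_def \<rho>_def power_mult[symmetric] mult.commute)
  have w_upper: "w n t \<le> \<kappa> n" if n: "1 \<le> n" for n t
  proof -
    have r2: "(\<rho> n)\<^sup>2 \<le> \<rho> n" using \<rho>[OF n] by (simp add: power2_eq_square mult_left_le)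
    have "w n t \<le> (\<Sum>k. ((\<rho> n)\<^sup>2) ^ k)"
      unfolding w_def using \<rho>[OF n] r2 by (intro sum_le_suminf summable_geometric) auto
    also have "\<dots> = 1 / (1 - (\<rho> n)\<^sup>2)" using \<rho>[OF n] r2 by (intro suminf_geometric) auto
    also have "\<dots> \<le> 1 / (1 - \<rho> n)" using \<rho>[OF n] r2 by (intro divide_left_mono) auto
    also have "\<dots> = \<kappa> n" by (simp add: \<rho>_def divide_inverse)
    finally show ?thesis .
  qed
  \<comment> \<open>By Bernoulli's inequality the squared weights at lags below
    \<open>\<kappa> n / 4\<close> are at least 1/2.\<close>
  have w_lower: "real m / 2 \<le> w n t" if n: "1 \<le> n" and m: "m \<le> t" "real m \<le> \<kappa> n / 4" for n m t
  proof -
    have "(\<Sum>k<m. 1 / 2) \<le> (\<Sum>k<m. ((\<rho> n)\<^sup>2) ^ k)"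
    proof (intro sum_mono)
      fix k assume "k \<in> {..<m}"
      then have "real (2 * k) \<le> \<kappa> n / 2" using m by simp
      then have "real (2 * k) * inverse (\<kappa> n) \<le> 1 / 2" using \<kappa>1[OF n] by (simp add: field_simps)
      moreover have "1 + real (2 * k) * (- inverse (\<kappa> n)) \<le> (1 + (- inverse (\<kappa> n))) ^ (2 * k)"
        using \<rho>[OF n] by (intro Bernoulli_inequality) (simp add: \<rho>_def)
      ultimately have "1 / 2 \<le> \<rho> n ^ (2 * k)" by (simp add: \<rho>_def)
      then show "1 / 2 \<le> ((\<rho> n)\<^sup>2) ^ k" by (simp add: power_mult)
    qed
    also have "\<dots> \<le> w n t" unfolding w_def using m by (intro sum_mono2) auto
    finally show ?thesis by simp
  qed
  have "coef_array \<phi> c (\<lambda>n k. suminf c * \<phi> n k) (\<lambda>_ _. 0) 1 (\<bar>suminf c\<bar> * 1) 0 \<gamma>"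
  proof (rule smooth_coef_array[OF c])
    fix n j assume n: "(1::nat) \<le> n"
    show "\<bar>\<phi> n j\<bar> \<le> 1" using \<phi> n \<rho>[OF n] by (simp add: \<rho>_def[symmetric] power_le_one)
  next
    fix R :: real
    define m where "m = nat \<lceil>2 * \<bar>R\<bar>\<rceil>"
    have "\<forall>\<^sub>F n in sequentially. 4 * real m \<le> \<kappa> n" using \<kappa>_top by (simp add: filterlim_at_top)
    then obtain N where N: "\<And>n. N \<le> n \<Longrightarrow> 4 * real m \<le> \<kappa> n" by (auto simp: eventually_sequentially)
    show "\<exists>d0. \<forall>n t. d0 \<le> t \<longrightarrow> t \<le> n \<longrightarrow> R \<le> (\<Sum>k<t. (\<phi> n k)\<^sup>2)"
    proof (intro exI[of _ "max 1 (max N m)"] allI impI)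
      fix n t assume t: "max 1 (max N m) \<le> t" "t \<le> n"
      have "R \<le> real m / 2" unfolding m_def by linarith
      also have "\<dots> \<le> w n t" using t N[of n] by (intro w_lower) auto
      finally show "R \<le> (\<Sum>k<t. (\<phi> n k)\<^sup>2)" using t by (simp add: W)
    qed
  next
    fix e :: real assume e: "0 < e"
    have "\<forall>\<^sub>F n in sequentially. inverse e \<le> \<kappa> n" using \<kappa>_top by (simp add: filterlim_at_top)
    then obtain N where N: "\<And>n. N \<le> n \<Longrightarrow> inverse e \<le> \<kappa> n" by (auto simp: eventually_sequentially)
    show "\<exists>k0. \<forall>n k. k0 \<le> n \<longrightarrow> k0 \<le> k \<longrightarrow> \<bar>\<phi> n (Suc k) - \<phi> n k\<bar> \<le> e * \<bar>\<phi> n k\<bar>"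
    proof (intro exI[of _ "max 1 N"] allI impI)
      fix n k assume n: "max 1 N \<le> n"
      then have n1: "1 \<le> n" by simp
      have "inverse (\<kappa> n) \<le> inverse (inverse e)" using N[of n] n e by (intro le_imp_inverse_le) auto
      then have "inverse (\<kappa> n) * \<rho> n ^ k \<le> e * \<rho> n ^ k" using \<rho>[OF n1] by (intro mult_right_mono) auto
      moreover have "\<rho> n ^ Suc k - \<rho> n ^ k = - (inverse (\<kappa> n) * \<rho> n ^ k)" by (simp add: \<rho>_def algebra_simps)
      moreover have "0 \<le> inverse (\<kappa> n) * \<rho> n ^ k" using \<rho>[OF n1] \<kappa>1[OF n1] by simp
      moreover have "\<phi> n i = \<rho> n ^ i" for i using \<phi> n1 by (simp add: \<rho>_def)
      moreover have "0 \<le> \<rho> n ^ k" using \<rho>[OF n1] by simp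
      ultimately show "\<bar>\<phi> n (Suc k) - \<phi> n k\<bar> \<le> e * \<bar>\<phi> n k\<bar>" by simp
    qed
  next
    fix \<delta> \<eta> :: real assume \<delta>: "0 < \<delta>" and \<eta>: "0 < \<eta>"
    have "(\<lambda>n. C * real n powr (\<gamma> - 1)) \<longlonglongrightarrow> C * 0"
      using \<gamma> by (intro tendsto_intros tendsto_neg_powr filterlim_real_sequentially) simp
    then have "\<forall>\<^sub>F n in sequentially. C * real n powr (\<gamma> - 1) < \<delta> * \<eta>"
      using \<delta> \<eta> by (intro order_tendstoD) auto
    then show "\<forall>\<^sub>F n in sequentially. \<forall>t. \<delta> * real n \<le> real t \<longrightarrow> t \<le> n \<longrightarrow> (1 - \<eta>) * (\<Sum>k<n. (\<phi> n k)\<^sup>2) \<le> (\<Sum>k<t. (\<phi> n k)\<^sup>2)"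
      using eventually_ge_at_top[of 1]
    proof eventually_elim
      case (elim n)
      note n = elim(2)
      show ?case unfolding W[OF n]
      proof (intro allI impI)
        fix t assume t: "\<delta> * real n \<le> real t" "t \<le> n"
        have "0 < \<delta> * real n" using \<delta> n by simp
        then have t0: "0 < real t" using t by linarith
        have "\<kappa> n \<le> C * real n powr (\<gamma> - 1) * real n" using C(2)[OF n] n by (simp add: powr_diff)
        also have "\<dots> \<le> \<delta> * \<eta> * real n" using elim by (intro mult_right_mono) auto
        also have "\<dots> \<le> \<eta> * real t" using t \<eta> mult_left_mono[OF t(1), of \<eta>] by (simp add: mult_ac)
        finally have \<kappa>t: "\<kappa> n \<le> \<eta> * real t" .
        have r: "((\<rho> n)\<^sup>2) ^ t \<le> \<eta>"
        proof -
          have "((\<rho> n)\<^sup>2) ^ t = \<rho> n ^ (2 * t)" by (simp add: power_mult)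
          also have "\<dots> \<le> \<rho> n ^ t" using \<rho>[OF n] by (intro power_decreasing) auto
          \<comment> \<open>From \<open>(1 - y) * (1 + y) \<le> 1\<close> with
            \<open>y = inverse (\<kappa> n)\<close>, and Bernoulli's inequality for
            \<open>(1 + y)^t\<close>.\<close>
          also have "\<dots> \<le> 1 / (1 + real t * inverse (\<kappa> n))"
          proof -
            have "1 + real t * inverse (\<kappa> n) \<le> (1 + inverse (\<kappa> n)) ^ t"
              using \<kappa>1[OF n] by (intro Bernoulli_inequality) (simp add: order_trans[of _ 0])
            then have "\<rho> n ^ t * (1 + real t * inverse (\<kappa> n)) \<le> \<rho> n ^ t * (1 + inverse (\<kappa> n)) ^ t" using \<rho>[OF n] by (intro mult_left_mono) auto
            also have "\<dots> = (1 - (inverse (\<kappa> n))\<^sup>2) ^ t" unfolding power_mult_distrib[symmetric] by (simp add: \<rho>_def algebra_simps power2_eq_square)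
            also have "\<dots> \<le> 1" using \<kappa>1[OF n] by (intro power_le_one) (auto simp: power_le_one inverse_le_1_iff)
            finally show ?thesis using \<kappa>1[OF n] by (simp add: pos_le_divide_eq add_pos_nonneg)
          qed
          also have "\<dots> \<le> 1 / (real t * inverse (\<kappa> n))"
            using \<kappa>1[OF n] t0 by (intro divide_left_mono mult_pos_pos add_pos_pos) auto
          also have "\<dots> \<le> \<eta>" using \<kappa>t t0 \<kappa>1[OF n] by (simp add: field_simps)
          finally show ?thesis .
        qed
        \<comment> \<open>The part of the sum from \<open>t\<close> on is an initial part of the
          same geometric sum, scaled by a factor of at most \<open>\<eta>\<close>.\<close>
        have "n = t + (n - t)" using t by simp
        then have "w n n = w n t + (\<Sum>k<n - t. ((\<rho> n)\<^sup>2) ^ (k + t))" unfolding w_def by (metis sum_lessThan_add)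
        also have "(\<Sum>k<n - t. ((\<rho> n)\<^sup>2) ^ (k + t)) = (\<Sum>k<n - t. ((\<rho> n)\<^sup>2) ^ k) * ((\<rho> n)\<^sup>2) ^ t"
          by (simp add: power_add sum_distrib_right)
        also have "\<dots> \<le> w n n * \<eta>" unfolding w_def using r by (intro mult_mono sum_mono2 sum_nonneg) auto
        finally show "(1 - \<eta>) * w n n \<le> w n t" by (simp add: algebra_simps)
      qed
    qed
  next
    have "\<forall>\<^sub>F n in sequentially. 8 \<le> \<kappa> n" using \<kappa>_top by (simp add: filterlim_at_top)
    then obtain N where N: "\<And>n. N \<le> n \<Longrightarrow> 8 \<le> \<kappa> n" by (auto simp: eventually_sequentially)
    \<comment> \<open>For blocks not shorter than \<open>m\<close>, 16 results from
      \<open>\<kappa> n / 8 \<le> m\<close> and \<open>m / 2 \<le> w n d\<close>; for shorter ones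
      \<open>2 * C\<close> results from \<open>d / 2 \<le> w n d\<close> and
      \<open>d powr \<gamma> \<le> d\<close>.\<close>
    define C' where "C' = max 16 (2 * C)"
    show "\<exists>C d0. \<forall>n d. d0 \<le> d \<longrightarrow> d \<le> n \<longrightarrow> (\<Sum>k<n. (\<phi> n k)\<^sup>2) \<le> C * (\<Sum>k<d. (\<phi> n k)\<^sup>2) * (real n / real d) powr \<gamma>"
    proof (intro exI[of _ C'] exI[of _ "max 1 N"] allI impI)
      fix n d assume d: "max 1 N \<le> d" "d \<le> n"
      then have n: "1 \<le> n" and d1: "1 \<le> real d" and nd: "1 \<le> real n / real d" by auto
      define m where "m = nat \<lfloor>\<kappa> n / 4\<rfloor>"
      have m: "real m \<le> \<kappa> n / 4" "\<kappa> n / 8 \<le> real m" using N[of n] d unfolding m_def by linarith+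
      have w0: "0 \<le> w n d" by (simp add: w_def sum_nonneg)
      have "\<kappa> n \<le> C' * w n d * (real n / real d) powr \<gamma>"
      proof (cases "m \<le> d")
        case True
        have "\<kappa> n \<le> 16 * w n d" using w_lower[OF n True m(1)] m by simp
        also have "\<dots> \<le> C' * w n d * 1" using w0 by (simp add: C'_def mult_right_mono)
        also have "\<dots> \<le> C' * w n d * (real n / real d) powr \<gamma>"
          using nd \<gamma> w0 by (intro mult_left_mono ge_one_powr_ge_zero) (auto simp: C'_def)
        finally show ?thesis .
      next
        case False
        then have wd: "real d / 2 \<le> w n d" using m by (intro w_lower[OF n]) auto
        have "\<kappa> n \<le> C * real n powr \<gamma>" by (rule C(2)[OF n])
        also have "real n powr \<gamma> = real d powr \<gamma> * (real n / real d) powr \<gamma>" using d1 by (simp add: powr_divide)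
        also have "C * (real d powr \<gamma> * (real n / real d) powr \<gamma>) \<le> C * (real d * (real n / real d) powr \<gamma>)"
          using C(1) d1 \<gamma> powr_mono[of \<gamma> 1 "real d"] by (intro mult_left_mono mult_right_mono) auto
        also have "\<dots> \<le> C * (2 * w n d * (real n / real d) powr \<gamma>)" using wd C(1) by (intro mult_left_mono mult_right_mono) auto
        also have "\<dots> = 2 * C * (w n d * (real n / real d) powr \<gamma>)" by simp
        also have "\<dots> \<le> C' * (w n d * (real n / real d) powr \<gamma>)" using w0 by (intro mult_right_mono) (auto simp: C'_def)
        finally show ?thesis by (simp add: mult.assoc)
      qed
      then show "(\<Sum>k<n. (\<phi> n k)\<^sup>2) \<le> C' * (\<Sum>k<d. (\<phi> n k)\<^sup>2) * (real n / real d) powr \<gamma>"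
        using w_upper[OF n, of n] by (simp add: W[OF n])
    qed
  qed (use \<gamma> in auto)
  then show ?thesis by blast
qed

text \<open>As \<open>c\<close> sums to 0, \<open>D k\<close> is the tail of the series beyond
  \<open>k\<close>. Its block up to \<open>2 * k\<close> is comparable with
  \<open>l(k) / sqrt k\<close>, and this quantity shrinks by a fixed factor at each doubling, so the
  whole tail is comparable with its first block.\<close>

lemma partial_sums_asymptotics:
  fixes c :: "nat \<Rightarrow> real"
  assumes scale: "FR_scale l" and asy: "c \<sim>[sequentially] (\<lambda>s. l (real s) * real s powr (- 3 / 2))" and sums: "c sums 0"
  defines "D \<equiv> \<lambda>k. - (\<Sum>i\<le>k. c i)"
  shows "\<exists>N\<ge>1. (\<forall>k\<ge>N. 0 \<le> c k \<and> 0 \<le> D k \<and> (\<forall>m\<ge>k. D m \<le> D k) \<and>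
      1 / 100 * ((l (real k))\<^sup>2 / real k) \<le> (D k)\<^sup>2 \<and> (D k)\<^sup>2 \<le> 121 * ((l (real k))\<^sup>2 / real k))"
proof -
  define u where "u j = l (real j) * real j powr (- 3 / 2)" for j :: nat
  define y where "y j = l (real j) * real j powr (- 1 / 2)" for j :: nat
  have u: "0 < u j" if "1 \<le> j" for j using that FR_pos[OF scale, of "real j"] by (simp add: u_def)
  have y: "0 < y j" if "1 \<le> j" for j using that FR_pos[OF scale, of "real j"] by (simp add: y_def)
  have uy: "real j * (l (real j) * real j powr (- 3 / 2)) = y j" if "1 \<le> j" for j
  proof -
    have "real j powr 1 * real j powr (- 3 / 2) = real j powr (- 1 / 2)" unfolding powr_add[symmetric] by simp
    then show ?thesis using that by (simp add: y_def mult.left_commute)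
  qed
  have y2: "(y j)\<^sup>2 = (l (real j))\<^sup>2 / real j" for j
  proof (cases "j = 0")
    case False
    have "(real j powr (- 1 / 2))\<^sup>2 = real j powr (- 1)" using False by (simp add: powr_power)
    then show ?thesis unfolding y_def power_mult_distrib by (simp only:) (simp add: powr_minus_divide)
  qed (simp add: y_def)
  have cu: "\<forall>\<^sub>F n in sequentially. u n / 2 \<le> c n \<and> c n \<le> 2 * u n"
    by (rule asymp_equiv_pos[OF asy[folded u_def]], erule u)
  then obtain N0 where N0: "\<And>n. N0 \<le> n \<Longrightarrow> u n / 2 \<le> c n \<and> c n \<le> 2 * u n" by (auto simp: eventually_sequentially)
  obtain K where K: "1 \<le> K" "\<And>k m. K \<le> k \<Longrightarrow> k \<le> m \<Longrightarrow> m \<le> 4 * k \<Longrightarrow> l (real m) \<le> (1 + 1 / 10) * l (real k) \<and> l (real k) \<le> (1 + 1 / 10) * l (real m)"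
    by (rule FR_ratio[OF scale, of "1 / 10"]) auto
  define N where "N = max N0 K"
  have N1: "1 \<le> N" using K by (simp add: N_def)
  have c0: "0 \<le> c k" if "N \<le> k" for k
  proof -
    have "1 \<le> k" using that N1 by simp
    then show ?thesis using N0[of k] u[of k] that by (simp add: N_def)
  qed
  have step: "D k = D (Suc k) + c (Suc k)" for k by (simp add: D_def)
  have dec: "D m \<le> D k" if "N \<le> k" "k \<le> m" for k m using that(2)
  proof (induction m rule: dec_induct)
    case (step m)
    then show ?case using \<open>\<And>k. D k = D (Suc k) + c (Suc k)\<close>[of m] c0[of "Suc m"] that(1) by simp
  qed simp
  have D0: "D \<longlonglongrightarrow> 0"
    using tendsto_minus[OF LIMSEQ_Suc[OF sums[unfolded sums_def]]] by (simp add: D_def lessThan_Suc_atMost)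
  have Dnn: "0 \<le> D k" if "N \<le> k" for k by (rule LIMSEQ_le_const2[OF D0]) (use dec that in blast)
  have block: "D k = D (2 * k) + (\<Sum>j\<in>{k<..2 * k}. c j)" for k
  proof -
    have "{..2 * k} = {..k} \<union> {k<..2 * k}" by auto
    then have "(\<Sum>i\<le>2 * k. c i) = (\<Sum>i\<le>k. c i) + (\<Sum>j\<in>{k<..2 * k}. c j)" by (simp only:) (rule sum.union_disjoint, auto)
    then show ?thesis by (simp add: D_def)
  qed
  \<comment> \<open>\<open>22 / 10\<close> is twice \<open>11 / 10\<close>, and
    \<open>1 / 10\<close> lies below \<open>1 / 2 * (10 / 11) * (1 / 4)\<close>, where
    \<open>1 / 4 \<le> 2 powr (- 3 / 2)\<close> accounts for the arguments up to
    \<open>2 * k\<close>.\<close>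
  have bounds: "(\<Sum>j\<in>{k<..2 * k}. c j) \<le> 22 / 10 * y k" "y k / 10 \<le> (\<Sum>j\<in>{k<..2 * k}. c j)" if k: "N \<le> k" for k
  proof -
    have k1: "1 \<le> k" using k N1 by simp
    define z where "z = l (real k) * real k powr (- 3 / 2)"
    have z: "real k * z = y k" unfolding z_def by (rule uy[OF k1])
    have z0: "0 < z" using u[OF k1] by (simp add: u_def z_def)
    have pt: "c j \<le> 22 / 10 * z" "z / 10 \<le> c j" if j: "j \<in> {k<..2 * k}" for j
    proof -
      have j1: "k \<le> j" "j \<le> 4 * k" "N0 \<le> j" "1 \<le> j" using j k k1 by (auto simp: N_def)
      have lj: "l (real j) \<le> 11 / 10 * l (real k)" "l (real k) \<le> 11 / 10 * l (real j)"
        using K(2)[of k j] j1 k by (auto simp: N_def)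
      have lk: "0 < l (real k)" "0 < l (real j)" using FR_pos[OF scale] k1 j1 by auto
      have pj: "real j powr (- 3 / 2) \<le> real k powr (- 3 / 2)" using j1 k1 by (intro powr_mono2') auto
      have "u j \<le> 11 / 10 * l (real k) * real k powr (- 3 / 2)"
        unfolding u_def using lj lk pj by (intro mult_mono) auto
      then show "c j \<le> 22 / 10 * z" using N0[OF j1(3)] by (simp add: z_def)
      have two: "(1 / 4 :: real) \<le> 2 powr (- 3 / 2)"
        using powr_mono[of "- 2" "- 3 / 2" "2 :: real"] by (simp add: powr_minus_divide powr_numeral)
      have "1 / 4 * real k powr (- 3 / 2) \<le> 2 powr (- 3 / 2) * real k powr (- 3 / 2)" using two by (intro mult_right_mono) auto
      also have "\<dots> = (2 * real k) powr (- 3 / 2)" by (simp add: powr_mult)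
      also have "\<dots> \<le> real j powr (- 3 / 2)" using j j1 by (intro powr_mono2') auto
      finally have "10 / 11 * l (real k) * (1 / 4 * real k powr (- 3 / 2)) \<le> u j"
        unfolding u_def using lj lk by (intro mult_mono) auto
      then have "10 / 44 * z \<le> u j" by (simp add: z_def)
      then show "z / 10 \<le> c j" using N0[OF j1(3)] z0 by linarith
    qed
    have "(\<Sum>j\<in>{k<..2 * k}. c j) \<le> (\<Sum>j\<in>{k<..2 * k}. 22 / 10 * z)" by (intro sum_mono pt)
    then show "(\<Sum>j\<in>{k<..2 * k}. c j) \<le> 22 / 10 * y k" by (simp add: z[symmetric])
    have "(\<Sum>j\<in>{k<..2 * k}. z / 10) \<le> (\<Sum>j\<in>{k<..2 * k}. c j)" by (intro sum_mono pt)
    then show "y k / 10 \<le> (\<Sum>j\<in>{k<..2 * k}. c j)" by (simp add: z[symmetric])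
  qed
  have yhalf: "y (2 * k) \<le> 4 / 5 * y k" if k: "N \<le> k" for k
  proof -
    have k1: "1 \<le> k" using k N1 by simp
    have "l (real (2 * k)) \<le> 11 / 10 * l (real k)" using K(2)[of k "2 * k"] k by (auto simp: N_def)
    then have "y (2 * k) \<le> 11 / 10 * l (real k) * (2 * real k) powr (- 1 / 2)"
      unfolding y_def of_nat_mult of_nat_numeral by (rule mult_right_mono) simp
    also have "(2 * real k) powr (- 1 / 2) = 2 powr (- 1 / 2) * real k powr (- 1 / 2)" by (simp add: powr_mult)
    also have "11 / 10 * l (real k) * (2 powr (- 1 / 2) * real k powr (- 1 / 2)) = 11 / 10 * 2 powr (- 1 / 2) * y k" by (simp add: y_def)
    also have "\<dots> \<le> 4 / 5 * y k"
    proof (rule mult_right_mono)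
      have "11 / 8 \<le> sqrt 2" by (rule real_le_rsqrt) (simp add: power2_eq_square)
      then have "1 / sqrt 2 \<le> 1 / (11 / 8)" by (intro divide_left_mono) auto
      moreover have "2 powr (- 1 / 2) = 1 / sqrt 2" by (simp add: powr_minus_divide powr_half_sqrt)
      ultimately have *: "2 powr (- 1 / 2) \<le> (8 / 11 :: real)" by (simp only:) simp
      have "11 / 10 * z \<le> 4 / 5" if "z \<le> 8 / 11" for z :: real using that by simp
      then show "11 / 10 * 2 powr (- 1 / 2) \<le> (4 / 5 :: real)" using * by blast
    qed (use y[OF k1] in simp)
    finally show ?thesis .
  qed
  \<comment> \<open>The constant 11 solves \<open>22 / 10 + 4 / 5 * a = a\<close>: then
    \<open>D - 11 * y\<close> does not decrease along doublings, while \<open>D\<close> tends to 0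
    and \<open>y\<close> is positive.\<close>
  have upper: "D k \<le> 11 * y k" if k: "N \<le> k" for k
  proof -
    have it: "D k - 11 * y k \<le> D (2 ^ r * k) - 11 * y (2 ^ r * k)" for r
    proof (induction r)
      case (Suc r)
      define m where "m = 2 ^ r * k"
      have "k \<le> m" by (simp add: m_def)
      then have m: "N \<le> m" using k by simp
      have "D m - 11 * y m \<le> D (2 * m) - 11 * y (2 * m)" using block[of m] bounds(1)[OF m] yhalf[OF m] by linarith
      then show ?case using Suc.IH by (simp add: m_def mult.assoc)
    qed simp
    have "D k - 11 * y k \<le> D (2 ^ r * k)" for r
    proof -
      have "1 \<le> 2 ^ r * k" using k N1 by simp
      then show ?thesis using it[of r] y[of "2 ^ r * k"] by linarith
    qed
    moreover have "(\<lambda>r. D (2 ^ r * k)) \<longlonglongrightarrow> 0"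
    proof (rule filterlim_compose[OF D0])
      have "r \<le> 2 ^ r * k" for r
      proof -
        have "r \<le> 2 ^ r" by (rule less_imp_le[OF less_exp])
        also have "\<dots> \<le> 2 ^ r * k" using k N1 by simp
        finally show ?thesis .
      qed
      then show "filterlim (\<lambda>r. 2 ^ r * k) sequentially sequentially"
        by (intro filterlim_at_top_mono[OF filterlim_ident]) auto
    qed
    ultimately have "D k - 11 * y k \<le> 0" by (intro LIMSEQ_le_const) auto
    then show ?thesis by simp
  qed
  have lower: "y k / 10 \<le> D k" if k: "N \<le> k" for k using block[of k] bounds(2)[OF k] Dnn[of "2 * k"] k by simp
  show ?thesis
  proof (intro exI[of _ N] conjI allI impI N1)
    fix k assume k: "N \<le> k"
    show "0 \<le> c k" "0 \<le> D k" using c0 Dnn k by auto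
    show "m \<ge> k \<Longrightarrow> D m \<le> D k" for m by (rule dec[OF k])
    have y0: "0 < y k" using y[of k] k N1 by simp
    have "(y k / 10)\<^sup>2 \<le> (D k)\<^sup>2" using lower[OF k] y0 by (intro power_mono) auto
    then show "1 / 100 * ((l (real k))\<^sup>2 / real k) \<le> (D k)\<^sup>2" unfolding y2[symmetric] by (simp add: power_divide)
    have "(D k)\<^sup>2 \<le> (11 * y k)\<^sup>2" using upper[OF k] Dnn[OF k] by (intro power_mono) auto
    then show "(D k)\<^sup>2 \<le> 121 * ((l (real k))\<^sup>2 / real k)" unfolding y2[symmetric] by (simp add: power_mult_distrib)
  qed
qed

lemma coef_unit_weights:
  assumes "\<And>j. p j = 1"
  shows "coef p c t k = (if k < t then \<Sum>i\<le>k. c i else (\<Sum>i\<le>k. c i) - (\<Sum>i\<le>k - t. c i)) \<or> t = 0"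
proof (cases "k < t")
  case True
  have "coef p c t k = (\<Sum>j<Suc k. c (Suc k - Suc j))"
    unfolding coef_def lessThan_Suc_atMost using True assms by (intro sum.cong) auto
  also have "\<dots> = (\<Sum>i<Suc k. c i)" by (rule sum.nat_diff_reindex)
  finally show ?thesis using True by (simp add: lessThan_Suc_atMost)
next
  case False
  have *: "(\<Sum>i\<le>k - t. c i) + (\<Sum>j<t. c (k - j)) = (\<Sum>i\<le>k. c i)" if "t \<le> k" for t using that
  proof (induction t)
    case (Suc t)
    have "k - t = Suc (k - Suc t)" using Suc.prems by simp
    then have "(\<Sum>i\<le>k - t. c i) = (\<Sum>i\<le>k - Suc t. c i) + c (k - t)" by simp
    then show ?case using Suc by (simp add: add.assoc add.commute add.left_commute)
  qed simp
  have "coef p c t k = (\<Sum>j\<in>{..k} \<inter> {..<t}. c (k - j))"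
    unfolding coef_def by (subst sum.inter_restrict) (auto intro!: sum.cong simp: assms)
  also have "{..k} \<inter> {..<t} = {..<t}" using False by auto
  finally show ?thesis using *[of t] False by simp
qed

text \<open>For unit weights the filter yields \<open>S k\<close> at lags below \<open>t\<close> and
  \<open>S k - S (k - t)\<close> from \<open>t\<close> on. In the second range \<open>S k\<close> is
  negligible in mean square, so the innovations up to time 0 have the weights of the later ones with
  the opposite sign; equal sums of squares mean \<open>\<tau> = 1 / 2\<close>.\<close>

lemma FR1_coef_array:
  assumes "assumption_FR1 \<phi> c"
  shows "\<exists>B'. coef_array \<phi> c (\<lambda>n k. \<Sum>i\<le>k. c i) (\<lambda>n k. - (\<Sum>i\<le>k. c i)) 1 B' (1 / 2) (1 / 2)"
proof -
  obtain l where scale: "FR_scale l" and \<phi>: "\<forall>n\<ge>1. \<forall>j. \<phi> n j = 1"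
    and asy: "c \<sim>[sequentially] (\<lambda>s. l (real s) * real s powr (- 3 / 2))" and sums: "c sums 0"
    using assms unfolding assumption_FR1_def by blast
  define S where "S k = (\<Sum>i\<le>k. c i)" for k
  define D where "D k = - S k" for k
  obtain N where N1: "1 \<le> N" and N: "\<And>k. N \<le> k \<Longrightarrow> 0 \<le> c k" "\<And>k. N \<le> k \<Longrightarrow> 0 \<le> D k" "\<And>k m. N \<le> k \<Longrightarrow> k \<le> m \<Longrightarrow> D m \<le> D k"
    "\<And>k. N \<le> k \<Longrightarrow> 1 / 100 * ((l (real k))\<^sup>2 / real k) \<le> (S k)\<^sup>2 \<and> (S k)\<^sup>2 \<le> 121 * ((l (real k))\<^sup>2 / real k)"
    using partial_sums_asymptotics[OF scale asy sums] unfolding D_def S_def power2_minus by blast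
  have c: "summable (\<lambda>i. \<bar>c i\<bar>)"
  proof (rule iffD1[OF summable_iff_shift[of _ N]])
    have "summable (\<lambda>i. c (i + N))" using sums by (simp add: summable_iff_shift sums_iff)
    then show "summable (\<lambda>i. \<bar>c (i + N)\<bar>)" using N(1) by simp
  qed
  have cmp: "\<forall>\<^sub>F k in sequentially. 1 / 100 * ((l (real k))\<^sup>2 / real k) \<le> (S k)\<^sup>2 \<and> (S k)\<^sup>2 \<le> 121 * ((l (real k))\<^sup>2 / real k)"
    using N(4) by (auto simp: eventually_sequentially)
  note FR = FR_comparable_at_top[OF scale _ _ cmp, simplified] FR_comparable_slow[OF scale _ _ cmp, simplified]
    FR_comparable_dominates[OF scale _ _ cmp, simplified]
  define w where "w n = (\<Sum>k<n. (S k)\<^sup>2)" for n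
  have w: "0 \<le> w n" "m \<le> n \<Longrightarrow> w m \<le> w n" for m n by (auto simp: w_def sum_nonneg intro: sum_mono2)
  have slow: "0 < \<eta> \<Longrightarrow> \<forall>\<^sub>F n in sequentially. w n \<le> (1 + \<eta>) * w (n div 2)" for \<eta> unfolding w_def by (rule FR(2))
  have dom: "0 < e \<Longrightarrow> \<forall>\<^sub>F n in sequentially. (l (real n))\<^sup>2 \<le> e * w n" for e unfolding w_def by (rule FR(3))
  have w_top: "filterlim w at_top sequentially" using FR(1) by (simp add: w_def[abs_def])
  \<comment> \<open>Beyond lag \<open>t + n\<close> the increments of \<open>D\<close> over
    \<open>t\<close> lags lie between 0 and \<open>D n\<close>. One factor of the square is bounded
    by \<open>D n\<close>, and the sum of the other telescopes to at most
    \<open>t * D n\<close>.\<close>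
  have tail: "(\<Sum>m<M. (D (n + m) - D (n + m + t))\<^sup>2) \<le> real t * (D n)\<^sup>2" if n: "N \<le> n" for n M t
  proof -
    have "(\<Sum>m<M. (D (n + m) - D (n + m + t))\<^sup>2) \<le> (\<Sum>m<M. D n * (D (n + m) - D (n + m + t)))"
    proof (intro sum_mono)
      fix m
      have "0 \<le> D (n + m) - D (n + m + t)" "D (n + m) - D (n + m + t) \<le> D n"
        using N(3)[of "n + m" "n + m + t"] N(3)[of n "n + m"] N(2)[of "n + m + t"] n by auto
      then show "(D (n + m) - D (n + m + t))\<^sup>2 \<le> D n * (D (n + m) - D (n + m + t))"
        unfolding power2_eq_square by (intro mult_right_mono)
    qed
    also have "\<dots> = D n * (\<Sum>m<M. D (n + m) - D (n + m + t))" by (simp add: sum_distrib_left)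
    also have "\<dots> \<le> D n * (real t * D n)"
    proof (rule mult_left_mono[OF _ N(2)[OF n]], induction t)
      case (Suc t)
      have "(\<Sum>m<M. D (n + m) - D (n + m + Suc t)) = (\<Sum>m<M. D (n + m) - D (n + m + t)) + (\<Sum>m<M. D (n + t + m) - D (n + t + Suc m))"
        by (simp add: sum.distrib[symmetric] add_ac)
      also have "(\<Sum>m<M. D (n + t + m) - D (n + t + Suc m)) = D (n + t) - D (n + t + M)"
        using sum_lessThan_telescope'[of "\<lambda>m. D (n + t + m)" M] by simp
      also have "\<dots> \<le> D n" using N(3)[of n "n + t"] N(2)[of "n + t + M"] n by simp
      finally show ?case using Suc by (simp add: algebra_simps)
    qed simp
    finally show ?thesis by (simp add: power2_eq_square mult_ac)
  qed
  have "coef_array \<phi> c (\<lambda>n. S) (\<lambda>n k. - S k) 1 (\<Sum>i. \<bar>c i\<bar>) (1 / 2) (1 / 2)"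
  proof (unfold_locales, unfold w_def[symmetric] power2_minus)
    show "summable (\<lambda>i. \<bar>c i\<bar>)" by (rule c)
    have S: "\<bar>S k\<bar> \<le> (\<Sum>i. \<bar>c i\<bar>)" for k unfolding S_def by (rule order_trans[OF sum_abs sum_le_suminf[OF c]]) auto
    then show "\<bar>S k\<bar> \<le> (\<Sum>i. \<bar>c i\<bar>)" "\<bar>- S k\<bar> \<le> (\<Sum>i. \<bar>c i\<bar>)" for k by auto
    show "1 \<le> n \<Longrightarrow> \<bar>\<phi> n j\<bar> \<le> 1" for n j using \<phi> by simp
    show "\<exists>d0. \<forall>n t. d0 \<le> t \<longrightarrow> t \<le> n \<longrightarrow> R \<le> w t" for R
      using w_top unfolding filterlim_at_top eventually_sequentially by blast
    show "\<forall>\<^sub>F n in sequentially. \<forall>t. \<delta> * real n \<le> real t \<longrightarrow> t \<le> n \<longrightarrow> (1 - \<eta>) * w n \<le> w t" if "0 < \<delta>" "0 < \<eta>" for \<delta> \<eta> :: real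
      by (rule slow_growth_flat[OF w slow that])
    show "\<exists>C d0. \<forall>n d. d0 \<le> d \<longrightarrow> d \<le> n \<longrightarrow> w n \<le> C * w d * (real n / real d) powr (1 / 2)"
      using slow_growth_powr[OF w slow] by blast
    show "\<exists>d0. \<forall>n d. d0 \<le> d \<longrightarrow> d \<le> n \<longrightarrow> w d \<le> 4 * (\<Sum>k<d. (coef (\<phi> n) c n k)\<^sup>2)"
    proof (intro exI[of _ 1] allI impI)
      fix n d :: nat assume d: "1 \<le> d" "d \<le> n"
      have "coef (\<phi> n) c n k = S k" if "k < d" for k
        using coef_unit_weights[of "\<phi> n" c n k] that d \<phi> by (auto simp: S_def)
      then have "(\<Sum>k<d. (coef (\<phi> n) c n k)\<^sup>2) = w d" by (simp add: w_def)
      then show "w d \<le> 4 * (\<Sum>k<d. (coef (\<phi> n) c n k)\<^sup>2)" using w(1)[of d] by simp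
    qed
    have "\<forall>\<^sub>F n in sequentially. w n / w n = 1"
    proof -
      have "\<forall>\<^sub>F n in sequentially. 0 < w n" using w_top by (auto simp: filterlim_at_top_dense)
      then show ?thesis by eventually_elim simp
    qed
    \<comment> \<open>\<open>f\<close> and \<open>g\<close> have equal squares, and
      \<open>\<tau> / (1 - \<tau>)\<close> is 1 at \<open>\<tau> = 1 / 2\<close>.\<close>
    then show "(\<lambda>n. w n / w n) \<longlonglongrightarrow> 1 / 2 / (1 - 1 / 2)" by (simp add: tendsto_cong)
  next
    fix \<delta> \<eta> :: real assume \<delta>: "0 < \<delta>" and \<eta>: "0 < \<eta>"
    obtain N2 where N2: "\<And>n. N2 \<le> n \<Longrightarrow> w n \<le> (1 + 1) * w (n div 2)"
      using slow[of 1] by (auto simp: eventually_sequentially)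
    \<comment> \<open>\<open>\<delta> / 2\<close> because flatness will be applied at
      \<open>2 * n\<close>.\<close>
    obtain N3 where N3: "\<And>n t. N3 \<le> n \<Longrightarrow> \<delta> / 2 * real n \<le> real t \<Longrightarrow> t \<le> n \<Longrightarrow> (1 - \<eta> / 4) * w n \<le> w t"
      using slow_growth_flat[OF w slow, of "\<delta> / 2" "\<eta> / 4"] \<delta> \<eta> by (auto simp: eventually_sequentially)
    have "\<forall>\<^sub>F n in sequentially. (l (real n))\<^sup>2 \<le> \<eta> / 242 * w n" using \<eta> by (intro dom) simp
    then show "\<forall>\<^sub>F n in sequentially. \<forall>t. \<delta> * real n \<le> real t \<longrightarrow> 1 \<le> t \<longrightarrow> t \<le> n \<longrightarrow>
      (\<Sum>k. (coef (\<phi> n) c t k - (if k < t then S k else if k < t + n then - S (k - t) else 0))\<^sup>2) \<le> \<eta> * w n"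
      using eventually_ge_at_top[of "max N (max N2 N3)"]
    proof eventually_elim
      case (elim n)
      show ?case
      proof (intro allI impI)
        fix t assume t: "\<delta> * real n \<le> real t" "1 \<le> t" "t \<le> n"
        have n: "N \<le> n" "N2 \<le> n" "N3 \<le> n" "1 \<le> n" using elim t by auto
        define r where "r k = (coef (\<phi> n) c t k - (if k < t then S k else if k < t + n then - S (k - t) else 0))\<^sup>2" for k
        have cf: "coef (\<phi> n) c t k = (if k < t then S k else S k - S (k - t))" for k
          using coef_unit_weights[of "\<phi> n" c t k] t n \<phi> by (auto simp: S_def)
        have "(\<Sum>k<M. r k) \<le> \<eta> * w n" for M
        proof -
          have "(\<Sum>k<M. r k) \<le> (\<Sum>k<(t + n) + M. r k)" by (intro sum_mono2) (auto simp: r_def)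
          also have "\<dots> = (\<Sum>k<t. r k) + (\<Sum>k<n. r (k + t)) + (\<Sum>k<M. r (k + (t + n)))" by (simp only: sum_lessThan_add)
          also have "(\<Sum>k<t. r k) = 0" by (simp add: r_def cf)
          \<comment> \<open>At these lags the remainder is \<open>S k\<close>, and the slow growth
            of \<open>w\<close> makes the block from \<open>t\<close> to \<open>t + n\<close>
            negligible.\<close>
          also have "(\<Sum>k<n. r (k + t)) = w (t + n) - w t" by (simp add: r_def cf w_def sum_lessThan_add)
          also have "(\<Sum>k<M. r (k + (t + n))) = (\<Sum>m<M. (D (n + m) - D (n + m + t))\<^sup>2)"
            by (intro sum.cong) (auto simp: r_def cf D_def add_ac)
          also have "\<dots> \<le> real t * (D n)\<^sup>2" by (rule tail[OF n(1)])
          also have "\<dots> \<le> real n * (121 * ((l (real n))\<^sup>2 / real n))"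
            using N(4)[OF n(1)] t by (intro mult_mono) (auto simp: D_def)
          also have "\<dots> = 121 * (l (real n))\<^sup>2" using n by simp
          \<comment> \<open>The threshold \<open>\<eta> / 242\<close> is
            \<open>\<eta> / (2 * 121)\<close>.\<close>
          also have "\<dots> \<le> \<eta> / 2 * w n" using elim by simp
          also have "0 + (w (t + n) - w t) + \<eta> / 2 * w n \<le> \<eta> * w n"
          proof -
            have "w (t + n) \<le> w (2 * n)" using t by (intro w) simp
            moreover have "(1 - \<eta> / 4) * w (2 * n) \<le> w t" using t n by (intro N3) auto
            moreover have "w (2 * n) \<le> 2 * w n" using N2[of "2 * n"] n by simp
            then have "\<eta> / 4 * w (2 * n) \<le> \<eta> / 4 * (2 * w n)" using \<eta> by (intro mult_left_mono) auto
            ultimately show ?thesis by (simp add: algebra_simps)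
          qed
          finally show ?thesis by simp
        qed
        then show "(\<Sum>k. (coef (\<phi> n) c t k - (if k < t then S k else if k < t + n then - S (k - t) else 0))\<^sup>2) \<le> \<eta> * w n"
          unfolding r_def[symmetric] by (intro nonneg_suminf_le) (auto simp: r_def)
      qed
    qed
  qed auto
  then show ?thesis by (auto simp: S_def[abs_def])
qed

section \<open>The theorem\<close>

text \<open>Positivity of the variance comes from absolute continuity: variance 0 would concentrate
  the law on the null set \<open>{0}\<close>.\<close>

lemma innovations_of_INN:
  assumes "prob_space M" and INN: "assumption_INN M \<xi>"
  shows "\<exists>\<sigma>2 \<theta>. innovations M \<xi> \<sigma>2 \<theta>"
proof -
  interpret prob_space M by fact
  note I = INN[unfolded assumption_INN_def]
  have [measurable]: "\<xi> 1 \<in> borel_measurable M" using I unfolding indep_vars_def by blast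
  let ?\<mu> = "distr M borel (\<xi> 1)"
  interpret mu: real_distribution ?\<mu> by (rule real_distribution_distr) measurable
  obtain \<theta> :: nat where \<theta>: "1 \<le> \<theta>" "integrable lborel (\<lambda>u. cmod (char ?\<mu> u) ^ \<theta>)" using I by blast
  define \<sigma>2 where "\<sigma>2 = (\<integral>x. x\<^sup>2 \<partial>?\<mu>)"
  have int1: "integrable ?\<mu> (\<lambda>x. x)" using I by (simp add: integrable_distr_eq)
  have int2: "integrable ?\<mu> (\<lambda>x. x\<^sup>2)" using I by (simp add: integrable_distr_eq)
  have mean: "(\<integral>x. x \<partial>?\<mu>) = 0" using I by (simp add: integral_distr)
  have pos: "0 < \<sigma>2"
  proof (rule ccontr)
    assume "\<not> 0 < \<sigma>2"
    moreover have "0 \<le> \<sigma>2" unfolding \<sigma>2_def by (rule integral_nonneg_AE) simp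
    ultimately have "\<sigma>2 = 0" by linarith
    then have "(\<integral>x. x\<^sup>2 \<partial>?\<mu>) = 0" by (simp only: \<sigma>2_def)
    then have z: "AE x in ?\<mu>. x\<^sup>2 = 0" using integral_nonneg_eq_0_iff_AE[OF int2] by simp
    have "AE x in (lborel :: real measure). x \<noteq> 0" by (rule AE_lborel_singleton)
    then have "AE x in ?\<mu>. x \<noteq> 0"
      using I by (intro absolutely_continuous_AE[of ?\<mu> lborel]) auto
    with z have "AE x in ?\<mu>. False" by eventually_elim simp
    then show False by simp
  qed
  have "innovations M \<xi> \<sigma>2 \<theta>" by unfold_locales (use I \<theta> int1 int2 mean pos in \<open>auto simp: \<sigma>2_def\<close>)
  then show ?thesis by blast
qed

context innovations
begin

text \<open>The delayed copies are series in the same innovations, and finitely many almost surely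
  convergent series may be added term by term.\<close>

lemma lin_array_eq_lin_proc:
  assumes c: "summable (\<lambda>i. \<bar>c i\<bar>)"
  shows "AE \<omega> in M. lin_array \<phi> c \<xi> n t \<omega> = lin_proc (coef (\<phi> n) c t) \<xi> (int t) \<omega>"
proof -
  have "AE \<omega> in M. \<forall>j\<in>{..<t}. lin_proc c \<xi> (int t - int j) \<omega> = lin_proc (shift j c) \<xi> (int t) \<omega>"
  proof (intro AE_finite_allI)
    fix j
    show "AE \<omega> in M. lin_proc c \<xi> (int t - int j) \<omega> = lin_proc (shift j c) \<xi> (int t) \<omega>"
      using lin_proc_shift[OF c, of "int t - int j" j] by simp
  qed simp
  moreover have "AE \<omega> in M. \<forall>j\<in>{..<t}. (\<lambda>k. shift j c k * \<xi> (int t - int k) \<omega>) sums lin_proc (shift j c) \<xi> (int t) \<omega>"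
    by (intro AE_finite_allI AE_lin_proc_sums summable_shift c) simp
  ultimately show ?thesis
  proof eventually_elim
    case (elim \<omega>)
    have "(\<lambda>k. \<Sum>j<t. \<phi> n j * (shift j c k * \<xi> (int t - int k) \<omega>)) sums (\<Sum>j<t. \<phi> n j * lin_proc (shift j c) \<xi> (int t) \<omega>)"
      using elim by (intro sums_sum sums_mult) auto
    moreover have "(\<Sum>j<t. \<phi> n j * (shift j c k * \<xi> (int t - int k) \<omega>)) = coef (\<phi> n) c t k * \<xi> (int t - int k) \<omega>" for k
    proof -
      have "(\<Sum>j<t. \<phi> n j * shift j c k) = (\<Sum>j\<in>{j\<in>{..<t}. j \<le> k}. \<phi> n j * c (k - j))"
        unfolding shift_def by (subst sum.inter_filter) (auto intro!: sum.cong)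
      also have "{j\<in>{..<t}. j \<le> k} = {j\<in>{..k}. j < t}" by auto
      also have "(\<Sum>j\<in>{j\<in>{..k}. j < t}. \<phi> n j * c (k - j)) = coef (\<phi> n) c t k"
        unfolding coef_def by (subst sum.inter_filter) (auto intro!: sum.cong)
      finally have e: "(\<Sum>j<t. \<phi> n j * shift j c k) = coef (\<phi> n) c t k" .
      show ?thesis unfolding e[symmetric] by (simp add: sum_distrib_right mult.assoc)
    qed
    ultimately have "(\<lambda>k. coef (\<phi> n) c t k * \<xi> (int t - int k) \<omega>) sums (\<Sum>j<t. \<phi> n j * lin_proc (shift j c) \<xi> (int t) \<omega>)" by simp
    then have "lin_proc (coef (\<phi> n) c t) \<xi> (int t) \<omega> = (\<Sum>j<t. \<phi> n j * lin_proc (shift j c) \<xi> (int t) \<omega>)"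
      unfolding lin_proc_def by (rule sums_unique[symmetric])
    then show ?case using elim by (simp add: lin_array_def)
  qed
qed

lemma var_lin_array:
  assumes c: "summable (\<lambda>i. \<bar>c i\<bar>)"
  shows "var M (lin_array \<phi> c \<xi> n t) = \<sigma>2 * (\<Sum>k. (coef (\<phi> n) c t k)\<^sup>2)"
proof -
  note ae = lin_array_eq_lin_proc[OF c, of \<phi> n t]
  note mom = lin_proc_second_moment(3,5)[OF summable_coef[OF c, of "\<phi> n" t], of "int t"]
  have [measurable]: "lin_array \<phi> c \<xi> n t \<in> borel_measurable M" unfolding lin_array_def[abs_def] by measurable
  have "expectation (lin_array \<phi> c \<xi> n t) = expectation (lin_proc (coef (\<phi> n) c t) \<xi> (int t))"
    by (rule integral_cong_AE) (use ae in auto)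
  then have "var M (lin_array \<phi> c \<xi> n t) = expectation (\<lambda>\<omega>. (lin_array \<phi> c \<xi> n t \<omega>)\<^sup>2)" using mom(2) by (simp add: var_def)
  also have "\<dots> = expectation (\<lambda>\<omega>. (lin_proc (coef (\<phi> n) c t) \<xi> (int t) \<omega>)\<^sup>2)"
    by (rule integral_cong_AE) (use ae in auto)
  finally show ?thesis using mom(1) by simp
qed

text \<open>Fix all innovations except the latest one with nonzero weight: the variable is an affine
  function of it with nonzero slope, and its law does not charge null sets. This permits changing
  \<open>K\<close> on a null set.\<close>

lemma lin_proc_avoids_null_set:
  assumes b: "summable (\<lambda>k. \<bar>b k\<bar>)" "b i \<noteq> 0" and ac: "absolutely_continuous lborel (distr M borel (\<xi> 1))"
    and A: "A \<in> null_sets lborel"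
  shows "AE \<omega> in M. lin_proc b \<xi> t \<omega> \<notin> A"
proof -
  define k0 where "k0 = (LEAST k. b k \<noteq> 0)"
  have k0: "b k0 \<noteq> 0" "\<And>k. k < k0 \<Longrightarrow> b k = 0"
    using LeastI[of "\<lambda>k. b k \<noteq> 0" i] b(2) not_less_Least[of _ "\<lambda>k. b k \<noteq> 0"] unfolding k0_def by blast+
  define d where "d = Suc k0"
  define s where "s = t - int d"
  have t: "t = s + int d" by (simp add: s_def)
  have lag: "lag_sum b d s = (\<lambda>\<omega>. b k0 * \<xi> (s + int d - int k0) \<omega>)" unfolding d_def by (rule ext) (simp add: k0)
  have [measurable]: "A \<in> sets borel" using A by auto
  define b1 where "b1 k = b (k + d)" for k
  define F :: "(real \<times> real) \<times> real \<Rightarrow> real" where "F p = indicator A (fst (fst p) + snd p)" for p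
  have [measurable]: "F \<in> borel_measurable ((borel \<Otimes>\<^sub>M borel) \<Otimes>\<^sub>M borel)" unfolding F_def[abs_def] by measurable
  have [measurable]: "(\<lambda>z. F (p, z)) \<in> borel_measurable borel" for p unfolding F_def fst_conv snd_conv by measurable
  have zero: "(\<integral>\<^sup>+ z. ennreal (F (p, z)) \<partial>distr M borel (lag_sum b d s)) = 0" for p
  proof -
    have "AE x in lborel. fst p + b k0 * x \<notin> A" by (rule AE_borel_affine[OF k0(1)]) (use AE_not_in[OF A] in auto)
    then have ae: "AE x in distr M borel (\<xi> 1). fst p + b k0 * x \<notin> A"
      by (intro absolutely_continuous_AE[OF _ ac]) auto
    have "(\<integral>\<^sup>+ z. ennreal (F (p, z)) \<partial>distr M borel (lag_sum b d s)) = (\<integral>\<^sup>+ \<omega>. ennreal (F (p, b k0 * \<xi> (s + int d - int k0) \<omega>)) \<partial>M)"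
      unfolding lag by (subst nn_integral_distr) auto
    also have "\<dots> = (\<integral>\<^sup>+ x. ennreal (F (p, b k0 * x)) \<partial>distr M borel (\<xi> 1))" by (rule nn_integral_xi) measurable
    also have "\<dots> = (\<integral>\<^sup>+ x. 0 \<partial>distr M borel (\<xi> 1))"
      by (rule nn_integral_cong_AE) (use ae in eventually_elim, simp add: F_def)
    finally show ?thesis by simp
  qed
  have "(\<integral>\<^sup>+ \<omega>. ennreal (F ((lin_proc b1 \<xi> s \<omega>, lin_proc b1 \<xi> s \<omega>), lag_sum b d s \<omega>)) \<partial>M) = 0"
    by (subst past_future_disintegration(1)) (simp_all add: zero)
  then have "AE \<omega> in M. F ((lin_proc b1 \<xi> s \<omega>, lin_proc b1 \<xi> s \<omega>), lag_sum b d s \<omega>) \<le> 0"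
    by (subst (asm) nn_integral_0_iff_AE) (auto simp: ennreal_eq_0_iff)
  then show ?thesis unfolding t using lin_proc_split[OF b(1), of s d]
  proof eventually_elim
    case (elim \<omega>)
    have b1: "(\<lambda>k. b (k + d)) = b1" by (auto simp: b1_def)
    show ?case using elim unfolding b1 by (auto simp: F_def indicator_def split: if_splits)
  qed
qed

end

text \<open>\<open>K\<close> is only Lebesgue measurable, so compositions with it are measurable
  with respect to the completion of \<open>M\<close>. Laws and probabilities of such variables are
  those of the measurable real version \<open>T\<close>.\<close>

lemma completion_AE_ereal:
  assumes [measurable]: "T \<in> borel_measurable M" and Z: "AE \<omega> in M. Z \<omega> = ereal (T \<omega>)"
  shows "distr (completion M) borel (\<lambda>\<omega>. real_of_ereal (Z \<omega>)) = distr M borel T"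
    and "measure (completion M) {\<omega> \<in> space (completion M). ereal e < \<bar>Z \<omega>\<bar>} = measure M {\<omega> \<in> space M. e < \<bar>T \<omega>\<bar>}"
proof -
  have Tc: "T \<in> borel_measurable (completion M)" by (intro measurable_completion) simp
  have Zc: "AE \<omega> in completion M. Z \<omega> = ereal (T \<omega>)" by (rule AE_completion[OF Z])
  have Rm: "(\<lambda>\<omega>. real_of_ereal (Z \<omega>)) \<in> borel_measurable (completion M)"
  proof (rule measurableI)
    fix B :: "real set" assume [measurable]: "B \<in> sets borel"
    show "(\<lambda>\<omega>. real_of_ereal (Z \<omega>)) -` B \<inter> space (completion M) \<in> sets (completion M)"
    proof (rule completion.in_sets_AE)
      show "AE \<omega> in completion M. (\<omega> \<in> T -` B \<inter> space (completion M)) = (\<omega> \<in> (\<lambda>\<omega>. real_of_ereal (Z \<omega>)) -` B \<inter> space (completion M))"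
        using Zc by eventually_elim simp
      show "T -` B \<inter> space (completion M) \<in> sets (completion M)" using Tc by (rule measurable_sets) simp
    qed simp
  qed simp
  have "distr (completion M) borel (\<lambda>\<omega>. real_of_ereal (Z \<omega>)) = distr (completion M) borel T"
    by (rule distr_cong_AE) (use Zc Tc Rm in auto)
  then show "distr (completion M) borel (\<lambda>\<omega>. real_of_ereal (Z \<omega>)) = distr M borel T" by (simp add: distr_completion)
  define S where "S = {\<omega> \<in> space M. e < \<bar>T \<omega>\<bar>}"
  have S: "S \<in> sets M" unfolding S_def by measurable
  have ae: "AE \<omega> in completion M. (\<omega> \<in> S) = (\<omega> \<in> {\<omega> \<in> space (completion M). ereal e < \<bar>Z \<omega>\<bar>})"
    using Zc by eventually_elim (auto simp: S_def)
  have "{\<omega> \<in> space (completion M). ereal e < \<bar>Z \<omega>\<bar>} \<in> sets (completion M)"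
    by (rule completion.in_sets_AE[OF ae]) (use S in auto)
  then have "measure (completion M) S = measure (completion M) {\<omega> \<in> space (completion M). ereal e < \<bar>Z \<omega>\<bar>}"
    using S by (intro measure_eq_AE[OF ae]) auto
  then show "measure (completion M) {\<omega> \<in> space (completion M). ereal e < \<bar>Z \<omega>\<bar>} = measure M {\<omega> \<in> space M. e < \<bar>T \<omega>\<bar>}"
    using S by (simp add: S_def)
qed

text \<open>Integrability makes \<open>K\<close> finite almost everywhere, and a Lebesgue measurable
  function agrees almost everywhere with a Borel one.\<close>

lemma integrable_ereal_borel_version:
  assumes K: "integrable_ereal lebesgue K" and K2: "integrable_ereal lebesgue (\<lambda>u :: real. (K u)\<^sup>2)"
  obtains K' where "K' \<in> borel_measurable borel" "AE u in lborel. K u = ereal (K' u)" "integrable lborel K'"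
    "integrable lborel (\<lambda>u. (K' u)\<^sup>2)" "integral_ereal lebesgue K = (\<integral>u. K' u \<partial>lborel)"
proof -
  have Km: "K \<in> borel_measurable lebesgue" and Kf: "(\<integral>\<^sup>+ x. e2ennreal \<bar>K x\<bar> \<partial>lebesgue) < \<infinity>"
    using K by (auto simp: integrable_ereal_def)
  have km: "(\<lambda>u. real_of_ereal (K u)) \<in> borel_measurable lebesgue" using Km by measurable
  obtain K' where K': "K' \<in> borel_measurable lborel" "AE u in lborel. real_of_ereal (K u) = K' u"
    using completion_ex_borel_measurable_real[OF km] by blast
  have "AE u in lebesgue. e2ennreal \<bar>K u\<bar> \<noteq> \<infinity>" by (rule nn_integral_PInf_AE) (use Km Kf in auto)
  then have "AE u in lborel. e2ennreal \<bar>K u\<bar> \<noteq> \<infinity>" by (simp add: AE_completion_iff)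
  with K'(2) have eq: "AE u in lborel. K u = ereal (K' u)"
  proof eventually_elim
    case (elim u)
    then show ?case by (cases "K u") auto
  qed
  have i1: "integrable lborel K'"
  proof (rule integrableI_bounded[OF K'(1)])
    have "(\<integral>\<^sup>+ x. ennreal (norm (K' x)) \<partial>lborel) = (\<integral>\<^sup>+ x. e2ennreal \<bar>K x\<bar> \<partial>lborel)"
      by (rule nn_integral_cong_AE) (use eq in eventually_elim, simp)
    then show "(\<integral>\<^sup>+ x. ennreal (norm (K' x)) \<partial>lborel) < \<infinity>" using Kf by (simp add: nn_integral_completion)
  qed
  have i2: "integrable lborel (\<lambda>u. (K' u)\<^sup>2)"
  proof (rule integrableI_bounded)
    have "(\<integral>\<^sup>+ x. ennreal (norm ((K' x)\<^sup>2)) \<partial>lborel) = (\<integral>\<^sup>+ x. e2ennreal \<bar>(K x)\<^sup>2\<bar> \<partial>lborel)"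
      by (rule nn_integral_cong_AE) (use eq in eventually_elim, simp)
    then show "(\<integral>\<^sup>+ x. ennreal (norm ((K' x)\<^sup>2)) \<partial>lborel) < \<infinity>"
      using K2 by (simp add: nn_integral_completion integrable_ereal_def)
  qed (use K' in measurable)
  have "integral_ereal lebesgue K = (\<integral>u. K' u \<partial>lebesgue)" unfolding integral_ereal_def
    by (rule integral_cong_AE[OF km measurable_completion[OF K'(1)]]) (use K'(2) in \<open>simp add: AE_completion_iff\<close>)
  also have "\<dots> = (\<integral>u. K' u \<partial>lborel)" by (rule integral_completion[OF K'(1)])
  finally show ?thesis using that[of K'] K'(1) eq i1 i2 by simp
qed

lemma char_distr_gauss:
  assumes "prob_space N" and X: "distributed N lborel X (gauss v)" and v: "0 < v"
  shows "char (distr N borel X) u = of_real (exp (- (v * u\<^sup>2 / 2)))"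
proof -
  interpret prob_space N by fact
  define s where "s = sqrt v"
  have s: "0 < s" "s\<^sup>2 = v" using v by (auto simp: s_def)
  have "distributed N lborel (\<lambda>\<omega>. 0 + inverse s * X \<omega>) (normal_density (0 + inverse s * 0) (\<bar>inverse s\<bar> * s))"
    by (rule normal_density_affine) (use X s in \<open>auto simp: gauss_def s_def\<close>)
  then have Y: "distributed N lborel (\<lambda>\<omega>. inverse s * X \<omega>) std_normal_density" using s by simp
  have [measurable]: "X \<in> borel_measurable N" using X by (auto simp: distributed_def)
  have "distr N lborel (\<lambda>\<omega>. inverse s * X \<omega>) = std_normal_distribution" using Y by (simp add: distributed_def)
  then have "char (distr N lborel (\<lambda>\<omega>. inverse s * X \<omega>)) (s * u) = of_real (exp (- ((s * u)\<^sup>2) / 2))" by (simp only: char_std_normal_distribution)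
  moreover have "char (distr N lborel (\<lambda>\<omega>. inverse s * X \<omega>)) (s * u) = (CLINT \<omega>|N. iexp ((s * u) * (inverse s * X \<omega>)))"
    unfolding char_def by (rule integral_distr) measurable
  moreover have "char (distr N borel X) u = (CLINT \<omega>|N. iexp (u * X \<omega>))"
    unfolding char_def by (rule integral_distr) measurable
  moreover have "(s * u) * (inverse s * X \<omega>) = u * X \<omega>" for \<omega> using s by simp
  ultimately show ?thesis by (simp add: power_mult_distrib s)
qed

lemma coef_array_exists:
  assumes "assumption_FR1 \<phi> c \<or> assumption_FR2 \<phi> c \<or> assumption_MI \<phi> c"
  shows "\<exists>f g B B' \<gamma>. coef_array \<phi> c f g B B' (if assumption_FR1 \<phi> c then 1 / 2 else 0) \<gamma>"
proof (cases "assumption_FR1 \<phi> c")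
  case True
  then show ?thesis using FR1_coef_array[OF True] by (simp only: if_True) blast
next
  case False
  then consider "assumption_FR2 \<phi> c" | "assumption_MI \<phi> c" using assms by blast
  then show ?thesis
  proof cases
    case 1
    then show ?thesis using FR2_coef_array[OF 1] False by (simp only: if_False) blast
  next
    case 2
    then show ?thesis using MI_coef_array[OF 2] False by (simp only: if_False) blast
  qed
qed

lemma leading_weight_nonzero:
  assumes "assumption_FR1 \<phi> c \<or> assumption_FR2 \<phi> c \<or> assumption_MI \<phi> c" and "1 \<le> n"
  shows "\<phi> n 0 \<noteq> 0" using assms unfolding assumption_FR1_def assumption_FR2_def assumption_MI_def by auto

text \<open>At the lag of the first nonzero \<open>c\<close> only the term with \<open>j = 0\<close>
  survives in the convolution.\<close>

lemma coef_nonzero: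
  assumes "p 0 \<noteq> 0" "c i \<noteq> 0" "1 \<le> t"
  shows "\<exists>k. coef p c t k \<noteq> 0"
proof -
  define i0 where "i0 = (LEAST i. c i \<noteq> 0)"
  have i0: "c i0 \<noteq> 0" "\<And>i. i < i0 \<Longrightarrow> c i = 0"
    using LeastI[of "\<lambda>i. c i \<noteq> 0" i] assms(2) not_less_Least[of _ "\<lambda>i. c i \<noteq> 0"] unfolding i0_def by blast+
  have "coef p c t i0 = (\<Sum>j\<in>{0}. (if j < t then p j else 0) * c (i0 - j))"
    unfolding coef_def by (rule sum.mono_neutral_right) (auto intro!: i0(2))
  then show ?thesis using assms i0(1) by (intro exI[of _ i0]) simp
qed

theorem theorem3p4:
  fixes M :: "'a measure" and N :: "'b measure"
    and \<xi> :: "int \<Rightarrow> 'a \<Rightarrow> real" and \<phi> :: "nat \<Rightarrow> nat \<Rightarrow> real" and c :: "nat \<Rightarrow> real"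
    and \<beta> h :: "nat \<Rightarrow> real" and K :: "real \<Rightarrow> ereal" and Xminus :: "'b \<Rightarrow> real"
  assumes "prob_space M"
    and "integrable_ereal lebesgue K"
    and "integrable_ereal lebesgue (\<lambda>u. (K u)\<^sup>2)"
    and "assumption_INN M \<xi>"
    and "assumption_FR1 \<phi> c \<or> assumption_FR2 \<phi> c \<or> assumption_MI \<phi> c"
    and "\<forall>n\<ge>1. \<beta> n > 0 \<and> (\<beta> n)\<^sup>2 = var M (lin_array \<phi> c \<xi> n n)"
    and "\<forall>n\<ge>1. h n > 0"
    and "(\<lambda>n. inverse (\<beta> n) * h n + \<beta> n * inverse (real n * h n)) \<longlonglongrightarrow> 0"
    and "\<forall>x t'. little_op1 (completion M) (kernel_sum K \<beta> h (lin_array \<phi> c \<xi>) x t')"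
    and "prob_space N"
    and "distributed N lborel Xminus (gauss (1 / 2))"
  shows "\<forall>x. conv_in_distr (completion M)
               (\<lambda>n. kernel_sum K \<beta> h (lin_array \<phi> c \<xi>) x n n)
               (distr N borel (\<lambda>\<omega>. varrho \<phi> c (Xminus \<omega>) 0 * integral_ereal lebesgue K))"
proof
  fix x
  interpret N: prob_space N by fact
  obtain \<sigma>2 \<theta> where "innovations M \<xi> \<sigma>2 \<theta>" using innovations_of_INN assms(1,4) by blast
  then interpret inn: innovations M \<xi> \<sigma>2 \<theta> .
  define \<tau> :: real where \<tau>: "\<tau> = (if assumption_FR1 \<phi> c then 1 / 2 else 0)"
  obtain f g B B' \<gamma> where ca: "coef_array \<phi> c f g B B' \<tau> \<gamma>" using coef_array_exists[OF assms(5)] unfolding \<tau> by blast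
  interpret ca: coef_array \<phi> c f g B B' \<tau> \<gamma> by (rule ca)
  note c = ca.c_summable
  interpret nc: normed_coef \<phi> c f g B B' \<tau> \<gamma> \<sigma>2 \<beta>
    by unfold_locales (use assms(6) inn.law.var_pos inn.var_lin_array[OF c] in auto)
  obtain K' where K'm: "K' \<in> borel_measurable borel" and K'eq: "AE u in lborel. K u = ereal (K' u)" and K'int: "integrable lborel K'"
    "integrable lborel (\<lambda>u. (K' u)\<^sup>2)" and K'val: "integral_ereal lebesgue K = (\<integral>u. K' u \<partial>lborel)"
    by (rule integrable_ereal_borel_version[OF assms(2,3)])
  obtain C\<^sub>V where CV: "1 \<le> C\<^sub>V" "\<exists>d0. \<forall>n d. d0 \<le> d \<longrightarrow> d \<le> n \<longrightarrow> (\<beta> n)\<^sup>2 \<le> C\<^sub>V * (\<Sum>k<d. (coef (\<phi> n) c n k)\<^sup>2) * (real n / real d) powr \<gamma>"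
    using nc.V_lower by blast
  \<comment> \<open>Both summands in (ii) are positive from \<open>n = 1\<close> on, so their sum
    squeezes each of them.\<close>
  have h: "(\<lambda>n. h n / \<beta> n) \<longlonglongrightarrow> 0" "(\<lambda>n. \<beta> n / (real n * h n)) \<longlonglongrightarrow> 0"
    by (rule tendsto_sandwich[OF _ _ tendsto_const assms(8)];
        rule eventually_mono[OF eventually_ge_at_top[of 1]];
        use assms(6,7) in \<open>auto simp: divide_inverse mult.commute less_imp_le\<close>)+
  interpret kg: kernel_gauss M \<xi> \<sigma>2 \<theta> "\<lambda>n t. coef (\<phi> n) c t" \<beta> h "B * (\<Sum>i. \<bar>c i\<bar>)" C\<^sub>V \<gamma> K' x f g B' \<tau>
  proof unfold_locales
    show "summable (\<lambda>k. \<bar>coef (\<phi> n) c t k\<bar>)" for n t by (rule summable_coef[OF c])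
    show "k < t \<Longrightarrow> t \<le> n \<Longrightarrow> coef (\<phi> n) c t k = coef (\<phi> n) c n k" for k t n by (rule coef_lag)
    show "1 \<le> n \<Longrightarrow> k < n \<Longrightarrow> \<bar>coef (\<phi> n) c n k\<bar> \<le> B * (\<Sum>i. \<bar>c i\<bar>)" for n k by (intro coef_bound c ca.\<phi>_bound)
    show "0 < h n" if "1 \<le> n" for n using assms(7) that by blast
  qed (fact nc.V_unbounded CV ca.\<gamma> ca.\<tau> nc.\<beta>_pos nc.\<beta>_at_top h K'int ca.f_bound ca.g_bound nc.f_norm nc.remainder nc.g_norm)+
  \<comment> \<open>If all \<open>c\<close> vanished, so would \<open>\<beta> 1\<close>.\<close>
  obtain i where i: "c i \<noteq> 0"
  proof (rule ccontr)
    assume "\<not> thesis"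
    then have "c = (\<lambda>_. 0)" using that by blast
    then have "(\<beta> 1)\<^sup>2 = 0" using nc.\<beta>_eq[of 1] by (simp add: coef_def)
    then show False using nc.\<beta>_pos[of 1] by simp
  qed
  have ac: "absolutely_continuous lborel (distr M borel (\<xi> 1))" using assms(4) by (simp add: assumption_INN_def)
  \<comment> \<open>A null set outside which \<open>K\<close> is finite and equal to its Borel
    version.\<close>
  obtain A where A: "A \<in> null_sets lborel" "\<And>u. u \<notin> A \<Longrightarrow> K u = ereal (K' u)" using K'eq by (rule AE_E3) auto
  have ks: "AE \<omega> in M. kernel_sum K \<beta> h (lin_array \<phi> c \<xi>) x m n \<omega> = ereal (kg.T m n \<omega>)" if mn: "m \<le> n" for m n
  proof -
    have "AE \<omega> in M. \<forall>t\<in>{1..m}. lin_array \<phi> c \<xi> n t \<omega> = kg.X n t \<omega> \<and> (kg.X n t \<omega> - x) / h n \<notin> A"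
    proof (intro AE_finite_allI AE_conjI)
      fix t assume t: "t \<in> {1..m}"
      then have n1: "1 \<le> n" using mn by simp
      show "AE \<omega> in M. lin_array \<phi> c \<xi> n t \<omega> = kg.X n t \<omega>"
        unfolding kg.X_def by (rule inn.lin_array_eq_lin_proc[OF c])
      have hn: "0 < h n" using assms(7) n1 by blast
      have [measurable]: "A \<in> sets borel" using A by auto
      have "AE y in lborel. - x / h n + inverse (h n) * y \<notin> A"
        by (rule AE_borel_affine) (use hn AE_not_in[OF A(1)] in auto)
      then have "AE y in lborel. (y - x) / h n \<notin> A" using hn by (simp add: field_simps)
      then have "{y. (y - x) / h n \<in> A} \<in> null_sets lborel" by (subst AE_iff_null_sets) auto
      moreover obtain k where "coef (\<phi> n) c t k \<noteq> 0"
        using coef_nonzero[of "\<phi> n" c i t] leading_weight_nonzero[OF assms(5) n1] i t by auto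
      ultimately have "AE \<omega> in M. kg.X n t \<omega> \<notin> {y. (y - x) / h n \<in> A}"
        unfolding kg.X_def by (intro inn.lin_proc_avoids_null_set[OF summable_coef[OF c] _ ac])
      then show "AE \<omega> in M. (kg.X n t \<omega> - x) / h n \<notin> A" by simp
    qed simp
    then show ?thesis
    proof eventually_elim
      case (elim \<omega>)
      then have "(\<Sum>t = 1..m. K ((lin_array \<phi> c \<xi> n t \<omega> - x) / h n)) = (\<Sum>t = 1..m. ereal (K' ((kg.X n t \<omega> - x) / h n)))"
        using A(2) by (intro sum.cong) auto
      then show ?case by (simp add: kernel_sum_def kg.T_def)
    qed
  qed
  \<comment> \<open>The limit law of \<open>Yp n / \<beta> n\<close>: that of \<open>X^-\<close>
    under FR1, the point mass at 0 otherwise.\<close>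
  define \<rho> where "\<rho> = distr N borel (\<lambda>\<omega>. if assumption_FR1 \<phi> c then Xminus \<omega> else 0)"
  have Xm [measurable]: "Xminus \<in> borel_measurable N" using assms(11) by (auto simp: distributed_def)
  have "weak_conv_m (\<lambda>n. distr M borel (kg.T n n)) (distr \<rho> borel kg.G)"
  proof (rule kg.kernel_sum_weak_limit)
    fix m and \<eta> :: real assume \<eta>: "0 < \<eta>"
    have "(\<lambda>n. measure (completion M) {\<omega> \<in> space (completion M). ereal \<eta> < \<bar>kernel_sum K \<beta> h (lin_array \<phi> c \<xi>) x m n \<omega>\<bar>}) \<longlonglongrightarrow> 0"
      using assms(9) \<eta> by (simp add: little_op1_def)
    moreover have "\<forall>\<^sub>F n in sequentially. measure (completion M) {\<omega> \<in> space (completion M). ereal \<eta> < \<bar>kernel_sum K \<beta> h (lin_array \<phi> c \<xi>) x m n \<omega>\<bar>}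
      = measure M {\<omega> \<in> space M. \<eta> < \<bar>kg.T m n \<omega>\<bar>}"
      using eventually_ge_at_top[of m] by eventually_elim (rule completion_AE_ereal(2)[OF kg.T_measurable ks])
    ultimately show "(\<lambda>n. measure M {\<omega> \<in> space M. \<eta> < \<bar>kg.T m n \<omega>\<bar>}) \<longlonglongrightarrow> 0" by (rule Lim_transform_eventually)
  next
    show "real_distribution \<rho>" unfolding \<rho>_def by (rule N.real_distribution_distr) measurable
    show "char \<rho> u = of_real (exp (- (\<tau> * u\<^sup>2 / 2)))" for u
    proof (cases "assumption_FR1 \<phi> c")
      case True
      then show ?thesis using char_distr_gauss[OF assms(10,11), of u] by (simp add: \<rho>_def \<tau>)
    next
      case False
      have "char \<rho> u = (CLINT \<omega>|N. iexp (u * (if assumption_FR1 \<phi> c then Xminus \<omega> else 0)))"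
        unfolding char_def \<rho>_def by (rule integral_distr) measurable
      then show ?thesis using False by (simp add: \<tau> N.prob_space)
    qed
  qed
  moreover have "distr \<rho> borel kg.G = distr N borel (\<lambda>\<omega>. varrho \<phi> c (Xminus \<omega>) 0 * integral_ereal lebesgue K)"
  proof -
    \<comment> \<open>\<open>1 - \<tau>\<close> is 1/2 under FR1 and 1 otherwise, and the normal
      density is even, so that \<open>0 - y\<close> and \<open>y\<close> give the same
      value.\<close>
    have "kg.G (if assumption_FR1 \<phi> c then Xminus \<omega> else 0) = varrho \<phi> c (Xminus \<omega>) 0 * integral_ereal lebesgue K" for \<omega>
      unfolding kg.G_def kg.J_def K'val by (simp add: varrho_def gauss_def \<tau> normal_density_def)
    then show ?thesis unfolding \<rho>_def by (subst distr_distr) (auto simp: comp_def)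
  qed
  moreover have "distr (completion M) borel (\<lambda>\<omega>. real_of_ereal (kernel_sum K \<beta> h (lin_array \<phi> c \<xi>) x n n \<omega>)) = distr M borel (kg.T n n)" for n
    by (rule completion_AE_ereal(1)[OF kg.T_measurable ks]) simp
  ultimately show "conv_in_distr (completion M) (\<lambda>n. kernel_sum K \<beta> h (lin_array \<phi> c \<xi>) x n n)
      (distr N borel (\<lambda>\<omega>. varrho \<phi> c (Xminus \<omega>) 0 * integral_ereal lebesgue K))" by (simp add: conv_in_distr_def)
qed

end
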